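(* (Continuous dependence upon initial data) Let $\{u,P\}$ be a solution of the problem $(\mathcal{P})$ with the external data system $\{f,M,u_0,\dot u_0,P_0,\dot P_0\}=\{0,0,u_0,\dot u_0,P_0,\dot P_0\}$ (that is, $f=0$ and $M=0$). Then there is a positive constant $a$ so that $$a\big(\|u_{,t}\|^2_{L^2(\Omega)}+\|P_{,t}\|^2_{L^2(\Omega)}+\|\nabla u\|^2_{L^2(\Omega)}+\|P\|^2_{L^2(\Omega)}+\|\mathrm{Curl}\,P\|^2_{L^2(\Omega)}\big)\le E(0)\quad\text{for all } t\in[0,T].$$
   Context: Setting. $\Omega\subset\mathbb{R}^3$ is a bounded domain with piecewise smooth boundary $\partial\Omega$ and unit outward normal $n$; $T>0$ is given. On $\mathbb{R}^{3\times3}$: $\langle X,Y\rangle=\mathrm{tr}(XY^T)$, $\|X\|^2=\langle X,X\rangle$, $\mathrm{sym}\,X=\frac12(X+X^T)$; $\mathrm{Sym}(3)$ is the set of symmetric matrices. A subscript $t$ after a comma denotes the time derivative. For a vector field $u$, $\nabla u$ is the matrix field whose $i$-th row is the gradient of $u_i$; for a matrix field, $\mathrm{Curl}$ and $\mathrm{Div}$ act row by row (curl, respectively divergence, of each row). Coefficients. $\mathbb{C},\mathbb{H},\mathbb{L}_c$ are fourth order tensors depending on the point of $\Omega$, of class $C^1(\Omega)$, acting by $(\mathbb{C}.X)_{ij}=\sum_{k,l}\mathbb{C}_{ijkl}X_{kl}$ (likewise for the others), with $\mathbb{C},\mathbb{H}:\mathrm{Sym}(3)\to\mathrm{Sym}(3)$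 and $\mathbb{L}_c:\mathbb{R}^{3\times3}\to\mathbb{R}^{3\times3}$, with the symmetries $\mathbb{C}_{ijrs}=\mathbb{C}_{rsij}=\mathbb{C}_{jirs}$, $\mathbb{H}_{ijrs}=\mathbb{H}_{rsij}=\mathbb{H}_{jirs}$, $(\mathbb{L}_c)_{ijrs}=(\mathbb{L}_c)_{rsij}$, and positive definite: there are positive constants $c_m,c_M,h_m,h_M,(L_c)_m,(L_c)_M$ with $c_m\|X\|^2\le\langle\mathbb{C}.X,X\rangle\le c_M\|X\|^2$ and $h_m\|X\|^2\le\langle\mathbb{H}.X,X\rangle\le h_M\|X\|^2$ for all $X\in\mathrm{Sym}(3)$, and $(L_c)_m\|X\|^2\le\langle\mathbb{L}_c.X,X\rangle\le(L_c)_M\|X\|^2$ for all $X\in\mathbb{R}^{3\times3}$. Problem $(\mathcal{P})$. Given the body force $f:\Omega\times[0,T]\to\mathbb{R}^3$, the body moment $M:\Omega\times[0,T]\to\mathbb{R}^{3\times3}$ and initial data $u_0,\dot u_0,P_0,\dot P_0$, find the displacement $u:\Omega\times[0,T]\to\mathbb{R}^3$ and the micro-distortion $P:\Omega\times[0,T]\to\mathbb{R}^{3\times3}$ with $$u_{,tt}=\mathrm{Div}[\mathbb{C}.\,\mathrm{sym}(\nabla u-P)]+f,\qquad P_{,tt}=-\mathrm{Curl}[\mathbb{L}_c.\,\mathrm{Curl}\,P]+\mathbb{C}.\,\mathrm{sym}(\nabla u-P)-\mathbb{H}.\,\mathrm{sym}\,P+M\quad\text{in }\Omega\times[0,T],$$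 the boundary conditions $u=0$ and $P_i\times n=0$, $i=1,2,3$, on $\partial\Omega\times[0,T]$ ($P_i$ being the rows of $P$), and the initial conditions $u(x,0)=u_0(x)$, $u_{,t}(x,0)=\dot u_0(x)$, $P(x,0)=P_0(x)$, $P_{,t}(x,0)=\dot P_0(x)$ for $x\in\overline\Omega$. Energy. The total energy of the solution at time $t$ is given by $$2E(t)=\int_\Omega\big(\|u_{,t}\|^2+\|P_{,t}\|^2+\langle\mathbb{C}.\,\mathrm{sym}(\nabla u-P),\mathrm{sym}(\nabla u-P)\rangle+\langle\mathbb{H}.\,\mathrm{sym}\,P,\mathrm{sym}\,P\rangle+\langle\mathbb{L}_c.\,\mathrm{Curl}\,P,\mathrm{Curl}\,P\rangle\big)\,dv.$$ *)

theory Defs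
  imports "HOL-Analysis.Analysis"
begin

section \<open>Classes of differentiability\<close>

text \<open>
  \<open>Ck_on k S f\<close>: all iterated partial derivatives of \<open>f\<close> of order at most \<open>k\<close> exist and are
  continuous on \<open>S\<close>. Derivatives are taken within \<open>S\<close>; this is used for open \<open>S\<close> and for
  \<open>S = \<Omega> \<times> {0..T}\<close> with \<open>\<Omega>\<close> open and \<open>T > 0\<close>, where derivatives within \<open>S\<close> are unique (for the
  latter the time derivative is one-sided at \<open>0\<close> and \<open>T\<close>).
\<close>

primrec Ck_on ::
  "nat \<Rightarrow> 'a::euclidean_space set \<Rightarrow> ('a \<Rightarrow> 'b::real_normed_vector) \<Rightarrow> bool" where
  "Ck_on 0 S f \<longleftrightarrow> continuous_on S f"
| "Ck_on (Suc k) S f \<longleftrightarrow>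
     (\<forall>x\<in>S. f differentiable (at x within S)) \<and>
     (\<forall>b\<in>Basis. Ck_on k S (\<lambda>x. frechet_derivative f (at x within S) b))"

definition smooth_on :: "'a::euclidean_space set \<Rightarrow> ('a \<Rightarrow> 'b::real_normed_vector) \<Rightarrow> bool" where
  "smooth_on S f \<longleftrightarrow> (\<forall>k. Ck_on k S f)"

text \<open>The class \<open>C\<^sup>1\<close> up to the boundary: \<open>f\<close> is continuous on the closure of \<open>S\<close>, and the first
  partial derivatives of \<open>f\<close> on \<open>S\<close> extend continuously to the closure of \<open>S\<close>.\<close>

definition C1_on_closure ::
  "'a::euclidean_space set \<Rightarrow> ('a \<Rightarrow> 'b::real_normed_vector) \<Rightarrow> bool" where
  "C1_on_closure S f \<longleftrightarrow>
     Ck_on 1 S f \<and> continuous_on (closure S) f \<and>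
     (\<forall>b\<in>Basis. \<exists>g. continuous_on (closure S) g \<and>
        (\<forall>x\<in>S. g x = frechet_derivative f (at x within S) b))"

section \<open>Bounded domains with piecewise smooth boundary\<close>

text \<open>Near a smooth boundary point, \<open>\<Omega>\<close> is the sublevel set \<open>\<phi> < 0\<close> of a smooth function
  without critical points; the outward normal there is the normalised gradient of \<open>\<phi>\<close>, which
  does not depend on the choice of \<open>\<phi>\<close>.\<close>

definition local_defining_function ::
  "(real^3) set \<Rightarrow> real^3 \<Rightarrow> (real^3) set \<Rightarrow> (real^3 \<Rightarrow> real) \<Rightarrow> bool" where
  "local_defining_function \<Omega> x U \<phi> \<longleftrightarrow>
     x \<in> frontier \<Omega> \<and> open U \<and> x \<in> U \<and> smooth_on U \<phi> \<and>
     (\<forall>y\<in>U. frechet_derivative \<phi> (at y) \<noteq> (\<lambda>_. 0)) \<and>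
     \<Omega> \<inter> U = {y \<in> U. \<phi> y < 0}"

definition smooth_boundary_point :: "(real^3) set \<Rightarrow> real^3 \<Rightarrow> bool" where
  "smooth_boundary_point \<Omega> x \<longleftrightarrow> (\<exists>U \<phi>. local_defining_function \<Omega> x U \<phi>)"

definition is_outward_unit_normal :: "(real^3) set \<Rightarrow> real^3 \<Rightarrow> real^3 \<Rightarrow> bool" where
  "is_outward_unit_normal \<Omega> x n \<longleftrightarrow>
     (\<exists>U \<phi> g. local_defining_function \<Omega> x U \<phi> \<and> GDERIV \<phi> x :> g \<and> n = sgn g)"

text \<open>A smooth patch is parametrised by the closed unit square \<open>cbox 0 1\<close> of the plane. It is
  smooth up to the edges of the square, and a regular parametrisation in the interior; edges may
  degenerate, so that three-sided patches and cone tips are covered.\<close>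

definition smooth_patch :: "(real^2 \<Rightarrow> real^3) \<Rightarrow> bool" where
  "smooth_patch \<sigma> \<longleftrightarrow>
     (\<exists>W. open W \<and> cbox 0 1 \<subseteq> W \<and> smooth_on W \<sigma>) \<and>
     inj_on \<sigma> (box 0 1) \<and>
     (\<forall>p\<in>box 0 1. inj (frechet_derivative \<sigma> (at p)))"

text \<open>The boundary is a finite union of smooth patches, and off the edges of the patches it is a
  smooth surface with \<open>\<Omega>\<close> on exactly one side.\<close>

definition piecewise_smooth_boundary :: "(real^3) set \<Rightarrow> bool" where
  "piecewise_smooth_boundary \<Omega> \<longleftrightarrow>
     (\<exists>\<Sigma>. finite \<Sigma> \<and> (\<forall>\<sigma>\<in>\<Sigma>. smooth_patch \<sigma>) \<and>
        frontier \<Omega> = (\<Union>\<sigma>\<in>\<Sigma>. \<sigma> ` cbox 0 1) \<and>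
        (\<forall>x \<in> frontier \<Omega> - (\<Union>\<sigma>\<in>\<Sigma>. \<sigma> ` frontier (cbox 0 1)). smooth_boundary_point \<Omega> x))"

definition bounded_domain :: "(real^3) set \<Rightarrow> bool" where
  "bounded_domain \<Omega> \<longleftrightarrow> open \<Omega> \<and> connected \<Omega> \<and> \<Omega> \<noteq> {} \<and> bounded \<Omega>"

section \<open>Matrices and differential operators\<close>

text \<open>The library inner product and norm on \<open>real^3^3\<close> are the Frobenius ones.\<close>

lemma inner_matrix_eq_trace:
  fixes X Y :: "real^3^3"
  shows "X \<bullet> Y = trace (X ** transpose Y)"
  by (simp add: inner_vec_def trace_def matrix_matrix_mult_def transpose_def)

definition sym_part :: "real^3^3 \<Rightarrow> real^3^3" where
  "sym_part X = (1/2) *\<^sub>R (X + transpose X)"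

definition Sym3 :: "(real^3^3) set" where
  "Sym3 = {X. transpose X = X}"

text \<open>The \<open>i\<close>-th row of \<open>grad u x\<close> is the gradient of the \<open>i\<close>-th component of \<open>u\<close>.\<close>

definition grad :: "(real^3 \<Rightarrow> real^3) \<Rightarrow> real^3 \<Rightarrow> real^3^3" where
  "grad u x = jacobian u (at x)"

definition div_vec :: "(real^3 \<Rightarrow> real^3) \<Rightarrow> real^3 \<Rightarrow> real" where
  "div_vec v x = trace (grad v x)"

definition curl_vec :: "(real^3 \<Rightarrow> real^3) \<Rightarrow> real^3 \<Rightarrow> real^3" where
  "curl_vec v x = vector
     [grad v x $ 3 $ 2 - grad v x $ 2 $ 3,
      grad v x $ 1 $ 3 - grad v x $ 3 $ 1,
      grad v x $ 2 $ 1 - grad v x $ 1 $ 2]"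

definition Div :: "(real^3 \<Rightarrow> real^3^3) \<Rightarrow> real^3 \<Rightarrow> real^3" where
  "Div X x = (\<chi> i. div_vec (\<lambda>y. X y $ i) x)"

definition Curl :: "(real^3 \<Rightarrow> real^3^3) \<Rightarrow> real^3 \<Rightarrow> real^3^3" where
  "Curl X x = (\<chi> i. curl_vec (\<lambda>y. X y $ i) x)"

text \<open>Time derivative on \<open>[0,T]\<close>, one-sided at the end points.\<close>

definition dt ::
  "real \<Rightarrow> (real^3 \<Rightarrow> real \<Rightarrow> 'b::real_normed_vector) \<Rightarrow> real^3 \<Rightarrow> real \<Rightarrow> 'b" where
  "dt T w x t = vector_derivative (\<lambda>s. w x s) (at t within {0..T})"

definition L2_norm :: "(real^3) set \<Rightarrow> (real^3 \<Rightarrow> 'b::real_normed_vector) \<Rightarrow> real" where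
  "L2_norm \<Omega> f = sqrt (LINT x:\<Omega>|lborel. (norm (f x))\<^sup>2)"

section \<open>Fourth order tensors\<close>

type_synonym tensor4 = "real^3^3^3^3"

definition tensor_app :: "tensor4 \<Rightarrow> real^3^3 \<Rightarrow> real^3^3"  (infixr \<open>\<odot>\<close> 75) where
  "A \<odot> X = (\<chi> i j. \<Sum>k\<in>UNIV. \<Sum>l\<in>UNIV. A $ i $ j $ k $ l * X $ k $ l)"

definition major_symmetric :: "tensor4 \<Rightarrow> bool" where
  "major_symmetric A \<longleftrightarrow> (\<forall>i j r s. A $ i $ j $ r $ s = A $ r $ s $ i $ j)"

definition minor_symmetric :: "tensor4 \<Rightarrow> bool" where
  "minor_symmetric A \<longleftrightarrow> (\<forall>i j r s. A $ i $ j $ r $ s = A $ j $ i $ r $ s)"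

text \<open>Minor symmetry makes every value of the tensor symmetric, so that it maps \<open>Sym3\<close> to
  \<open>Sym3\<close>.\<close>

lemma minor_symmetric_app:
  assumes "minor_symmetric A"
  shows "A \<odot> X \<in> Sym3"
proof -
  have "A $ j $ i $ k $ l = A $ i $ j $ k $ l" for i j k l
    using assms by (simp add: minor_symmetric_def)
  then show ?thesis
    by (simp add: Sym3_def tensor_app_def transpose_def vec_eq_iff)
qed

definition positive_definite_on ::
  "(real^3^3) set \<Rightarrow> (real^3) set \<Rightarrow> (real^3 \<Rightarrow> tensor4) \<Rightarrow> bool" where
  "positive_definite_on V \<Omega> A \<longleftrightarrow>
     (\<exists>m M. 0 < m \<and> 0 < M \<and>
        (\<forall>x\<in>\<Omega>. \<forall>X\<in>V. m * (norm X)\<^sup>2 \<le> (A x \<odot> X) \<bullet> X \<and> (A x \<odot> X) \<bullet> X \<le> M * (norm X)\<^sup>2))"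

definition admissible_coefficients ::
  "(real^3) set \<Rightarrow> (real^3 \<Rightarrow> tensor4) \<Rightarrow> (real^3 \<Rightarrow> tensor4) \<Rightarrow> (real^3 \<Rightarrow> tensor4) \<Rightarrow> bool" where
  "admissible_coefficients \<Omega> \<C> \<H> \<L> \<longleftrightarrow>
     Ck_on 1 \<Omega> \<C> \<and> Ck_on 1 \<Omega> \<H> \<and> Ck_on 1 \<Omega> \<L> \<and>
     (\<forall>x\<in>\<Omega>. major_symmetric (\<C> x) \<and> minor_symmetric (\<C> x)) \<and>
     (\<forall>x\<in>\<Omega>. major_symmetric (\<H> x) \<and> minor_symmetric (\<H> x)) \<and>
     (\<forall>x\<in>\<Omega>. major_symmetric (\<L> x)) \<and>
     positive_definite_on Sym3 \<Omega> \<C> \<and>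
     positive_definite_on Sym3 \<Omega> \<H> \<and>
     positive_definite_on UNIV \<Omega> \<L>"

section \<open>The initial-boundary value problem and the energy\<close>

text \<open>Solutions are classical: of class \<open>C\<^sup>2\<close> on \<open>\<Omega> \<times> [0,T]\<close>, where the equations are posed, and
  of class \<open>C\<^sup>1\<close> up to the boundary. The tangential condition is imposed at the boundary points
  that have a normal, i.e. not at edges and corners.\<close>

definition solution_of_P ::
  "(real^3) set \<Rightarrow> real \<Rightarrow>
   (real^3 \<Rightarrow> tensor4) \<Rightarrow> (real^3 \<Rightarrow> tensor4) \<Rightarrow> (real^3 \<Rightarrow> tensor4) \<Rightarrow>
   (real^3 \<Rightarrow> real \<Rightarrow> real^3) \<Rightarrow> (real^3 \<Rightarrow> real \<Rightarrow> real^3^3) \<Rightarrow>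
   (real^3 \<Rightarrow> real^3) \<Rightarrow> (real^3 \<Rightarrow> real^3) \<Rightarrow> (real^3 \<Rightarrow> real^3^3) \<Rightarrow> (real^3 \<Rightarrow> real^3^3) \<Rightarrow>
   (real^3 \<Rightarrow> real \<Rightarrow> real^3) \<Rightarrow> (real^3 \<Rightarrow> real \<Rightarrow> real^3^3) \<Rightarrow> bool" where
  "solution_of_P \<Omega> T \<C> \<H> \<L> f M u0 du0 P0 dP0 u P \<longleftrightarrow>
     Ck_on 2 (\<Omega> \<times> {0..T}) (\<lambda>(x, t). u x t) \<and>
     Ck_on 2 (\<Omega> \<times> {0..T}) (\<lambda>(x, t). P x t) \<and>
     C1_on_closure (\<Omega> \<times> {0..T}) (\<lambda>(x, t). u x t) \<and>
     C1_on_closure (\<Omega> \<times> {0..T}) (\<lambda>(x, t). P x t) \<and>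
     (\<forall>x\<in>\<Omega>. \<forall>t\<in>{0..T}.
        dt T (dt T u) x t =
          Div (\<lambda>y. \<C> y \<odot> sym_part (grad (\<lambda>z. u z t) y - P y t)) x + f x t) \<and>
     (\<forall>x\<in>\<Omega>. \<forall>t\<in>{0..T}.
        dt T (dt T P) x t =
          - Curl (\<lambda>y. \<L> y \<odot> Curl (\<lambda>z. P z t) y) x
          + \<C> x \<odot> sym_part (grad (\<lambda>z. u z t) x - P x t)
          - \<H> x \<odot> sym_part (P x t) + M x t) \<and>
     (\<forall>x\<in>frontier \<Omega>. \<forall>t\<in>{0..T}. u x t = 0) \<and>
     (\<forall>x\<in>frontier \<Omega>. \<forall>t\<in>{0..T}. \<forall>n. is_outward_unit_normal \<Omega> x n \<longrightarrow>
        (\<forall>i. cross3 (P x t $ i) n = 0)) \<and>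
     (\<forall>x\<in>closure \<Omega>. u x 0 = u0 x \<and> dt T u x 0 = du0 x \<and> P x 0 = P0 x \<and> dt T P x 0 = dP0 x)"

definition energy ::
  "(real^3) set \<Rightarrow> real \<Rightarrow>
   (real^3 \<Rightarrow> tensor4) \<Rightarrow> (real^3 \<Rightarrow> tensor4) \<Rightarrow> (real^3 \<Rightarrow> tensor4) \<Rightarrow>
   (real^3 \<Rightarrow> real \<Rightarrow> real^3) \<Rightarrow> (real^3 \<Rightarrow> real \<Rightarrow> real^3^3) \<Rightarrow> real \<Rightarrow> real" where
  "energy \<Omega> T \<C> \<H> \<L> u P t =
     (1/2) * (LINT x:\<Omega>|lborel.
        (norm (dt T u x t))\<^sup>2 + (norm (dt T P x t))\<^sup>2
        + (\<C> x \<odot> sym_part (grad (\<lambda>z. u z t) x - P x t)) \<bullet> sym_part (grad (\<lambda>z. u z t) x - P x t)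
        + (\<H> x \<odot> sym_part (P x t)) \<bullet> sym_part (P x t)
        + (\<L> x \<odot> Curl (\<lambda>z. P z t) x) \<bullet> Curl (\<lambda>z. P z t) x)"

end

theory Submission
  imports Defs
begin

text \<open>
  For vanishing loads the energy is conserved, and it controls the five norms; the constant \<open>a\<close> is the ratio between the two.

  The energy controls the norms. By positive definiteness it bounds the velocities, \<open>sym (\<nabla>u - P)\<close>, \<open>sym P\<close> and \<open>Curl P\<close> in \<open>L\<^sup>2\<close>. For \<open>P\<close> itself one needs
  \<open>\<parallel>P\<parallel>\<^sup>2 \<le> C (\<parallel>sym P\<parallel>\<^sup>2 + \<parallel>Curl P\<parallel>\<^sup>2)\<close> for fields with vanishing tangential part on the boundary (\<open>incompatible_korn_on_domain\<close>), and then Korn's first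
  inequality for \<open>u\<close> (\<open>korn_on_domain\<close>) bounds \<open>\<nabla>u\<close>, because \<open>sym \<nabla>u = sym (\<nabla>u - P) + sym P\<close>. For the inequality for \<open>P\<close>, the field is extended by zero
  to the whole space. Each mollified row is written as the gradient of an explicit compactly supported potential plus a remainder that is bounded by the curl
  (\<open>gradient_part_of_row\<close>), and Korn's first inequality is applied to the potentials. The constant depends only on the radius of a ball that contains the domain.

  The energy is conserved. A solution is of class \<open>C\<^sup>1\<close> up to the boundary, but its second derivatives may blow up there, so the energy integral cannot simply be
  differentiated. Instead, for two times \<open>s\<close> and \<open>t\<close>, consider \<open>N(s, t) = \<integral> u\<^sub>t(s) \<bullet> u(t) + P\<^sub>t(s) \<bullet> P(t)\<close>. Its derivative in \<open>t\<close> is the kinetic form \<open>k(s, t)\<close>, and its derivative in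
  \<open>s\<close> is minus the elastic form \<open>b(s, t)\<close>, which is the weak form of the field equations (\<open>pairing_derivative_first\<close>). Both forms are symmetric, hence \<open>N(s, t) - N(t, s)\<close>
  depends on \<open>s - t\<close> only, and its derivative on the diagonal, \<open>- (b(t, t) + k(t, t)) = - 2 E(t)\<close>, is constant
  (\<open>energy_identity_from_symmetric_pairing\<close>).

  Both parts rest on Green formulas for fields that are continuous up to the boundary but have derivatives only inside, on a domain whose boundary is only piecewise
  smooth. They are proved with cutoffs that are functions of the squared distance to the boundary (\<open>boundary_cutoffs\<close>). The squared distance differs from \<open>\<parallel>x\<parallel>\<^sup>2\<close> by a convex
  function; almost everywhere it has the gradient \<open>2 (x - p)\<close>, where \<open>p\<close> is the nearest boundary point, and \<open>x - p\<close> is normal to the boundary if \<open>p\<close> is a smooth point.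
  So the boundary conditions make the integrals over the layer of width \<open>\<delta>\<close> vanish in the limit, where the cutoff has slope \<open>O(1 / \<delta>)\<close>. The edges of the boundary do no harm, since
  their \<open>\<delta>\<close>-neighbourhoods have volume \<open>O(\<delta>\<^sup>2)\<close>.
\<close>

section \<open>Volume of thin neighbourhoods of the boundary\<close>

lemma frechet_bound_from_basis:
  fixes f' :: "'a::euclidean_space \<Rightarrow> 'b::real_normed_vector"
  assumes "linear f'" and B: "\<And>b. b \<in> Basis \<Longrightarrow> norm (f' b) \<le> B b"
  shows "norm (f' h) \<le> (\<Sum>b\<in>Basis. B b) * norm h"
proof -
  have "f' h = (\<Sum>b\<in>Basis. (h \<bullet> b) *\<^sub>R f' b)"
    using assms(1) by (subst euclidean_representation[of h, symmetric])
      (simp only: linear_sum linear_cmul)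
  also have "norm \<dots> \<le> (\<Sum>b\<in>Basis. norm h * B b)"
    by (rule sum_norm_le) (auto intro!: mult_mono Basis_le_norm B)
  finally show ?thesis by (simp add: sum_distrib_left mult.commute)
qed

lemma C1_lipschitz_on_compact_convex:
  fixes f :: "'a::euclidean_space \<Rightarrow> 'b::real_normed_vector"
  assumes W: "open W" "Ck_on 1 W f" and S: "compact S" "convex S" "S \<subseteq> W"
  shows "\<exists>L\<ge>0. \<forall>x\<in>S. \<forall>y\<in>S. dist (f x) (f y) \<le> L * dist x y"
proof -
  have der: "(f has_derivative frechet_derivative f (at x within W)) (at x within S)" if "x \<in> S" for x
    using W that S frechet_derivative_works has_derivative_subset[of f _ x W S] by fastforce
  have "\<exists>B. \<forall>x\<in>S. norm (frechet_derivative f (at x within W) b) \<le> B" if "b \<in> Basis" for b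
  proof -
    have "continuous_on S (\<lambda>x. frechet_derivative f (at x within W) b)"
      using W that S by (auto intro: continuous_on_subset)
    then have "bounded ((\<lambda>x. frechet_derivative f (at x within W) b) ` S)"
      using S compact_continuous_image compact_imp_bounded by blast
    then show ?thesis by (auto simp: bounded_iff)
  qed
  then obtain B where B: "\<And>b x. b \<in> Basis \<Longrightarrow> x \<in> S \<Longrightarrow>
      norm (frechet_derivative f (at x within W) b) \<le> B b"
    by metis
  define L where "L = max 0 (\<Sum>b\<in>Basis. B b)"
  have "norm (f x - f y) \<le> L * norm (x - y)" if "x \<in> S" "y \<in> S" for x y
  proof (rule differentiable_bound[OF S(2) der _ that])
    fix z assume z: "z \<in> S"
    have "norm (frechet_derivative f (at z within W) h) \<le> L * norm h" for h
    proof -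
      have "norm (frechet_derivative f (at z within W) h) \<le> (\<Sum>b\<in>Basis. B b) * norm h"
        by (rule frechet_bound_from_basis)
          (use der[OF z] B z in \<open>auto intro: has_derivative_linear\<close>)
      also have "\<dots> \<le> L * norm h" by (auto simp: L_def intro!: mult_right_mono)
      finally show ?thesis .
    qed
    then show "onorm (frechet_derivative f (at z within W)) \<le> L" by (rule onorm_le)
  qed
  moreover have "L \<ge> 0" by (simp add: L_def)
  ultimately show ?thesis by (auto simp: dist_norm)
qed

definition thickening :: "'a::metric_space set \<Rightarrow> real \<Rightarrow> 'a set" where
  "thickening K r = (\<Union>p\<in>K. cball p r)"

lemma mem_thickening: "x \<in> thickening K r \<longleftrightarrow> (\<exists>p\<in>K. dist x p \<le> r)"
  by (auto simp: thickening_def dist_commute)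

lemma compact_thickening:
  fixes K :: "'a::euclidean_space set"
  assumes "compact K" shows "compact (thickening K r)"
proof -
  have "thickening K r = {x + y |x y. x \<in> K \<and> y \<in> cball 0 r}"
  proof (intro set_eqI iffI)
    fix x assume "x \<in> thickening K r"
    then obtain p where "p \<in> K" "dist x p \<le> r" by (auto simp: mem_thickening)
    moreover have "x = p + (x - p)" by simp
    ultimately show "x \<in> {x + y |x y. x \<in> K \<and> y \<in> cball 0 r}"
      unfolding mem_Collect_eq mem_cball_0 dist_norm by blast
  qed (auto simp: mem_thickening dist_norm intro!: bexI)
  then show ?thesis using compact_sums[OF assms compact_cball, of 0 r] by simp
qed

lemma measure_thickening_le_net:
  fixes K :: "(real^3) set"
  assumes K: "compact K" and A: "finite A" "card A \<le> m"
    and net: "\<And>p. p \<in> K \<Longrightarrow> \<exists>a\<in>A. dist p a \<le> s" and rs: "0 \<le> r" "0 \<le> s"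
  shows "measure lborel (thickening K r) \<le> m * (unit_ball_vol 3 * (r + s) ^ 3)"
proof -
  have sub: "thickening K r \<subseteq> (\<Union>a\<in>A. cball a (r + s))"
  proof
    fix x assume "x \<in> thickening K r"
    then obtain p where p: "p \<in> K" "dist x p \<le> r" by (auto simp: mem_thickening)
    with net obtain a where "a \<in> A" "dist p a \<le> s" by blast
    with p show "x \<in> (\<Union>a\<in>A. cball a (r + s))"
      using dist_triangle[of x a p] by (auto simp: dist_commute intro!: bexI[of _ a])
  qed
  have "measure lborel (thickening K r) \<le> measure lborel (\<Union>a\<in>A. cball a (r + s))"
    using A compact_thickening[OF K, of r]
    by (intro measure_mono_fmeasurable[OF sub])
      (auto intro!: fmeasurable.finite_UN fmeasurable_compact borel_compact)
  also have "\<dots> \<le> (\<Sum>a\<in>A. measure lborel (cball a (r + s)))"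
    by (rule measure_UNION_le) (use A in auto)
  also have "\<dots> = card A * (unit_ball_vol 3 * (r + s) ^ 3)"
    using rs by (simp add: content_cball)
  also have "\<dots> \<le> m * (unit_ball_vol 3 * (r + s) ^ 3)"
    using A rs by (intro mult_right_mono) auto
  finally show ?thesis .
qed

text \<open>A patch is Lipschitz on the closed square. Hence, with \<open>N\<close> close to \<open>1 / r\<close>, the images of the \<open>(N + 1)\<^sup>2\<close> points of a square grid form a
  net of mesh \<open>O(r)\<close> in the patch, and the images of the \<open>O(N)\<close> grid points on the edges form such a net in its edges. Balls of radius \<open>O(r)\<close>
  about these points have volume \<open>O(r\<^sup>3)\<close> each.\<close>

lemma patch_thickening:
  assumes "smooth_patch \<sigma>"
  shows "\<exists>C\<ge>0. \<forall>r\<in>{0<..1}. measure lborel (thickening (\<sigma> ` cbox 0 1) r) \<le> C * r \<and>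
    measure lborel (thickening (\<sigma> ` frontier (cbox 0 1)) r) \<le> C * r\<^sup>2"
proof -
  obtain W where W: "open W" "cbox 0 1 \<subseteq> W" "smooth_on W \<sigma>" using assms by (auto simp: smooth_patch_def)
  then have "Ck_on 1 W \<sigma>" by (auto simp: smooth_on_def)
  from C1_lipschitz_on_compact_convex[OF W(1) this _ _ W(2)]
  obtain L where L: "L \<ge> 0" "\<And>x y. x \<in> cbox 0 1 \<Longrightarrow> y \<in> cbox 0 1 \<Longrightarrow> dist (\<sigma> x) (\<sigma> y) \<le> L * dist x y"
    by auto
  have cont: "continuous_on (cbox 0 1) \<sigma>"
  proof -
    have "Ck_on 0 W \<sigma>" using W by (simp only: smooth_on_def)
    then show ?thesis using W(2) by (auto intro: continuous_on_subset)
  qed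
  have fr: "frontier (cbox 0 1) \<subseteq> cbox (0::real^2) 1" by (simp add: frontier_subset_closed closed_cbox)
  have cK: "compact (\<sigma> ` cbox 0 1)" "compact (\<sigma> ` frontier (cbox 0 1))"
    using cont fr by (auto intro!: compact_continuous_image compact_frontier intro: continuous_on_subset)
  define g :: "nat \<Rightarrow> nat \<times> nat \<Rightarrow> real^2" where "g N = (\<lambda>(i, j). vector [i / N, j / N])" for N
  have g: "\<exists>i\<le>N. \<exists>j\<le>N. dist p (g N (i, j)) \<le> 2 / N \<and> g N (i, j) \<in> cbox 0 1 \<and>
      (p $ 1 \<in> {0, 1} \<longrightarrow> i \<in> {0, N}) \<and> (p $ 2 \<in> {0, 1} \<longrightarrow> j \<in> {0, N})"
    if p: "p \<in> cbox 0 1" and N: "N > 0" for p :: "real^2" and N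
  proof -
    have "\<exists>i\<le>N. \<bar>t - i / N\<bar> \<le> 1 / N \<and> (t \<in> {0, 1} \<longrightarrow> i \<in> {0, N})" if t: "0 \<le> t" "t \<le> 1" for t :: real
    proof (intro exI[of _ "nat \<lfloor>N * t\<rfloor>"] conjI)
      have "N * t \<le> N" using t by (simp add: mult_left_le)
      then show "nat \<lfloor>N * t\<rfloor> \<le> N" by linarith
      have "0 \<le> N * t" using t by simp
      then have "\<bar>N * t - real (nat \<lfloor>N * t\<rfloor>)\<bar> \<le> 1" by linarith
      then have "\<bar>N * t - real (nat \<lfloor>N * t\<rfloor>)\<bar> / N \<le> 1 / N" by (rule divide_right_mono) simp
      moreover have "\<bar>N * t - real (nat \<lfloor>N * t\<rfloor>)\<bar> / N = \<bar>t - real (nat \<lfloor>N * t\<rfloor>) / N\<bar>"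
        using N by (simp add: field_simps abs_divide)
      ultimately show "\<bar>t - real (nat \<lfloor>N * t\<rfloor>) / N\<bar> \<le> 1 / N" by simp
    qed auto
    moreover have "0 \<le> p $ 1" "p $ 1 \<le> 1" "0 \<le> p $ 2" "p $ 2 \<le> 1"
      using p by (auto simp: mem_box_cart)
    ultimately obtain i j where ij: "i \<le> N" "\<bar>p $ 1 - i / N\<bar> \<le> 1 / N" "p $ 1 \<in> {0, 1} \<longrightarrow> i \<in> {0, N}"
      "j \<le> N" "\<bar>p $ 2 - j / N\<bar> \<le> 1 / N" "p $ 2 \<in> {0, 1} \<longrightarrow> j \<in> {0, N}" by metis
    have "dist p (g N (i, j)) \<le> (\<Sum>k\<in>UNIV. \<bar>(p - g N (i, j)) $ k\<bar>)"
      unfolding dist_norm by (rule norm_le_l1_cart)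
    also have "\<dots> \<le> 2 / N" using ij by (simp add: sum_2 g_def vector_2)
    finally have "dist p (g N (i, j)) \<le> 2 / N" .
    moreover have "g N (i, j) \<in> cbox 0 1"
      using ij by (auto simp: mem_box_cart g_def forall_2 vector_2 divide_le_eq_1)
    ultimately show ?thesis using ij by blast
  qed
  define c where "c = unit_ball_vol 3 * (2 * L + 1) ^ 3"
  have c: "c \<ge> 0" using L by (auto simp: c_def)
  have main: "measure lborel (thickening (\<sigma> ` cbox 0 1) r) \<le> 9 * c * r \<and>
     measure lborel (thickening (\<sigma> ` frontier (cbox 0 1)) r) \<le> 12 * c * r\<^sup>2" if r: "r \<in> {0<..1}" for r
  proof -
    define N where "N = nat \<lceil>1 / r\<rceil>"
    have "1 / r \<ge> 1" using r by auto
    then have "real N = of_int \<lceil>1 / r\<rceil>" unfolding N_def by (intro of_nat_nat) simp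
    then have N: "N \<ge> 1 / r" "N < 1 / r + 1"
      using ceiling_correct[of "1 / r"] by simp_all
    then have "N \<ge> 1" using \<open>1 / r \<ge> 1\<close> by linarith
    then have "N > 0" by simp
    note N = N this
    have "N + 1 \<le> 1 / r + (1 / r + 1 / r)" using N(2) \<open>1 / r \<ge> 1\<close> by linarith
    then have N1: "N + 1 \<le> 3 / r" by simp
    have "1 \<le> N * r" using N(1) r by (simp add: divide_le_eq)
    then have "2 / N \<le> 2 * r" using N(3) by (simp add: divide_le_eq mult_ac)
    then have net: "\<exists>i\<le>N. \<exists>j\<le>N. dist (\<sigma> p) (\<sigma> (g N (i, j))) \<le> 2 * L * r \<and>
      (p $ 1 \<in> {0, 1} \<longrightarrow> i \<in> {0, N}) \<and> (p $ 2 \<in> {0, 1} \<longrightarrow> j \<in> {0, N})"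
      if p: "p \<in> cbox 0 1" for p :: "real^2"
    proof -
      obtain i j where ij: "i \<le> N" "j \<le> N" "dist p (g N (i, j)) \<le> 2 / N" "g N (i, j) \<in> cbox 0 1"
        "(p $ 1 \<in> {0, 1} \<longrightarrow> i \<in> {0, N}) \<and> (p $ 2 \<in> {0, 1} \<longrightarrow> j \<in> {0, N})"
        using g[OF p N(3)] by blast
      have "dist (\<sigma> p) (\<sigma> (g N (i, j))) \<le> L * dist p (g N (i, j))" using L p ij by auto
      also have "\<dots> \<le> L * (2 * r)" using ij \<open>2 / N \<le> 2 * r\<close> L by (intro mult_left_mono) auto
      finally show ?thesis using ij by (auto simp: mult_ac)
    qed
    have e: "r + 2 * L * r = (2 * L + 1) * r" by algebra
    have 1: "measure lborel (thickening (\<sigma> ` cbox 0 1) r)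
        \<le> ((N + 1) * (N + 1)) * (unit_ball_vol 3 * (r + 2 * L * r) ^ 3)"
    proof (rule measure_thickening_le_net[where A = "(\<sigma> \<circ> g N) ` ({..N} \<times> {..N})"])
      show "card ((\<sigma> \<circ> g N) ` ({..N} \<times> {..N})) \<le> (N + 1) * (N + 1)"
        by (rule order_trans[OF card_image_le]) auto
      show "\<exists>a\<in>(\<sigma> \<circ> g N) ` ({..N} \<times> {..N}). dist q a \<le> 2 * L * r" if q: "q \<in> \<sigma> ` cbox 0 1" for q
      proof -
        obtain p where p: "p \<in> cbox 0 1" "q = \<sigma> p" using q by blast
        obtain i j where "i \<le> N" "j \<le> N" "dist (\<sigma> p) (\<sigma> (g N (i, j))) \<le> 2 * L * r"
          using net[OF p(1)] by blast
        then show ?thesis using p by (intro bexI[of _ "\<sigma> (g N (i, j))"]) auto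
      qed
      show "compact (\<sigma> ` cbox 0 1)" by (rule cK)
    qed (use r L in auto)
    have 2: "measure lborel (thickening (\<sigma> ` frontier (cbox 0 1)) r)
        \<le> (4 * (N + 1)) * (unit_ball_vol 3 * (r + 2 * L * r) ^ 3)"
    proof (rule measure_thickening_le_net[where A = "(\<sigma> \<circ> g N) ` ({0, N} \<times> {..N} \<union> {..N} \<times> {0, N})"])
      have "card ({0, N} \<times> {..N} \<union> {..N} \<times> {0, N}) \<le> 4 * (N + 1)"
        by (rule order_trans[OF card_Un_le]) (auto simp: card_cartesian_product card_insert_if)
      then show "card ((\<sigma> \<circ> g N) ` ({0, N} \<times> {..N} \<union> {..N} \<times> {0, N})) \<le> 4 * (N + 1)"
        by (rule order_trans[OF card_image_le, rotated]) auto
      show "compact (\<sigma> ` frontier (cbox 0 1))" by (rule cK)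
      fix q assume "q \<in> \<sigma> ` frontier (cbox 0 1)"
      then obtain p where p: "p \<in> frontier (cbox 0 1)" "q = \<sigma> p" by auto
      then have pc: "p \<in> cbox 0 1" using fr by auto
      have "p \<notin> box 0 1" using p by (auto simp: frontier_def)
      then have "p $ 1 \<in> {0, 1} \<or> p $ 2 \<in> {0, 1}" using pc by (auto simp: mem_box_cart forall_2)
      with net[OF pc] obtain i j where ij: "i \<le> N" "j \<le> N" "dist (\<sigma> p) (\<sigma> (g N (i, j))) \<le> 2 * L * r"
        and "i \<in> {0, N} \<or> j \<in> {0, N}" by blast
      then have "(i, j) \<in> {0, N} \<times> {..N} \<union> {..N} \<times> {0, N}" by auto
      with ij(3) p show "\<exists>a\<in>(\<sigma> \<circ> g N) ` ({0, N} \<times> {..N} \<union> {..N} \<times> {0, N}). dist q a \<le> 2 * L * r"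
        by (intro bexI[of _ "\<sigma> (g N (i, j))"]) (auto intro!: image_eqI[of _ _ "(i, j)"])
    qed (use r L in auto)
    have "((N + 1) * (N + 1)) * (unit_ball_vol 3 * (r + 2 * L * r) ^ 3) = (N + 1) * (N + 1) * (c * r ^ 3)"
      unfolding e c_def by (simp add: power_mult_distrib)
    also have "\<dots> \<le> (3 / r * (3 / r)) * (c * r ^ 3)"
      unfolding of_nat_mult using N1 c r by (intro mult_right_mono mult_mono) auto
    also have "\<dots> = 9 * c * r" using r by (simp add: field_simps power3_eq_cube)
    finally have 3: "((N + 1) * (N + 1)) * (unit_ball_vol 3 * (r + 2 * L * r) ^ 3) \<le> 9 * c * r" .
    have "(4 * (N + 1)) * (unit_ball_vol 3 * (r + 2 * L * r) ^ 3) = 4 * (N + 1) * (c * r ^ 3)"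
      unfolding e c_def by (simp add: power_mult_distrib)
    also have "\<dots> \<le> 4 * (3 / r) * (c * r ^ 3)"
      using N1 c r by (intro mult_right_mono mult_left_mono) auto
    also have "\<dots> = 12 * c * r\<^sup>2" using r by (simp add: field_simps power3_eq_cube power2_eq_square)
    finally show ?thesis using 1 2 3 by auto
  qed
  show ?thesis
  proof (intro exI[of _ "12 * c"] conjI ballI)
    fix r :: real assume r: "r \<in> {0<..1}"
    have "9 * c * r \<le> 12 * c * r" using c r by (intro mult_right_mono) auto
    then show "measure lborel (thickening (\<sigma> ` cbox 0 1) r) \<le> 12 * c * r" using main[OF r] by linarith
    show "measure lborel (thickening (\<sigma> ` frontier (cbox 0 1)) r) \<le> 12 * c * r\<^sup>2" using main[OF r] by blast
  qed (use c in auto)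
qed

text \<open>The set \<open>K\<close> of the patch edges, where a normal need not exist, is one dimension smaller than the boundary. Its neighbourhoods are
  therefore negligible against cutoffs of slope \<open>1 / r\<close>, while those of the whole boundary are just small enough to give a bounded contribution.\<close>

lemma piecewise_smooth_boundary_thickening:
  assumes "piecewise_smooth_boundary \<Omega>"
  shows "\<exists>K C. compact K \<and> K \<subseteq> frontier \<Omega> \<and> C \<ge> 0 \<and>
    (\<forall>p\<in>frontier \<Omega> - K. smooth_boundary_point \<Omega> p) \<and>
    (\<forall>r\<in>{0<..1}. measure lborel (thickening (frontier \<Omega>) r) \<le> C * r \<and>
                  measure lborel (thickening K r) \<le> C * r\<^sup>2)"
proof -
  obtain \<Sigma> where S: "finite \<Sigma>" "\<And>\<sigma>. \<sigma> \<in> \<Sigma> \<Longrightarrow> smooth_patch \<sigma>"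
    and F: "frontier \<Omega> = (\<Union>\<sigma>\<in>\<Sigma>. \<sigma> ` cbox 0 1)"
    and sm: "\<forall>x \<in> frontier \<Omega> - (\<Union>\<sigma>\<in>\<Sigma>. \<sigma> ` frontier (cbox 0 1)). smooth_boundary_point \<Omega> x"
    using assms unfolding piecewise_smooth_boundary_def by auto
  define K where "K = (\<Union>\<sigma>\<in>\<Sigma>. \<sigma> ` frontier (cbox 0 1))"
  have fr: "frontier (cbox 0 1) \<subseteq> cbox (0::real^2) 1" by (simp add: frontier_subset_closed closed_cbox)
  have cont: "continuous_on (cbox 0 1) \<sigma>" if \<sigma>: "\<sigma> \<in> \<Sigma>" for \<sigma>
  proof -
    obtain W where W: "open W" "cbox 0 1 \<subseteq> W" "smooth_on W \<sigma>"
      using S(2)[OF \<sigma>] unfolding smooth_patch_def by auto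
    moreover from W have "Ck_on 0 W \<sigma>" by (simp only: smooth_on_def)
    ultimately show ?thesis by (auto intro: continuous_on_subset)
  qed
  have c1: "compact (\<sigma> ` cbox 0 1)" "compact (\<sigma> ` frontier (cbox 0 1))" if "\<sigma> \<in> \<Sigma>" for \<sigma>
    using cont[OF that] fr by (auto intro!: compact_continuous_image compact_frontier intro: continuous_on_subset)
  have "\<forall>\<sigma>\<in>\<Sigma>. \<exists>C\<ge>0. \<forall>r\<in>{0<..1}. measure lborel (thickening (\<sigma> ` cbox 0 1) r) \<le> C * r \<and>
    measure lborel (thickening (\<sigma> ` frontier (cbox 0 1)) r) \<le> C * r\<^sup>2"
    using S patch_thickening by blast
  then obtain C where C: "\<And>\<sigma>. \<sigma> \<in> \<Sigma> \<Longrightarrow> C \<sigma> \<ge> 0"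
    "\<And>\<sigma> r. \<sigma> \<in> \<Sigma> \<Longrightarrow> r \<in> {0<..1} \<Longrightarrow> measure lborel (thickening (\<sigma> ` cbox 0 1) r) \<le> C \<sigma> * r \<and>
    measure lborel (thickening (\<sigma> ` frontier (cbox 0 1)) r) \<le> C \<sigma> * r\<^sup>2"
    by metis
  have U: "measure lborel (thickening (\<Union>\<sigma>\<in>\<Sigma>. A \<sigma>) r) \<le> (\<Sum>\<sigma>\<in>\<Sigma>. measure lborel (thickening (A \<sigma>) r))"
    if "\<And>\<sigma>. \<sigma> \<in> \<Sigma> \<Longrightarrow> compact (A \<sigma>)" for A :: "(real^2 \<Rightarrow> real^3) \<Rightarrow> (real^3) set" and r
  proof -
    have "thickening (\<Union>\<sigma>\<in>\<Sigma>. A \<sigma>) r = (\<Union>\<sigma>\<in>\<Sigma>. thickening (A \<sigma>) r)" by (auto simp: thickening_def)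
    then show ?thesis
      using S(1) that by (auto intro!: measure_UNION_le borel_compact compact_thickening)
  qed
  show ?thesis
  proof (intro exI[of _ K] exI[of _ "\<Sum>\<sigma>\<in>\<Sigma>. C \<sigma>"] conjI ballI)
    show "compact K" unfolding K_def using S c1 by (intro compact_UN) auto
    show "K \<subseteq> frontier \<Omega>" unfolding K_def F using fr by auto
    show "(\<Sum>\<sigma>\<in>\<Sigma>. C \<sigma>) \<ge> 0" using C by (intro sum_nonneg) auto
    show "smooth_boundary_point \<Omega> p" if "p \<in> frontier \<Omega> - K" for p using sm that K_def by auto
    fix r :: real assume r: "r \<in> {0<..1}"
    show "measure lborel (thickening (frontier \<Omega>) r) \<le> (\<Sum>\<sigma>\<in>\<Sigma>. C \<sigma>) * r"
      unfolding F sum_distrib_right using C r c1 by (intro order_trans[OF U] sum_mono) auto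
    show "measure lborel (thickening K r) \<le> (\<Sum>\<sigma>\<in>\<Sigma>. C \<sigma>) * r\<^sup>2"
      unfolding K_def sum_distrib_right using C r c1 by (intro order_trans[OF U] sum_mono) auto
  qed
qed

section \<open>The gradient of the squared distance\<close>

lemma lborel_integral_shift:
  fixes f :: "'a::euclidean_space \<Rightarrow> real"
  assumes "f \<in> borel_measurable borel"
  shows "(LINT x|lborel. f (x + c)) = (LINT x|lborel. f x)"
proof -
  have "(LINT x|lborel. f x) = (LINT x|distr lborel borel ((+) c). f x)"
    by (simp add: lborel_distr_plus)
  also have "\<dots> = (LINT x|lborel. f (c + x))"
    by (rule integral_distr) (use assms in auto)
  finally show ?thesis by (simp add: add.commute)
qed

lemma lborel_integrable_shift:
  fixes f :: "'a::euclidean_space \<Rightarrow> real"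
  assumes "integrable lborel f"
  shows "integrable lborel (\<lambda>x. f (x + c))"
proof -
  have [measurable]: "f \<in> borel_measurable borel" using assms by simp
  have "integrable (distr lborel borel ((+) c)) f" using assms by (simp add: lborel_distr_plus)
  then have "integrable lborel (\<lambda>x. f (c + x))" by (subst (asm) integrable_distr_eq) auto
  then show ?thesis by (simp add: add.commute)
qed

lemma integrable_bounded_support:
  fixes f :: "'a::euclidean_space \<Rightarrow> real"
  assumes "f \<in> borel_measurable borel" "\<And>x. \<bar>f x\<bar> \<le> B" "\<And>x. norm x > R \<Longrightarrow> f x = 0"
  shows "integrable lborel f"
proof (rule Bochner_Integration.integrable_bound[of _ "\<lambda>x. B * indicator (cball 0 R) x"])
  show "integrable lborel (\<lambda>x. B * indicator (cball 0 R) x :: real)"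
    by (intro integrable_mult_right integrable_real_indicator) (use emeasure_bounded_finite[OF bounded_cball] in auto)
  show "AE x in lborel. norm (f x) \<le> norm (B * indicator (cball 0 R) x)"
  proof (rule AE_I2)
    fix x show "norm (f x) \<le> norm (B * indicator (cball 0 R) x)"
      using assms(2)[of x] assms(3)[of x] by (cases "norm x > R") (auto simp: indicator_def)
  qed
qed (use assms in auto)

text \<open>Since \<open>\<parallel>x\<parallel>\<^sup>2 - dist(x, F)\<^sup>2\<close> is the supremum over \<open>p \<in> F\<close> of the affine functions \<open>2 x \<bullet> p - \<parallel>p\<parallel>\<^sup>2\<close>, it is convex, and every nearest
  point \<open>p\<close> of \<open>x\<close> gives a subgradient \<open>2 p\<close> at \<open>x\<close>.\<close>

lemma sqdist_eq_sup_affine: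
  fixes F :: "'a::euclidean_space set"
  assumes "p \<in> F" "dist x p = infdist x F"
  shows "(norm (x + v))\<^sup>2 - (infdist (x + v) F)\<^sup>2 \<ge> (norm x)\<^sup>2 - (infdist x F)\<^sup>2 + 2 * (v \<bullet> p)"
proof -
  have "(infdist (x + v) F)\<^sup>2 \<le> (norm (x + v - p))\<^sup>2"
    using infdist_le[OF assms(1), of "x + v"] by (intro power_mono) (auto simp: dist_norm infdist_nonneg)
  moreover have "(infdist x F)\<^sup>2 = (norm (x - p))\<^sup>2" using assms by (simp add: dist_norm)
  ultimately show ?thesis
    by (simp add: power2_norm_eq_inner inner_simps inner_commute)
qed

text \<open>The convex function \<open>f x = \<parallel>x\<parallel>\<^sup>2 - dist(x, F)\<^sup>2\<close> has nonnegative second differences. Their weighted integrals are \<open>O(\<parallel>v\<parallel>\<^sup>2)\<close>, so after division by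
  the step length they tend to zero in \<open>L\<^sup>1\<close>, hence almost everywhere along a sequence \<open>h\<close> of steps. At such a point the difference quotients of
  \<open>f\<close> are squeezed towards the subgradient given by any nearest point, which is therefore unique. Convergence along this single sequence of steps is
  what the integration by parts below needs.\<close>

lemma sqdist_gradient_AE:
  fixes F :: "'a::euclidean_space set"
  assumes F: "compact F" "F \<noteq> {}"
  shows "\<exists>Dq h. Dq \<in> borel_measurable borel \<and> (\<forall>n. 0 < h n) \<and> h \<longlonglongrightarrow> (0::real) \<and>
    (AE x in lborel. norm x \<le> R \<longrightarrow>
      (\<forall>p\<in>F. dist x p = infdist x F \<longrightarrow> Dq x = 2 *\<^sub>R (x - p)) \<and>
      (\<forall>b\<in>Basis. (\<lambda>n. ((infdist (x + h n *\<^sub>R b) F)\<^sup>2 - (infdist x F)\<^sup>2) / h n) \<longlonglongrightarrow> Dq x \<bullet> b))"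
proof -
  define f where "f x = (norm x)\<^sup>2 - (infdist x F)\<^sup>2" for x :: 'a
  have near: "\<exists>p\<in>F. dist x p = infdist x F" for x
    using infdist_attains_inf[OF compact_imp_closed[OF F(1)] F(2)] by metis
  have sub: "f (x + v) \<ge> f x + 2 * (v \<bullet> p)" if "p \<in> F" "dist x p = infdist x F" for x v p
    using sqdist_eq_sup_affine[OF that] by (simp add: f_def)
  obtain B where B: "\<And>p. p \<in> F \<Longrightarrow> norm p \<le> B" using F compact_imp_bounded bounded_iff by metis
  have B0: "B \<ge> 0" using B F norm_ge_zero order_trans by blast
  have lip: "\<bar>f (x + v) - f x\<bar> \<le> 2 * B * norm v" for x v
  proof -
    have *: "\<bar>2 * (v \<bullet> p)\<bar> \<le> 2 * B * norm v" if "p \<in> F" for p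
      using Cauchy_Schwarz_ineq2[of v p] mult_left_mono[OF B[OF that] norm_ge_zero[of v]] by (simp add: mult_ac)
    obtain p p' where p: "p \<in> F" "dist x p = infdist x F" and p': "p' \<in> F" "dist (x + v) p' = infdist (x + v) F"
      using near by metis
    show ?thesis using sub[OF p, of v] sub[OF p', of "-v"] *[OF p(1)] *[OF p'(1)] by (simp add: abs_le_iff)
  qed
  have fc: "continuous_on UNIV f" unfolding f_def by (intro continuous_intros)
  have fm[measurable]: "f \<in> borel_measurable borel" using fc by (rule borel_measurable_continuous_onI)
  \<comment> \<open>a Lipschitz weight of bounded support that is at least \<open>1\<close> on the ball of radius \<open>R\<close>\<close>
  define \<psi> where "\<psi> x = max 0 (R + 1 - norm x)" for x :: 'a
  have \<psi>m[measurable]: "\<psi> \<in> borel_measurable borel" unfolding \<psi>_def by measurable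
  have \<psi>lip: "\<bar>\<psi> (x + v) - \<psi> x\<bar> \<le> norm v" for x v
    using norm_triangle_ineq3[of "x + v" x] by (auto simp: \<psi>_def max_def abs_le_iff)
  have \<psi>0: "\<psi> x \<ge> 0" "\<psi> x \<le> \<bar>R\<bar> + 1" "norm x > R + 1 \<Longrightarrow> \<psi> x = 0" for x
    using norm_ge_zero[of x] abs_ge_self[of R] by (auto simp: \<psi>_def simp del: norm_ge_zero)
  define g where "g v x = f (x + v) - 2 * f x + f (x - v)" for v x
  have g0: "g v x \<ge> 0" for v x
  proof -
    obtain p where p: "p \<in> F" "dist x p = infdist x F" using near by metis
    show ?thesis using sub[OF p, of v] sub[OF p, of "-v"] by (simp add: g_def)
  qed
  have [measurable]: "g v \<in> borel_measurable borel" for v unfolding g_def by measurable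
  define C where "C = 2 * B * measure lborel (cball (0::'a) (R + 2))"
  have intg: "integrable lborel (\<lambda>x. g v x * \<psi> x)" for v
  proof (rule integrable_bounded_support[where B = "4 * B * norm v * (\<bar>R\<bar> + 1)" and R = "R + 1"])
    fix x
    have "\<bar>g v x\<bar> \<le> 4 * B * norm v" using lip[of x v] lip[of x "-v"] by (simp add: g_def abs_le_iff)
    then show "\<bar>g v x * \<psi> x\<bar> \<le> 4 * B * norm v * (\<bar>R\<bar> + 1)"
      unfolding abs_mult using \<psi>0 by (intro mult_mono) auto
  qed (use \<psi>0 in auto)
  \<comment> \<open>moving one difference to the weight leaves \<open>\<integral> (f (x + v) - f x) (\<psi> x - \<psi> (x + v))\<close>, where both factors are \<open>O(\<parallel>v\<parallel>)\<close>\<close>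
  have small: "(LINT x|lborel. g v x * \<psi> x) \<le> C * (norm v)\<^sup>2" if v: "norm v \<le> 1" for v
  proof -
    define k where "k x = (f x - f (x - v)) * \<psi> x" for x
    have [measurable]: "k \<in> borel_measurable borel" unfolding k_def by measurable
    have ik: "integrable lborel k"
    proof (rule integrable_bounded_support[where B = "2 * B * norm v * (\<bar>R\<bar> + 1)" and R = "R + 1"])
      fix x
      have "\<bar>f x - f (x - v)\<bar> \<le> 2 * B * norm v" using lip[of x "-v"] by (simp add: abs_minus_commute)
      then show "\<bar>k x\<bar> \<le> 2 * B * norm v * (\<bar>R\<bar> + 1)"
        unfolding abs_mult k_def using \<psi>0 by (intro mult_mono) auto
    qed (use \<psi>0 in \<open>auto simp: k_def\<close>)
    have ik': "integrable lborel (\<lambda>x. (f (x + v) - f x) * \<psi> x)"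
    proof (rule integrable_bounded_support[where B = "2 * B * norm v * (\<bar>R\<bar> + 1)" and R = "R + 1"])
      fix x
      show "\<bar>(f (x + v) - f x) * \<psi> x\<bar> \<le> 2 * B * norm v * (\<bar>R\<bar> + 1)"
        unfolding abs_mult using \<psi>0 lip[of x v] by (intro mult_mono) auto
    qed (use \<psi>0 in auto)
    have "(LINT x|lborel. g v x * \<psi> x) = (LINT x|lborel. (f (x + v) - f x) * \<psi> x - k x)"
      by (rule Bochner_Integration.integral_cong) (auto simp: g_def k_def algebra_simps)
    also have "\<dots> = (LINT x|lborel. (f (x + v) - f x) * \<psi> x) - (LINT x|lborel. k x)"
      by (rule Bochner_Integration.integral_diff[OF ik' ik])
    also have "(LINT x|lborel. k x) = (LINT x|lborel. k (x + v))"
      by (rule lborel_integral_shift[symmetric]) simp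
    also have "(LINT x|lborel. (f (x + v) - f x) * \<psi> x) - (LINT x|lborel. k (x + v)) =
        (LINT x|lborel. (f (x + v) - f x) * \<psi> x - k (x + v))"
      by (rule Bochner_Integration.integral_diff[symmetric, OF ik' lborel_integrable_shift[OF ik]])
    also have "\<dots> \<le> (LINT x::'a|lborel. 2 * B * (norm v)\<^sup>2 * indicator (cball 0 (R + 2)) x)"
    proof (rule Bochner_Integration.integral_mono)
      show "integrable lborel (\<lambda>x. (f (x + v) - f x) * \<psi> x - k (x + v))"
        using ik' lborel_integrable_shift[OF ik] by (rule Bochner_Integration.integrable_diff)
      show "integrable lborel (\<lambda>x::'a. 2 * B * (norm v)\<^sup>2 * indicator (cball 0 (R + 2)) x :: real)"
        by (intro integrable_mult_right integrable_real_indicator) (use emeasure_bounded_finite[OF bounded_cball] in auto)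
      fix x
      have e: "(f (x + v) - f x) * \<psi> x - k (x + v) = (f (x + v) - f x) * (\<psi> x - \<psi> (x + v))"
        by (simp add: k_def algebra_simps)
      show "(f (x + v) - f x) * \<psi> x - k (x + v) \<le> 2 * B * (norm v)\<^sup>2 * indicator (cball 0 (R + 2)) x"
      proof (cases "norm x \<le> R + 2")
        case True
        have "(f (x + v) - f x) * (\<psi> x - \<psi> (x + v)) \<le> (2 * B * norm v) * norm v"
        proof -
          have "\<bar>(f (x + v) - f x) * (\<psi> x - \<psi> (x + v))\<bar> \<le> (2 * B * norm v) * norm v"
            unfolding abs_mult using lip[of x v] \<psi>lip[of x v] B0
            by (intro mult_mono) (auto simp: abs_minus_commute)
          then show ?thesis by linarith
        qed
        then show ?thesis using True unfolding e by (simp add: power2_eq_square mult_ac)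
      next
        case False
        then have "norm (x + v) > R + 1" using norm_triangle_ineq2[of x "-v"] v by simp
        then have "\<psi> x = 0" "\<psi> (x + v) = 0" using \<psi>0(3) False by auto
        then show ?thesis unfolding e using False by simp
      qed
    qed
    also have "\<dots> = C * (norm v)\<^sup>2" by (simp add: C_def)
    finally show ?thesis .
  qed
  define \<eta> where "\<eta> n = inverse (real (Suc n))" for n
  have \<eta>: "\<eta> n > 0" "\<eta> n \<le> 1" "\<eta> \<longlonglongrightarrow> 0" for n
    unfolding \<eta>_def using LIMSEQ_inverse_real_of_nat by (auto simp: divide_simps)
  define u where "u n x = (\<Sum>b\<in>Basis. g (\<eta> n *\<^sub>R b) x * \<psi> x / \<eta> n)" for n x
  have iu: "integrable lborel (u n)" for n
    unfolding u_def by (intro Bochner_Integration.integrable_sum integrable_divide_zero intg impI)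
  have u0: "u n x \<ge> 0" for n x
    unfolding u_def using g0 \<psi>0 \<eta> by (intro sum_nonneg divide_nonneg_nonneg mult_nonneg_nonneg) (auto intro: less_imp_le)
  have "(\<lambda>n. LINT x|lborel. norm (u n x)) \<longlonglongrightarrow> 0"
  proof (rule tendsto_sandwich[OF _ _ tendsto_const])
    show "\<forall>\<^sub>F n in sequentially. 0 \<le> (LINT x|lborel. norm (u n x))" by (intro always_eventually) auto
    have "(LINT x|lborel. norm (u n x)) \<le> DIM('a) * C * \<eta> n" for n
    proof -
      have "(LINT x|lborel. norm (u n x)) = (LINT x|lborel. u n x)" using u0 by simp
      also have "\<dots> = (\<Sum>b\<in>Basis. (LINT x|lborel. g (\<eta> n *\<^sub>R b) x * \<psi> x) / \<eta> n)"
        unfolding u_def by (subst Bochner_Integration.integral_sum) (auto intro!: integrable_divide_zero intg)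
      also have "\<dots> \<le> (\<Sum>b\<in>(Basis::'a set). C * \<eta> n)"
      proof (rule sum_mono)
        fix b :: 'a assume b: "b \<in> Basis"
        have "(LINT x|lborel. g (\<eta> n *\<^sub>R b) x * \<psi> x) \<le> C * (norm (\<eta> n *\<^sub>R b))\<^sup>2"
          using b \<eta>(1,2)[of n] by (intro small) auto
        also have "\<dots> = (C * \<eta> n) * \<eta> n" using b by (simp add: power2_eq_square)
        finally show "(LINT x|lborel. g (\<eta> n *\<^sub>R b) x * \<psi> x) / \<eta> n \<le> C * \<eta> n"
          using \<eta>(1)[of n] by (simp add: divide_le_eq)
      qed
      finally show ?thesis by simp
    qed
    then show "\<forall>\<^sub>F n in sequentially. (LINT x|lborel. norm (u n x)) \<le> DIM('a) * C * \<eta> n" by simp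
    show "(\<lambda>n. DIM('a) * C * \<eta> n) \<longlonglongrightarrow> 0" using tendsto_mult_right_zero[OF \<eta>(3)] by simp
  qed
  from tendsto_L1_AE_subseq[OF iu this] obtain r where
    r: "strict_mono r" "AE x in lborel. (\<lambda>n. u (r n) x) \<longlonglongrightarrow> 0" by auto
  define h where "h n = \<eta> (r n)" for n
  have h: "h n > 0" "h \<longlonglongrightarrow> 0" for n
    using \<eta> LIMSEQ_subseq_LIMSEQ[OF \<eta>(3) r(1)] by (auto simp: h_def[abs_def] o_def)
  define D where "D x b n = ((infdist (x + h n *\<^sub>R b) F)\<^sup>2 - (infdist x F)\<^sup>2) / h n" for x b n
  define Dq where "Dq x = (\<Sum>b\<in>Basis. lim (D x b) *\<^sub>R b)" for x
  have lim: "D x b \<longlonglongrightarrow> 2 * ((x - p) \<bullet> b)"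
    if x: "(\<lambda>n. u (r n) x) \<longlonglongrightarrow> 0" "norm x \<le> R" and b: "b \<in> Basis" and p: "p \<in> F" "dist x p = infdist x F" for x b p
  proof -
    have up: "(f (x + h n *\<^sub>R b) - f x) / h n - 2 * (b \<bullet> p) \<le> u (r n) x" for n
    proof -
      have "f (x + h n *\<^sub>R b) - f x - 2 * (h n *\<^sub>R b \<bullet> p) \<le> g (h n *\<^sub>R b) x"
        using sub[OF p, of "- (h n *\<^sub>R b)"] by (simp add: g_def)
      also have "\<dots> \<le> g (h n *\<^sub>R b) x * \<psi> x"
        using g0[of "h n *\<^sub>R b" x] x(2) by (simp add: \<psi>_def mult_le_cancel_left1)
      finally have "(f (x + h n *\<^sub>R b) - f x - 2 * (h n *\<^sub>R b \<bullet> p)) / h n \<le> g (h n *\<^sub>R b) x * \<psi> x / h n"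
        using h(1)[of n] by (intro divide_right_mono) auto
      also have "\<dots> \<le> u (r n) x"
        unfolding u_def h_def using b g0 \<psi>0 \<eta>
        by (intro member_le_sum[of b Basis "\<lambda>b. g (\<eta> (r n) *\<^sub>R b) x * \<psi> x / \<eta> (r n)"])
          (auto intro!: divide_nonneg_nonneg mult_nonneg_nonneg less_imp_le[OF \<eta>(1)])
      finally show ?thesis using h(1)[of n] by (simp add: diff_divide_distrib)
    qed
    have lo: "0 \<le> (f (x + h n *\<^sub>R b) - f x) / h n - 2 * (b \<bullet> p)" for n
      using sub[OF p, of "h n *\<^sub>R b"] h(1)[of n] by (simp add: le_divide_eq mult_ac)
    have "(\<lambda>n. (f (x + h n *\<^sub>R b) - f x) / h n - 2 * (b \<bullet> p)) \<longlonglongrightarrow> 0"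
      by (rule tendsto_sandwich[OF _ _ tendsto_const x(1)]) (use up lo in auto)
    then have "(\<lambda>n. (f (x + h n *\<^sub>R b) - f x) / h n) \<longlonglongrightarrow> 2 * (b \<bullet> p)" by (simp add: LIM_zero_iff)
    moreover have "(\<lambda>n. 2 * (x \<bullet> b) + h n) \<longlonglongrightarrow> 2 * (x \<bullet> b) + 0"
      by (intro tendsto_intros h)
    ultimately have "(\<lambda>n. (2 * (x \<bullet> b) + h n) - (f (x + h n *\<^sub>R b) - f x) / h n) \<longlonglongrightarrow> 2 * (x \<bullet> b) + 0 - 2 * (b \<bullet> p)"
      by (rule tendsto_diff[rotated])
    moreover have "(2 * (x \<bullet> b) + h n) - (f (x + h n *\<^sub>R b) - f x) / h n = D x b n" for n
    proof -
      have "(norm (x + h n *\<^sub>R b))\<^sup>2 - (norm x)\<^sup>2 = 2 * (x \<bullet> b) * h n + h n * h n"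
        using b by (simp add: power2_norm_eq_inner inner_simps inner_commute)
      then have "f (x + h n *\<^sub>R b) - f x = (2 * (x \<bullet> b) + h n) * h n - ((infdist (x + h n *\<^sub>R b) F)\<^sup>2 - (infdist x F)\<^sup>2)"
        by (simp add: f_def algebra_simps)
      then show ?thesis using h(1)[of n] by (simp add: D_def diff_divide_distrib)
    qed
    ultimately show ?thesis by (simp add: inner_diff_left inner_commute algebra_simps)
  qed
  have Dqb: "Dq x \<bullet> b = lim (D x b)" if "b \<in> Basis" for x b
    using that by (simp add: Dq_def)
  have key: "(\<forall>p\<in>F. dist x p = infdist x F \<longrightarrow> Dq x = 2 *\<^sub>R (x - p)) \<and> (\<forall>b\<in>Basis. D x b \<longlonglongrightarrow> Dq x \<bullet> b)"
    if x: "(\<lambda>n. u (r n) x) \<longlonglongrightarrow> 0" "norm x \<le> R" for x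
  proof -
    have *: "Dq x \<bullet> b = 2 * ((x - p) \<bullet> b)" if "p \<in> F" "dist x p = infdist x F" "b \<in> Basis" for p b
      using limI[OF lim[OF x that(3,1,2)]] Dqb that by simp
    obtain p where p: "p \<in> F" "dist x p = infdist x F" using near by metis
    have "Dq x = 2 *\<^sub>R (x - p')" if "p' \<in> F" "dist x p' = infdist x F" for p'
      using *[OF that] by (intro euclidean_eqI[of "Dq x"]) simp
    then show ?thesis using lim[OF x _ p] *[OF p] by auto
  qed
  have "Dq \<in> borel_measurable borel"
  proof -
    have [measurable]: "(\<lambda>x. infdist (x + c) F) \<in> borel_measurable borel" for c
      by (intro borel_measurable_continuous_onI continuous_intros)
    have [measurable]: "(\<lambda>x. D x b n) \<in> borel_measurable borel" for b n
    proof -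
      have "continuous_on UNIV (\<lambda>x. D x b n)"
        using h(1)[of n] unfolding D_def by (intro continuous_intros) auto
      then show ?thesis by (rule borel_measurable_continuous_onI)
    qed
    have "(\<lambda>x. lim (D x b)) \<in> borel_measurable borel" for b
      by (rule borel_measurable_lim_metric) simp
    then show ?thesis unfolding Dq_def by measurable
  qed
  moreover have "AE x in lborel. norm x \<le> R \<longrightarrow> (\<forall>p\<in>F. dist x p = infdist x F \<longrightarrow> Dq x = 2 *\<^sub>R (x - p)) \<and>
      (\<forall>b\<in>Basis. (\<lambda>n. ((infdist (x + h n *\<^sub>R b) F)\<^sup>2 - (infdist x F)\<^sup>2) / h n) \<longlonglongrightarrow> Dq x \<bullet> b)"
    using r(2)
  proof (rule AE_mp, intro AE_I2 impI)
    fix x assume "(\<lambda>n. u (r n) x) \<longlonglongrightarrow> 0" "norm x \<le> R"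
    from key[OF this] show "(\<forall>p\<in>F. dist x p = infdist x F \<longrightarrow> Dq x = 2 *\<^sub>R (x - p)) \<and>
      (\<forall>b\<in>Basis. (\<lambda>n. ((infdist (x + h n *\<^sub>R b) F)\<^sup>2 - (infdist x F)\<^sup>2) / h n) \<longlonglongrightarrow> Dq x \<bullet> b)"
      unfolding D_def by simp
  qed
  ultimately show ?thesis using h by blast
qed

section \<open>Cutoff functions near the boundary\<close>

lemma max0_power_has_derivative:
  assumes "n \<ge> 1"
  shows "((\<lambda>t::real. (max 0 t) ^ Suc n) has_real_derivative real (Suc n) * (max 0 t) ^ n) (at t)"
proof (cases "t = 0")
  case True
  have "((\<lambda>h::real. (max 0 h) ^ Suc n / h) \<longlongrightarrow> 0) (at 0)"
  proof (rule Lim_null_comparison)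
    show "\<forall>\<^sub>F h in at 0. norm ((max 0 h) ^ Suc n / h) \<le> \<bar>h\<bar> ^ n"
      by (rule always_eventually) (auto simp: max_def power_abs)
    have "((\<lambda>h::real. \<bar>h\<bar> ^ n) \<longlongrightarrow> \<bar>0\<bar> ^ n) (at 0)" by (intro tendsto_intros)
    then show "((\<lambda>h::real. \<bar>h\<bar> ^ n) \<longlongrightarrow> 0) (at 0)" using assms by (simp add: power_0_left)
  qed
  then show ?thesis using True assms by (simp add: has_field_derivative_iff power_0_left)
next
  case False
  then consider "t > 0" | "t < 0" by linarith
  then show ?thesis
  proof cases
    case 1
    have "((\<lambda>t::real. t ^ Suc n) has_real_derivative real (Suc n) * t ^ n) (at t)"
      by (auto intro!: derivative_eq_intros simp del: power_Suc)
    moreover have "t \<in> {0<..}" using 1 by simp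
    ultimately have "((\<lambda>t::real. (max 0 t) ^ Suc n) has_real_derivative real (Suc n) * t ^ n) (at t)"
      by (rule has_field_derivative_transform_within_open[OF _ open_greaterThan]) auto
    then show ?thesis using 1 by (simp del: power_Suc)
  next
    case 2
    have "((\<lambda>t::real. 0) has_real_derivative 0) (at t)" by simp
    moreover have "t \<in> {..<0}" using 2 by simp
    ultimately have "((\<lambda>t::real. (max 0 t) ^ Suc n) has_real_derivative 0) (at t)"
      by (rule has_field_derivative_transform_within_open[OF _ open_lessThan]) (auto simp: max_def)
    then show ?thesis using 2 assms by (simp add: max_def power_0_left del: power_Suc)
  qed
qed

lemma max0_cube_has_derivative:
  "((\<lambda>t::real. (max 0 t) ^ 3) has_real_derivative 3 * (max 0 t) ^ 2) (at t)"
  using max0_power_has_derivative[of 2 t] by (simp del: power_Suc)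

text \<open>A step of class \<open>C\<^sup>2\<close> from \<open>0\<close> on \<open>s \<le> 0\<close> to \<open>1\<close> on \<open>s \<ge> 1\<close>, built from cubes of positive parts, followed by its first two derivatives.\<close>

definition smoothstep :: "real \<Rightarrow> real" where
  "smoothstep s = 1 - (max 0 (1 - (max 0 s) ^ 3)) ^ 3"
definition smoothstep' :: "real \<Rightarrow> real" where
  "smoothstep' s = 9 * (max 0 (1 - (max 0 s) ^ 3)) ^ 2 * (max 0 s) ^ 2"
definition smoothstep'' :: "real \<Rightarrow> real" where
  "smoothstep'' s = 18 * (max 0 (1 - (max 0 s) ^ 3)) ^ 2 * max 0 s
     - 54 * max 0 (1 - (max 0 s) ^ 3) * (max 0 s) ^ 4"

lemma smoothstep_has_derivative: "(smoothstep has_real_derivative smoothstep' s) (at s)"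
proof -
  have "((\<lambda>s. 1 - (max 0 s) ^ 3) has_real_derivative - (3 * (max 0 s) ^ 2)) (at s)" for s :: real
    using DERIV_diff[OF DERIV_const[of 1] max0_cube_has_derivative[of s]] by simp
  from DERIV_chain2[OF max0_cube_has_derivative this[of s]]
  have "((\<lambda>s. (max 0 (1 - (max 0 s) ^ 3)) ^ 3) has_real_derivative - smoothstep' s) (at s)"
    by (rule DERIV_cong) (simp add: smoothstep'_def)
  from DERIV_diff[OF DERIV_const[of 1] this] show ?thesis by (simp add: smoothstep_def[abs_def])
qed

lemma smoothstep'_has_derivative: "(smoothstep' has_real_derivative smoothstep'' s) (at s)"
proof -
  have 1: "((\<lambda>s. 1 - (max 0 s) ^ 3) has_real_derivative - (3 * (max 0 s) ^ 2)) (at s)" for s :: real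
    using DERIV_diff[OF DERIV_const[of 1] max0_cube_has_derivative[of s]] by simp
  have 2: "((\<lambda>s. (max 0 s) ^ 2) has_real_derivative 2 * max 0 s) (at s)" for s :: real
    using max0_power_has_derivative[of 1 s] by (simp add: power2_eq_square)
  from DERIV_mult[OF DERIV_cmult[OF DERIV_chain2[OF 2 1[of s]], of 9] 2[of s]]
  show ?thesis unfolding smoothstep'_def[abs_def]
    by (rule DERIV_cong) (simp add: smoothstep''_def power2_eq_square power4_eq_xxxx)
qed

lemma smoothstep_continuous [continuous_intros]:
  "continuous_on A f \<Longrightarrow> continuous_on A (\<lambda>x. smoothstep (f x))"
  "continuous_on A f \<Longrightarrow> continuous_on A (\<lambda>x. smoothstep' (f x))"
  "continuous_on A f \<Longrightarrow> continuous_on A (\<lambda>x. smoothstep'' (f x))"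
  unfolding smoothstep_def smoothstep'_def smoothstep''_def by (auto intro!: continuous_intros)

lemma smoothstep_eq_0: "s \<le> 0 \<Longrightarrow> smoothstep s = 0" "s \<le> 0 \<Longrightarrow> smoothstep' s = 0"
  by (auto simp: smoothstep_def smoothstep'_def max_def)

lemma smoothstep_eq_1: "s \<ge> 1 \<Longrightarrow> smoothstep s = 1" "s \<ge> 1 \<Longrightarrow> smoothstep' s = 0"
proof -
  assume "s \<ge> 1"
  then have "max 0 (1 - (max 0 s) ^ 3) = 0" using one_le_power[of s 3] by simp
  then show "smoothstep s = 1" "smoothstep' s = 0" by (simp_all add: smoothstep_def smoothstep'_def)
qed

lemma smoothstep_bounds: "0 \<le> smoothstep s" "smoothstep s \<le> 1" "0 \<le> smoothstep' s" "smoothstep' s \<le> 9"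
proof -
  have m: "0 \<le> max 0 (1 - (max 0 s) ^ 3)" "max 0 (1 - (max 0 s) ^ 3) \<le> 1" by auto
  show "0 \<le> smoothstep s" "smoothstep s \<le> 1"
    using power_le_one[OF m, of 3] m by (auto simp: smoothstep_def)
  show "0 \<le> smoothstep' s" by (simp add: smoothstep'_def)
  show "smoothstep' s \<le> 9"
  proof (cases "s \<ge> 1")
    case False
    then have "(max 0 s) ^ 2 \<le> 1" by (intro power_le_one) auto
    then have "(max 0 (1 - (max 0 s) ^ 3)) ^ 2 * (max 0 s) ^ 2 \<le> 1 * 1"
      using power_le_one[OF m, of 2] by (intro mult_mono) auto
    then show ?thesis by (simp add: smoothstep'_def)
  qed (simp add: smoothstep_eq_1)
qed

lemma smoothstep_lipschitz: "\<bar>smoothstep s - smoothstep t\<bar> \<le> 9 * \<bar>s - t\<bar>"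
  using field_differentiable_bound[of UNIV smoothstep smoothstep' 9 s t] smoothstep_has_derivative smoothstep_bounds
  by (auto simp: abs_le_iff)

lemma same_side_of_frontier:
  fixes \<Omega> :: "'a::euclidean_space set"
  assumes "closed_segment x y \<inter> frontier \<Omega> = {}"
  shows "x \<in> \<Omega> \<longleftrightarrow> y \<in> \<Omega>"
  using connected_Int_frontier[of "closed_segment x y" \<Omega>] assms
  by (metis Diff_eq_empty_iff connected_segment(1) disjoint_iff ends_in_segment subsetD)

lemma segment_within_infdist:
  fixes x y :: "'a::euclidean_space"
  assumes "dist x y < infdist x F"
  shows "closed_segment x y \<inter> F = {}"
proof -
  have "z \<notin> F" if "z \<in> closed_segment x y" for z
    using dist_in_closed_segment[OF that] infdist_le[of z F x] assms by (auto simp: dist_commute)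
  then show ?thesis by auto
qed

text \<open>The cutoff vanishes up to distance \<open>\<delta>\<close> from the boundary and equals \<open>1\<close> beyond \<open>2 \<delta>\<close>. It is a function of the squared distance
  because the gradient of the latter is known almost everywhere; \<open>cutoff'\<close> is the factor by which that gradient has to be multiplied to obtain the
  gradient of the cutoff.\<close>

definition cutoff :: "'a::euclidean_space set \<Rightarrow> real \<Rightarrow> 'a \<Rightarrow> real" where
  "cutoff \<Omega> \<delta> x = smoothstep ((infdist x (frontier \<Omega>))\<^sup>2 / \<delta>\<^sup>2 - 1)"

definition cutoff' :: "'a::euclidean_space set \<Rightarrow> real \<Rightarrow> 'a \<Rightarrow> real" where
  "cutoff' \<Omega> \<delta> x = smoothstep' ((infdist x (frontier \<Omega>))\<^sup>2 / \<delta>\<^sup>2 - 1) / \<delta>\<^sup>2"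

lemma cutoff_continuous: "continuous_on A (cutoff \<Omega> \<delta>)" "continuous_on A (cutoff' \<Omega> \<delta>)"
  unfolding cutoff_def[abs_def] cutoff'_def[abs_def] divide_inverse by (auto intro!: continuous_intros)

lemma cutoff_measurable [measurable]:
  "cutoff \<Omega> \<delta> \<in> borel_measurable borel" "cutoff' \<Omega> \<delta> \<in> borel_measurable borel"
  by (rule borel_measurable_continuous_onI[OF cutoff_continuous(1)],
      rule borel_measurable_continuous_onI[OF cutoff_continuous(2)])

lemma cutoff_bounds: "0 \<le> cutoff \<Omega> \<delta> x" "cutoff \<Omega> \<delta> x \<le> 1" "0 \<le> cutoff' \<Omega> \<delta> x" "cutoff' \<Omega> \<delta> x \<le> 9 / \<delta>\<^sup>2"
  using smoothstep_bounds by (auto simp: cutoff_def cutoff'_def intro!: divide_right_mono divide_nonneg_nonneg)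

lemma cutoff_eq_0:
  assumes "\<delta> > 0" "infdist x (frontier \<Omega>) \<le> \<delta>"
  shows "cutoff \<Omega> \<delta> x = 0" "cutoff' \<Omega> \<delta> x = 0"
proof -
  have "(infdist x (frontier \<Omega>))\<^sup>2 \<le> \<delta>\<^sup>2" using assms by (intro power_mono) (auto simp: infdist_nonneg)
  then have "(infdist x (frontier \<Omega>))\<^sup>2 / \<delta>\<^sup>2 - 1 \<le> 0" using assms by (simp add: divide_le_eq)
  then show "cutoff \<Omega> \<delta> x = 0" "cutoff' \<Omega> \<delta> x = 0" by (simp_all add: cutoff_def cutoff'_def smoothstep_eq_0)
qed

lemma cutoff_eq_1:
  assumes "\<delta> > 0" "infdist x (frontier \<Omega>) \<ge> 2 * \<delta>"
  shows "cutoff \<Omega> \<delta> x = 1" "cutoff' \<Omega> \<delta> x = 0"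
proof -
  have "(infdist x (frontier \<Omega>))\<^sup>2 \<ge> (2 * \<delta>)\<^sup>2" using assms by (intro power_mono) auto
  then have "(infdist x (frontier \<Omega>))\<^sup>2 \<ge> 2 * \<delta>\<^sup>2"
  proof -
    have "(2 * \<delta>)\<^sup>2 = 4 * \<delta>\<^sup>2" by (simp add: power_mult_distrib)
    then show ?thesis using \<open>(2 * \<delta>)\<^sup>2 \<le> _\<close> zero_le_power2[of \<delta>] by linarith
  qed
  then have "(infdist x (frontier \<Omega>))\<^sup>2 / \<delta>\<^sup>2 - 1 \<ge> 1" using assms by (simp add: le_divide_eq)
  then show "cutoff \<Omega> \<delta> x = 1" "cutoff' \<Omega> \<delta> x = 0" by (simp_all add: cutoff_def cutoff'_def smoothstep_eq_1)
qed

lemma sqdist_lipschitz: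
  fixes x v :: "'a::euclidean_space"
  shows "\<bar>(infdist (x + v) F)\<^sup>2 - (infdist x F)\<^sup>2\<bar> \<le> norm v * (2 * infdist x F + norm v)"
proof -
  have a: "\<bar>infdist (x + v) F - infdist x F\<bar> \<le> norm v"
    using infdist_triangle[of "x + v" F x] infdist_triangle[of x F "x + v"] by (simp add: dist_norm)
  have "(infdist (x + v) F)\<^sup>2 - (infdist x F)\<^sup>2 = (infdist (x + v) F - infdist x F) * (infdist (x + v) F + infdist x F)"
    by (simp add: power2_eq_square algebra_simps)
  also have "\<bar>\<dots>\<bar> \<le> norm v * (2 * infdist x F + norm v)"
    unfolding abs_mult using a infdist_nonneg[of x F] infdist_nonneg[of "x + v" F] by (intro mult_mono) auto
  finally show ?thesis .
qed

text \<open>Translation invariance of the measure moves a difference quotient from \<open>w\<close> to the cutoff. The steps run through the sequence along which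
  the quotients of the squared distance converge. The cutoff vanishes near the boundary, so \<open>w\<close> may be unbounded there.\<close>

lemma cutoff_integration_by_parts:
  fixes \<Omega> :: "'a::euclidean_space set"
  assumes \<Omega>: "open \<Omega>" "bounded \<Omega>" "\<Omega> \<noteq> {}"
  shows "\<exists>Dq \<in> borel_measurable borel.
    (AE x in lborel. x \<in> \<Omega> \<longrightarrow>
       (\<forall>p\<in>frontier \<Omega>. dist x p = infdist x (frontier \<Omega>) \<longrightarrow> Dq x = 2 *\<^sub>R (x - p))) \<and>
    (\<forall>\<delta>>0. \<forall>b\<in>Basis. \<forall>w w'. continuous_on \<Omega> w \<longrightarrow> continuous_on \<Omega> w' \<longrightarrow>
       (\<forall>x\<in>\<Omega>. ((\<lambda>t. w (x + t *\<^sub>R b)) has_real_derivative w' x) (at 0)) \<longrightarrow>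
       (LINT x|lborel. indicator \<Omega> x * (cutoff \<Omega> \<delta> x * w' x)) =
       - (LINT x|lborel. indicator \<Omega> x * (cutoff' \<Omega> \<delta> x * (Dq x \<bullet> b) * w x)))"
proof -
  define F where "F = frontier \<Omega>"
  have F: "compact F" "F \<noteq> {}"
    using \<Omega> not_bounded_UNIV frontier_eq_empty[of \<Omega>] by (auto simp: F_def compact_frontier_bounded)
  obtain R where R: "R > 0" "\<And>x. x \<in> \<Omega> \<Longrightarrow> norm x \<le> R" using \<Omega>(2) by (auto simp: bounded_pos)
  obtain Dq h where Dq: "Dq \<in> borel_measurable borel" and h: "\<And>n. 0 < h n" "h \<longlonglongrightarrow> (0::real)"
    and AE: "AE x in lborel. norm x \<le> R \<longrightarrow>
      (\<forall>p\<in>F. dist x p = infdist x F \<longrightarrow> Dq x = 2 *\<^sub>R (x - p)) \<and>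
      (\<forall>b\<in>Basis. (\<lambda>n. ((infdist (x + h n *\<^sub>R b) F)\<^sup>2 - (infdist x F)\<^sup>2) / h n) \<longlonglongrightarrow> Dq x \<bullet> b)"
    using sqdist_gradient_AE[OF F, of R] by blast
  note [measurable] = Dq
  show ?thesis
  proof (intro bexI[OF _ Dq] conjI allI ballI impI)
    show "AE x in lborel. x \<in> \<Omega> \<longrightarrow>
       (\<forall>p\<in>frontier \<Omega>. dist x p = infdist x (frontier \<Omega>) \<longrightarrow> Dq x = 2 *\<^sub>R (x - p))"
      using AE by eventually_elim (use R in \<open>auto simp: F_def\<close>)
    fix \<delta> :: real and b :: 'a and w w' :: "'a \<Rightarrow> real"
    assume \<delta>: "\<delta> > 0" and b: "b \<in> Basis" and w: "continuous_on \<Omega> w" and w': "continuous_on \<Omega> w'"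
      and der: "\<forall>x\<in>\<Omega>. ((\<lambda>t. w (x + t *\<^sub>R b)) has_real_derivative w' x) (at 0)"
    have nb: "norm b = 1" using b by simp
    define K where "K = {x \<in> \<Omega>. \<delta> / 2 \<le> infdist x F}"
    have "K = closure \<Omega> \<inter> {x. \<delta> / 2 \<le> infdist x F}"
    proof -
      have "x \<in> \<Omega> \<longleftrightarrow> x \<in> closure \<Omega>" if "\<delta> / 2 \<le> infdist x F" for x
      proof -
        have "x \<notin> F" using that \<delta> infdist_zero[of x F] by auto
        then show ?thesis using closure_subset[of \<Omega>] by (auto simp: F_def frontier_def interior_open[OF \<Omega>(1)])
      qed
      then show ?thesis by (auto simp: K_def)
    qed
    moreover have "closed {x. \<delta> / 2 \<le> infdist x F}" by (intro closed_Collect_le continuous_intros)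
    ultimately have K: "compact K" using \<Omega>(2) by (metis compact_Int_closed compact_closure)
    have KO: "K \<subseteq> \<Omega>" by (auto simp: K_def)
    obtain B where B: "\<And>x. x \<in> K \<Longrightarrow> \<bar>w x\<bar> \<le> B" "B \<ge> 0"
    proof -
      have "bounded (w ` K)" by (intro compact_imp_bounded compact_continuous_image continuous_on_subset[OF w] K KO)
      then obtain B where "\<And>x. x \<in> K \<Longrightarrow> \<bar>w x\<bar> \<le> B" by (auto simp: bounded_iff)
      then show thesis using that[of "max 0 B"] by fastforce
    qed
    obtain B' where B': "\<And>x. x \<in> K \<Longrightarrow> \<bar>w' x\<bar> \<le> B'" "B' \<ge> 0"
    proof -
      have "bounded (w' ` K)" by (intro compact_imp_bounded compact_continuous_image continuous_on_subset[OF w'] K KO)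
      then obtain B where "\<And>x. x \<in> K \<Longrightarrow> \<bar>w' x\<bar> \<le> B" by (auto simp: bounded_iff)
      then show thesis using that[of "max 0 B"] by fastforce
    qed
    let ?c = "cutoff \<Omega> \<delta>"
    define wz where "wz x = indicator \<Omega> x * w x" for x
    have [measurable]: "wz \<in> borel_measurable borel"
      using borel_measurable_continuous_on_indicator[OF _ w] \<Omega>(1) unfolding wz_def by (simp add: borel_open)
    obtain N where N: "\<And>n. n \<ge> N \<Longrightarrow> h n < \<delta> / 4"
      using order_tendstoD(2)[OF h(2), of "\<delta> / 4"] \<delta> by (auto simp: eventually_sequentially)
    define k where "k n = h (n + N)" for n
    have k: "k n > 0" "k n < \<delta> / 4" for n using h N by (auto simp: k_def)
    have klim: "k \<longlonglongrightarrow> 0" unfolding k_def[abs_def] using h(2) by (rule LIMSEQ_ignore_initial_segment)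
    have inf_shift: "\<bar>infdist (x + t *\<^sub>R b) F - infdist x F\<bar> \<le> \<bar>t\<bar>" for x t
      using infdist_triangle[of "x + t *\<^sub>R b" F x] infdist_triangle[of x F "x + t *\<^sub>R b"] nb by (simp add: dist_norm)
    have c0: "?c x = 0" if "infdist x F \<le> \<delta>" for x
      using cutoff_eq_0(1)[OF \<delta>, of x \<Omega>] that by (simp add: F_def)
    have side: "x + t *\<^sub>R b \<in> \<Omega> \<longleftrightarrow> x \<in> \<Omega>" if "\<delta> < infdist x F" "\<bar>t\<bar> \<le> \<delta> / 4" for x t
    proof -
      have "dist x (x + t *\<^sub>R b) < infdist x F" using that nb \<delta> by (simp add: dist_norm)
      from same_side_of_frontier[OF segment_within_infdist[OF this, unfolded F_def]] show ?thesis by simp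
    qed
    have inK: "x + t *\<^sub>R b \<in> K" if "x \<in> \<Omega>" "\<delta> < infdist x F" "\<bar>t\<bar> \<le> \<delta> / 4" for x t
      using side[OF that(2,3)] that inf_shift[of x t] \<delta> by (auto simp: K_def)
    have intK: "integrable lborel (\<lambda>x. C * indicator K x :: real)" for C
      using emeasure_bounded_finite[OF compact_imp_bounded[OF K]] borel_compact[OF K]
      by (intro integrable_mult_right integrable_real_indicator) auto
    have domint: "integrable lborel f" if "f \<in> borel_measurable borel" "\<And>x. \<bar>f x\<bar> \<le> C * indicator K x" for f :: "'a \<Rightarrow> real" and C
      by (rule Bochner_Integration.integrable_bound[OF intK[of C]]) (use that in \<open>auto intro!: AE_I2 order_trans[OF that(2)]\<close>)
    have eq: "(LINT x|lborel. (?c (x + k n *\<^sub>R b) - ?c x) / k n * wz x) =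
        (LINT x|lborel. ?c x * ((wz (x - k n *\<^sub>R b) - wz x) / k n))" for n
    proof -
      let ?v = "k n *\<^sub>R b"
      define G where "G x = ?c x * wz (x - ?v)" for x
      have [measurable]: "G \<in> borel_measurable borel" unfolding G_def by measurable
      have i1: "integrable lborel (\<lambda>x. ?c (x + ?v) * wz x)"
      proof (rule domint[where C = B])
        fix x show "\<bar>?c (x + ?v) * wz x\<bar> \<le> B * indicator K x"
        proof (cases "?c (x + ?v) = 0 \<or> x \<notin> \<Omega>")
          case False
          then have "\<delta> < infdist (x + ?v) F" using c0 by force
          then have "x \<in> K" using inf_shift[of x "k n"] k[of n] False by (auto simp: K_def)
          moreover have "\<bar>?c (x + ?v)\<bar> * \<bar>w x\<bar> \<le> 1 * B"
            using B \<open>x \<in> K\<close> cutoff_bounds[of \<Omega> \<delta> "x + ?v"] by (intro mult_mono) auto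
          ultimately show ?thesis using False by (simp add: wz_def abs_mult)
        qed (use B in \<open>auto simp: wz_def\<close>)
      qed measurable
      have i2: "integrable lborel (\<lambda>x. ?c x * wz x)"
      proof (rule domint[where C = B])
        fix x show "\<bar>?c x * wz x\<bar> \<le> B * indicator K x"
        proof (cases "?c x = 0 \<or> x \<notin> \<Omega>")
          case False
          then have "\<delta> < infdist x F" using c0 by force
          then have "x \<in> K" using False \<delta> by (auto simp: K_def)
          moreover have "\<bar>?c x\<bar> * \<bar>w x\<bar> \<le> 1 * B"
            using B \<open>x \<in> K\<close> cutoff_bounds[of \<Omega> \<delta> x] by (intro mult_mono) auto
          ultimately show ?thesis using False by (simp add: wz_def abs_mult)
        qed (use B in \<open>auto simp: wz_def\<close>)
      qed measurable
      have Gs: "(\<lambda>x. G (x + ?v)) = (\<lambda>x. ?c (x + ?v) * wz x)" by (simp add: G_def)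
      have i3: "integrable lborel G"
        using lborel_integrable_shift[OF i1, of "- ?v"] by (simp add: G_def[abs_def])
      have "(LINT x|lborel. ?c (x + ?v) * wz x) = (LINT x|lborel. G x)"
        using lborel_integral_shift[of G ?v] by (simp add: Gs)
      then have "(LINT x|lborel. ?c (x + ?v) * wz x) - (LINT x|lborel. ?c x * wz x)
          = (LINT x|lborel. G x) - (LINT x|lborel. ?c x * wz x)" by simp
      then have "(LINT x|lborel. ?c (x + ?v) * wz x - ?c x * wz x) = (LINT x|lborel. G x - ?c x * wz x)"
        by (simp only: Bochner_Integration.integral_diff[OF i1 i2] Bochner_Integration.integral_diff[OF i3 i2])
      then have "(LINT x|lborel. (?c (x + ?v) * wz x - ?c x * wz x) / k n) = (LINT x|lborel. (G x - ?c x * wz x) / k n)"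
        by simp
      moreover have "(?c (x + ?v) * wz x - ?c x * wz x) / k n = (?c (x + ?v) - ?c x) / k n * wz x" for x
        by (simp add: left_diff_distrib diff_divide_distrib)
      moreover have "(G x - ?c x * wz x) / k n = ?c x * ((wz (x - ?v) - wz x) / k n)" for x
        by (simp add: G_def right_diff_distrib diff_divide_distrib)
      ultimately show ?thesis by simp
    qed
      obtain S where S: "\<And>x. x \<in> K \<Longrightarrow> infdist x F \<le> S" "S \<ge> 0"
      proof -
        have "bounded ((\<lambda>x. infdist x F) ` K)" by (intro compact_imp_bounded compact_continuous_image K continuous_intros)
        then obtain S where "\<And>x. x \<in> K \<Longrightarrow> infdist x F \<le> S" by (auto simp: bounded_iff abs_le_iff)
        then show thesis using that[of "max 0 S"] by fastforce
      qed
      define M where "M = 9 * (2 * S + \<delta>) / \<delta>\<^sup>2 * B"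
    have L1: "(\<lambda>n. LINT x|lborel. (?c (x + k n *\<^sub>R b) - ?c x) / k n * wz x) \<longlonglongrightarrow>
        (LINT x|lborel. indicator \<Omega> x * (cutoff' \<Omega> \<delta> x * (Dq x \<bullet> b) * w x))"
    proof (rule integral_dominated_convergence)
      show "integrable lborel (\<lambda>x. M * indicator K x)" by (rule intK)
      show "AE x in lborel. norm ((?c (x + k n *\<^sub>R b) - ?c x) / k n * wz x) \<le> M * indicator K x" for n
      proof (rule AE_I2)
        fix x
        show "norm ((?c (x + k n *\<^sub>R b) - ?c x) / k n * wz x) \<le> M * indicator K x"
        proof (cases "x \<in> K")
          case True
          have "\<bar>?c (x + k n *\<^sub>R b) - ?c x\<bar> \<le> 9 * \<bar>(infdist (x + k n *\<^sub>R b) F)\<^sup>2 / \<delta>\<^sup>2 - (infdist x F)\<^sup>2 / \<delta>\<^sup>2\<bar>"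
            unfolding cutoff_def F_def by (rule order_trans[OF smoothstep_lipschitz]) simp
          also have "\<dots> = 9 / \<delta>\<^sup>2 * \<bar>(infdist (x + k n *\<^sub>R b) F)\<^sup>2 - (infdist x F)\<^sup>2\<bar>"
            by (simp add: diff_divide_distrib[symmetric])
          also have "\<dots> \<le> 9 / \<delta>\<^sup>2 * (k n * (2 * S + \<delta>))"
          proof (rule mult_left_mono)
            have "norm (k n *\<^sub>R b) * (2 * infdist x F + norm (k n *\<^sub>R b)) \<le> k n * (2 * S + \<delta>)"
              using nb k[of n] S(1)[OF True] \<delta> infdist_nonneg[of x F] by (intro mult_mono) auto
            then show "\<bar>(infdist (x + k n *\<^sub>R b) F)\<^sup>2 - (infdist x F)\<^sup>2\<bar> \<le> k n * (2 * S + \<delta>)"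
              using sqdist_lipschitz[of x "k n *\<^sub>R b" F] by linarith
          qed simp
          finally have "\<bar>?c (x + k n *\<^sub>R b) - ?c x\<bar> / k n \<le> 9 * (2 * S + \<delta>) / \<delta>\<^sup>2"
            using k(1)[of n] by (simp add: divide_le_eq mult_ac)
          moreover have "\<bar>wz x\<bar> \<le> B" using B(1)[OF True] True KO by (auto simp: wz_def)
          ultimately have "\<bar>?c (x + k n *\<^sub>R b) - ?c x\<bar> / k n * \<bar>wz x\<bar> \<le> M"
            unfolding M_def using S(2) \<delta> by (intro mult_mono) auto
          then show ?thesis using True k(1)[of n] by (simp add: abs_mult)
        next
          case False
          have "wz x = 0 \<or> (?c (x + k n *\<^sub>R b) = 0 \<and> ?c x = 0)"
          proof (cases "x \<in> \<Omega>")
            case True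
            with False have "infdist x F < \<delta> / 2" by (auto simp: K_def)
            then show ?thesis using inf_shift[of x "k n"] k[of n] \<delta> by (auto intro!: c0)
          qed (simp add: wz_def)
          then show ?thesis using False by auto
        qed
      qed
      show "AE x in lborel. (\<lambda>n. (?c (x + k n *\<^sub>R b) - ?c x) / k n * wz x) \<longlonglongrightarrow>
          indicator \<Omega> x * (cutoff' \<Omega> \<delta> x * (Dq x \<bullet> b) * w x)"
        using AE
      proof eventually_elim
        case (elim x)
        show ?case
        proof (cases "x \<in> \<Omega>")
          case True
          define q where "q y = (infdist y F)\<^sup>2 / \<delta>\<^sup>2 - 1" for y
          have "(\<lambda>n. ((infdist (x + h n *\<^sub>R b) F)\<^sup>2 - (infdist x F)\<^sup>2) / h n) \<longlonglongrightarrow> Dq x \<bullet> b"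
            using elim R(2)[OF True] b by auto
          then have "(\<lambda>n. ((infdist (x + k n *\<^sub>R b) F)\<^sup>2 - (infdist x F)\<^sup>2) / k n) \<longlonglongrightarrow> Dq x \<bullet> b"
            unfolding k_def by (rule LIMSEQ_ignore_initial_segment)
          then have "(\<lambda>n. ((infdist (x + k n *\<^sub>R b) F)\<^sup>2 - (infdist x F)\<^sup>2) / k n / \<delta>\<^sup>2) \<longlonglongrightarrow> (Dq x \<bullet> b) / \<delta>\<^sup>2"
            by (intro tendsto_divide tendsto_const) (use \<delta> in auto)
          moreover have "((infdist (x + k n *\<^sub>R b) F)\<^sup>2 - (infdist x F)\<^sup>2) / k n / \<delta>\<^sup>2 = (q (x + k n *\<^sub>R b) - q x) / k n" for n
            by (simp add: q_def diff_divide_distrib mult.commute)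
          ultimately have ql: "(\<lambda>n. (q (x + k n *\<^sub>R b) - q x) / k n) \<longlonglongrightarrow> (Dq x \<bullet> b) / \<delta>\<^sup>2" by simp
          have "(\<lambda>n. q (x + k n *\<^sub>R b)) \<longlonglongrightarrow> q x"
          proof -
            have "continuous_on UNIV q" unfolding q_def[abs_def] divide_inverse by (intro continuous_intros)
            moreover have "(\<lambda>n. x + k n *\<^sub>R b) \<longlonglongrightarrow> x + 0 *\<^sub>R b" by (intro tendsto_intros klim)
            ultimately show ?thesis using continuous_on_tendsto_compose[of UNIV q] by fastforce
          qed
          obtain \<rho> where \<rho>: "\<And>z. smoothstep z - smoothstep (q x) = \<rho> z * (z - q x)" "isCont \<rho> (q x)" "\<rho> (q x) = smoothstep' (q x)"
            using smoothstep_has_derivative[of "q x"] unfolding CARAT_DERIV by blast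
          have "(\<lambda>n. \<rho> (q (x + k n *\<^sub>R b))) \<longlonglongrightarrow> smoothstep' (q x)"
            using isCont_tendsto_compose[OF \<rho>(2) \<open>(\<lambda>n. q (x + k n *\<^sub>R b)) \<longlonglongrightarrow> q x\<close>] \<rho>(3) by simp
          from tendsto_mult[OF tendsto_mult[OF this ql] tendsto_const[of "w x"]]
          have "(\<lambda>n. \<rho> (q (x + k n *\<^sub>R b)) * ((q (x + k n *\<^sub>R b) - q x) / k n) * w x)
              \<longlonglongrightarrow> smoothstep' (q x) * ((Dq x \<bullet> b) / \<delta>\<^sup>2) * w x" .
          moreover have "\<rho> (q (x + k n *\<^sub>R b)) * ((q (x + k n *\<^sub>R b) - q x) / k n) = (?c (x + k n *\<^sub>R b) - ?c x) / k n" for n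
            using \<rho>(1)[of "q (x + k n *\<^sub>R b)"] by (simp add: cutoff_def q_def F_def)
          moreover have "smoothstep' (q x) * ((Dq x \<bullet> b) / \<delta>\<^sup>2) * w x = cutoff' \<Omega> \<delta> x * (Dq x \<bullet> b) * w x"
            by (simp add: cutoff'_def q_def F_def)
          ultimately have "(\<lambda>n. (?c (x + k n *\<^sub>R b) - ?c x) / k n * w x) \<longlonglongrightarrow> cutoff' \<Omega> \<delta> x * (Dq x \<bullet> b) * w x"
            by (simp only:)
          then show ?thesis using True by (simp add: wz_def)
        qed (simp add: wz_def)
      qed
      have "(\<lambda>x. cutoff' \<Omega> \<delta> x * (Dq x \<bullet> b) * wz x) \<in> borel_measurable borel" by measurable
      then show "(\<lambda>x. indicator \<Omega> x * (cutoff' \<Omega> \<delta> x * (Dq x \<bullet> b) * w x)) \<in> borel_measurable lborel"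
        by (simp add: wz_def mult_ac)
    qed measurable
    have L2: "(\<lambda>n. LINT x|lborel. ?c x * ((wz (x - k n *\<^sub>R b) - wz x) / k n)) \<longlonglongrightarrow>
        (LINT x|lborel. - (indicator \<Omega> x * (?c x * w' x)))"
    proof (rule integral_dominated_convergence)
      show "integrable lborel (\<lambda>x. B' * indicator K x)" by (rule intK)
      have D: "((\<lambda>t. w (x + t *\<^sub>R b)) has_real_derivative w' (x + t *\<^sub>R b)) (at t)"
        if "x + t *\<^sub>R b \<in> \<Omega>" for x t
      proof -
        have "((\<lambda>s. w (x + t *\<^sub>R b + s *\<^sub>R b)) has_real_derivative w' (x + t *\<^sub>R b)) (at 0)"
          using der that by blast
        then have "((\<lambda>s. w (x + (s + t) *\<^sub>R b)) has_real_derivative w' (x + t *\<^sub>R b)) (at 0)"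
          by (simp add: algebra_simps)
        then show ?thesis using DERIV_shift[of "\<lambda>t. w (x + t *\<^sub>R b)" _ 0 t] by simp
      qed
      show "AE x in lborel. norm (?c x * ((wz (x - k n *\<^sub>R b) - wz x) / k n)) \<le> B' * indicator K x" for n
      proof (rule AE_I2)
        fix x
        show "norm (?c x * ((wz (x - k n *\<^sub>R b) - wz x) / k n)) \<le> B' * indicator K x"
        proof (cases "?c x = 0")
          case False
          then have d: "\<delta> < infdist x F" using c0 by force
          show ?thesis
          proof (cases "x \<in> \<Omega>")
            case True
            have xK: "x + t *\<^sub>R b \<in> K" if "t \<in> {- k n..0}" for t using inK[OF True d, of t] that k[of n] by auto
            have "norm (w (x + (- k n) *\<^sub>R b) - w (x + 0 *\<^sub>R b)) \<le> B' * norm (- k n - 0)"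
            proof (rule field_differentiable_bound[of "{- k n..0}"])
              show "((\<lambda>t. w (x + t *\<^sub>R b)) has_field_derivative w' (x + t *\<^sub>R b)) (at t within {- k n..0})"
                if "t \<in> {- k n..0}" for t using D[of x t] xK[OF that] KO by (auto intro: has_field_derivative_at_within)
            qed (use xK B' k[of n] in auto)
            then have "\<bar>wz (x - k n *\<^sub>R b) - wz x\<bar> / k n \<le> B'"
              using True xK[of "- k n"] KO k(1)[of n] by (auto simp: wz_def divide_le_eq)
            then have "\<bar>?c x\<bar> * (\<bar>wz (x - k n *\<^sub>R b) - wz x\<bar> / k n) \<le> 1 * B'"
              using cutoff_bounds[of \<Omega> \<delta> x] k(1)[of n] by (intro mult_mono) auto
            moreover have "x \<in> K" using xK[of 0] k(1)[of n] by simp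
            ultimately show ?thesis using k(1)[of n] by (simp add: abs_mult)
          next
            case f: False
            then have "x - k n *\<^sub>R b \<notin> \<Omega>" using side[OF d, of "- k n"] k[of n] by auto
            then show ?thesis using f B' by (simp add: wz_def)
          qed
        qed (use B' in auto)
      qed
      show "AE x in lborel. (\<lambda>n. ?c x * ((wz (x - k n *\<^sub>R b) - wz x) / k n)) \<longlonglongrightarrow> - (indicator \<Omega> x * (?c x * w' x))"
      proof (rule AE_I2)
        fix x
        show "(\<lambda>n. ?c x * ((wz (x - k n *\<^sub>R b) - wz x) / k n)) \<longlonglongrightarrow> - (indicator \<Omega> x * (?c x * w' x))"
        proof (cases "?c x = 0")
          case False
          then have d: "\<delta> < infdist x F" using c0 by force
          have s: "x - k n *\<^sub>R b \<in> \<Omega> \<longleftrightarrow> x \<in> \<Omega>" for n using side[OF d, of "- k n"] k[of n] by auto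
          show ?thesis
          proof (cases "x \<in> \<Omega>")
            case True
            have "((\<lambda>t. (w (x + t *\<^sub>R b) - w x) / t) \<longlongrightarrow> w' x) (at 0)"
              using der True by (auto simp: has_field_derivative_iff)
            moreover have "filterlim (\<lambda>n. - k n) (at 0) sequentially"
              using tendsto_minus[OF klim] k(1) by (auto simp: filterlim_at less_imp_neq[symmetric] eventually_sequentially)
            ultimately have "(\<lambda>n. (w (x + (- k n) *\<^sub>R b) - w x) / (- k n)) \<longlonglongrightarrow> w' x"
              by (rule filterlim_compose)
            then have "(\<lambda>n. ?c x * (- ((w (x + (- k n) *\<^sub>R b) - w x) / (- k n)))) \<longlonglongrightarrow> ?c x * (- w' x)"
              by (rule tendsto_mult[OF tendsto_const tendsto_minus])
            then show ?thesis using True s by (simp add: wz_def)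
          qed (use s in \<open>simp add: wz_def\<close>)
        qed simp
      qed
      have "(\<lambda>x. indicator \<Omega> x * w' x) \<in> borel_measurable borel"
        using borel_measurable_continuous_on_indicator[OF _ w'] \<Omega>(1) by (simp add: borel_open)
      then have "(\<lambda>x. - (?c x * (indicator \<Omega> x * w' x))) \<in> borel_measurable borel" by measurable
      then show "(\<lambda>x. - (indicator \<Omega> x * (?c x * w' x))) \<in> borel_measurable lborel"
        by (simp add: mult_ac)
    qed measurable
    have "(LINT x|lborel. indicator \<Omega> x * (cutoff' \<Omega> \<delta> x * (Dq x \<bullet> b) * w x)) =
        (LINT x|lborel. - (indicator \<Omega> x * (?c x * w' x)))"
      using L1 L2 unfolding eq by (rule LIMSEQ_unique)
    then show "(LINT x|lborel. indicator \<Omega> x * (?c x * w' x)) =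
       - (LINT x|lborel. indicator \<Omega> x * (cutoff' \<Omega> \<delta> x * (Dq x \<bullet> b) * w x))"
      by simp
  qed
qed

section \<open>Partial derivatives\<close>

lemma Ck1_iff:
  fixes f :: "'a::euclidean_space \<Rightarrow> 'b::real_normed_vector"
  assumes "open S"
  shows "Ck_on 1 S f \<longleftrightarrow> (\<exists>f'. (\<forall>x\<in>S. (f has_derivative f' x) (at x)) \<and>
           (\<forall>b\<in>Basis. continuous_on S (\<lambda>x. f' x b)))"
proof
  assume L: "Ck_on 1 S f"
  then show "\<exists>f'. (\<forall>x\<in>S. (f has_derivative f' x) (at x)) \<and> (\<forall>b\<in>Basis. continuous_on S (\<lambda>x. f' x b))"
    using assms by (intro exI[of _ "\<lambda>x. frechet_derivative f (at x within S)"])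
      (auto simp: frechet_derivative_works at_within_open[OF _ assms])
next
  assume "\<exists>f'. (\<forall>x\<in>S. (f has_derivative f' x) (at x)) \<and> (\<forall>b\<in>Basis. continuous_on S (\<lambda>x. f' x b))"
  then obtain f' where f': "\<And>x. x \<in> S \<Longrightarrow> (f has_derivative f' x) (at x)"
    "\<And>b. b \<in> Basis \<Longrightarrow> continuous_on S (\<lambda>x. f' x b)" by blast
  have e: "frechet_derivative f (at x within S) = f' x" if "x \<in> S" for x
    using frechet_derivative_at[OF f'(1)[OF that]] at_within_open[OF that assms] by metis
  have "continuous_on S (\<lambda>x. frechet_derivative f (at x within S) b)" if "b \<in> Basis" for b
    using f'(2)[OF that] e by (simp cong: continuous_on_cong)
  moreover have "f differentiable (at x within S)" if "x \<in> S" for x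
    using f'(1)[OF that] by (metis differentiable_at_withinI differentiableI)
  ultimately show "Ck_on 1 S f" by simp
qed

lemma Ck1_differentiable:
  assumes "open S" "Ck_on 1 S f" "x \<in> S" shows "f differentiable (at x)"
  using assms(2,3) at_within_open[OF assms(3,1)] by (metis Ck_on.simps(2) One_nat_def)

lemma Ck1_continuous:
  fixes f :: "'a::euclidean_space \<Rightarrow> 'b::real_normed_vector"
  assumes "open S" "Ck_on 1 S f" shows "continuous_on S f"
  using Ck1_differentiable[OF assms] by (intro continuous_at_imp_continuous_on)
    (auto intro: differentiable_imp_continuous_within)

lemma Ck1_linear:
  fixes f :: "'a::euclidean_space \<Rightarrow> 'b::real_normed_vector"
  assumes "open S" "Ck_on 1 S f" "bounded_linear h" shows "Ck_on 1 S (\<lambda>x. h (f x))"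
proof -
  obtain f' where f': "\<forall>x\<in>S. (f has_derivative f' x) (at x)" "\<forall>b\<in>Basis. continuous_on S (\<lambda>x. f' x b)"
    using assms Ck1_iff by blast
  show ?thesis unfolding Ck1_iff[OF assms(1)]
    by (rule exI[of _ "\<lambda>x v. h (f' x v)"])
      (use f' in \<open>auto intro: bounded_linear.has_derivative[OF assms(3)] bounded_linear.continuous_on[OF assms(3)]\<close>)
qed

lemma Ck1_bilinear:
  fixes f :: "'a::euclidean_space \<Rightarrow> 'b::real_normed_vector" and g :: "'a \<Rightarrow> 'c::real_normed_vector"
  assumes "open S" "Ck_on 1 S f" "Ck_on 1 S g" "bounded_bilinear h" shows "Ck_on 1 S (\<lambda>x. h (f x) (g x))"
proof -
  obtain f' g' where f': "\<forall>x\<in>S. (f has_derivative f' x) (at x)" "\<forall>b\<in>Basis. continuous_on S (\<lambda>x. f' x b)"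
    and g': "\<forall>x\<in>S. (g has_derivative g' x) (at x)" "\<forall>b\<in>Basis. continuous_on S (\<lambda>x. g' x b)"
    using assms Ck1_iff by metis
  show ?thesis unfolding Ck1_iff[OF assms(1)]
    by (rule exI[of _ "\<lambda>x v. h (f x) (g' x v) + h (f' x v) (g x)"])
      (use f' g' Ck1_continuous[OF assms(1,2)] Ck1_continuous[OF assms(1,3)] in
       \<open>auto intro!: bounded_bilinear.FDERIV[OF assms(4)] continuous_on_add bounded_bilinear.continuous_on[OF assms(4)]\<close>)
qed

lemma Ck1_add:
  fixes f g :: "'a::euclidean_space \<Rightarrow> 'b::real_normed_vector"
  assumes "open S" "Ck_on 1 S f" "Ck_on 1 S g" shows "Ck_on 1 S (\<lambda>x. f x + g x)"
proof -
  obtain f' g' where f': "\<forall>x\<in>S. (f has_derivative f' x) (at x)" "\<forall>b\<in>Basis. continuous_on S (\<lambda>x. f' x b)"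
    and g': "\<forall>x\<in>S. (g has_derivative g' x) (at x)" "\<forall>b\<in>Basis. continuous_on S (\<lambda>x. g' x b)"
    using assms Ck1_iff by metis
  show ?thesis unfolding Ck1_iff[OF assms(1)]
    by (rule exI[of _ "\<lambda>x v. f' x v + g' x v"]) (use f' g' in \<open>auto intro!: has_derivative_add continuous_on_add\<close>)
qed

lemma Ck1_sum:
  fixes f :: "'i \<Rightarrow> 'a::euclidean_space \<Rightarrow> 'b::real_normed_vector"
  assumes "open S" "\<And>i. i \<in> I \<Longrightarrow> Ck_on 1 S (f i)" "finite I" shows "Ck_on 1 S (\<lambda>x. \<Sum>i\<in>I. f i x)"
  using assms(3,2)
proof (induction I)
  case empty
  show ?case unfolding Ck1_iff[OF assms(1)] by (auto intro!: exI[of _ "\<lambda>x v. 0"])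
next
  case (insert i I)
  then show ?case by (simp add: Ck1_add[OF assms(1), simplified])
qed

lemma Ck1_nth: "open S \<Longrightarrow> Ck_on 1 S f \<Longrightarrow> Ck_on 1 S (\<lambda>x. f x $ i)"
  for f :: "'a::euclidean_space \<Rightarrow> 'b::real_normed_vector ^ 'n"
  using Ck1_linear[OF _ _ bounded_linear_vec_nth] .

lemma Ck1_vec:
  fixes f :: "'a::euclidean_space \<Rightarrow> 'b::euclidean_space ^ 'n"
  assumes "open S" "\<And>i. Ck_on 1 S (\<lambda>x. f x $ i)" shows "Ck_on 1 S f"
proof -
  have bl: "bounded_linear (axis i :: 'b \<Rightarrow> 'b ^ 'n)" for i
    unfolding linear_conv_bounded_linear[symmetric] by (intro linearI) (auto simp: axis_def vec_eq_iff)
  have "Ck_on 1 S (\<lambda>x. \<Sum>i\<in>UNIV. axis i (f x $ i))"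
    by (intro Ck1_sum assms(1) Ck1_linear[OF assms(1,2) bl]) simp
  moreover have "(\<Sum>i\<in>UNIV. axis i (f x $ i)) = f x" for x
    by (simp add: vec_eq_iff axis_def if_distrib[of "\<lambda>v. v $ _"] if_distrib sum.If_cases cong: if_cong)
  ultimately show ?thesis by simp
qed

lemma Ck1_mult:
  fixes f g :: "'a::euclidean_space \<Rightarrow> real"
  shows "open S \<Longrightarrow> Ck_on 1 S f \<Longrightarrow> Ck_on 1 S g \<Longrightarrow> Ck_on 1 S (\<lambda>x. f x * g x)"
  using Ck1_bilinear[OF _ _ _ bounded_bilinear_mult] .

definition pd :: "3 \<Rightarrow> (real^3 \<Rightarrow> real) \<Rightarrow> real^3 \<Rightarrow> real" where
  "pd j f x = frechet_derivative f (at x) (axis j 1)"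

lemma pd_eq: "(f has_derivative f') (at x) \<Longrightarrow> pd j f x = f' (axis j 1)"
  by (simp add: pd_def frechet_derivative_at[symmetric])

lemma pd_along_axis:
  assumes "f differentiable (at x)"
  shows "((\<lambda>t. f (x + t *\<^sub>R axis j 1)) has_real_derivative pd j f x) (at 0)"
proof -
  have f: "(f has_derivative frechet_derivative f (at x)) (at (x + 0 *\<^sub>R axis j 1))"
    using assms by (simp add: frechet_derivative_works)
  have "((\<lambda>t::real. x + t *\<^sub>R axis j 1) has_derivative (\<lambda>t. t *\<^sub>R axis j 1)) (at 0)"
    by (auto intro!: derivative_eq_intros)
  from has_derivative_compose[OF this f]
  have "((\<lambda>t. f (x + t *\<^sub>R axis j 1)) has_derivative (\<lambda>t. frechet_derivative f (at x) (t *\<^sub>R axis j 1))) (at 0)" .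
  moreover have "frechet_derivative f (at x) (t *\<^sub>R axis j 1) = t * pd j f x" for t
    using linear_cmul[OF linear_frechet_derivative[OF assms]] by (simp add: pd_def)
  ultimately show ?thesis by (simp add: has_field_derivative_def mult_commute_abs)
qed

lemma pd_continuous: "open S \<Longrightarrow> Ck_on 1 S f \<Longrightarrow> continuous_on S (pd j f)"
proof -
  assume S: "open S" "Ck_on 1 S f"
  have "continuous_on S (\<lambda>x. frechet_derivative f (at x within S) (axis j 1))"
    using S by (auto simp: Basis_vec_def)
  moreover have "frechet_derivative f (at x within S) (axis j 1) = pd j f x" if "x \<in> S" for x
    unfolding pd_def at_within_open[OF that S(1)] by simp
  ultimately show ?thesis by (simp cong: continuous_on_cong)
qed

lemma pd_mult: "f differentiable (at x) \<Longrightarrow> g differentiable (at x) \<Longrightarrow>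
    pd j (\<lambda>x. f x * g x) x = pd j f x * g x + f x * pd j g x"
  using pd_eq[OF has_derivative_mult[of f _ x UNIV g]] frechet_derivative_works
  by (fastforce simp: pd_def)

lemma pd_diff: "f differentiable (at x) \<Longrightarrow> g differentiable (at x) \<Longrightarrow>
    pd j (\<lambda>x. f x - g x) x = pd j f x - pd j g x"
  using pd_eq[OF has_derivative_diff[of f _ "at x" g]] frechet_derivative_works
  by (fastforce simp: pd_def)

lemma pd_sum: "(\<And>i. i \<in> I \<Longrightarrow> f i differentiable (at x)) \<Longrightarrow>
    pd j (\<lambda>x. \<Sum>i\<in>I. f i x) x = (\<Sum>i\<in>I. pd j (f i) x)"
  using pd_eq[OF has_derivative_sum[of I f "\<lambda>i. frechet_derivative (f i) (at x)" "at x"]] frechet_derivative_works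
  by (fastforce simp: pd_def)

lemma differentiable_nth: "f differentiable F \<Longrightarrow> (\<lambda>x. f x $ i) differentiable F"
  for f :: "_ \<Rightarrow> 'b::real_normed_vector ^ 'n"
  using bounded_linear.has_derivative[OF bounded_linear_vec_nth] unfolding differentiable_def by blast

lemma grad_nth: "u differentiable (at x) \<Longrightarrow> grad u x $ i $ j = pd j (\<lambda>y. u y $ i) x"
proof -
  assume "u differentiable (at x)"
  then have "(u has_derivative frechet_derivative u (at x)) (at x)" by (simp add: frechet_derivative_works)
  from bounded_linear.has_derivative[OF bounded_linear_vec_nth this]
  have "((\<lambda>y. u y $ i) has_derivative (\<lambda>v. frechet_derivative u (at x) v $ i)) (at x)" .
  from pd_eq[OF this] show ?thesis by (simp add: grad_def jacobian_def matrix_def)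
qed

lemma Div_nth: "X differentiable (at x) \<Longrightarrow> Div X x $ i = (\<Sum>j\<in>UNIV. pd j (\<lambda>y. X y $ i $ j) x)"
  by (simp add: Div_def div_vec_def trace_def grad_nth differentiable_nth)

lemma Curl_nth:
  assumes "X differentiable (at x)"
  shows "Curl X x $ i $ 1 = pd 2 (\<lambda>y. X y $ i $ 3) x - pd 3 (\<lambda>y. X y $ i $ 2) x"
    "Curl X x $ i $ 2 = pd 3 (\<lambda>y. X y $ i $ 1) x - pd 1 (\<lambda>y. X y $ i $ 3) x"
    "Curl X x $ i $ 3 = pd 1 (\<lambda>y. X y $ i $ 2) x - pd 2 (\<lambda>y. X y $ i $ 1) x"
  using differentiable_nth[OF assms] by (simp_all add: Curl_def curl_vec_def grad_nth vector_3)

lemma div_cross_rows: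
  assumes "m differentiable (at x)" "Q differentiable (at x)"
  shows "(\<Sum>j\<in>UNIV. pd j (\<lambda>y. cross3 (m y $ i) (Q y $ i) $ j) x) =
    Curl m x $ i \<bullet> Q x $ i - m x $ i \<bullet> Curl Q x $ i"
proof -
  have d: "(\<lambda>y. m y $ i $ j) differentiable (at x)" "(\<lambda>y. Q y $ i $ j) differentiable (at x)" for j
    using assms by (auto intro: differentiable_nth)
  show ?thesis
    by (simp add: sum_3 cross_components inner_vec_def Curl_nth[OF assms(1)] Curl_nth[OF assms(2)]
        pd_diff pd_mult d differentiable_mult) (simp add: algebra_simps)
qed

lemma div_mat_vec:
  assumes "s differentiable (at x)" "v differentiable (at x)"
  shows "(\<Sum>j\<in>UNIV. pd j (\<lambda>y. \<Sum>i\<in>UNIV. s y $ i $ j * v y $ i) x) = Div s x \<bullet> v x + s x \<bullet> grad v x"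
proof -
  have d: "(\<lambda>y. s y $ i $ j) differentiable (at x)" "(\<lambda>y. v y $ i) differentiable (at x)" for i j
    using assms by (auto intro: differentiable_nth)
  have "(\<Sum>j\<in>UNIV. pd j (\<lambda>y. \<Sum>i\<in>UNIV. s y $ i $ j * v y $ i) x) =
    (\<Sum>j\<in>UNIV. \<Sum>i\<in>UNIV. pd j (\<lambda>y. s y $ i $ j) x * v x $ i + s x $ i $ j * pd j (\<lambda>y. v y $ i) x)"
    by (simp add: pd_sum pd_mult d differentiable_mult)
  also have "\<dots> = (\<Sum>i\<in>UNIV. \<Sum>j\<in>UNIV. pd j (\<lambda>y. s y $ i $ j) x * v x $ i + s x $ i $ j * pd j (\<lambda>y. v y $ i) x)"
    by (rule sum.swap)
  finally show ?thesis
    by (simp add: inner_vec_def Div_nth[OF assms(1)] grad_nth[OF assms(2)] sum.distrib sum_distrib_right)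
qed

lemma ball_in_domain:
  fixes \<Omega> :: "'a::euclidean_space set"
  assumes "x \<in> \<Omega>" shows "ball x (infdist x (frontier \<Omega>)) \<subseteq> \<Omega>"
  using same_side_of_frontier[OF segment_within_infdist] assms by (auto simp: subset_iff)

section \<open>Nearest boundary points\<close>

text \<open>The open ball about \<open>x\<close> through \<open>p\<close> lies in \<open>\<Omega>\<close>, so near \<open>p\<close> the defining function \<open>\<phi>\<close> is negative on it, and it is zero at \<open>p\<close>. Its gradient \<open>g\<close> thus satisfies
  \<open>v \<bullet> g \<le> 0\<close> for every direction \<open>v\<close> pointing into the ball, that is with \<open>v \<bullet> (x - p) > 0\<close>. A half-space of directions with this property
  forces \<open>g\<close> to be parallel to \<open>x - p\<close>.\<close>

lemma nearest_point_on_normal: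
  fixes \<Omega> :: "(real^3) set"
  assumes \<Omega>: "open \<Omega>" and x: "x \<in> \<Omega>" and p: "p \<in> frontier \<Omega>" "dist x p = infdist x (frontier \<Omega>)"
    and sm: "smooth_boundary_point \<Omega> p"
  shows "\<exists>n c. is_outward_unit_normal \<Omega> p n \<and> x - p = c *\<^sub>R n"
proof -
  obtain U \<phi> where U: "local_defining_function \<Omega> p U \<phi>" using sm by (auto simp: smooth_boundary_point_def)
  then have oU: "open U" "p \<in> U" and sm\<phi>: "smooth_on U \<phi>" and D0: "frechet_derivative \<phi> (at p) \<noteq> (\<lambda>_. 0)"
    and \<Omega>U: "\<Omega> \<inter> U = {y \<in> U. \<phi> y < 0}" by (auto simp: local_defining_function_def)
  have "Ck_on 1 U \<phi>" using sm\<phi> by (simp only: smooth_on_def)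
  from Ck1_differentiable[OF oU(1) this oU(2)] have der: "(\<phi> has_derivative frechet_derivative \<phi> (at p)) (at p)"
    by (simp add: frechet_derivative_works)
  define g where "g = (\<Sum>b\<in>Basis. frechet_derivative \<phi> (at p) b *\<^sub>R b)"
  have lin: "linear (frechet_derivative \<phi> (at p))" using der by (rule has_derivative_linear)
  have gi: "frechet_derivative \<phi> (at p) v = v \<bullet> g" for v
  proof -
    have "frechet_derivative \<phi> (at p) v = (\<Sum>b\<in>Basis. (v \<bullet> b) * frechet_derivative \<phi> (at p) b)"
      using lin by (subst euclidean_representation[of v, symmetric]) (simp only: linear_sum linear_cmul real_scaleR_def)
    then show ?thesis by (simp add: g_def inner_sum_right mult.commute)
  qed
  have gd: "GDERIV \<phi> p :> g" unfolding gderiv_def 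
  proof -
    have "frechet_derivative \<phi> (at p) = (\<lambda>h. h \<bullet> g)" using gi by blast
    with der show "(\<phi> has_derivative (\<lambda>h. h \<bullet> g)) (at p)" by simp
  qed
  have g0: "g \<noteq> 0" using D0 gi by auto
  have "p \<notin> \<Omega>" using p \<Omega> by (auto simp: frontier_def interior_open)
  then have xp: "x \<noteq> p" using x by auto
  have cont: "isCont \<phi> p" using der has_derivative_continuous by blast
  have \<phi>p: "\<phi> p = 0"
  proof (rule antisym)
    show "\<phi> p \<ge> 0" using \<open>p \<notin> \<Omega>\<close> oU(2) \<Omega>U by force
    show "\<phi> p \<le> 0"
    proof (rule ccontr)
      assume "\<not> \<phi> p \<le> 0"
      then have "eventually (\<lambda>y. \<phi> y > 0 \<and> y \<in> U) (nhds p)"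
      proof (intro eventually_conj eventually_nhds_in_open oU)
        have "(\<phi> \<longlongrightarrow> \<phi> p) (nhds p)" using cont by (simp add: isCont_def tendsto_at_iff_tendsto_nhds)
        then show "eventually (\<lambda>y. \<phi> y > 0) (nhds p)"
          using \<open>\<not> \<phi> p \<le> 0\<close> by (intro order_tendstoD(1)) auto
      qed
      then obtain V where V: "open V" "p \<in> V" "\<And>y. y \<in> V \<Longrightarrow> \<phi> y > 0 \<and> y \<in> U"
        unfolding eventually_nhds by blast
      have "p \<in> closure \<Omega>" using p(1) by (auto simp: frontier_def)
      then obtain y where "y \<in> V" "y \<in> \<Omega>" using V(1,2) closure_iff_nhds_not_empty[of p \<Omega>] by blast
      then have "y \<in> \<Omega> \<inter> U" using V(3)[of y] by simp
      then show False using V(3)[OF \<open>y \<in> V\<close>] \<Omega>U by simp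
    qed
  qed
  have half: "v \<bullet> g \<le> 0" if v: "v \<bullet> (x - p) > 0" for v
  proof (rule ccontr)
    assume "\<not> v \<bullet> g \<le> 0"
    then have pos: "v \<bullet> g > 0" by simp
    have line: "((\<lambda>t::real. p + t *\<^sub>R v) has_derivative (\<lambda>t. t *\<^sub>R v)) (at 0)"
      by (auto intro!: derivative_eq_intros)
    have der': "(\<phi> has_derivative frechet_derivative \<phi> (at p)) (at (p + 0 *\<^sub>R v))" using der by simp
    have "((\<lambda>t. \<phi> (p + t *\<^sub>R v)) has_real_derivative v \<bullet> g) (at 0)"
      using has_derivative_compose[OF line der'] by (simp add: has_field_derivative_def gi mult_commute_abs)
    from DERIV_pos_inc_right[OF this pos] obtain d where d: "d > 0" "\<And>h. 0 < h \<Longrightarrow> h < d \<Longrightarrow> \<phi> p < \<phi> (p + h *\<^sub>R v)"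
      by auto
    obtain e where e: "e > 0" "ball p e \<subseteq> U" using oU openE by blast
    \<comment> \<open>a step so short that \<open>p + h v\<close> is in \<open>U\<close>, has \<open>\<phi> > 0\<close> and lies in the ball about \<open>x\<close>\<close>
    define h where "h = min (d / 2) (min (e / (2 * (norm v + 1))) (v \<bullet> (x - p) / ((norm v)\<^sup>2 + 1)))"
    have h: "h > 0" "h < d" using d e v by (auto simp: h_def add_nonneg_pos min_less_iff_disj)
    have "h * norm v < e"
    proof -
      have "h * norm v \<le> e / (2 * (norm v + 1)) * (norm v + 1)"
        using h by (intro mult_mono) (auto simp: h_def)
      also have "\<dots> = e / 2" by (simp add: field_simps add_nonneg_eq_0_iff)
      finally show ?thesis using e by simp
    qed
    then have inU: "p + h *\<^sub>R v \<in> U" using e h by (auto simp: dist_norm)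
    have "h * (norm v)\<^sup>2 < 2 * (v \<bullet> (x - p))"
    proof -
      have "h * (norm v)\<^sup>2 \<le> v \<bullet> (x - p) / ((norm v)\<^sup>2 + 1) * ((norm v)\<^sup>2 + 1)"
        using h v by (intro mult_mono) (auto simp: h_def)
      also have "\<dots> = v \<bullet> (x - p)" by (simp add: field_simps add_nonneg_eq_0_iff)
      finally show ?thesis using v by simp
    qed
    then have "h * (h * (norm v)\<^sup>2) < h * (2 * (v \<bullet> (x - p)))" using h by (intro mult_strict_left_mono) simp_all
    moreover have "(norm (x - (p + h *\<^sub>R v)))\<^sup>2 = (norm (x - p))\<^sup>2 - h * (2 * (v \<bullet> (x - p))) + h * (h * (norm v)\<^sup>2)"
      by (simp add: power2_norm_eq_inner inner_simps inner_commute algebra_simps)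
    ultimately have "(norm (x - (p + h *\<^sub>R v)))\<^sup>2 < (norm (x - p))\<^sup>2" by simp
    then have "norm (x - (p + h *\<^sub>R v)) < norm (x - p)"
      by (rule power2_less_imp_less[OF _ norm_ge_zero])
    then have "dist x (p + h *\<^sub>R v) < infdist x (frontier \<Omega>)"
      using p(2) by (simp add: dist_norm)
    then have "p + h *\<^sub>R v \<in> \<Omega>" using ball_in_domain[OF x] by auto
    then have "\<phi> (p + h *\<^sub>R v) < 0" using inU \<Omega>U by auto
    then show False using d(2)[OF h] \<phi>p by simp
  qed
  define z where "z = x - p"
  have z0: "z \<bullet> z > 0" using xp by (simp add: z_def)
  have orth: "v \<bullet> g = 0" if "v \<bullet> z = 0" for v
  proof -
    have le: "v \<bullet> g \<le> 0" if v: "v \<bullet> z = 0" for v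
    proof (rule ccontr)
      assume "\<not> v \<bullet> g \<le> 0"
      then have "v \<bullet> g > 0" by simp
      define s where "s = v \<bullet> g / (2 * (\<bar>z \<bullet> g\<bar> + 1))"
      have s: "s > 0" using \<open>v \<bullet> g > 0\<close> by (auto simp: s_def add_nonneg_pos)
      have "(v + s *\<^sub>R z) \<bullet> g \<le> 0" using half[of "v + s *\<^sub>R z"] s z0 v by (simp add: z_def[symmetric] inner_add_left)
      then have "v \<bullet> g \<le> s * \<bar>z \<bullet> g\<bar>" using s by (simp add: inner_add_left) (smt (verit) mult_minus_right mult_left_mono)
      also have "\<dots> \<le> s * (\<bar>z \<bullet> g\<bar> + 1)" using s by (intro mult_left_mono) auto
      also have "\<dots> = v \<bullet> g / 2" by (simp add: s_def field_simps add_nonneg_eq_0_iff)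
      finally show False using \<open>v \<bullet> g > 0\<close> by simp
    qed
    from le[OF that] le[of "-v"] that show ?thesis by simp
  qed
  define c where "c = (z \<bullet> g) / (z \<bullet> z)"
  have "g - c *\<^sub>R z = 0"
  proof -
    have "(g - c *\<^sub>R z) \<bullet> z = 0" 
      using z0 unfolding c_def inner_diff_left inner_scaleR_left by (simp add: inner_commute)
    then have "(g - c *\<^sub>R z) \<bullet> g = 0" "(g - c *\<^sub>R z) \<bullet> z = 0" using orth by auto
    then have "(g - c *\<^sub>R z) \<bullet> (g - c *\<^sub>R z) = 0" by (simp add: inner_diff_right)
    then show ?thesis by simp
  qed
  then have gc: "g = c *\<^sub>R z" by simp
  with g0 have "c \<noteq> 0" by auto
  have "z = (norm g / c) *\<^sub>R sgn g"
  proof -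
    have "(norm g / c) *\<^sub>R sgn g = (1 / c) *\<^sub>R g" using g0 by (simp add: sgn_div_norm)
    then show ?thesis using gc \<open>c \<noteq> 0\<close> by simp
  qed
  moreover have "is_outward_unit_normal \<Omega> p (sgn g)"
    unfolding is_outward_unit_normal_def using U gd by blast
  ultimately show ?thesis unfolding z_def by blast
qed

section \<open>The boundary layer\<close>

lemma interior_compact:
  fixes \<Omega> :: "'a::euclidean_space set"
  assumes "open \<Omega>" "bounded \<Omega>" "\<delta> > 0"
  shows "compact {x \<in> \<Omega>. \<delta> \<le> infdist x (frontier \<Omega>)}"
proof -
  have "x \<in> \<Omega> \<longleftrightarrow> x \<in> closure \<Omega>" if "\<delta> \<le> infdist x (frontier \<Omega>)" for x
  proof -
    have "x \<notin> frontier \<Omega>" using that assms(3) infdist_zero[of x "frontier \<Omega>"] by auto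
    then show ?thesis using closure_subset[of \<Omega>] by (auto simp: frontier_def interior_open[OF assms(1)])
  qed
  then have "{x \<in> \<Omega>. \<delta> \<le> infdist x (frontier \<Omega>)} = closure \<Omega> \<inter> {x. \<delta> \<le> infdist x (frontier \<Omega>)}" by auto
  moreover have "closed {x. \<delta> \<le> infdist x (frontier \<Omega>)}" by (intro closed_Collect_le continuous_intros)
  ultimately show ?thesis using assms(2) by (metis compact_Int_closed compact_closure)
qed

lemma continuous_on_bounded_above:
  fixes f :: "'a::euclidean_space \<Rightarrow> 'b::real_normed_vector"
  assumes "continuous_on S f" "compact K" "K \<subseteq> S"
  obtains B where "\<And>x. x \<in> K \<Longrightarrow> norm (f x) \<le> B" "B \<ge> 0"
proof -
  have "bounded (f ` K)" by (intro compact_imp_bounded compact_continuous_image continuous_on_subset[OF assms(1)] assms)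
  then obtain B where "\<And>x. x \<in> K \<Longrightarrow> norm (f x) \<le> B" by (auto simp: bounded_iff)
  then show thesis using that[of "max 0 B"] by fastforce
qed

lemma integrable_dominated_by_compact:
  fixes f :: "'a::euclidean_space \<Rightarrow> real"
  assumes "f \<in> borel_measurable borel" "compact K" "AE x in lborel. \<bar>f x\<bar> \<le> C * indicator K x"
  shows "integrable lborel f"
proof (rule Bochner_Integration.integrable_bound)
  show "integrable lborel (\<lambda>x. C * indicator K x :: real)"
    using emeasure_bounded_finite[OF compact_imp_bounded[OF assms(2)]] borel_compact[OF assms(2)]
    by (intro integrable_mult_right integrable_real_indicator) auto
  show "AE x in lborel. norm (f x) \<le> norm (C * indicator K x)"
    using assms(3) by eventually_elim auto
qed (use assms in auto)

lemma indicator_times_integrable: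
  fixes f :: "'a::euclidean_space \<Rightarrow> real"
  assumes "open \<Omega>" "bounded \<Omega>" "continuous_on \<Omega> f" "\<And>x. x \<in> \<Omega> \<Longrightarrow> \<bar>f x\<bar> \<le> B"
  shows "integrable lborel (\<lambda>x. indicator \<Omega> x * f x)"
proof (rule integrable_dominated_by_compact[OF _ _ AE_I2])
  show "(\<lambda>x. indicator \<Omega> x * f x) \<in> borel_measurable borel"
    using borel_measurable_continuous_on_indicator[OF _ assms(3)] assms(1) by (simp add: borel_open)
  show "compact (closure \<Omega>)" using assms(2) by simp
  show "\<bar>indicator \<Omega> x * f x\<bar> \<le> \<bar>B\<bar> * indicator (closure \<Omega>) x" for x
    using assms(4)[of x] closure_subset[of \<Omega>] by (cases "x \<in> \<Omega>") auto
qed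

lemma cutoff_integrable_continuous:
  fixes f \<theta> :: "'a::euclidean_space \<Rightarrow> real"
  assumes \<Omega>: "open \<Omega>" "bounded \<Omega>" and f: "continuous_on \<Omega> f"
    and \<theta>: "continuous_on UNIV \<theta>" "\<And>x. 0 \<le> \<theta> x \<and> \<theta> x \<le> 1"
    and K: "compact K" "K \<subseteq> \<Omega>" "\<And>x. x \<in> \<Omega> - K \<Longrightarrow> \<theta> x = 0"
  shows "integrable lborel (\<lambda>x. indicator \<Omega> x * (\<theta> x * f x))"
proof -
  obtain B where B: "\<And>x. x \<in> K \<Longrightarrow> norm (f x) \<le> B" "B \<ge> 0" using continuous_on_bounded_above[OF f K(1,2)] by blast
  show ?thesis
  proof (rule indicator_times_integrable[OF \<Omega>])
    show "continuous_on \<Omega> (\<lambda>x. \<theta> x * f x)"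
      by (intro continuous_on_mult f continuous_on_subset[OF \<theta>(1)]) simp
    show "\<bar>\<theta> x * f x\<bar> \<le> B" if "x \<in> \<Omega>" for x
    proof (cases "x \<in> K")
      case True
      then show ?thesis using B(1)[OF True] \<theta>(2)[of x] mult_mono[of "\<bar>\<theta> x\<bar>" 1 "\<bar>f x\<bar>" B] by (simp add: abs_mult)
    next
      case False
      then show ?thesis using K(3)[of x] that B(2) by simp
    qed
  qed
qed

lemma integrable_cutoff:
  fixes \<Omega> :: "'a::euclidean_space set"
  assumes \<Omega>: "open \<Omega>" "bounded \<Omega>" and \<delta>: "\<delta> > 0" and f: "continuous_on \<Omega> f"
  shows "integrable lborel (\<lambda>x. indicator \<Omega> x * (cutoff \<Omega> \<delta> x * f x))"
proof (rule cutoff_integrable_continuous[OF \<Omega> f cutoff_continuous(1) _ interior_compact[OF \<Omega> \<delta>]])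
  show "cutoff \<Omega> \<delta> x = 0" if "x \<in> \<Omega> - {x \<in> \<Omega>. \<delta> \<le> infdist x (frontier \<Omega>)}" for x
    by (rule cutoff_eq_0(1)[OF \<delta>]) (use that in auto)
qed (auto simp: cutoff_bounds)

lemma exists_nearest:
  fixes F :: "'a::euclidean_space set"
  assumes "compact F" "F \<noteq> {}" shows "\<exists>p\<in>F. dist x p = infdist x F"
  using infdist_attains_inf[OF compact_imp_closed[OF assms(1)] assms(2)] by metis

lemma bounded_open_frontier:
  fixes \<Omega> :: "'a::euclidean_space set"
  assumes "open \<Omega>" "bounded \<Omega>" "\<Omega> \<noteq> {}"
  shows "compact (frontier \<Omega>)" "frontier \<Omega> \<noteq> {}"
  using assms not_bounded_UNIV frontier_eq_empty[of \<Omega>] by (auto simp: compact_frontier_bounded)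

text \<open>The gradient of the cutoff is \<open>O(1 / \<delta>)\<close>: where \<open>cutoff'\<close> does not vanish, the distance to the boundary is at most \<open>2 \<delta>\<close>.\<close>

lemma cutoff'_infdist_le:
  assumes "\<delta> > 0"
  shows "cutoff' \<Omega> \<delta> x * (2 * infdist x (frontier \<Omega>)) \<le> 36 / \<delta>"
proof (cases "infdist x (frontier \<Omega>) \<ge> 2 * \<delta>")
  case False
  then have "cutoff' \<Omega> \<delta> x * (2 * infdist x (frontier \<Omega>)) \<le> 9 / \<delta>\<^sup>2 * (4 * \<delta>)"
    by (intro mult_mono[OF cutoff_bounds(4)]) (use False infdist_nonneg[of x "frontier \<Omega>"] in auto)
  then show ?thesis using assms by (simp add: power2_eq_square)
next
  case True
  then show ?thesis using assms cutoff_eq_1(2)[OF assms, of x \<Omega>] by simp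
qed

text \<open>A divergence theorem without surface integrals: the flux through the boundary appears as an integral over the layer where the cutoff varies, and
  twice the vector from the nearest boundary point takes the place of the normal.\<close>

lemma cutoff_divergence_theorem:
  fixes \<Omega> :: "(real^3) set"
  assumes \<Omega>: "open \<Omega>" "bounded \<Omega>" "\<Omega> \<noteq> {}"
  shows "\<exists>Dq \<in> borel_measurable borel.
    (AE x in lborel. x \<in> \<Omega> \<longrightarrow>
       (\<forall>p\<in>frontier \<Omega>. dist x p = infdist x (frontier \<Omega>) \<longrightarrow> Dq x = 2 *\<^sub>R (x - p))) \<and>
    (\<forall>\<delta>>0. \<forall>w :: real^3 \<Rightarrow> real^3. Ck_on 1 \<Omega> w \<longrightarrow>
       (LINT x|lborel. indicator \<Omega> x * (cutoff \<Omega> \<delta> x * (\<Sum>j\<in>UNIV. pd j (\<lambda>y. w y $ j) x))) =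
       - (LINT x|lborel. indicator \<Omega> x * (cutoff' \<Omega> \<delta> x * (Dq x \<bullet> w x))))"
proof -
  from cutoff_integration_by_parts[OF \<Omega>] obtain Dq where Dq: "Dq \<in> borel_measurable borel"
    "AE x in lborel. x \<in> \<Omega> \<longrightarrow>
       (\<forall>p\<in>frontier \<Omega>. dist x p = infdist x (frontier \<Omega>) \<longrightarrow> Dq x = 2 *\<^sub>R (x - p))"
    and ibp: "\<And>\<delta> b w w'. \<delta> > 0 \<Longrightarrow> b \<in> Basis \<Longrightarrow> continuous_on \<Omega> w \<Longrightarrow> continuous_on \<Omega> w' \<Longrightarrow>
       (\<forall>x\<in>\<Omega>. ((\<lambda>t. w (x + t *\<^sub>R b)) has_real_derivative w' x) (at 0)) \<Longrightarrow>
       (LINT x|lborel. indicator \<Omega> x * (cutoff \<Omega> \<delta> x * w' x)) =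
       - (LINT x|lborel. indicator \<Omega> x * (cutoff' \<Omega> \<delta> x * (Dq x \<bullet> b) * w x))"
    by blast
  note [measurable] = Dq(1)
  show ?thesis
  proof (intro bexI[OF _ Dq(1)] conjI Dq(2) allI impI)
    fix \<delta> :: real and w :: "real^3 \<Rightarrow> real^3"
    assume \<delta>: "\<delta> > 0" and w: "Ck_on 1 \<Omega> w"
    have wj: "Ck_on 1 \<Omega> (\<lambda>y. w y $ j)" for j by (rule Ck1_nth[OF \<Omega>(1) w])
    have c: "continuous_on \<Omega> (\<lambda>y. w y $ j)" for j by (rule Ck1_continuous[OF \<Omega>(1) wj])
    have c': "continuous_on \<Omega> (pd j (\<lambda>y. w y $ j))" for j by (rule pd_continuous[OF \<Omega>(1) wj])
    have d: "\<forall>x\<in>\<Omega>. ((\<lambda>t. w (x + t *\<^sub>R axis j 1) $ j) has_real_derivative pd j (\<lambda>y. w y $ j) x) (at 0)" for j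
      using pd_along_axis[OF Ck1_differentiable[OF \<Omega>(1) wj]] by blast
    have i1: "integrable lborel (\<lambda>x. indicator \<Omega> x * (cutoff \<Omega> \<delta> x * pd j (\<lambda>y. w y $ j) x))" for j
      by (rule integrable_cutoff[OF \<Omega>(1,2) \<delta> c'])
    have i2: "integrable lborel (\<lambda>x. indicator \<Omega> x * (cutoff' \<Omega> \<delta> x * (Dq x \<bullet> axis j 1) * w x $ j))" for j
    proof -
      let ?K = "{x \<in> \<Omega>. \<delta> \<le> infdist x (frontier \<Omega>)}"
      obtain B where B: "\<And>x. x \<in> ?K \<Longrightarrow> norm (w x $ j) \<le> B" "B \<ge> 0"
        using continuous_on_bounded_above[OF c interior_compact[OF \<Omega>(1,2) \<delta>]] by auto
      have [measurable]: "(\<lambda>x. indicator \<Omega> x * w x $ j) \<in> borel_measurable borel"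
        using borel_measurable_continuous_on_indicator[OF _ c] \<Omega>(1) by (simp add: borel_open)
      have "(\<lambda>x. cutoff' \<Omega> \<delta> x * (Dq x \<bullet> axis j 1) * (indicator \<Omega> x * w x $ j)) \<in> borel_measurable borel"
        by measurable
      then have m: "(\<lambda>x. indicator \<Omega> x * (cutoff' \<Omega> \<delta> x * (Dq x \<bullet> axis j 1) * w x $ j)) \<in> borel_measurable borel"
        by (simp add: mult_ac)
      show ?thesis
      proof (rule integrable_dominated_by_compact[OF m interior_compact[OF \<Omega>(1,2) \<delta>]])
        show "AE x in lborel. \<bar>indicator \<Omega> x * (cutoff' \<Omega> \<delta> x * (Dq x \<bullet> axis j 1) * w x $ j)\<bar> \<le> 36 / \<delta> * B * indicator ?K x"
          using Dq(2)
        proof eventually_elim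
          case (elim x)
          show ?case
          proof (cases "x \<in> ?K")
            case True
            obtain p where p: "p \<in> frontier \<Omega>" "dist x p = infdist x (frontier \<Omega>)"
              using exists_nearest[OF bounded_open_frontier[OF \<Omega>]] by blast
            have "\<bar>Dq x \<bullet> axis j 1\<bar> \<le> norm (Dq x) * norm (axis j (1::real))" by (rule Cauchy_Schwarz_ineq2)
            also have "\<dots> = 2 * infdist x (frontier \<Omega>)" using elim True p by (simp add: dist_norm)
            finally have "\<bar>cutoff' \<Omega> \<delta> x\<bar> * \<bar>Dq x \<bullet> axis j 1\<bar> \<le> cutoff' \<Omega> \<delta> x * (2 * infdist x (frontier \<Omega>))"
              using cutoff_bounds[of \<Omega> \<delta> x] by (simp add: mult_left_mono)
            also have "\<dots> \<le> 36 / \<delta>" by (rule cutoff'_infdist_le[OF \<delta>])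
            finally have "\<bar>cutoff' \<Omega> \<delta> x\<bar> * \<bar>Dq x \<bullet> axis j 1\<bar> * \<bar>w x $ j\<bar> \<le> 36 / \<delta> * B"
              using B(1)[OF True] \<delta> by (intro mult_mono) auto
            then show ?thesis using True by (simp add: abs_mult)
          next
            case False
            then have "x \<notin> \<Omega> \<or> cutoff' \<Omega> \<delta> x = 0" using cutoff_eq_0(2)[OF \<delta>, of x \<Omega>] by auto
            then show ?thesis using False by auto
          qed
        qed
      qed
    qed
    have inn: "(\<Sum>j\<in>UNIV. indicator \<Omega> x * (cutoff' \<Omega> \<delta> x * (Dq x \<bullet> axis j 1) * w x $ j)) =
        indicator \<Omega> x * (cutoff' \<Omega> \<delta> x * (Dq x \<bullet> w x))" for x
      unfolding cart_eq_inner_axis[symmetric] by (simp add: inner_vec_def sum_distrib_left mult_ac)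
    have "(LINT x|lborel. indicator \<Omega> x * (cutoff \<Omega> \<delta> x * (\<Sum>j\<in>UNIV. pd j (\<lambda>y. w y $ j) x))) =
      (LINT x|lborel. (\<Sum>j\<in>UNIV. indicator \<Omega> x * (cutoff \<Omega> \<delta> x * pd j (\<lambda>y. w y $ j) x)))"
      by (simp add: sum_distrib_left)
    also have "\<dots> = (\<Sum>j\<in>UNIV. (LINT x|lborel. indicator \<Omega> x * (cutoff \<Omega> \<delta> x * pd j (\<lambda>y. w y $ j) x)))"
      by (rule Bochner_Integration.integral_sum) (rule i1)
    also have "\<dots> = (\<Sum>j\<in>UNIV. - (LINT x|lborel. indicator \<Omega> x * (cutoff' \<Omega> \<delta> x * (Dq x \<bullet> axis j 1) * w x $ j)))"
      by (intro sum.cong refl ibp[OF \<delta> _ c c' d]) (auto simp: Basis_vec_def)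
    also have "\<dots> = - (LINT x|lborel. (\<Sum>j\<in>UNIV. indicator \<Omega> x * (cutoff' \<Omega> \<delta> x * (Dq x \<bullet> axis j 1) * w x $ j)))"
      by (subst Bochner_Integration.integral_sum) (auto simp: sum_negf intro: i2)
    finally show "(LINT x|lborel. indicator \<Omega> x * (cutoff \<Omega> \<delta> x * (\<Sum>j\<in>UNIV. pd j (\<lambda>y. w y $ j) x))) =
       - (LINT x|lborel. indicator \<Omega> x * (cutoff' \<Omega> \<delta> x * (Dq x \<bullet> w x)))"
      by (simp only: inn)
  qed
qed

text \<open>On a layer of volume \<open>O(\<delta>)\<close> the weight is \<open>O(1 / \<delta>)\<close>, so the integrals are bounded. They even tend to zero: where the nearest point \<open>p\<close> lies off \<open>K\<close>,
  \<open>v x - v p\<close> is small by uniform continuity, and the part of the layer near \<open>K\<close> has volume \<open>O(\<delta>\<^sup>2)\<close>.\<close>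

lemma boundary_layer_integral:
  fixes \<Omega> :: "(real^3) set" and v :: "real^3 \<Rightarrow> 'b::real_normed_vector"
  assumes \<Omega>: "open \<Omega>" "bounded \<Omega>" "\<Omega> \<noteq> {}"
    and K: "compact K" and C: "C \<ge> 0"
    and vol: "\<And>r. r \<in> {0<..1} \<Longrightarrow> measure lborel (thickening (frontier \<Omega>) r) \<le> C * r"
      "\<And>r. r \<in> {0<..1} \<Longrightarrow> measure lborel (thickening K r) \<le> C * r\<^sup>2"
    and v: "continuous_on (closure \<Omega>) v" and g: "\<And>x. g x \<ge> 0"
    and bd: "AE x in lborel. x \<in> \<Omega> \<longrightarrow> (\<forall>p\<in>frontier \<Omega>. dist x p = infdist x (frontier \<Omega>) \<longrightarrow>
        g x \<le> 2 * dist x p * norm (v x) \<and> (p \<notin> K \<longrightarrow> g x \<le> 2 * dist x p * norm (v x - v p)))"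
  shows "(\<lambda>n. LINT x|lborel. indicator \<Omega> x * (cutoff' \<Omega> (1 / real (Suc n)) x * g x)) \<longlonglongrightarrow> 0"
proof -
  let ?F = "frontier \<Omega>"
  note F = bounded_open_frontier[OF \<Omega>]
  define I where "I n = (LINT x|lborel. indicator \<Omega> x * (cutoff' \<Omega> (1 / real (Suc n)) x * g x))" for n
  obtain B where B: "\<And>x. x \<in> closure \<Omega> \<Longrightarrow> norm (v x) \<le> B" "B \<ge> 0"
    using continuous_on_bounded_above[OF v, of "closure \<Omega>"] \<Omega>(2) by auto
  have I0: "I n \<ge> 0" for n
    unfolding I_def by (intro integral_nonneg_AE AE_I2 mult_nonneg_nonneg g cutoff_bounds(3)) simp
  \<comment> \<open>the bound is \<open>36 / \<delta> * (e * C * 2 \<delta> + B * C * (2 \<delta>)\<^sup>2)\<close>: the weight times the volumes of the two layers\<close>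
  have ub: "\<forall>\<^sub>F n in sequentially. I n \<le> 72 * C * e + 144 * B * C * (1 / real (Suc n))" if e: "e > 0" for e
  proof -
    have "uniformly_continuous_on (closure \<Omega>) v"
      using v \<Omega>(2) by (intro compact_uniformly_continuous) auto
    then obtain d0 where d0: "d0 > 0" "\<And>x y. x \<in> closure \<Omega> \<Longrightarrow> y \<in> closure \<Omega> \<Longrightarrow> dist x y < d0 \<Longrightarrow> dist (v x) (v y) < e"
      using e unfolding uniformly_continuous_on_def by metis
    have "(\<lambda>n. 2 * (1 / real (Suc n))) \<longlonglongrightarrow> 2 * 0"
      using LIMSEQ_inverse_real_of_nat by (intro tendsto_mult tendsto_const) (simp add: inverse_eq_divide)
    then have "\<forall>\<^sub>F n in sequentially. 2 * (1 / real (Suc n)) < min d0 1"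
      by (rule order_tendstoD(2)) (use d0 in auto)
    then show ?thesis
    proof eventually_elim
      case (elim n)
      define \<delta> where "\<delta> = 1 / real (Suc n)"
      have \<delta>: "\<delta> > 0" "2 * \<delta> < d0" "2 * \<delta> \<le> 1" using elim by (auto simp: \<delta>_def)
      let ?u = "\<lambda>x. 36 / \<delta> * (e * indicator (thickening ?F (2 * \<delta>)) x + B * indicator (thickening K (2 * \<delta>)) x)"
      have iA: "integrable lborel (\<lambda>x. indicator (thickening A (2 * \<delta>)) x :: real)" if "compact A" for A :: "(real^3) set"
        using compact_thickening[OF that, of "2 * \<delta>"] emeasure_bounded_finite[OF compact_imp_bounded] borel_compact
        by (intro integrable_real_indicator) auto
      have "I n \<le> (LINT x|lborel. ?u x)" unfolding I_def \<delta>_def[symmetric]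
      proof (rule integral_mono_AE')
        show "integrable lborel ?u"
          by (intro integrable_mult_right Bochner_Integration.integrable_add iA F K)
        show "AE x in lborel. 0 \<le> ?u x" using e B \<delta> by (intro AE_I2) auto
        show "AE x in lborel. indicator \<Omega> x * (cutoff' \<Omega> \<delta> x * g x) \<le> ?u x"
          using bd
        proof eventually_elim
          case (elim x)
          have u0: "0 \<le> ?u x" using e B \<delta> by auto
          show ?case
          proof (cases "x \<in> \<Omega> \<and> infdist x ?F < 2 * \<delta>")
            case False
            then have "x \<notin> \<Omega> \<or> cutoff' \<Omega> \<delta> x = 0" using cutoff_eq_1(2)[OF \<delta>(1), of x \<Omega>] by auto
            then show ?thesis using u0 by auto
          next
            case True
            obtain p where p: "p \<in> ?F" "dist x p = infdist x ?F" using exists_nearest[OF F] by blast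
            have xt: "x \<in> thickening ?F (2 * \<delta>)" using p True by (auto simp: mem_thickening intro!: bexI[of _ p])
            have cl: "x \<in> closure \<Omega>" "p \<in> closure \<Omega>" using True p closure_subset by (auto simp: frontier_def)
            define y where "y = (if p \<in> K then B else e)"
            have "g x \<le> 2 * dist x p * norm (v x) \<and> (p \<notin> K \<longrightarrow> g x \<le> 2 * dist x p * norm (v x - v p))"
              using elim True p by blast
            then have gx: "g x \<le> 2 * dist x p * norm (v x)" "p \<notin> K \<Longrightarrow> g x \<le> 2 * dist x p * norm (v x - v p)"
              by simp_all
            have "g x \<le> 2 * dist x p * y"
            proof (cases "p \<in> K")
              case True
              have "2 * dist x p * norm (v x) \<le> 2 * dist x p * B"
                by (rule mult_left_mono[OF B(1)[OF cl(1)]]) simp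
              then show ?thesis using gx(1) True by (simp add: y_def)
            next
              case False
              have "norm (v x - v p) \<le> e" using d0(2)[OF cl] p True \<delta>(2) by (simp add: dist_norm)
              then have "2 * dist x p * norm (v x - v p) \<le> 2 * dist x p * e" by (rule mult_left_mono) simp
              then show ?thesis using gx(2)[OF False] False by (simp add: y_def)
            qed
            then have "cutoff' \<Omega> \<delta> x * g x \<le> cutoff' \<Omega> \<delta> x * (2 * infdist x ?F * y)"
              using cutoff_bounds[of \<Omega> \<delta> x] p by (intro mult_left_mono) auto
            also have "\<dots> = (cutoff' \<Omega> \<delta> x * (2 * infdist x ?F)) * y" by simp
            also have "\<dots> \<le> 36 / \<delta> * y"
              using cutoff'_infdist_le[OF \<delta>(1)] B e by (intro mult_right_mono) (auto simp: y_def)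
            also have "\<dots> \<le> ?u x"
            proof -
              have "y \<le> e * indicator (thickening ?F (2 * \<delta>)) x + B * indicator (thickening K (2 * \<delta>)) x"
              proof (cases "p \<in> K")
                case True
                then have "x \<in> thickening K (2 * \<delta>)" using p \<open>x \<in> \<Omega> \<and> _\<close> by (auto simp: mem_thickening intro!: bexI[of _ p])
                then show ?thesis using True e by (simp add: y_def)
              qed (use xt B in \<open>simp add: y_def\<close>)
              then show ?thesis using \<delta> by (intro mult_left_mono) auto
            qed
            finally show ?thesis using True by simp
          qed
        qed
      qed
      also have "\<dots> = 36 / \<delta> * (e * measure lborel (thickening ?F (2 * \<delta>)) + B * measure lborel (thickening K (2 * \<delta>)))"
        using compact_thickening[OF F(1)] compact_thickening[OF K]
        by (simp add: iA F K borel_compact)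
      also have "\<dots> \<le> 36 / \<delta> * (e * (C * (2 * \<delta>)) + B * (C * (2 * \<delta>)\<^sup>2))"
        using vol[of "2 * \<delta>"] \<delta> e B by (intro mult_left_mono add_mono) auto
      also have "\<dots> = 72 * C * e + 144 * B * C * \<delta>"
        using \<delta>(1) by (simp add: field_simps power2_eq_square)
      finally show ?case by (simp add: \<delta>_def)
    qed
  qed
  show ?thesis unfolding I_def[symmetric]
  proof (rule LIMSEQ_I)
    fix r :: real assume r: "r > 0"
    define e where "e = r / (2 * (72 * C + 1))"
    have e: "e > 0" "72 * C * e \<le> r / 2"
    proof -
      show "e > 0" using r C by (auto simp: e_def)
      then have "72 * C * e \<le> (72 * C + 1) * e" by (simp add: algebra_simps)
      also have "\<dots> = r / 2" using C by (simp add: e_def field_simps add_nonneg_eq_0_iff)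
      finally show "72 * C * e \<le> r / 2" .
    qed
    have "(\<lambda>n. 144 * B * C * (1 / real (Suc n))) \<longlonglongrightarrow> 144 * B * C * 0"
      using LIMSEQ_inverse_real_of_nat by (intro tendsto_mult tendsto_const) (simp add: inverse_eq_divide)
    then have "\<forall>\<^sub>F n in sequentially. 144 * B * C * (1 / real (Suc n)) < r / 2"
      by (rule order_tendstoD(2)) (use r in auto)
    with ub[OF e(1)] have "\<forall>\<^sub>F n in sequentially. norm (I n - 0) < r"
      by eventually_elim (use I0 e in auto)
    then show "\<exists>no. \<forall>n\<ge>no. norm (I n - 0) < r" by (simp add: eventually_sequentially)
  qed
qed

section \<open>Green formulas up to the boundary\<close>

definition tangentially_zero :: "(real^3) set \<Rightarrow> (real^3 \<Rightarrow> real^3^3) \<Rightarrow> bool" where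
  "tangentially_zero \<Omega> Q \<longleftrightarrow>
     (\<forall>x\<in>frontier \<Omega>. \<forall>n. is_outward_unit_normal \<Omega> x n \<longrightarrow> (\<forall>i. cross3 (Q x $ i) n = 0))"

lemma norm_cross_le: "norm (cross3 x y) \<le> norm x * norm y"
proof (rule power2_le_imp_le)
  show "(norm (cross3 x y))\<^sup>2 \<le> (norm x * norm y)\<^sup>2"
    using norm_cross_dot[of x y] by (simp add: algebra_simps) (smt (verit) zero_le_power2)
qed simp

lemma bounded_bilinear_cross3: "bounded_bilinear cross3"
  using bilinear_cross by (simp add: bilinear_conv_bounded_bilinear)

lemma norm_outer_product:
  fixes v w :: "real^'n"
  shows "norm (\<chi> i j. v $ i * w $ j) = norm v * norm w"
proof -
  have "(norm (\<chi> i j. v $ i * w $ j))\<^sup>2 = (\<Sum>i\<in>UNIV. \<Sum>j\<in>UNIV. (v $ i * v $ i) * (w $ j * w $ j))"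
    by (simp add: power2_norm_eq_inner inner_vec_def mult_ac)
  also have "\<dots> = (norm v * norm w)\<^sup>2"
    by (simp add: power_mult_distrib power2_norm_eq_inner inner_vec_def sum_product)
  finally show ?thesis by (simp add: power2_eq_iff_nonneg)
qed

text \<open>Cutoffs for which both Green formulas hold in the limit. The error is at most the supremum of the arbitrary factor (\<open>s\<close> or \<open>m\<close>) times a null
  sequence that depends only on the factor with the boundary condition (\<open>v\<close> or \<open>Q\<close>). This uniformity allows \<open>s\<close> and \<open>m\<close> to depend on time, and
  their derivatives to blow up at the boundary.\<close>

definition exhausting_cutoffs :: "(real^3) set \<Rightarrow> (nat \<Rightarrow> real^3 \<Rightarrow> real) \<Rightarrow> bool" where
  "exhausting_cutoffs \<Omega> \<theta> \<longleftrightarrow>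
    (\<forall>n. continuous_on UNIV (\<theta> n)) \<and> (\<forall>n x. 0 \<le> \<theta> n x \<and> \<theta> n x \<le> 1) \<and>
    (\<forall>n. \<exists>K. compact K \<and> K \<subseteq> \<Omega> \<and> (\<forall>x\<in>\<Omega> - K. \<theta> n x = 0)) \<and>
    (\<lambda>n. LINT x|lborel. indicator \<Omega> x * (1 - \<theta> n x)) \<longlonglongrightarrow> 0 \<and>
    (\<forall>v :: real^3 \<Rightarrow> real^3. continuous_on (closure \<Omega>) v \<and> Ck_on 1 \<Omega> v \<and> (\<forall>x\<in>frontier \<Omega>. v x = 0) \<longrightarrow>
      (\<exists>e. e \<longlonglongrightarrow> 0 \<and> (\<forall>n s M. Ck_on 1 \<Omega> s \<and> (\<forall>x\<in>\<Omega>. norm (s x) \<le> M) \<longrightarrow>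
        \<bar>(LINT x|lborel. indicator \<Omega> x * (\<theta> n x * (Div s x \<bullet> v x + s x \<bullet> grad v x)))\<bar> \<le> M * e n))) \<and>
    (\<forall>Q. continuous_on (closure \<Omega>) Q \<and> Ck_on 1 \<Omega> Q \<and> tangentially_zero \<Omega> Q \<longrightarrow>
      (\<exists>e. e \<longlonglongrightarrow> 0 \<and> (\<forall>n m M. Ck_on 1 \<Omega> m \<and> (\<forall>x\<in>\<Omega>. norm (m x) \<le> M) \<longrightarrow>
        \<bar>(LINT x|lborel. indicator \<Omega> x * (\<theta> n x * (Curl m x \<bullet> Q x - m x \<bullet> Curl Q x)))\<bar> \<le> M * e n)))"

text \<open>If the nearest boundary point \<open>p\<close> of \<open>x\<close> is a smooth one, then \<open>x - p\<close> is normal to the boundary. The flux of the divergence formula contains the factor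
  \<open>v x = v x - v p\<close>, and that of the curl formula contains the rows of \<open>Q x\<close> only through their cross products with \<open>x - p\<close>, which do not
  change when \<open>Q p\<close> is subtracted. Both are thus covered by \<open>boundary_layer_integral\<close>.\<close>

theorem boundary_cutoffs:
  assumes dom: "bounded_domain \<Omega>" and pw: "piecewise_smooth_boundary \<Omega>"
  shows "frontier \<Omega> \<in> null_sets lborel" and "\<exists>\<theta>. exhausting_cutoffs \<Omega> \<theta>"
proof -
  have \<Omega>: "open \<Omega>" "bounded \<Omega>" "\<Omega> \<noteq> {}" using dom by (auto simp: bounded_domain_def)
  let ?F = "frontier \<Omega>"
  note F = bounded_open_frontier[OF \<Omega>]
  obtain K C where K: "compact K" "K \<subseteq> ?F" and C: "C \<ge> 0"
    and smooth: "\<And>p. p \<in> ?F - K \<Longrightarrow> smooth_boundary_point \<Omega> p"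
    and vol: "\<And>r. r \<in> {0<..1} \<Longrightarrow> measure lborel (thickening ?F r) \<le> C * r"
      "\<And>r. r \<in> {0<..1} \<Longrightarrow> measure lborel (thickening K r) \<le> C * r\<^sup>2"
    using piecewise_smooth_boundary_thickening[OF pw] by blast
  obtain Dq where Dq[measurable]: "Dq \<in> borel_measurable borel"
    and near: "AE x in lborel. x \<in> \<Omega> \<longrightarrow> (\<forall>p\<in>?F. dist x p = infdist x ?F \<longrightarrow> Dq x = 2 *\<^sub>R (x - p))"
    and flux: "\<And>\<delta> w. \<delta> > 0 \<Longrightarrow> Ck_on 1 \<Omega> w \<Longrightarrow>
       (LINT x|lborel. indicator \<Omega> x * (cutoff \<Omega> \<delta> x * (\<Sum>j\<in>UNIV. pd j (\<lambda>y. w y $ j) x))) =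
       - (LINT x|lborel. indicator \<Omega> x * (cutoff' \<Omega> \<delta> x * (Dq x \<bullet> w x)))"
    using cutoff_divergence_theorem[OF \<Omega>] by blast
  define \<delta> where "\<delta> n = 1 / real (Suc n)" for n
  have \<delta>: "\<delta> n > 0" "\<delta> n \<le> 1" for n by (auto simp: \<delta>_def)
  have \<delta>0: "\<delta> \<longlonglongrightarrow> 0"
    unfolding \<delta>_def[abs_def] using LIMSEQ_inverse_real_of_nat by (simp add: inverse_eq_divide)
  \<comment> \<open>the two Green formulas differ only in the factor \<open>v\<close> with the boundary condition and in the bound \<open>g\<close> of the flux\<close>
  have layer: "\<exists>e. e \<longlonglongrightarrow> 0 \<and> (\<forall>n w M. Ck_on 1 \<Omega> w \<and> M \<ge> 0 \<and> (\<forall>x\<in>\<Omega>. \<bar>Dq x \<bullet> w x\<bar> \<le> M * g x) \<longrightarrow>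
      \<bar>(LINT x|lborel. indicator \<Omega> x * (cutoff \<Omega> (\<delta> n) x * (\<Sum>j\<in>UNIV. pd j (\<lambda>y. w y $ j) x)))\<bar> \<le> M * e n)"
    if v: "continuous_on (closure \<Omega>) v" and g: "\<And>x. g x \<ge> 0" "\<And>x. x \<in> \<Omega> \<Longrightarrow> g x \<le> norm (Dq x) * norm (v x)"
      and gm: "(\<lambda>x. indicator \<Omega> x * g x) \<in> borel_measurable borel"
      and gp: "\<And>x p. x \<in> \<Omega> \<Longrightarrow> p \<in> ?F \<Longrightarrow> p \<notin> K \<Longrightarrow> dist x p = infdist x ?F \<Longrightarrow> Dq x = 2 *\<^sub>R (x - p) \<Longrightarrow>
        g x \<le> norm (Dq x) * norm (v x - v p)"
    for v :: "real^3 \<Rightarrow> 'b::real_normed_vector" and g :: "real^3 \<Rightarrow> real"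
  proof -
    define e where "e n = (LINT x|lborel. indicator \<Omega> x * (cutoff' \<Omega> (1 / real (Suc n)) x * g x))" for n
    have bd: "AE x in lborel. x \<in> \<Omega> \<longrightarrow> (\<forall>p\<in>?F. dist x p = infdist x ?F \<longrightarrow>
        g x \<le> 2 * dist x p * norm (v x) \<and> (p \<notin> K \<longrightarrow> g x \<le> 2 * dist x p * norm (v x - v p)))"
      using near
    proof (eventually_elim, intro impI ballI)
      fix x p assume a: "x \<in> \<Omega> \<longrightarrow> (\<forall>p\<in>?F. dist x p = infdist x ?F \<longrightarrow> Dq x = 2 *\<^sub>R (x - p))"
        and x: "x \<in> \<Omega>" and p: "p \<in> ?F" "dist x p = infdist x ?F"
      then have D: "Dq x = 2 *\<^sub>R (x - p)" by blast
      then have "norm (Dq x) = 2 * dist x p" by (simp add: dist_norm)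
      then show "g x \<le> 2 * dist x p * norm (v x) \<and> (p \<notin> K \<longrightarrow> g x \<le> 2 * dist x p * norm (v x - v p))"
        using g(2)[OF x] gp[OF x p(1) _ p(2) D] by auto
    qed
    have "e \<longlonglongrightarrow> 0"
      unfolding e_def[abs_def] by (rule boundary_layer_integral[OF \<Omega> K(1) C vol v g(1) bd]) simp_all
    moreover have "\<bar>(LINT x|lborel. indicator \<Omega> x * (cutoff \<Omega> (\<delta> n) x * (\<Sum>j\<in>UNIV. pd j (\<lambda>y. w y $ j) x)))\<bar> \<le> M * e n"
      if w: "Ck_on 1 \<Omega> w" and M: "M \<ge> 0" "\<And>x. x \<in> \<Omega> \<Longrightarrow> \<bar>Dq x \<bullet> w x\<bar> \<le> M * g x" for n w M
    proof -
      let ?K = "{x \<in> \<Omega>. \<delta> n \<le> infdist x ?F}"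
      obtain B where B: "\<And>x. x \<in> closure \<Omega> \<Longrightarrow> norm (v x) \<le> B" "B \<ge> 0"
        using continuous_on_bounded_above[OF v, of "closure \<Omega>"] \<Omega>(2) by auto
      have "(\<lambda>x. cutoff' \<Omega> (\<delta> n) x * (indicator \<Omega> x * g x)) \<in> borel_measurable borel"
        using gm by measurable
      then have m: "(\<lambda>x. indicator \<Omega> x * (cutoff' \<Omega> (\<delta> n) x * g x)) \<in> borel_measurable borel"
        by (simp add: mult_ac)
      have i: "integrable lborel (\<lambda>x. indicator \<Omega> x * (cutoff' \<Omega> (\<delta> n) x * g x))"
      proof (rule integrable_dominated_by_compact[OF m interior_compact[OF \<Omega>(1,2) \<delta>(1)]])
        show "AE x in lborel. \<bar>indicator \<Omega> x * (cutoff' \<Omega> (\<delta> n) x * g x)\<bar> \<le> 36 / \<delta> n * B * indicator ?K x"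
          using bd
        proof eventually_elim
          case (elim x)
          show ?case
          proof (cases "x \<in> ?K")
            case True
            obtain p where p: "p \<in> ?F" "dist x p = infdist x ?F" using exists_nearest[OF F] by blast
            have "g x \<le> 2 * infdist x ?F * norm (v x)" using elim True p by auto
            also have "\<dots> \<le> 2 * infdist x ?F * B"
              using B True closure_subset[of \<Omega>] infdist_nonneg by (intro mult_left_mono) auto
            finally have "cutoff' \<Omega> (\<delta> n) x * g x \<le> cutoff' \<Omega> (\<delta> n) x * (2 * infdist x ?F * B)"
              using cutoff_bounds(3) by (rule mult_left_mono)
            also have "\<dots> = cutoff' \<Omega> (\<delta> n) x * (2 * infdist x ?F) * B" by simp
            also have "\<dots> \<le> 36 / \<delta> n * B"
              by (rule mult_right_mono[OF cutoff'_infdist_le[OF \<delta>(1)] B(2)])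
            finally show ?thesis using True g(1)[of x] cutoff_bounds(3)[of \<Omega> "\<delta> n" x] by (simp add: abs_mult)
          next
            case False
            then have "x \<notin> \<Omega> \<or> cutoff' \<Omega> (\<delta> n) x = 0" using cutoff_eq_0(2)[OF \<delta>(1), of x \<Omega>] by auto
            then show ?thesis using False by auto
          qed
        qed
      qed
      have "\<bar>(LINT x|lborel. indicator \<Omega> x * (cutoff \<Omega> (\<delta> n) x * (\<Sum>j\<in>UNIV. pd j (\<lambda>y. w y $ j) x)))\<bar>
          = \<bar>(LINT x|lborel. indicator \<Omega> x * (cutoff' \<Omega> (\<delta> n) x * (Dq x \<bullet> w x)))\<bar>"
        by (simp add: flux[OF \<delta>(1) w])
      also have "\<dots> \<le> (LINT x|lborel. \<bar>indicator \<Omega> x * (cutoff' \<Omega> (\<delta> n) x * (Dq x \<bullet> w x))\<bar>)"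
        by (rule integral_abs_bound)
      also have "\<dots> \<le> (LINT x|lborel. M * (indicator \<Omega> x * (cutoff' \<Omega> (\<delta> n) x * g x)))"
      proof (rule integral_mono_AE', rule integrable_mult_right, rule i)
        have "\<bar>indicator \<Omega> x * (cutoff' \<Omega> (\<delta> n) x * (Dq x \<bullet> w x))\<bar> \<le> M * (indicator \<Omega> x * (cutoff' \<Omega> (\<delta> n) x * g x))" for x
        proof (cases "x \<in> \<Omega>")
          case True
          have "cutoff' \<Omega> (\<delta> n) x * \<bar>Dq x \<bullet> w x\<bar> \<le> cutoff' \<Omega> (\<delta> n) x * (M * g x)"
            by (rule mult_left_mono[OF M(2)[OF True] cutoff_bounds(3)])
          then show ?thesis using True cutoff_bounds(3)[of \<Omega> "\<delta> n" x] by (simp add: abs_mult mult_ac)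
        qed simp
        then show "AE x in lborel. \<bar>indicator \<Omega> x * (cutoff' \<Omega> (\<delta> n) x * (Dq x \<bullet> w x))\<bar>
            \<le> M * (indicator \<Omega> x * (cutoff' \<Omega> (\<delta> n) x * g x))" by simp
        show "AE x in lborel. 0 \<le> M * (indicator \<Omega> x * (cutoff' \<Omega> (\<delta> n) x * g x))"
          by (intro AE_I2 mult_nonneg_nonneg M(1) g(1) cutoff_bounds(3)) simp
      qed
      also have "\<dots> = M * e n" by (simp add: e_def \<delta>_def)
      finally show ?thesis .
    qed
    ultimately show ?thesis by blast
  qed
  have thick: "?F \<subseteq> thickening ?F r" if "r > 0" for r
  proof
    fix x assume "x \<in> ?F"
    then show "x \<in> thickening ?F r" using that by (auto simp: mem_thickening intro!: bexI[of _ x])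
  qed
  have "measure lborel ?F \<le> 0"
  proof (rule LIMSEQ_le_const[where X = "\<lambda>n. C * \<delta> n"])
    show "(\<lambda>n. C * \<delta> n) \<longlonglongrightarrow> 0" using tendsto_mult_right_zero[OF \<delta>0] by simp
    have "measure lborel ?F \<le> C * \<delta> n" for n
      using vol(1)[of "\<delta> n"] \<delta>[of n] compact_thickening[OF F(1)] F(1) thick
        measure_mono_fmeasurable[of ?F "thickening ?F (\<delta> n)" lborel]
      by (force simp: borel_compact fmeasurable_compact)
    then show "\<exists>N. \<forall>n\<ge>N. measure lborel ?F \<le> C * \<delta> n" by blast
  qed
  then have m0: "measure lborel ?F = 0" using measure_nonneg[of lborel ?F] by linarith
  have "emeasure lborel ?F = ennreal (measure lborel ?F)"
    using emeasure_bounded_finite[OF compact_imp_bounded[OF F(1)]] by (intro emeasure_eq_ennreal_measure) auto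
  then show "?F \<in> null_sets lborel"
    using borel_compact[OF F(1)] m0 by (intro null_setsI) auto
  show "\<exists>\<theta>. exhausting_cutoffs \<Omega> \<theta>"
    unfolding exhausting_cutoffs_def
  proof (intro exI[of _ "\<lambda>n. cutoff \<Omega> (\<delta> n)"] conjI allI impI)
    show "continuous_on UNIV (cutoff \<Omega> (\<delta> n))" for n by (rule cutoff_continuous)
    show "0 \<le> cutoff \<Omega> (\<delta> n) x" "cutoff \<Omega> (\<delta> n) x \<le> 1" for n x by (simp_all add: cutoff_bounds)
    show "\<exists>K. compact K \<and> K \<subseteq> \<Omega> \<and> (\<forall>x\<in>\<Omega> - K. cutoff \<Omega> (\<delta> n) x = 0)" for n
    proof (intro exI[of _ "{x \<in> \<Omega>. \<delta> n \<le> infdist x ?F}"] conjI ballI)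
      fix x assume "x \<in> \<Omega> - {x \<in> \<Omega>. \<delta> n \<le> infdist x ?F}"
      then have "infdist x ?F \<le> \<delta> n" by auto
      then show "cutoff \<Omega> (\<delta> n) x = 0" by (rule cutoff_eq_0(1)[OF \<delta>(1)])
    qed (use interior_compact[OF \<Omega>(1,2) \<delta>(1)[of n]] in auto)
    show "(\<lambda>n. LINT x|lborel. indicator \<Omega> x * (1 - cutoff \<Omega> (\<delta> n) x)) \<longlonglongrightarrow> 0"
    proof (rule tendsto_sandwich[OF _ _ tendsto_const])
      show "\<forall>\<^sub>F n in sequentially. 0 \<le> (LINT x|lborel. indicator \<Omega> x * (1 - cutoff \<Omega> (\<delta> n) x))"
        by (intro always_eventually allI integral_nonneg_AE AE_I2 mult_nonneg_nonneg) (auto simp: cutoff_bounds)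
      have "\<forall>\<^sub>F n in sequentially. \<delta> n < 1 / 2" using \<delta>0 by (rule order_tendstoD(2)) simp
      then show "\<forall>\<^sub>F n in sequentially. (LINT x|lborel. indicator \<Omega> x * (1 - cutoff \<Omega> (\<delta> n) x)) \<le> C * (2 * \<delta> n)"
      proof eventually_elim
        case (elim n)
        have cT: "compact (thickening ?F (2 * \<delta> n))" by (rule compact_thickening[OF F(1)])
        have "(LINT x|lborel. indicator \<Omega> x * (1 - cutoff \<Omega> (\<delta> n) x)) \<le> (LINT x|lborel. indicator (thickening ?F (2 * \<delta> n)) x)"
        proof (rule integral_mono')
          show "integrable lborel (\<lambda>x. indicator (thickening ?F (2 * \<delta> n)) x :: real)"
            using emeasure_bounded_finite[OF compact_imp_bounded[OF cT]] borel_compact[OF cT] by (intro integrable_real_indicator) auto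
          fix x
          show "indicator \<Omega> x * (1 - cutoff \<Omega> (\<delta> n) x) \<le> indicator (thickening ?F (2 * \<delta> n)) x"
          proof (cases "infdist x ?F \<ge> 2 * \<delta> n")
            case True
            then show ?thesis using cutoff_eq_1(1)[OF \<delta>(1), of n x \<Omega>] by simp
          next
            case False
            obtain p where "p \<in> ?F" "dist x p = infdist x ?F" using exists_nearest[OF F] by blast
            then have "x \<in> thickening ?F (2 * \<delta> n)" using False by (auto simp: mem_thickening intro!: bexI[of _ p])
            then show ?thesis using cutoff_bounds(1)[of \<Omega> "\<delta> n" x] by (auto simp: indicator_def)
          qed
        qed auto
        also have "\<dots> = measure lborel (thickening ?F (2 * \<delta> n))" using borel_compact[OF cT] by simp
        also have "\<dots> \<le> C * (2 * \<delta> n)" using vol(1)[of "2 * \<delta> n"] elim \<delta>(1)[of n] by auto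
        finally show ?case .
      qed
      show "(\<lambda>n. C * (2 * \<delta> n)) \<longlonglongrightarrow> 0"
        using tendsto_mult_right_zero[OF \<delta>0, of "C * 2"] by (simp add: mult_ac)
    qed
  next
    fix v :: "real^3 \<Rightarrow> real^3"
    assume v: "continuous_on (closure \<Omega>) v \<and> Ck_on 1 \<Omega> v \<and> (\<forall>x\<in>?F. v x = 0)"
    then have v': "Ck_on 1 \<Omega> v" by blast
    have "(\<lambda>x. indicator \<Omega> x *\<^sub>R v x) \<in> borel_measurable borel"
      by (rule borel_measurable_continuous_on_indicator[OF _ Ck1_continuous[OF \<Omega>(1) v']]) (simp add: borel_open \<Omega>)
    then have "(\<lambda>x. norm (Dq x) * norm (indicator \<Omega> x *\<^sub>R v x)) \<in> borel_measurable borel" by measurable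
    then have gm: "(\<lambda>x. indicator \<Omega> x * (norm (Dq x) * norm (v x))) \<in> borel_measurable borel"
      by (simp add: mult_ac)
    obtain e where e: "e \<longlonglongrightarrow> 0" "\<And>n w M. Ck_on 1 \<Omega> w \<Longrightarrow> M \<ge> 0 \<Longrightarrow> (\<forall>x\<in>\<Omega>. \<bar>Dq x \<bullet> w x\<bar> \<le> M * (norm (Dq x) * norm (v x))) \<Longrightarrow>
      \<bar>(LINT x|lborel. indicator \<Omega> x * (cutoff \<Omega> (\<delta> n) x * (\<Sum>j\<in>UNIV. pd j (\<lambda>y. w y $ j) x)))\<bar> \<le> M * e n"
      using layer[of v "\<lambda>x. norm (Dq x) * norm (v x)"] v gm by auto
    have "\<bar>(LINT x|lborel. indicator \<Omega> x * (cutoff \<Omega> (\<delta> n) x * (Div s x \<bullet> v x + s x \<bullet> grad v x)))\<bar> \<le> M * e n"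
      if s: "Ck_on 1 \<Omega> s" "\<And>x. x \<in> \<Omega> \<Longrightarrow> norm (s x) \<le> M" for n s M
    proof -
      define w where "w y = (\<chi> j. \<Sum>i\<in>UNIV. s y $ i $ j * v y $ i)" for y
      have "Ck_on 1 \<Omega> w"
        unfolding w_def[abs_def]
        by (intro Ck1_vec[OF \<Omega>(1)]) (simp only: vec_lambda_beta, intro Ck1_sum Ck1_mult Ck1_nth s v' \<Omega>(1) finite)
      moreover have "M \<ge> 0" using s(2) \<Omega>(3) norm_ge_zero order_trans by blast
      moreover have "\<bar>Dq x \<bullet> w x\<bar> \<le> M * (norm (Dq x) * norm (v x))" if "x \<in> \<Omega>" for x
      proof -
        have "Dq x \<bullet> w x = (\<Sum>j\<in>UNIV. \<Sum>i\<in>UNIV. s x $ i $ j * (v x $ i * Dq x $ j))"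
          by (simp add: inner_vec_def w_def sum_distrib_left mult_ac)
        also have "\<dots> = (\<Sum>i\<in>UNIV. \<Sum>j\<in>UNIV. s x $ i $ j * (v x $ i * Dq x $ j))" by (rule sum.swap)
        also have "\<dots> = s x \<bullet> (\<chi> i j. v x $ i * Dq x $ j)" by (simp add: inner_vec_def)
        also have "\<bar>\<dots>\<bar> \<le> norm (s x) * (norm (v x) * norm (Dq x))"
          using Cauchy_Schwarz_ineq2[of "s x" "\<chi> i j. v x $ i * Dq x $ j"] by (simp add: norm_outer_product)
        also have "\<dots> \<le> M * (norm (v x) * norm (Dq x))" using s(2)[OF that] by (intro mult_right_mono) auto
        finally show ?thesis by (simp add: mult_ac)
      qed
      ultimately have "\<bar>(LINT x|lborel. indicator \<Omega> x * (cutoff \<Omega> (\<delta> n) x * (\<Sum>j\<in>UNIV. pd j (\<lambda>y. w y $ j) x)))\<bar> \<le> M * e n"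
        by (intro e(2)) auto
      moreover have "(\<Sum>j\<in>UNIV. pd j (\<lambda>y. w y $ j) x) = Div s x \<bullet> v x + s x \<bullet> grad v x" if "x \<in> \<Omega>" for x
        using div_mat_vec[OF Ck1_differentiable[OF \<Omega>(1) s(1) that] Ck1_differentiable[OF \<Omega>(1) v' that]] by (simp add: w_def)
      then have "(\<lambda>x. indicator \<Omega> x * (cutoff \<Omega> (\<delta> n) x * (\<Sum>j\<in>UNIV. pd j (\<lambda>y. w y $ j) x))) =
          (\<lambda>x. indicator \<Omega> x * (cutoff \<Omega> (\<delta> n) x * (Div s x \<bullet> v x + s x \<bullet> grad v x)))"
        by (auto simp: fun_eq_iff indicator_def)
      ultimately show ?thesis by simp
    qed
    then show "\<exists>e. e \<longlonglongrightarrow> 0 \<and> (\<forall>n s M. Ck_on 1 \<Omega> s \<and> (\<forall>x\<in>\<Omega>. norm (s x) \<le> M) \<longrightarrow>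
        \<bar>(LINT x|lborel. indicator \<Omega> x * (cutoff \<Omega> (\<delta> n) x * (Div s x \<bullet> v x + s x \<bullet> grad v x)))\<bar> \<le> M * e n)"
      using e(1) by blast
  next
    fix Q :: "real^3 \<Rightarrow> real^3^3"
    assume Q: "continuous_on (closure \<Omega>) Q \<and> Ck_on 1 \<Omega> Q \<and> tangentially_zero \<Omega> Q"
    then have Q': "Ck_on 1 \<Omega> Q" by blast
    \<comment> \<open>the mean over the rows, so that \<open>g x \<le> \<parallel>Dq x\<parallel> \<parallel>Q x\<parallel>\<close>\<close>
    define g where "g x = (1/3) * (\<Sum>i\<in>UNIV. norm (cross3 (Q x $ i) (Dq x)))" for x
    have g0: "g x \<ge> 0" for x by (auto simp: g_def intro!: sum_nonneg)
    have gle: "g x \<le> c" if "\<And>i. norm (cross3 (Q x $ i) (Dq x)) \<le> c" for x c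
      using that[of 1] that[of 2] that[of 3] by (simp add: g_def sum_3)
    have g1: "g x \<le> norm (Dq x) * norm (Q x)" for x
    proof (rule gle)
      fix i
      have "norm (Q x $ i) * norm (Dq x) \<le> norm (Q x) * norm (Dq x)"
        by (rule mult_right_mono[OF Finite_Cartesian_Product.norm_nth_le norm_ge_zero])
      then show "norm (cross3 (Q x $ i) (Dq x)) \<le> norm (Dq x) * norm (Q x)"
        using norm_cross_le[of "Q x $ i" "Dq x"] by (simp add: mult.commute)
    qed
    have gm: "(\<lambda>x. indicator \<Omega> x * g x) \<in> borel_measurable borel"
    proof -
      have [measurable]: "(\<lambda>x. indicator \<Omega> x *\<^sub>R (Q x $ i)) \<in> borel_measurable borel" for i
        by (rule borel_measurable_continuous_on_indicator[OF _ Ck1_continuous[OF \<Omega>(1) Ck1_nth[OF \<Omega>(1) Q']]]) (simp add: borel_open \<Omega>)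
      have [measurable]: "(\<lambda>x. cross3 (indicator \<Omega> x *\<^sub>R (Q x $ i)) (Dq x)) \<in> borel_measurable borel" for i
      proof (rule borel_measurable_continuous_Pair[where H = cross3])
        show "continuous_on UNIV (\<lambda>x. cross3 (fst x) (snd x))" by (intro continuous_on_cross continuous_intros)
      qed measurable
      have "(\<lambda>x. (1/3) * (\<Sum>i\<in>UNIV. norm (cross3 (indicator \<Omega> x *\<^sub>R (Q x $ i)) (Dq x)))) \<in> borel_measurable borel" by measurable
      moreover have "(1/3) * (\<Sum>i\<in>UNIV. norm (cross3 (indicator \<Omega> x *\<^sub>R (Q x $ i)) (Dq x))) = indicator \<Omega> x * g x" for x
        by (cases "x \<in> \<Omega>") (auto simp: g_def)
      ultimately show ?thesis by (simp only:)
    qed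
    have gp: "g x \<le> norm (Dq x) * norm (Q x - Q p)"
      if x: "x \<in> \<Omega>" and p: "p \<in> ?F" "p \<notin> K" "dist x p = infdist x ?F" "Dq x = 2 *\<^sub>R (x - p)" for x p
    proof (rule gle)
      fix i
      obtain n c where n: "is_outward_unit_normal \<Omega> p n" "x - p = c *\<^sub>R n"
        using nearest_point_on_normal[OF \<Omega>(1) x p(1,3) smooth] p by blast
      then have "cross3 (Q p $ i) n = 0" using Q p(1) by (auto simp: tangentially_zero_def)
      then have "cross3 (Q p $ i) (Dq x) = 0" using p(4) n(2) by (simp add: cross_mult_right)
      then have "cross3 (Q x $ i) (Dq x) = cross3 ((Q x - Q p) $ i) (Dq x)"
        by (simp add: Cross3.left_diff_distrib)
      then show "norm (cross3 (Q x $ i) (Dq x)) \<le> norm (Dq x) * norm (Q x - Q p)"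
        using norm_cross_le[of "(Q x - Q p) $ i" "Dq x"] mult_right_mono[OF Finite_Cartesian_Product.norm_nth_le[of "Q x - Q p" i] norm_ge_zero[of "Dq x"]]
        by (simp add: mult.commute)
    qed
    have Qc: "continuous_on (closure \<Omega>) Q" using Q by blast
    have ex: "\<exists>e. e \<longlonglongrightarrow> 0 \<and> (\<forall>n w M. Ck_on 1 \<Omega> w \<and> M \<ge> 0 \<and> (\<forall>x\<in>\<Omega>. \<bar>Dq x \<bullet> w x\<bar> \<le> M * g x) \<longrightarrow>
      \<bar>(LINT x|lborel. indicator \<Omega> x * (cutoff \<Omega> (\<delta> n) x * (\<Sum>j\<in>UNIV. pd j (\<lambda>y. w y $ j) x)))\<bar> \<le> M * e n)"
      by (rule layer[OF Qc g0 g1 gm gp]) simp_all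
    obtain e where e: "e \<longlonglongrightarrow> 0" "\<And>n w M. Ck_on 1 \<Omega> w \<Longrightarrow> M \<ge> 0 \<Longrightarrow> (\<forall>x\<in>\<Omega>. \<bar>Dq x \<bullet> w x\<bar> \<le> M * g x) \<Longrightarrow>
      \<bar>(LINT x|lborel. indicator \<Omega> x * (cutoff \<Omega> (\<delta> n) x * (\<Sum>j\<in>UNIV. pd j (\<lambda>y. w y $ j) x)))\<bar> \<le> M * e n"
      using ex by blast
    have "\<bar>(LINT x|lborel. indicator \<Omega> x * (cutoff \<Omega> (\<delta> n) x * (Curl m x \<bullet> Q x - m x \<bullet> Curl Q x)))\<bar> \<le> M * (3 * e n)"
      if m: "Ck_on 1 \<Omega> m" "\<And>x. x \<in> \<Omega> \<Longrightarrow> norm (m x) \<le> M" for n m M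
    proof -
      define w where "w y = (\<Sum>i\<in>UNIV. cross3 (m y $ i) (Q y $ i))" for y
      have wi: "Ck_on 1 \<Omega> (\<lambda>y. cross3 (m y $ i) (Q y $ i))" for i
        by (intro Ck1_bilinear[OF \<Omega>(1) _ _ bounded_bilinear_cross3] Ck1_nth \<Omega>(1) m Q')
      have w: "Ck_on 1 \<Omega> w" unfolding w_def[abs_def] by (rule Ck1_sum[OF \<Omega>(1) wi]) simp
      have M0: "M \<ge> 0" using m(2) \<Omega>(3) norm_ge_zero order_trans by blast
      have "\<bar>Dq x \<bullet> w x\<bar> \<le> 3 * M * g x" if "x \<in> \<Omega>" for x
      proof -
        have c: "Dq x \<bullet> cross3 (m x $ i) (Q x $ i) = m x $ i \<bullet> cross3 (Q x $ i) (Dq x)" for i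
          by (simp add: cross3_simps)
        have "\<bar>Dq x \<bullet> w x\<bar> \<le> (\<Sum>i\<in>UNIV. \<bar>m x $ i \<bullet> cross3 (Q x $ i) (Dq x)\<bar>)"
          unfolding w_def inner_sum_right c by (rule sum_abs)
        also have "\<dots> \<le> (\<Sum>i\<in>UNIV. M * norm (cross3 (Q x $ i) (Dq x)))"
        proof (rule sum_mono)
          fix i
          have "\<bar>m x $ i \<bullet> cross3 (Q x $ i) (Dq x)\<bar> \<le> norm (m x $ i) * norm (cross3 (Q x $ i) (Dq x))"
            by (rule Cauchy_Schwarz_ineq2)
          also have "\<dots> \<le> M * norm (cross3 (Q x $ i) (Dq x))"
            using m(2)[OF that] Finite_Cartesian_Product.norm_nth_le[of "m x" i] by (intro mult_right_mono) auto
          finally show "\<bar>m x $ i \<bullet> cross3 (Q x $ i) (Dq x)\<bar> \<le> M * norm (cross3 (Q x $ i) (Dq x))" .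
        qed
        also have "\<dots> = 3 * M * g x" by (simp add: g_def sum_distrib_left)
        finally show ?thesis .
      qed
      then have "\<bar>(LINT x|lborel. indicator \<Omega> x * (cutoff \<Omega> (\<delta> n) x * (\<Sum>j\<in>UNIV. pd j (\<lambda>y. w y $ j) x)))\<bar> \<le> (3 * M) * e n"
        using M0 by (intro e(2) w) auto
      moreover have "(\<Sum>j\<in>UNIV. pd j (\<lambda>y. w y $ j) x) = Curl m x \<bullet> Q x - m x \<bullet> Curl Q x" if x: "x \<in> \<Omega>" for x
      proof -
        have "(\<lambda>y. cross3 (m y $ i) (Q y $ i) $ j) differentiable (at x)" for i j
          by (rule differentiable_nth[OF Ck1_differentiable[OF \<Omega>(1) wi x]])
        then have "(\<Sum>j\<in>UNIV. pd j (\<lambda>y. w y $ j) x) = (\<Sum>j\<in>UNIV. \<Sum>i\<in>UNIV. pd j (\<lambda>y. cross3 (m y $ i) (Q y $ i) $ j) x)"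
          by (simp add: w_def pd_sum)
        also have "\<dots> = (\<Sum>i\<in>UNIV. \<Sum>j\<in>UNIV. pd j (\<lambda>y. cross3 (m y $ i) (Q y $ i) $ j) x)" by (rule sum.swap)
        also have "\<dots> = (\<Sum>i\<in>UNIV. Curl m x $ i \<bullet> Q x $ i - m x $ i \<bullet> Curl Q x $ i)"
          by (intro sum.cong refl div_cross_rows Ck1_differentiable[OF \<Omega>(1) _ x] m Q')
        also have "\<dots> = Curl m x \<bullet> Q x - m x \<bullet> Curl Q x" by (simp only: inner_vec_def[of "Curl m x"] inner_vec_def[of "m x"] sum_subtractf)
        finally show ?thesis .
      qed
      then have "(\<lambda>x. indicator \<Omega> x * (cutoff \<Omega> (\<delta> n) x * (\<Sum>j\<in>UNIV. pd j (\<lambda>y. w y $ j) x))) =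
          (\<lambda>x. indicator \<Omega> x * (cutoff \<Omega> (\<delta> n) x * (Curl m x \<bullet> Q x - m x \<bullet> Curl Q x)))"
        by (auto simp: fun_eq_iff indicator_def)
      ultimately show ?thesis by (simp add: mult_ac)
    qed
    moreover have "(\<lambda>n. 3 * e n) \<longlonglongrightarrow> 0" using tendsto_mult_right_zero[OF e(1)] by simp
    ultimately show "\<exists>e. e \<longlonglongrightarrow> 0 \<and> (\<forall>n m M. Ck_on 1 \<Omega> m \<and> (\<forall>x\<in>\<Omega>. norm (m x) \<le> M) \<longrightarrow>
        \<bar>(LINT x|lborel. indicator \<Omega> x * (cutoff \<Omega> (\<delta> n) x * (Curl m x \<bullet> Q x - m x \<bullet> Curl Q x)))\<bar> \<le> M * e n)"
      by blast
  qed
qed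

lemma exhausting_cutoffs_Div:
  assumes "exhausting_cutoffs \<Omega> \<theta>" "continuous_on (closure \<Omega>) v" "Ck_on 1 \<Omega> v" "\<And>x. x \<in> frontier \<Omega> \<Longrightarrow> v x = 0"
  shows "\<exists>e. e \<longlonglongrightarrow> 0 \<and> (\<forall>n s M. Ck_on 1 \<Omega> s \<and> (\<forall>x\<in>\<Omega>. norm (s x) \<le> M) \<longrightarrow>
        \<bar>(LINT x|lborel. indicator \<Omega> x * (\<theta> n x * (Div s x \<bullet> v x + s x \<bullet> grad v x)))\<bar> \<le> M * e n)"
proof -
  have "\<forall>v :: real^3 \<Rightarrow> real^3. continuous_on (closure \<Omega>) v \<and> Ck_on 1 \<Omega> v \<and> (\<forall>x\<in>frontier \<Omega>. v x = 0) \<longrightarrow>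
      (\<exists>e. e \<longlonglongrightarrow> 0 \<and> (\<forall>n s M. Ck_on 1 \<Omega> s \<and> (\<forall>x\<in>\<Omega>. norm (s x) \<le> M) \<longrightarrow>
        \<bar>(LINT x|lborel. indicator \<Omega> x * (\<theta> n x * (Div s x \<bullet> v x + s x \<bullet> grad v x)))\<bar> \<le> M * e n))"
    using assms(1) unfolding exhausting_cutoffs_def by (elim conjE)
  from this[rule_format, of v] show ?thesis using assms(2-4) by blast
qed

lemma exhausting_cutoffs_Curl:
  assumes "exhausting_cutoffs \<Omega> \<theta>" "continuous_on (closure \<Omega>) Q" "Ck_on 1 \<Omega> Q" "tangentially_zero \<Omega> Q"
  shows "\<exists>e. e \<longlonglongrightarrow> 0 \<and> (\<forall>n m M. Ck_on 1 \<Omega> m \<and> (\<forall>x\<in>\<Omega>. norm (m x) \<le> M) \<longrightarrow>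
        \<bar>(LINT x|lborel. indicator \<Omega> x * (\<theta> n x * (Curl m x \<bullet> Q x - m x \<bullet> Curl Q x)))\<bar> \<le> M * e n)"
proof -
  have "\<forall>Q. continuous_on (closure \<Omega>) Q \<and> Ck_on 1 \<Omega> Q \<and> tangentially_zero \<Omega> Q \<longrightarrow>
      (\<exists>e. e \<longlonglongrightarrow> 0 \<and> (\<forall>n m M. Ck_on 1 \<Omega> m \<and> (\<forall>x\<in>\<Omega>. norm (m x) \<le> M) \<longrightarrow>
        \<bar>(LINT x|lborel. indicator \<Omega> x * (\<theta> n x * (Curl m x \<bullet> Q x - m x \<bullet> Curl Q x)))\<bar> \<le> M * e n))"
    using assms(1) unfolding exhausting_cutoffs_def by (elim conjE)
  from this[rule_format, of Q] show ?thesis using assms(2-4) by blast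
qed

section \<open>Korn's first inequality\<close>

lemma difference_quotient_tendsto:
  fixes k :: "'a::real_normed_vector \<Rightarrow> real"
  assumes "(k has_derivative D) (at x)"
  shows "((\<lambda>t. (k (x + t *\<^sub>R v) - k x) / t) \<longlongrightarrow> D v) (at 0)"
proof -
  have "((\<lambda>t. k (x + t *\<^sub>R v)) has_derivative (\<lambda>t. D (t *\<^sub>R v))) (at 0)"
    by (rule has_derivative_compose[of "\<lambda>t. x + t *\<^sub>R v" "\<lambda>t. t *\<^sub>R v" 0 UNIV k D])
      (auto intro!: derivative_eq_intros simp: assms)
  moreover have "(\<lambda>t. D (t *\<^sub>R v)) = (*) (D v)"
    using linear_cmul[OF has_derivative_linear[OF assms]] by (simp add: fun_eq_iff mult.commute)
  ultimately have "((\<lambda>t. k (x + t *\<^sub>R v)) has_real_derivative D v) (at 0)"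
    by (simp add: has_field_derivative_def)
  then show ?thesis by (simp add: has_field_derivative_iff)
qed

text \<open>For smooth functions this is two integrations by parts. For Lipschitz functions the second derivatives are replaced by differences: the corresponding
  identity for difference quotients is a change of variables, and dominated convergence gives the limit.\<close>

lemma exchange_of_partial_derivatives:
  fixes f g :: "'a::euclidean_space \<Rightarrow> real"
  assumes f: "\<And>x y. \<bar>f x - f y\<bar> \<le> L * dist x y" and g: "\<And>x y. \<bar>g x - g y\<bar> \<le> L * dist x y"
    and supp: "\<And>x. norm x > R \<Longrightarrow> f x = 0" "\<And>x. norm x > R \<Longrightarrow> g x = 0"
    and df: "AE x in lborel. (f has_derivative f' x) (at x)" and dg: "AE x in lborel. (g has_derivative g' x) (at x)"
    and bc: "norm b = 1" "norm c = 1"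
    and m: "\<And>v. v \<in> {b, c} \<Longrightarrow> (\<lambda>x. f' x v) \<in> borel_measurable borel"
      "\<And>v. v \<in> {b, c} \<Longrightarrow> (\<lambda>x. g' x v) \<in> borel_measurable borel"
  shows "(LINT x|lborel. f' x b * g' x c) = (LINT x|lborel. f' x c * g' x b)"
proof -
  have L0: "L \<ge> 0" using order_trans[OF abs_ge_zero f[of b 0]] bc by simp
  have lipcont: "continuous_on UNIV k" if "\<And>x y. \<bar>k x - k y\<bar> \<le> L * dist x y" for k :: "'a \<Rightarrow> real"
  proof -
    have "L-lipschitz_on UNIV k" using that L0 by (intro lipschitz_onI) (auto simp: dist_real_def)
    then show ?thesis by (rule lipschitz_on_continuous_on)
  qed
  have [measurable]: "f \<in> borel_measurable borel" "g \<in> borel_measurable borel"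
    using lipcont[OF f] lipcont[OF g] by (auto intro: borel_measurable_continuous_onI)
  define h where "h n = inverse (real (Suc n))" for n
  have h: "h n > 0" "h n \<le> 1" for n by (auto simp: h_def divide_simps)
  have hl: "h \<longlonglongrightarrow> 0" unfolding h_def by (rule LIMSEQ_inverse_real_of_nat)
  define q where "q k v n x = (k (x + h n *\<^sub>R v) - k x) / h n" for k v n and x :: 'a
  have qb: "\<bar>q k v n x\<bar> \<le> L * indicator (cball 0 (R + 1)) x"
    if k: "\<And>x y. \<bar>k x - k y\<bar> \<le> L * dist x y" "\<And>x. norm x > R \<Longrightarrow> k x = (0::real)" and v: "norm v = 1" for k v n x
  proof (cases "norm x \<le> R + 1")
    case True
    have "\<bar>k (x + h n *\<^sub>R v) - k x\<bar> \<le> L * h n"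
      using k(1)[of "x + h n *\<^sub>R v" x] v h(1)[of n] by (simp add: dist_norm)
    then show ?thesis using True h(1)[of n] by (simp add: q_def divide_le_eq)
  next
    case False
    then have "norm (x + h n *\<^sub>R v) > R" using norm_triangle_ineq2[of x "- (h n *\<^sub>R v)"] v h[of n] by simp
    then show ?thesis using False k(2) by (simp add: q_def)
  qed
  have lim: "(\<lambda>n. q k v n x) \<longlonglongrightarrow> D v" if "(k has_derivative D) (at x)" for k :: "'a \<Rightarrow> real" and v D x
  proof -
    from difference_quotient_tendsto[OF that]
    have "((\<lambda>t. (k (x + t *\<^sub>R v) - k x) / t) \<longlongrightarrow> D v) (at 0)" .
    moreover have "filterlim h (at 0) sequentially"
      using hl h(1) by (auto simp: filterlim_at less_imp_neq[symmetric] eventually_sequentially)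
    ultimately show ?thesis unfolding q_def by (rule filterlim_compose)
  qed
  have intp: "integrable lborel (\<lambda>x. k (x + v) * l (x + w))"
    if kl: "\<And>x y. \<bar>k x - k y\<bar> \<le> L * dist x y" "\<And>x. norm x > R \<Longrightarrow> k x = 0"
      "\<And>x y. \<bar>l x - l y\<bar> \<le> L * dist x y" "\<And>x. norm x > R \<Longrightarrow> l x = 0" for k l :: "'a \<Rightarrow> real" and v w
  proof -
    have bd: "\<exists>B. \<forall>x. \<bar>k x\<bar> \<le> B" if k: "\<And>x y. \<bar>k x - k y\<bar> \<le> L * dist x y" "\<And>x. norm x > R \<Longrightarrow> k x = 0" for k :: "'a \<Rightarrow> real"
    proof -
      have "\<bar>k x\<bar> \<le> \<bar>k 0\<bar> + L * \<bar>R\<bar>" for x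
      proof (cases "norm x > R")
        case False
        have "L * norm x \<le> L * \<bar>R\<bar>" using False L0 by (intro mult_left_mono) auto
        then show ?thesis using k(1)[of x 0] by (simp add: dist_norm)
      qed (use k(2) L0 in auto)
      then show ?thesis by blast
    qed
    obtain A B where AB: "\<And>x. \<bar>k x\<bar> \<le> A" "\<And>x. \<bar>l x\<bar> \<le> B" using bd[OF kl(1,2)] bd[OF kl(3,4)] by blast
    have [measurable]: "k \<in> borel_measurable borel" "l \<in> borel_measurable borel"
      using lipcont[OF kl(1)] lipcont[OF kl(3)] by (auto intro: borel_measurable_continuous_onI)
    show ?thesis
    proof (rule integrable_bounded_support[where B = "A * B" and R = "R + norm v"])
      show "\<bar>k (x + v) * l (x + w)\<bar> \<le> A * B" for x
        unfolding abs_mult using AB order_trans[OF abs_ge_zero AB(1)] by (intro mult_mono) auto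
      show "k (x + v) * l (x + w) = 0" if "norm x > R + norm v" for x
        using that norm_triangle_ineq2[of x "- v"] kl(2)[of "x + v"] by simp
    qed measurable
  qed
  have key: "(LINT x|lborel. q f b n x * q g c n x) = (LINT x|lborel. q f (- c) n x * q g (- b) n x)" for n
  proof -
    let ?b = "h n *\<^sub>R b" and ?c = "h n *\<^sub>R c"
    note I = intp[OF f supp(1) g supp(2)]
    have e1: "(LINT x|lborel. (f (x + v) - f x) * (g (x + w) - g x)) =
       (LINT x|lborel. f (x + v) * g (x + w)) - (LINT x|lborel. f (x + v) * g x) - (LINT x|lborel. f x * g (x + w)) + (LINT x|lborel. f x * g x)" for v w
    proof -
      have "(LINT x|lborel. (f (x + v) - f x) * (g (x + w) - g x)) =
        (LINT x|lborel. ((f (x + v) * g (x + w) - f (x + v) * g x) - f x * g (x + w)) + f x * g x)"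
        by (simp add: algebra_simps)
      then show ?thesis using I[of v w] I[of v 0] I[of 0 w] I[of 0 0] by simp
    qed
    have s: "(LINT x|lborel. f (x + v + u) * g (x + w + u)) = (LINT x|lborel. f (x + v) * g (x + w))" for u v w
      using lborel_integral_shift[of "\<lambda>x. f (x + v) * g (x + w)" u] by (simp add: add_ac)
    have "(LINT x|lborel. (f (x + ?b) - f x) * (g (x + ?c) - g x)) = (LINT x|lborel. (f (x + - ?c) - f x) * (g (x + - ?b) - g x))"
      unfolding e1 using s[of "-?c" "?b + ?c" "-?b"] s[of ?b "-?b" 0] s[of 0 "-?c" ?c] by (simp add: add_ac)
    then show ?thesis by (simp add: q_def)
  qed
  have conv: "(\<lambda>n. LINT x|lborel. q f v n x * q g w n x) \<longlonglongrightarrow> (LINT x|lborel. f' x v * g' x w)"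
    if v: "norm v = 1" "norm w = 1" "(\<lambda>x. f' x v) \<in> borel_measurable borel" "(\<lambda>x. g' x w) \<in> borel_measurable borel" for v w
  proof (rule integral_dominated_convergence)
    show "integrable lborel (\<lambda>x::'a. L * L * indicator (cball 0 (R + 1)) x :: real)"
      by (intro integrable_mult_right integrable_real_indicator) (use emeasure_bounded_finite[OF bounded_cball] in auto)
    show "AE x in lborel. norm (q f v n x * q g w n x) \<le> L * L * indicator (cball 0 (R + 1)) x" for n
    proof (rule AE_I2)
      fix x
      have "\<bar>q f v n x\<bar> * \<bar>q g w n x\<bar> \<le> (L * indicator (cball 0 (R + 1)) x) * (L * indicator (cball 0 (R + 1)) x)"
        using qb[OF f supp(1) v(1), of n x] qb[OF g supp(2) v(2), of n x] L0 by (intro mult_mono) auto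
      then show "norm (q f v n x * q g w n x) \<le> L * L * indicator (cball 0 (R + 1)) x"
        by (cases "x \<in> cball 0 (R + 1)") (auto simp: abs_mult)
    qed
    show "AE x in lborel. (\<lambda>n. q f v n x * q g w n x) \<longlonglongrightarrow> f' x v * g' x w"
      using df dg by eventually_elim (auto intro!: tendsto_mult lim)
    show "(\<lambda>x. f' x v * g' x w) \<in> borel_measurable lborel" using v by simp
    show "(\<lambda>x. q f v n x * q g w n x) \<in> borel_measurable lborel" for n unfolding q_def by measurable
  qed
  have neg: "AE x in lborel. f' x (- c) * g' x (- b) = f' x c * g' x b"
    using df dg by eventually_elim (simp add: linear_neg has_derivative_linear)
  have "(\<lambda>n. LINT x|lborel. q f (- c) n x * q g (- b) n x) \<longlonglongrightarrow> (LINT x|lborel. f' x c * g' x b)"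
  proof -
    have "(\<lambda>n. LINT x|lborel. q f (- c) n x * q g (- b) n x) \<longlonglongrightarrow> (LINT x|lborel. (- f' x c) * (- g' x b))"
    proof (rule integral_dominated_convergence)
      show "integrable lborel (\<lambda>x::'a. L * L * indicator (cball 0 (R + 1)) x :: real)"
        by (intro integrable_mult_right integrable_real_indicator) (use emeasure_bounded_finite[OF bounded_cball] in auto)
      show "AE x in lborel. norm (q f (- c) n x * q g (- b) n x) \<le> L * L * indicator (cball 0 (R + 1)) x" for n
      proof (rule AE_I2)
        fix x
        have "\<bar>q f (- c) n x\<bar> * \<bar>q g (- b) n x\<bar> \<le> (L * indicator (cball 0 (R + 1)) x) * (L * indicator (cball 0 (R + 1)) x)"
          using qb[OF f supp(1), of "- c" n x] qb[OF g supp(2), of "- b" n x] L0 bc by (intro mult_mono) auto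
        then show "norm (q f (- c) n x * q g (- b) n x) \<le> L * L * indicator (cball 0 (R + 1)) x"
          by (cases "x \<in> cball 0 (R + 1)") (auto simp: abs_mult)
      qed
      show "AE x in lborel. (\<lambda>n. q f (- c) n x * q g (- b) n x) \<longlonglongrightarrow> (- f' x c) * (- g' x b)"
        using df dg
      proof eventually_elim
        case (elim x)
        have "f' x (- c) = - f' x c" "g' x (- b) = - g' x b"
          using elim by (simp_all add: linear_neg has_derivative_linear)
        then show ?case using tendsto_mult[OF lim[OF elim(1), of "- c"] lim[OF elim(2), of "- b"]] by simp
      qed
      show "(\<lambda>x. (- f' x c) * (- g' x b)) \<in> borel_measurable lborel" using m by simp
      show "(\<lambda>x. q f (- c) n x * q g (- b) n x) \<in> borel_measurable lborel" for n unfolding q_def by measurable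
    qed
    then show ?thesis by simp
  qed
  with conv[of b c] key bc m show ?thesis by (intro LIMSEQ_unique[of "\<lambda>n. LINT x|lborel. q f b n x * q g c n x"]) auto
qed

lemma has_derivative_bound_along:
  fixes f :: "'a::real_normed_vector \<Rightarrow> real"
  assumes D: "(f has_derivative D) (at x)" and lip: "\<And>y. \<bar>f y - f x\<bar> \<le> L * norm (y - x)"
  shows "norm (D v) \<le> L * norm v"
proof -
  from difference_quotient_tendsto[OF D]
  have "((\<lambda>t. (f (x + t *\<^sub>R v) - f x) / t) \<longlongrightarrow> D v) (at 0)" .
  then have "((\<lambda>t. norm ((f (x + t *\<^sub>R v) - f x) / t)) \<longlongrightarrow> norm (D v)) (at 0)" by (rule tendsto_norm)
  moreover have "\<forall>\<^sub>F t in at 0. norm ((f (x + t *\<^sub>R v) - f x) / t) \<le> L * norm v"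
    unfolding eventually_at_filter
  proof (intro always_eventually allI impI)
    fix t :: real assume t: "t \<noteq> 0"
    have "\<bar>f (x + t *\<^sub>R v) - f x\<bar> \<le> L * norm v * \<bar>t\<bar>" using lip[of "x + t *\<^sub>R v"] by (simp add: mult_ac)
    then show "norm ((f (x + t *\<^sub>R v) - f x) / t) \<le> L * norm v" using t by (simp add: divide_le_eq)
  qed
  ultimately show ?thesis by (rule tendsto_upperbound) simp
qed

lemma norm_matrix_sq: "(norm (X::real^3^3))\<^sup>2 = (\<Sum>i\<in>UNIV. \<Sum>j\<in>UNIV. X $ i $ j * X $ i $ j)"
  by (simp add: power2_norm_eq_inner inner_vec_def)

lemma norm_sym_part_sq:
  "2 * (norm (sym_part X))\<^sup>2 = (norm X)\<^sup>2 + (\<Sum>i\<in>UNIV. \<Sum>j\<in>UNIV. X $ i $ j * X $ j $ i)"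
proof -
  have "2 * (norm (sym_part X))\<^sup>2 = (\<Sum>i\<in>UNIV. \<Sum>j\<in>UNIV. 1/2 * (X $ i $ j * X $ i $ j) + 1/2 * (X $ j $ i * X $ j $ i) + X $ i $ j * X $ j $ i)"
    unfolding norm_matrix_sq sum_distrib_left
    by (intro sum.cong refl) (simp add: sym_part_def transpose_def algebra_simps)
  moreover have "(\<Sum>i\<in>UNIV. \<Sum>j\<in>UNIV. 1/2 * (X $ j $ i * X $ j $ i)) = (\<Sum>i\<in>UNIV. \<Sum>j\<in>UNIV. 1/2 * (X $ i $ j * X $ i $ j))"
    by (rule sum.swap)
  moreover have "(\<Sum>i\<in>UNIV. \<Sum>j\<in>UNIV. 1/2 * (X $ i $ j * X $ i $ j)) = 1/2 * (\<Sum>i\<in>UNIV. \<Sum>j\<in>UNIV. X $ i $ j * X $ i $ j)"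
    by (simp only: sum_distrib_left)
  ultimately show ?thesis
    unfolding norm_matrix_sq sum.distrib by linarith
qed

text \<open>By the exchange of derivatives, \<open>\<integral> \<partial>\<^sub>j u\<^sub>i \<partial>\<^sub>i u\<^sub>j = \<integral> \<partial>\<^sub>i u\<^sub>i \<partial>\<^sub>j u\<^sub>j\<close>, and the sum over \<open>i\<close> and \<open>j\<close> of the right-hand sides is \<open>\<integral> (div u)\<^sup>2 \<ge> 0\<close>.\<close>

lemma korn_first:
  fixes u :: "real^3 \<Rightarrow> real^3" and W :: "real^3 \<Rightarrow> real^3^3"
  assumes lip: "\<And>x y. dist (u x) (u y) \<le> L * dist x y" and supp: "\<And>x. norm x > R \<Longrightarrow> u x = 0"
    and der: "AE x in lborel. (u has_derivative (\<lambda>v. W x *v v)) (at x)"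
    and m: "W \<in> borel_measurable borel"
  shows "(LINT x|lborel. (norm (W x))\<^sup>2) \<le> 2 * (LINT x|lborel. (norm (sym_part (W x)))\<^sup>2)"
proof -
  have m'[measurable]: "(\<lambda>x. W x $ i $ j) \<in> borel_measurable borel" for i j
    by (rule borel_measurable_continuous_on[OF _ m]) (intro continuous_intros)
  have lipi: "\<bar>u x $ i - u y $ i\<bar> \<le> L * dist x y" for i x y
    using order_trans[OF Finite_Cartesian_Product.norm_nth_le[of "u x - u y" i] lip[of x y, unfolded dist_norm[of "u x"]]] by simp
  have L0: "L \<ge> 0" using order_trans[OF zero_le_dist lip[of "axis 1 1" 0]] by simp
  have deri: "AE x in lborel. ((\<lambda>x. u x $ i) has_derivative (\<lambda>v. (W x *v v) $ i)) (at x)" for i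
    using der by eventually_elim (rule bounded_linear.has_derivative[OF bounded_linear_vec_nth])
  have Wax: "(W x *v axis j 1) $ i = W x $ i $ j" for x i j
    by (simp add: matrix_vector_mult_def axis_def if_distrib cong: if_cong)
  have bound: "AE x in lborel. \<bar>W x $ i $ j\<bar> \<le> L * indicator (cball 0 R) x" for i j
    using deri[of i]
  proof eventually_elim
    case (elim x)
    show ?case
    proof (cases "norm x > R")
      case True
      have "((\<lambda>x. u x $ i) has_derivative (\<lambda>v. 0)) (at x)"
      proof (rule has_derivative_transform_within_open[of "\<lambda>x. 0" _ _ _ "{x. norm x > R}"])
        show "open {x::real^3. norm x > R}" by (intro open_Collect_less continuous_intros)
      qed (use supp True in auto)
      from has_derivative_unique[OF elim this] have "(W x *v axis j 1) $ i = 0" by metis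
      then show ?thesis using True by (simp add: Wax)
    next
      case False
      have "norm ((W x *v axis j 1) $ i) \<le> L * norm (axis j (1::real))"
      proof (rule has_derivative_bound_along[OF elim])
        show "\<bar>u y $ i - u x $ i\<bar> \<le> L * norm (y - x)" for y
          using lipi[of y i x] by (simp add: dist_norm)
      qed
      then show ?thesis using False by (simp add: Wax)
    qed
  qed
  have bW: "AE x in lborel. \<bar>W x $ i $ j * W x $ k $ l\<bar> \<le> L * L * indicator (cball 0 R) x" for i j k l
    using bound[of i j] bound[of k l]
  proof eventually_elim
    case (elim x)
    have "\<bar>W x $ i $ j\<bar> * \<bar>W x $ k $ l\<bar> \<le> (L * indicator (cball 0 R) x) * (L * indicator (cball 0 R) x)"
      using elim L0 by (intro mult_mono) auto
    then show ?case by (cases "x \<in> cball 0 R") (auto simp: abs_mult)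
  qed
  have iW: "integrable lborel (\<lambda>x. W x $ i $ j * W x $ k $ l)" for i j k l
    by (rule integrable_dominated_by_compact[OF _ compact_cball bW]) measurable
  have ex: "(LINT x|lborel. W x $ i $ j * W x $ j $ i) = (LINT x|lborel. W x $ i $ i * W x $ j $ j)" for i j
  proof -
    have "(LINT x|lborel. (W x *v axis j 1) $ i * (W x *v axis i 1) $ j) =
        (LINT x|lborel. (W x *v axis i 1) $ i * (W x *v axis j 1) $ j)"
    proof (rule exchange_of_partial_derivatives[OF lipi lipi _ _ deri deri])
      show "u x $ i = 0" "u x $ j = 0" if "norm x > R" for x using supp[OF that] by simp_all
    qed (auto simp: Wax)
    then show ?thesis by (simp add: Wax)
  qed
  have iN: "integrable lborel (\<lambda>x. (norm (W x))\<^sup>2)"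
    unfolding norm_matrix_sq by (intro Bochner_Integration.integrable_sum iW)
  have iT: "integrable lborel (\<lambda>x. \<Sum>i\<in>UNIV. \<Sum>j\<in>UNIV. W x $ i $ j * W x $ j $ i)"
    by (intro Bochner_Integration.integrable_sum iW)
  have "0 \<le> (LINT x|lborel. (\<Sum>i\<in>UNIV. W x $ i $ i) * (\<Sum>j\<in>UNIV. W x $ j $ j))"
    by (rule integral_nonneg_AE) simp
  also have "\<dots> = (LINT x|lborel. (\<Sum>i\<in>UNIV. \<Sum>j\<in>UNIV. W x $ i $ i * W x $ j $ j))"
    by (simp add: sum_product)
  also have "\<dots> = (\<Sum>i\<in>UNIV. \<Sum>j\<in>UNIV. (LINT x|lborel. W x $ i $ i * W x $ j $ j))"
    by (simp add: iW Bochner_Integration.integral_sum Bochner_Integration.integrable_sum)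
  also have "\<dots> = (\<Sum>i\<in>UNIV. \<Sum>j\<in>UNIV. (LINT x|lborel. W x $ i $ j * W x $ j $ i))"
    by (simp only: ex)
  also have "\<dots> = (LINT x|lborel. (\<Sum>i\<in>UNIV. \<Sum>j\<in>UNIV. W x $ i $ j * W x $ j $ i))"
    by (simp add: iW Bochner_Integration.integral_sum Bochner_Integration.integrable_sum)
  finally have "0 \<le> (LINT x|lborel. (\<Sum>i\<in>UNIV. \<Sum>j\<in>UNIV. W x $ i $ j * W x $ j $ i))" .
  moreover have "(LINT x|lborel. 2 * (norm (sym_part (W x)))\<^sup>2) =
      (LINT x|lborel. (norm (W x))\<^sup>2) + (LINT x|lborel. (\<Sum>i\<in>UNIV. \<Sum>j\<in>UNIV. W x $ i $ j * W x $ j $ i))"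
    unfolding norm_sym_part_sq by (rule Bochner_Integration.integral_add[OF iN iT])
  ultimately show ?thesis by simp
qed

section \<open>Integral operators\<close>

text \<open>Schur's test: the Cauchy-Schwarz inequality for the weights \<open>w x\<close>, followed by Fubini's theorem.\<close>

lemma schur_test:
  fixes w :: "'a::euclidean_space \<Rightarrow> 'a \<Rightarrow> real" and \<rho> :: "'a \<Rightarrow> real"
  assumes wm: "case_prod w \<in> borel_measurable (borel \<Otimes>\<^sub>M borel)" and w0: "\<And>x y. w x y \<ge> 0"
    and rm[measurable]: "\<rho> \<in> borel_measurable borel" and r0: "\<And>y. \<rho> y \<ge> 0" and ab: "a \<ge> 0" "b \<ge> 0"
    and wa: "\<And>x. (\<integral>\<^sup>+y. ennreal (w x y) \<partial>lborel) \<le> ennreal a"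
    and wb: "\<And>y. (\<integral>\<^sup>+x. ennreal (w x y) \<partial>lborel) \<le> ennreal b"
  shows "(\<integral>\<^sup>+x. (\<integral>\<^sup>+y. ennreal (w x y * \<rho> y) \<partial>lborel)\<^sup>2 \<partial>lborel) \<le>
    ennreal (a * b) * (\<integral>\<^sup>+y. ennreal ((\<rho> y)\<^sup>2) \<partial>lborel)"
proof -
  have wm': "case_prod w \<in> borel_measurable (lborel \<Otimes>\<^sub>M lborel)"
    using wm by (simp cong: measurable_cong_sets)
  have wx[measurable]: "w x \<in> borel_measurable borel" for x
  proof -
    have "(\<lambda>y. case_prod w (x, y)) \<in> borel_measurable borel" by (rule measurable_compose[OF _ wm]) measurable
    then show ?thesis by simp
  qed
  have wy[measurable]: "(\<lambda>x. w x y) \<in> borel_measurable borel" for y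
  proof -
    have "(\<lambda>x. case_prod w (x, y)) \<in> borel_measurable borel" by (rule measurable_compose[OF _ wm]) measurable
    then show ?thesis by simp
  qed
  have cs: "(\<integral>\<^sup>+y. ennreal (w x y * \<rho> y) \<partial>lborel)\<^sup>2 \<le> ennreal a * (\<integral>\<^sup>+y. ennreal (w x y * (\<rho> y)\<^sup>2) \<partial>lborel)" for x
  proof -
    have "(\<integral>\<^sup>+y. ennreal (w x y * \<rho> y) \<partial>lborel)\<^sup>2 =
        (\<integral>\<^sup>+y. ennreal (sqrt (w x y)) * ennreal (sqrt (w x y) * \<rho> y) \<partial>lborel)\<^sup>2"
      using w0 r0 by (intro arg_cong[where f = "\<lambda>t. t\<^sup>2"] nn_integral_cong)
        (simp add: ennreal_mult[symmetric] mult.assoc[symmetric])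
    also have "\<dots> \<le> (\<integral>\<^sup>+y. (ennreal (sqrt (w x y)))\<^sup>2 \<partial>lborel) * (\<integral>\<^sup>+y. (ennreal (sqrt (w x y) * \<rho> y))\<^sup>2 \<partial>lborel)"
      by (rule Cauchy_Schwarz_nn_integral) measurable
    also have "(\<integral>\<^sup>+y. (ennreal (sqrt (w x y)))\<^sup>2 \<partial>lborel) = (\<integral>\<^sup>+y. ennreal (w x y) \<partial>lborel)"
      using w0 by (intro nn_integral_cong) (simp add: ennreal_power)
    also have "(\<integral>\<^sup>+y. (ennreal (sqrt (w x y) * \<rho> y))\<^sup>2 \<partial>lborel) = (\<integral>\<^sup>+y. ennreal (w x y * (\<rho> y)\<^sup>2) \<partial>lborel)"
      using w0 r0 by (intro nn_integral_cong) (simp add: ennreal_power power_mult_distrib)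
    also have "(\<integral>\<^sup>+y. ennreal (w x y) \<partial>lborel) * (\<integral>\<^sup>+y. ennreal (w x y * (\<rho> y)\<^sup>2) \<partial>lborel) \<le>
        ennreal a * (\<integral>\<^sup>+y. ennreal (w x y * (\<rho> y)\<^sup>2) \<partial>lborel)"
      by (rule mult_right_mono[OF wa]) simp
    finally show ?thesis .
  qed
  have m2: "(\<lambda>(x, y). ennreal (w x y * (\<rho> y)\<^sup>2)) \<in> borel_measurable (lborel \<Otimes>\<^sub>M lborel)"
    using wm' by measurable
  have "(\<integral>\<^sup>+x. (\<integral>\<^sup>+y. ennreal (w x y * \<rho> y) \<partial>lborel)\<^sup>2 \<partial>lborel) \<le>
      (\<integral>\<^sup>+x. ennreal a * (\<integral>\<^sup>+y. ennreal (w x y * (\<rho> y)\<^sup>2) \<partial>lborel) \<partial>lborel)"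
    by (rule nn_integral_mono) (rule cs)
  also have "\<dots> = ennreal a * (\<integral>\<^sup>+x. (\<integral>\<^sup>+y. ennreal (w x y * (\<rho> y)\<^sup>2) \<partial>lborel) \<partial>lborel)"
    by (rule nn_integral_cmult) (use lborel.borel_measurable_nn_integral[OF m2] in simp)
  also have "(\<integral>\<^sup>+x. (\<integral>\<^sup>+y. ennreal (w x y * (\<rho> y)\<^sup>2) \<partial>lborel) \<partial>lborel) =
      (\<integral>\<^sup>+y. (\<integral>\<^sup>+x. ennreal (w x y * (\<rho> y)\<^sup>2) \<partial>lborel) \<partial>lborel)"
    using lborel_pair.Fubini'[of "\<lambda>x y. ennreal (w x y * (\<rho> y)\<^sup>2)"] m2 by simp
  also have "\<dots> \<le> (\<integral>\<^sup>+y. ennreal b * ennreal ((\<rho> y)\<^sup>2) \<partial>lborel)"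
  proof (rule nn_integral_mono)
    fix y
    have "(\<integral>\<^sup>+x. ennreal (w x y * (\<rho> y)\<^sup>2) \<partial>lborel) = (\<integral>\<^sup>+x. ennreal (w x y) * ennreal ((\<rho> y)\<^sup>2) \<partial>lborel)"
      using w0 by (simp add: ennreal_mult)
    also have "\<dots> = (\<integral>\<^sup>+x. ennreal (w x y) \<partial>lborel) * ennreal ((\<rho> y)\<^sup>2)"
      by (rule nn_integral_multc) measurable
    also have "\<dots> \<le> ennreal b * ennreal ((\<rho> y)\<^sup>2)" by (rule mult_right_mono[OF wb]) simp
    finally show "(\<integral>\<^sup>+x. ennreal (w x y * (\<rho> y)\<^sup>2) \<partial>lborel) \<le> ennreal b * ennreal ((\<rho> y)\<^sup>2)" .
  qed
  also have "(\<integral>\<^sup>+y. ennreal b * ennreal ((\<rho> y)\<^sup>2) \<partial>lborel) = ennreal b * (\<integral>\<^sup>+y. ennreal ((\<rho> y)\<^sup>2) \<partial>lborel)"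
    by (rule nn_integral_cmult) measurable
  finally show ?thesis using ab by (simp add: ennreal_mult mult.assoc mult_left_mono)
qed

lemma nn_integral_vec3:
  fixes f1 f2 f3 :: "real \<Rightarrow> ennreal"
  assumes [measurable]: "f1 \<in> borel_measurable borel" "f2 \<in> borel_measurable borel" "f3 \<in> borel_measurable borel"
  shows "(\<integral>\<^sup>+x. f1 ((x::real^3) $ 1) * f2 (x $ 2) * f3 (x $ 3) \<partial>lborel) =
    (\<integral>\<^sup>+t. f1 t \<partial>lborel) * (\<integral>\<^sup>+t. f2 t \<partial>lborel) * (\<integral>\<^sup>+t. f3 t \<partial>lborel)"
proof -
  define f :: "real^3 \<Rightarrow> real \<Rightarrow> ennreal" where
    "f b = (if b = axis 1 1 then f1 else if b = axis 2 1 then f2 else f3)" for b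
  have Bas: "(Basis :: (real^3) set) = {axis 1 1, axis 2 1, axis 3 1}"
    by (auto simp: Basis_vec_def UNIV_3)
  have ne: "axis 1 1 \<noteq> (axis 2 1 :: real^3)" "axis 1 1 \<noteq> (axis 3 1 :: real^3)" "axis 2 1 \<noteq> (axis 3 1 :: real^3)"
    by (simp_all add: axis_eq_axis)
  have P: "(\<Prod>b\<in>Basis. g b) = g (axis 1 1) * g (axis 2 1) * g (axis 3 1 :: real^3)" for g :: "real^3 \<Rightarrow> ennreal"
    unfolding Bas using ne by (simp add: mult.assoc)
  have [measurable]: "f b \<in> borel_measurable borel" for b by (simp add: f_def)
  have "(\<integral>\<^sup>+x. (\<Prod>b\<in>Basis. f b (x \<bullet> b)) \<partial>lborel) = (\<Prod>b\<in>Basis. (\<integral>\<^sup>+x. f b x \<partial>lborel))"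
    by (rule nn_integral_lborel_prod) simp_all
  then show ?thesis unfolding P using ne ne[symmetric] by (simp add: f_def cart_eq_inner_axis[symmetric])
qed

text \<open>The derivative of the step rescaled to width \<open>\<epsilon>\<close>, which for \<open>\<epsilon> > 0\<close> is a probability density supported in \<open>[0, \<epsilon>]\<close>, and its derivative.\<close>

definition bump :: "real \<Rightarrow> real \<Rightarrow> real" where "bump \<epsilon> s = smoothstep' (s / \<epsilon>) / \<epsilon>"
definition bump' :: "real \<Rightarrow> real \<Rightarrow> real" where "bump' \<epsilon> s = smoothstep'' (s / \<epsilon>) / \<epsilon>\<^sup>2"

lemma smoothstep_scaled_derivative: "((\<lambda>s. smoothstep (s / \<epsilon>)) has_real_derivative bump \<epsilon> s) (at s)"
  using DERIV_chain2[OF smoothstep_has_derivative DERIV_cdivide[OF DERIV_ident], of \<epsilon> s] by (simp add: bump_def)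

lemma bump_derivative: "(bump \<epsilon> has_real_derivative bump' \<epsilon> s) (at s)"
  using DERIV_cdivide[OF DERIV_chain2[OF smoothstep'_has_derivative DERIV_cdivide[OF DERIV_ident], of \<epsilon> s], of \<epsilon>]
  by (simp add: bump_def[abs_def] bump'_def power2_eq_square)

lemma bump_continuous [continuous_intros]:
  "continuous_on A f \<Longrightarrow> continuous_on A (\<lambda>x. bump \<epsilon> (f x))"
  "continuous_on A f \<Longrightarrow> continuous_on A (\<lambda>x. bump' \<epsilon> (f x))"
  unfolding bump_def bump'_def divide_inverse by (auto intro!: continuous_intros)

lemma bump_measurable [measurable]: "bump \<epsilon> \<in> borel_measurable borel"
  by (rule borel_measurable_continuous_onI) (auto intro!: continuous_intros)

lemma bump_nonneg: "\<epsilon> > 0 \<Longrightarrow> bump \<epsilon> s \<ge> 0"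
  using smoothstep_bounds(3)[of "s / \<epsilon>"] by (simp add: bump_def)

lemma bump_eq_0: "\<epsilon> > 0 \<Longrightarrow> s \<le> 0 \<or> s \<ge> \<epsilon> \<Longrightarrow> bump \<epsilon> s = 0"
  by (auto simp: bump_def divide_nonpos_pos smoothstep_eq_0 smoothstep_eq_1)

lemma nn_integral_bump:
  assumes "\<epsilon> > 0"
  shows "(\<integral>\<^sup>+s. ennreal (bump \<epsilon> (s - c)) \<partial>lborel) = 1" "(\<integral>\<^sup>+s. ennreal (bump \<epsilon> (c - s)) \<partial>lborel) = 1"
proof -
  have 0: "(\<integral>\<^sup>+s. ennreal (bump \<epsilon> s) \<partial>lborel) = 1"
  proof -
    have "((\<lambda>s. smoothstep (s / \<epsilon>)) \<longlongrightarrow> 1) at_top"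
    proof (rule tendsto_eventually)
      show "\<forall>\<^sub>F s in at_top. smoothstep (s / \<epsilon>) = 1"
        using eventually_ge_at_top[of \<epsilon>] by eventually_elim (use assms in \<open>simp add: smoothstep_eq_1\<close>)
    qed
    then have "(\<integral>\<^sup>+s. ennreal (bump \<epsilon> s) * indicator {0..} s \<partial>lborel) = ennreal (1 - smoothstep (0 / \<epsilon>))"
      by (intro nn_integral_FTC_atLeast smoothstep_scaled_derivative bump_nonneg assms) measurable
    moreover have "ennreal (bump \<epsilon> s) * indicator {0..} s = ennreal (bump \<epsilon> s)" for s
      using bump_eq_0[OF assms, of s] by (cases "s \<ge> 0") auto
    ultimately show ?thesis by (simp add: smoothstep_eq_0)
  qed
  show "(\<integral>\<^sup>+s. ennreal (bump \<epsilon> (s - c)) \<partial>lborel) = 1"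
    using nn_integral_real_affine[of "\<lambda>s. ennreal (bump \<epsilon> s)" 1 "- c"] 0 by simp
  show "(\<integral>\<^sup>+s. ennreal (bump \<epsilon> (c - s)) \<partial>lborel) = 1"
    using nn_integral_real_affine[of "\<lambda>s. ennreal (bump \<epsilon> s)" "-1" c] 0 by simp
qed

lemma continuous_on_sections:
  assumes "continuous_on UNIV (\<lambda>(x, y). H x y)"
  shows "continuous_on UNIV (H x)" "continuous_on UNIV (\<lambda>x. H x y)"
  using continuous_on_compose2[OF assms continuous_on_Pair[OF continuous_on_const[of UNIV x] continuous_on_id]]
    continuous_on_compose2[OF assms continuous_on_Pair[OF continuous_on_id continuous_on_const[of UNIV y]]] by simp_all

lemma continuous_integral_kernel:
  fixes H :: "'a::euclidean_space \<Rightarrow> 'b::euclidean_space \<Rightarrow> real"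
  assumes H: "continuous_on UNIV (\<lambda>(x, y). H x y)"
    and f: "integrable lborel f" and B: "compact B" "\<And>y. y \<notin> B \<Longrightarrow> f y = 0"
  shows "continuous_on UNIV (\<lambda>x. LINT y|lborel. H x y * f y)"
proof (rule continuous_on_sequentiallyI)
  have [measurable]: "f \<in> borel_measurable borel" using f by auto
  have Hy: "continuous_on UNIV (H x)" for x
    by (rule continuous_on_sections(1)[OF H])
  have [measurable]: "H x \<in> borel_measurable borel" for x by (rule borel_measurable_continuous_onI[OF Hy])
  fix X :: "nat \<Rightarrow> 'a" and x assume X: "X \<longlonglongrightarrow> x"
  have "bounded ((\<lambda>(x, y). H x y) ` (cball x 1 \<times> B))"
    by (intro compact_imp_bounded compact_continuous_image continuous_on_subset[OF H] compact_Times B compact_cball) auto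
  then obtain L where "\<forall>x'\<in>cball x 1. \<forall>y\<in>B. \<bar>H x' y\<bar> \<le> L" by (auto simp: bounded_iff)
  then have L: "\<bar>H x' y\<bar> \<le> L" if "x' \<in> cball x 1" "y \<in> B" for x' y using that by blast
  obtain N where N: "\<And>n. n \<ge> N \<Longrightarrow> dist (X n) x < 1" using X by (metis lim_sequentially zero_less_one)
  have "(\<lambda>n. LINT y|lborel. H (X (n + N)) y * f y) \<longlonglongrightarrow> (LINT y|lborel. H x y * f y)"
  proof (rule integral_dominated_convergence)
    show "integrable lborel (\<lambda>y. \<bar>L * f y\<bar>)" by (intro integrable_abs integrable_mult_right f)
    show "AE y in lborel. norm (H (X (n + N)) y * f y) \<le> \<bar>L * f y\<bar>" for n
    proof (rule AE_I2)
      fix y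
      show "norm (H (X (n + N)) y * f y) \<le> \<bar>L * f y\<bar>"
      proof (cases "y \<in> B")
        case True
        have "X (n + N) \<in> cball x 1" using N[of "n + N"] by (simp add: dist_commute less_imp_le)
        then have "\<bar>H (X (n + N)) y\<bar> \<le> L" using L True by blast
        then show ?thesis by (simp add: abs_mult mult_right_mono)
      qed (simp add: B)
    qed
    show "AE y in lborel. (\<lambda>n. H (X (n + N)) y * f y) \<longlonglongrightarrow> H x y * f y"
    proof (rule AE_I2)
      fix y
      have "continuous_on UNIV (\<lambda>x. H x y)"
        by (rule continuous_on_sections(2)[OF H])
      then have "(\<lambda>n. H (X (n + N)) y) \<longlonglongrightarrow> H x y"
        using continuous_on_tendsto_compose[of UNIV "\<lambda>x. H x y" _ x] LIMSEQ_ignore_initial_segment[OF X] by auto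
      then show "(\<lambda>n. H (X (n + N)) y * f y) \<longlonglongrightarrow> H x y * f y" by (rule tendsto_mult[OF _ tendsto_const])
    qed
  qed measurable
  then show "(\<lambda>n. LINT y|lborel. H (X n) y * f y) \<longlonglongrightarrow> (LINT y|lborel. H x y * f y)" by (rule LIMSEQ_offset)
qed

lemma has_derivative_integral_kernel:
  fixes G :: "'a::euclidean_space \<Rightarrow> 'b::euclidean_space \<Rightarrow> real"
  assumes G: "\<And>x y. ((\<lambda>x. G x y) has_derivative G' x y) (at x)"
    and Gc: "\<And>b. b \<in> Basis \<Longrightarrow> continuous_on UNIV (\<lambda>(x, y). G' x y b)"
    and Gy: "\<And>x. continuous_on UNIV (G x)"
    and f: "integrable lborel f" and B: "compact B" "\<And>y. y \<notin> B \<Longrightarrow> f y = 0"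
  shows "((\<lambda>x. LINT y|lborel. G x y * f y) has_derivative (\<lambda>v. LINT y|lborel. G' x y v * f y)) (at x)"
proof -
  have [measurable]: "f \<in> borel_measurable borel" using f by auto
  have [measurable]: "G x \<in> borel_measurable borel" for x by (rule borel_measurable_continuous_onI[OF Gy])
  have lin: "linear (G' x y)" for x y using G has_derivative_linear by blast
  have Gr: "G' x y v = (\<Sum>b\<in>Basis. (v \<bullet> b) * G' x y b)" for x y v
    using lin[of x y] by (subst euclidean_representation[of v, symmetric]) (simp only: linear_sum linear_cmul real_scaleR_def)
  have G'y: "continuous_on UNIV (\<lambda>y. G' x y b)" if "b \<in> Basis" for x b
    by (rule continuous_on_sections(1)[OF Gc[OF that]])
  have G'm[measurable]: "(\<lambda>y. G' x y v) \<in> borel_measurable borel" for x v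
  proof -
    have "continuous_on UNIV (\<lambda>y. \<Sum>b\<in>Basis. (v \<bullet> b) * G' x y b)"
      by (intro continuous_on_sum continuous_on_mult continuous_on_const G'y) assumption
    then show ?thesis unfolding Gr[of x _ v] by (rule borel_measurable_continuous_onI)
  qed
  have bd: "\<exists>L\<ge>0. \<forall>x'\<in>cball x 1. \<forall>y\<in>B. \<forall>v. \<bar>G' x' y v\<bar> \<le> L * norm v" for x
  proof -
    have "\<exists>L. \<forall>z\<in>cball x 1 \<times> B. norm (case z of (x, y) \<Rightarrow> G' x y b) \<le> L" if "b \<in> Basis" for b
    proof -
      have "bounded ((\<lambda>(x, y). G' x y b) ` (cball x 1 \<times> B))"
        by (intro compact_imp_bounded compact_continuous_image continuous_on_subset[OF Gc[OF that]] compact_Times B compact_cball) auto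
      then show ?thesis by (auto simp: bounded_iff)
    qed
    then obtain L where L: "\<And>b z. b \<in> Basis \<Longrightarrow> z \<in> cball x 1 \<times> B \<Longrightarrow> norm (case z of (x, y) \<Rightarrow> G' x y b) \<le> L b"
      by metis
    show ?thesis
    proof (intro exI[of _ "max 0 (\<Sum>b\<in>Basis. L b)"] conjI ballI allI)
      fix x' y v assume "x' \<in> cball x 1" "y \<in> B"
      then have "norm (G' x' y v) \<le> (\<Sum>b\<in>Basis. L b) * norm v"
        using L[of _ "(x', y)"] by (intro frechet_bound_from_basis lin) auto
      also have "\<dots> \<le> max 0 (\<Sum>b\<in>Basis. L b) * norm v" by (intro mult_right_mono) auto
      finally show "\<bar>G' x' y v\<bar> \<le> max 0 (\<Sum>b\<in>Basis. L b) * norm v" by simp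
    qed simp
  qed
  have i': "integrable lborel (\<lambda>y. G' x y v * f y)" for x v
  proof -
    obtain L where L: "L \<ge> 0" "\<forall>x'\<in>cball x 1. \<forall>y\<in>B. \<forall>v. \<bar>G' x' y v\<bar> \<le> L * norm v" using bd by blast
    have "\<bar>G' x y v * f y\<bar> \<le> \<bar>(L * norm v) * f y\<bar>" for y
    proof (cases "y \<in> B")
      case True
      then have "\<bar>G' x y v\<bar> \<le> L * norm v" using L(2) by simp
      then show ?thesis using L(1) by (simp add: abs_mult mult_right_mono)
    qed (simp add: B)
    then show ?thesis
      by (intro Bochner_Integration.integrable_bound[OF integrable_mult_right[OF f, of "L * norm v"]]) auto
  qed
  have i: "integrable lborel (\<lambda>y. G x y * f y)" for x
  proof -
    have "bounded (G x ` B)" by (intro compact_imp_bounded compact_continuous_image B continuous_on_subset[OF Gy]) auto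
    then obtain M where M: "\<And>y. y \<in> B \<Longrightarrow> \<bar>G x y\<bar> \<le> M" by (auto simp: bounded_iff)
    have "\<bar>G x y * f y\<bar> \<le> \<bar>M * f y\<bar>" for y
    proof (cases "y \<in> B")
      case True
      then show ?thesis using M[of y] by (simp add: abs_mult mult_right_mono)
    qed (simp add: B)
    then show ?thesis by (intro Bochner_Integration.integrable_bound[OF integrable_mult_right[OF f, of M]]) auto
  qed
  show "((\<lambda>x. LINT y|lborel. G x y * f y) has_derivative (\<lambda>v. LINT y|lborel. G' x y v * f y)) (at x)"
  proof (rule has_derivativeI)
    show "bounded_linear (\<lambda>v. LINT y|lborel. G' x y v * f y)"
      unfolding linear_conv_bounded_linear[symmetric]
      by (intro linearI)
        (simp_all add: linear_add[OF lin] linear_cmul[OF lin] ring_distribs i' Bochner_Integration.integral_add mult.assoc)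
    show "((\<lambda>z. ((LINT y|lborel. G z y * f y) - (LINT y|lborel. G x y * f y) - (LINT y|lborel. G' x y (z - x) * f y)) /\<^sub>R norm (z - x)) \<longlongrightarrow> 0) (at x)"
      unfolding tendsto_at_iff_sequentially o_def
    proof (intro allI impI)
    fix X :: "nat \<Rightarrow> 'a" assume X': "\<forall>n. X n \<in> UNIV - {x}" and X2: "X \<longlonglongrightarrow> x"
    have X: "\<And>n. X n \<noteq> x" "X \<longlonglongrightarrow> x" using X' X2 by auto
    obtain L where L: "L \<ge> 0" "\<forall>x'\<in>cball x 1. \<forall>y\<in>B. \<forall>v. \<bar>G' x' y v\<bar> \<le> L * norm v" using bd by blast
    obtain N where N: "\<And>n. n \<ge> N \<Longrightarrow> dist (X n) x < 1" using X(2) by (metis lim_sequentially zero_less_one)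
    define Y where "Y n = X (n + N)" for n
    have Y: "Y n \<noteq> x" "dist (Y n) x < 1" for n using X(1) N by (auto simp: Y_def)
    have Yl: "Y \<longlonglongrightarrow> x" unfolding Y_def using X(2) by (rule LIMSEQ_ignore_initial_segment)
    have "(\<lambda>n. LINT y::'b|lborel. (G (Y n) y - G x y - G' x y (Y n - x)) / norm (Y n - x) * f y) \<longlonglongrightarrow> (LINT y::'b|lborel. (0::real))"
    proof (rule integral_dominated_convergence)
      show "integrable lborel (\<lambda>y. \<bar>2 * L * f y\<bar>)" by (intro integrable_abs integrable_mult_right f)
      show "AE y in lborel. norm ((G (Y n) y - G x y - G' x y (Y n - x)) / norm (Y n - x) * f y) \<le> \<bar>2 * L * f y\<bar>" for n
      proof (rule AE_I2)
        fix y
        show "norm ((G (Y n) y - G x y - G' x y (Y n - x)) / norm (Y n - x) * f y) \<le> \<bar>2 * L * f y\<bar>"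
        proof (cases "y \<in> B")
          case True
          have "norm (G (Y n) y - G x y) \<le> L * norm (Y n - x)"
          proof (rule differentiable_bound[of "cball x 1" "\<lambda>x. G x y" "\<lambda>x. G' x y"])
            show "onorm (G' z y) \<le> L" if "z \<in> cball x 1" for z
              using L(2) that True by (intro onorm_le) auto
          qed (use Y(2)[of n] G in \<open>auto simp: dist_commute intro: has_derivative_at_withinI less_imp_le\<close>)
          moreover have "\<bar>G' x y (Y n - x)\<bar> \<le> L * norm (Y n - x)" using L(2) True by simp
          ultimately have "\<bar>G (Y n) y - G x y - G' x y (Y n - x)\<bar> \<le> 2 * L * norm (Y n - x)" by simp
          then have "\<bar>G (Y n) y - G x y - G' x y (Y n - x)\<bar> / norm (Y n - x) \<le> 2 * L"
            using Y(1)[of n] by (simp add: divide_le_eq)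
          from mult_right_mono[OF this abs_ge_zero[of "f y"]] show ?thesis using L(1) by (simp add: abs_mult)
        qed (simp add: B)
      qed
      show "AE y in lborel. (\<lambda>n. (G (Y n) y - G x y - G' x y (Y n - x)) / norm (Y n - x) * f y) \<longlonglongrightarrow> 0"
      proof (rule AE_I2)
        fix y
        have "((\<lambda>z. (G z y - G x y - G' x y (z - x)) /\<^sub>R norm (z - x)) \<longlongrightarrow> 0) (at x)"
          using G[of y x] by (simp add: has_derivative_at_within)
        moreover have "filterlim Y (at x) sequentially" using Yl Y(1) by (auto simp: filterlim_at)
        ultimately have "(\<lambda>n. (G (Y n) y - G x y - G' x y (Y n - x)) /\<^sub>R norm (Y n - x)) \<longlonglongrightarrow> 0" by (rule filterlim_compose)
        from tendsto_mult_left_zero[OF this, of "f y"] show "(\<lambda>n. (G (Y n) y - G x y - G' x y (Y n - x)) / norm (Y n - x) * f y) \<longlonglongrightarrow> 0"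
          by (simp add: divide_inverse mult_ac)
      qed
    qed measurable
    moreover have "(LINT y|lborel. (G (Y n) y - G x y - G' x y (Y n - x)) / norm (Y n - x) * f y) =
      ((LINT y|lborel. G (Y n) y * f y) - (LINT y|lborel. G x y * f y) - (LINT y|lborel. G' x y (Y n - x) * f y)) / norm (Y n - x)" for n
    proof -
      have "(LINT y|lborel. (G (Y n) y - G x y - G' x y (Y n - x)) / norm (Y n - x) * f y) =
        (LINT y|lborel. (G (Y n) y * f y - G x y * f y - G' x y (Y n - x) * f y) / norm (Y n - x))"
        by (simp add: algebra_simps)
      then show ?thesis by (simp add: i i')
    qed
    ultimately have "(\<lambda>n. ((LINT y|lborel. G (Y n) y * f y) - (LINT y|lborel. G x y * f y) - (LINT y|lborel. G' x y (Y n - x) * f y)) / norm (Y n - x)) \<longlonglongrightarrow> 0"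
      by (simp only: Bochner_Integration.integral_zero)
    then have *: "(\<lambda>n. ((LINT y|lborel. G (Y n) y * f y) - (LINT y|lborel. G x y * f y) - (LINT y|lborel. G' x y (Y n - x) * f y)) /\<^sub>R norm (Y n - x)) \<longlonglongrightarrow> 0"
      by (simp add: divide_inverse_commute)
    show "(\<lambda>n. ((LINT y|lborel. G (X n) y * f y) - (LINT y|lborel. G x y * f y) - (LINT y|lborel. G' x y (X n - x) * f y)) /\<^sub>R norm (X n - x)) \<longlonglongrightarrow> 0"
      using * unfolding Y_def by (rule LIMSEQ_offset)
    qed
  qed
qed

section \<open>Gradient part of a mollified row\<close>

definition moll_kernel :: "real \<Rightarrow> real^3 \<Rightarrow> real^3 \<Rightarrow> real" where
  "moll_kernel \<epsilon> x y = bump \<epsilon> (x $ 1 - y $ 1) * bump \<epsilon> (x $ 2 - y $ 2) * bump \<epsilon> (x $ 3 - y $ 3)"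

definition mollify :: "real \<Rightarrow> (real^3 \<Rightarrow> real) \<Rightarrow> real^3 \<Rightarrow> real" where
  "mollify \<epsilon> f x = (LINT y|lborel. moll_kernel \<epsilon> x y * f y)"

lemma moll_kernel_nonneg: "\<epsilon> > 0 \<Longrightarrow> moll_kernel \<epsilon> x y \<ge> 0"
  by (simp add: moll_kernel_def bump_nonneg)

lemma nth_measurable [measurable]: "(\<lambda>x::real^'n. x $ i) \<in> borel_measurable borel"
  by (rule borel_measurable_continuous_onI) (intro continuous_intros)

lemma moll_kernel_measurable [measurable]: "moll_kernel \<epsilon> x \<in> borel_measurable borel"
  unfolding moll_kernel_def[abs_def] by measurable

lemma has_bochner_integral_moll_kernel:
  assumes "\<epsilon> > 0"
  shows "has_bochner_integral lborel (moll_kernel \<epsilon> x) 1"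
proof (rule has_bochner_integral_nn_integral)
  have "(\<integral>\<^sup>+y. ennreal (moll_kernel \<epsilon> x y) \<partial>lborel) =
      (\<integral>\<^sup>+y. ennreal (bump \<epsilon> (x $ 1 - (y::real^3) $ 1)) * ennreal (bump \<epsilon> (x $ 2 - y $ 2)) * ennreal (bump \<epsilon> (x $ 3 - y $ 3)) \<partial>lborel)"
    using bump_nonneg[OF assms] by (simp add: moll_kernel_def ennreal_mult[symmetric])
  also have "\<dots> = 1"
    using nn_integral_vec3[of "\<lambda>t. ennreal (bump \<epsilon> (x $ 1 - t))" "\<lambda>t. ennreal (bump \<epsilon> (x $ 2 - t))" "\<lambda>t. ennreal (bump \<epsilon> (x $ 3 - t))"]
    by (simp add: nn_integral_bump[OF assms])
  finally show "(\<integral>\<^sup>+y. ennreal (moll_kernel \<epsilon> x y) \<partial>lborel) = ennreal 1" by simp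
qed (use moll_kernel_nonneg[OF assms] in auto)

lemma moll_kernel_eq_0:
  assumes "\<epsilon> > 0" "norm (x - y) > 3 * \<epsilon>"
  shows "moll_kernel \<epsilon> x y = 0"
proof -
  have "\<exists>i. \<bar>x $ i - y $ i\<bar> > \<epsilon>"
  proof (rule ccontr)
    assume "\<nexists>i. \<bar>x $ i - y $ i\<bar> > \<epsilon>"
    then have "(\<Sum>i\<in>UNIV. \<bar>(x - y) $ i\<bar>) \<le> (\<Sum>i\<in>(UNIV::3 set). \<epsilon>)" by (intro sum_mono) (auto simp: not_less)
    then show False using norm_le_l1_cart[of "x - y"] assms by simp
  qed
  then obtain i where "\<bar>x $ i - y $ i\<bar> > \<epsilon>" by blast
  then have "x $ i - y $ i \<le> 0 \<or> x $ i - y $ i \<ge> \<epsilon>" by linarith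
  then have "bump \<epsilon> (x $ i - y $ i) = 0" by (rule bump_eq_0[OF assms(1)])
  moreover have "i = 1 \<or> i = 2 \<or> i = 3" using exhaust_3[of i] .
  ultimately show ?thesis by (auto simp: moll_kernel_def)
qed

lemma moll_kernel_times_integrable:
  assumes "\<epsilon> > 0" "f \<in> borel_measurable borel" "\<And>y. \<bar>f y\<bar> \<le> B"
  shows "integrable lborel (\<lambda>y. moll_kernel \<epsilon> x y * f y)"
proof (rule Bochner_Integration.integrable_bound)
  show "integrable lborel (\<lambda>y. B * moll_kernel \<epsilon> x y)"
    using has_bochner_integral_moll_kernel[OF assms(1)] by (intro integrable_mult_right) (auto simp: has_bochner_integral_iff)
  show "AE y in lborel. norm (moll_kernel \<epsilon> x y * f y) \<le> norm (B * moll_kernel \<epsilon> x y)"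
  proof (rule AE_I2)
    fix y
    have "B \<ge> 0" using assms(3)[of y] by simp
    then show "norm (moll_kernel \<epsilon> x y * f y) \<le> norm (B * moll_kernel \<epsilon> x y)"
      using mult_left_mono[OF assms(3)[of y] abs_ge_zero[of "moll_kernel \<epsilon> x y"]] by (simp add: abs_mult mult.commute)
  qed
qed (use assms in auto)

lemma mollify_bound:
  assumes "\<epsilon> > 0" "f \<in> borel_measurable borel" "\<And>y. \<bar>f y\<bar> \<le> B"
  shows "\<bar>mollify \<epsilon> f x\<bar> \<le> B"
proof -
  have "\<bar>mollify \<epsilon> f x\<bar> \<le> (LINT y|lborel. \<bar>moll_kernel \<epsilon> x y * f y\<bar>)" unfolding mollify_def by (rule integral_abs_bound)
  also have "\<dots> \<le> (LINT y|lborel. B * moll_kernel \<epsilon> x y)"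
  proof (rule integral_mono')
    show "integrable lborel (\<lambda>y. B * moll_kernel \<epsilon> x y)"
      using has_bochner_integral_moll_kernel[OF assms(1)] by (intro integrable_mult_right) (auto simp: has_bochner_integral_iff)
    fix y
    have "B \<ge> 0" using assms(3)[of y] by simp
    then show "0 \<le> B * moll_kernel \<epsilon> x y" using moll_kernel_nonneg[OF assms(1)] by simp
    show "\<bar>moll_kernel \<epsilon> x y * f y\<bar> \<le> B * moll_kernel \<epsilon> x y"
      using mult_left_mono[OF assms(3)[of y] moll_kernel_nonneg[OF assms(1), of x y]] moll_kernel_nonneg[OF assms(1), of x y]
      by (simp add: abs_mult mult.commute)
  qed
  also have "\<dots> = B" using has_bochner_integral_moll_kernel[OF assms(1), of x] by (simp add: has_bochner_integral_iff)
  finally show ?thesis .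
qed

lemma mollify_tendsto:
  assumes f: "f \<in> borel_measurable borel" "\<And>y. \<bar>f y\<bar> \<le> B" and c: "isCont f x"
  shows "(\<lambda>n. mollify (1 / real (Suc n)) f x) \<longlonglongrightarrow> f x"
proof (rule LIMSEQ_I)
  fix r :: real assume r: "r > 0"
  obtain d where d: "d > 0" "\<And>y. dist y x < d \<Longrightarrow> dist (f y) (f x) < r / 2"
    using c r unfolding continuous_at_eps_delta by (metis half_gt_zero)
  have "(\<lambda>n. 3 * (1 / real (Suc n))) \<longlonglongrightarrow> 3 * 0"
    using LIMSEQ_inverse_real_of_nat by (intro tendsto_mult tendsto_const) (simp add: inverse_eq_divide)
  then have "\<forall>\<^sub>F n in sequentially. 3 * (1 / real (Suc n)) < d"
    by (rule order_tendstoD(2)) (use d in auto)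
  then have "\<forall>\<^sub>F n in sequentially. norm (mollify (1 / real (Suc n)) f x - f x) < r"
  proof eventually_elim
    case (elim n)
    define \<epsilon> where "\<epsilon> = 1 / real (Suc n)"
    have e: "\<epsilon> > 0" "3 * \<epsilon> < d" using elim by (auto simp: \<epsilon>_def)
    have k: "integrable lborel (moll_kernel \<epsilon> x)" "(LINT y|lborel. moll_kernel \<epsilon> x y) = 1"
      using has_bochner_integral_moll_kernel[OF e(1), of x] by (simp_all add: has_bochner_integral_iff)
    have "mollify \<epsilon> f x - f x = (LINT y|lborel. moll_kernel \<epsilon> x y * f y) - (LINT y|lborel. f x * moll_kernel \<epsilon> x y)"
      using k by (simp add: mollify_def)
    also have "\<dots> = (LINT y|lborel. moll_kernel \<epsilon> x y * f y - f x * moll_kernel \<epsilon> x y)"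
      by (rule Bochner_Integration.integral_diff[symmetric, OF moll_kernel_times_integrable[OF e(1) f] integrable_mult_right[OF k(1)]])
    also have "\<bar>\<dots>\<bar> \<le> (LINT y|lborel. \<bar>moll_kernel \<epsilon> x y * f y - f x * moll_kernel \<epsilon> x y\<bar>)" by (rule integral_abs_bound)
    also have "\<dots> \<le> (LINT y|lborel. r / 2 * moll_kernel \<epsilon> x y)"
    proof (rule integral_mono')
      show "integrable lborel (\<lambda>y. r / 2 * moll_kernel \<epsilon> x y)" by (intro integrable_mult_right k)
      fix y
      show "0 \<le> r / 2 * moll_kernel \<epsilon> x y" using moll_kernel_nonneg[OF e(1)] r by simp
      show "\<bar>moll_kernel \<epsilon> x y * f y - f x * moll_kernel \<epsilon> x y\<bar> \<le> r / 2 * moll_kernel \<epsilon> x y"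
      proof (cases "norm (x - y) > 3 * \<epsilon>")
        case False
        then have "\<bar>f y - f x\<bar> \<le> r / 2" using d(2)[of y] e(2) by (simp add: dist_norm norm_minus_commute)
        from mult_left_mono[OF this moll_kernel_nonneg[OF e(1), of x y]]
        have "\<bar>moll_kernel \<epsilon> x y * (f y - f x)\<bar> \<le> moll_kernel \<epsilon> x y * (r / 2)"
          using moll_kernel_nonneg[OF e(1), of x y] by (simp add: abs_mult)
        then show ?thesis by (simp add: algebra_simps)
      qed (simp add: moll_kernel_eq_0 e)
    qed
    also have "\<dots> = r / 2" using k by simp
    finally show ?case using r by (simp add: \<epsilon>_def)
  qed
  then show "\<exists>no. \<forall>n\<ge>no. norm (mollify (1 / real (Suc n)) f x - f x) < r" by (simp add: eventually_sequentially)
qed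

lemma has_derivative_coord_diff:
  fixes f :: "real \<Rightarrow> real"
  assumes "\<And>s. (f has_real_derivative f' s) (at s)"
  shows "((\<lambda>x::real^3. f (x $ k - c)) has_derivative (\<lambda>v. f' (x $ k - c) * v $ k)) (at x)"
    and "((\<lambda>y::real^3. f (c - y $ k)) has_derivative (\<lambda>v. - (f' (c - y $ k) * v $ k))) (at y)"
proof -
  have f: "(f has_derivative (*) (f' s)) (at s)" for s using assms[of s] by (simp add: has_field_derivative_def)
  have "((\<lambda>x::real^3. x $ k - c) has_derivative (\<lambda>v. v $ k)) (at x)"
    by (auto intro!: derivative_eq_intros bounded_linear.has_derivative[OF bounded_linear_vec_nth])
  from has_derivative_compose[OF this f]
  show "((\<lambda>x::real^3. f (x $ k - c)) has_derivative (\<lambda>v. f' (x $ k - c) * v $ k)) (at x)" .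
  have "((\<lambda>y::real^3. c - y $ k) has_derivative (\<lambda>v. - v $ k)) (at y)"
    by (auto intro!: derivative_eq_intros bounded_linear.has_derivative[OF bounded_linear_vec_nth])
  from has_derivative_compose[OF this f]
  show "((\<lambda>y::real^3. f (c - y $ k)) has_derivative (\<lambda>v. - (f' (c - y $ k) * v $ k))) (at y)" by simp
qed

text \<open>Here \<open>p\<close> stands for a row of a matrix field and \<open>r\<close> for its curl in the sense of distributions. The potential
    \<open>F x = \<integral> (k (x\<^sub>1 - y\<^sub>1) - \<tau> x\<^sub>1) b (x\<^sub>2 - y\<^sub>2) b (x\<^sub>3 - y\<^sub>3) p\<^sub>1(y) dy\<close>,
  with \<open>b\<close> the mollifying density and \<open>k\<close> its antiderivative, is an antiderivative in the first direction of the mollified \<open>p\<^sub>1\<close>; the slow step \<open>\<tau>\<close>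
  cancels the value that the antiderivative keeps behind the support of \<open>p\<close>, so that \<open>F\<close> has compact support. The correction contributes \<open>\<tau>' g\<close> to
  \<open>\<partial>\<^sub>1 F\<close>, where \<open>g\<close> is the integral of the mollified \<open>p\<^sub>1\<close> along the line through \<open>x\<close> in the first direction.
  In \<open>\<partial>\<^sub>2 F\<close> and \<open>\<partial>\<^sub>3 F\<close> the weak curl identities, tested with the kernel itself, turn the derivatives of \<open>p\<^sub>1\<close> into \<open>\<partial>\<^sub>1 p\<^sub>2\<close> and \<open>\<partial>\<^sub>1 p\<^sub>3\<close> plus
  components of \<open>r\<close>. Also \<open>g\<close> is an integral of \<open>r\<^sub>3\<close>, because the line integral vanishes far away. All components of the remainder \<open>Z\<close> are
  thus integral operators applied to \<open>r\<close>, to which Schur's test applies.\<close>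

lemma gradient_part_of_row:
  fixes p r :: "real^3 \<Rightarrow> real^3"
  assumes pm: "p \<in> borel_measurable borel" and rm: "r \<in> borel_measurable borel"
    and bd: "\<And>x. norm (p x) \<le> B" "\<And>x. norm (r x) \<le> B"
    and supp: "\<And>x. norm x > \<rho> \<Longrightarrow> p x = 0" "\<And>x. norm x > \<rho> \<Longrightarrow> r x = 0" and \<rho>: "\<rho> \<ge> 1"
    and weak3: "\<And>\<phi>. Ck_on 1 UNIV \<phi> \<Longrightarrow>
      (LINT y|lborel. r y $ 3 * \<phi> y) = (LINT y|lborel. p y $ 1 * pd 2 \<phi> y - p y $ 2 * pd 1 \<phi> y)"
    and weak2: "\<And>\<phi>. Ck_on 1 UNIV \<phi> \<Longrightarrow>
      (LINT y|lborel. r y $ 2 * \<phi> y) = (LINT y|lborel. p y $ 3 * pd 1 \<phi> y - p y $ 1 * pd 3 \<phi> y)"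
    and \<epsilon>: "0 < \<epsilon>" "\<epsilon> \<le> 1"
  shows "\<exists>F Z. (\<forall>x. (F has_derivative (\<lambda>v. ((\<chi> j. mollify \<epsilon> (\<lambda>y. p y $ j) x) - Z x) \<bullet> v)) (at x)) \<and>
      continuous_on UNIV Z \<and> continuous_on UNIV (\<lambda>x. \<chi> j. mollify \<epsilon> (\<lambda>y. p y $ j) x) \<and>
      (\<forall>x. (\<exists>i. \<bar>x $ i\<bar> > 2 * \<rho>) \<longrightarrow> F x = 0 \<and> (\<forall>j. mollify \<epsilon> (\<lambda>y. p y $ j) x = 0)) \<and>
      (\<integral>\<^sup>+x. ennreal ((norm (Z x))\<^sup>2) * indicator {x. \<forall>i. \<bar>x $ i\<bar> \<le> 2 * \<rho>} x \<partial>lborel) \<le>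
        ennreal (340 * \<rho>\<^sup>2) * (\<integral>\<^sup>+x. ennreal ((norm (r x))\<^sup>2) \<partial>lborel)"
proof -
  define \<tau> where "\<tau> s = smoothstep ((s + 2 * \<rho>) / (4 * \<rho>))" for s
  define \<tau>' where "\<tau>' s = smoothstep' ((s + 2 * \<rho>) / (4 * \<rho>)) / (4 * \<rho>)" for s
  have \<tau>: "(\<tau> has_real_derivative \<tau>' s) (at s)" for s
    unfolding \<tau>_def[abs_def] \<tau>'_def
    by (rule DERIV_cong[OF DERIV_chain2[OF smoothstep_has_derivative]]) (use \<rho> in \<open>auto intro!: derivative_eq_intros\<close>)
  have \<tau>'b: "0 \<le> \<tau>' s" "\<tau>' s \<le> 9 / (4 * \<rho>)" for s
    using smoothstep_bounds(3,4) \<rho> by (auto simp: \<tau>'_def intro!: divide_right_mono)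
  have \<tau>01: "0 \<le> \<tau> s" "\<tau> s \<le> 1" for s using smoothstep_bounds(1,2) by (auto simp: \<tau>_def)
  have \<tau>c[continuous_intros]: "continuous_on S f \<Longrightarrow> continuous_on S (\<lambda>x. \<tau> (f x))"
    "continuous_on S f \<Longrightarrow> continuous_on S (\<lambda>x. \<tau>' (f x))" for S and f :: "'z::topological_space \<Rightarrow> real"
    unfolding \<tau>_def \<tau>'_def divide_inverse by (auto intro!: continuous_intros)
  define k where "k s = smoothstep (s / \<epsilon>)" for s
  have kd: "(k has_real_derivative bump \<epsilon> s) (at s)" for s
    unfolding k_def[abs_def] by (rule smoothstep_scaled_derivative)
  have k01: "0 \<le> k s" "k s \<le> 1" for s using smoothstep_bounds(1,2) by (auto simp: k_def)
  have kc[continuous_intros]: "continuous_on S f \<Longrightarrow> continuous_on S (\<lambda>x. k (f x))" for S and f :: "'z::topological_space \<Rightarrow> real"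
    unfolding k_def divide_inverse by (auto intro!: continuous_intros)
  define A where "A x y = k (x $ 1 - y $ 1) - \<tau> (x $ 1)" for x y :: "real^3"
  have A1: "\<bar>A x y\<bar> \<le> 1" for x y using k01[of "x $ 1 - y $ 1"] \<tau>01[of "x $ 1"] by (auto simp: A_def)
  have Ac[continuous_intros]: "continuous_on S f \<Longrightarrow> continuous_on S g \<Longrightarrow> continuous_on S (\<lambda>x. A (f x) (g x))" for S and f g :: "'z::topological_space \<Rightarrow> real^3"
    unfolding A_def by (auto intro!: continuous_intros)
  let ?b = "\<lambda>j x y::real^3. bump \<epsilon> (x $ j - y $ j)"
  let ?b' = "\<lambda>j x y::real^3. bump' \<epsilon> (x $ j - y $ j)"
  define G where "G x y = A x y * ?b 2 x y * ?b 3 x y" for x y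
  define G' where "G' x y v = (?b 1 x y - \<tau>' (x $ 1)) * v $ 1 * ?b 2 x y * ?b 3 x y
      + A x y * (?b' 2 x y * v $ 2) * ?b 3 x y + A x y * ?b 2 x y * (?b' 3 x y * v $ 3)" for x y and v :: "real^3"
  have Ad: "((\<lambda>x. A x y) has_derivative (\<lambda>v. (?b 1 x y - \<tau>' (x $ 1)) * v $ 1)) (at x)" for x y
    using has_derivative_diff[OF has_derivative_coord_diff(1)[OF kd, of 1 "y $ 1" x] has_derivative_coord_diff(1)[OF \<tau>, of 1 0 x]]
    by (simp add: A_def[abs_def] algebra_simps)
  note bd1 = has_derivative_coord_diff(1)[OF bump_derivative]
  have Gd: "((\<lambda>x. G x y) has_derivative G' x y) (at x)" for x y
    unfolding G_def
    by (rule has_derivative_eq_rhs[OF has_derivative_mult[OF has_derivative_mult[OF Ad[of y x] bd1[of \<epsilon> 2 "y $ 2" x]] bd1[of \<epsilon> 3 "y $ 3" x]]])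
      (auto simp: G'_def fun_eq_iff algebra_simps)
  have Gc: "continuous_on UNIV (\<lambda>(x, y). G x y)"
    unfolding G_def case_prod_unfold by (intro continuous_intros)
  have G'c: "continuous_on UNIV (\<lambda>(x, y). G' x y b)" for b
    unfolding G'_def case_prod_unfold by (intro continuous_intros)
  have Gy: "continuous_on UNIV (G x)" for x
    unfolding G_def[abs_def] by (intro continuous_intros)
  have G'y: "continuous_on UNIV (\<lambda>y. G' x y b)" for x b
    unfolding G'_def[abs_def] by (intro continuous_intros)
  \<comment> \<open>continuous kernels are integrable against the bounded, compactly supported \<open>p\<close> and \<open>r\<close>\<close>
  have pjm[measurable]: "(\<lambda>y. p y $ j) \<in> borel_measurable borel" and rjm[measurable]: "(\<lambda>y. r y $ j) \<in> borel_measurable borel" for j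
    by (rule borel_measurable_continuous_on[OF _ pm], intro continuous_intros)
       (rule borel_measurable_continuous_on[OF _ rm], intro continuous_intros)
  have pb: "\<bar>p y $ j\<bar> \<le> B" and rb: "\<bar>r y $ j\<bar> \<le> B" for y j
    using order_trans[OF Finite_Cartesian_Product.norm_nth_le bd(1)[of y]] order_trans[OF Finite_Cartesian_Product.norm_nth_le bd(2)[of y]] by simp_all
  have pi: "integrable lborel (\<lambda>y. p y $ j)" and ri: "integrable lborel (\<lambda>y. r y $ j)" for j
    by (rule integrable_bounded_support[OF pjm pb, where R = \<rho>], simp add: supp)
       (rule integrable_bounded_support[OF rjm rb, where R = \<rho>], simp add: supp)
  have p0: "y \<notin> cball 0 \<rho> \<Longrightarrow> p y $ j = 0" and r0: "y \<notin> cball 0 \<rho> \<Longrightarrow> r y $ j = 0" for y j using supp by auto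
  have ci: "continuous_on UNIV H \<Longrightarrow> integrable lborel (\<lambda>y. H y * p y $ j)"
    "continuous_on UNIV H \<Longrightarrow> integrable lborel (\<lambda>y. H y * r y $ j)" for H :: "real^3 \<Rightarrow> real" and j
  proof -
    assume H: "continuous_on UNIV H"
    have [measurable]: "H \<in> borel_measurable borel" by (rule borel_measurable_continuous_onI[OF H])
    obtain M where M: "\<And>y. y \<in> cball 0 \<rho> \<Longrightarrow> norm (H y) \<le> M" "M \<ge> 0"
      using continuous_on_bounded_above[OF H compact_cball[of 0 \<rho>]] by auto
    have "\<bar>H y * f y $ j\<bar> \<le> M * B * indicator (cball 0 \<rho>) y" if "\<And>y. \<bar>f y $ j\<bar> \<le> B" "\<And>y. norm y > \<rho> \<Longrightarrow> f y $ j = 0" for f :: "real^3 \<Rightarrow> real^3" and y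
    proof (cases "y \<in> cball 0 \<rho>")
      case True
      have "\<bar>H y\<bar> * \<bar>f y $ j\<bar> \<le> M * B" using M(1)[OF True] M(2) that(1)[of y] by (intro mult_mono) auto
      then show ?thesis using True by (simp add: abs_mult)
    qed (use that(2) in auto)
    note hb = this
    have hi: "integrable lborel (\<lambda>y. H y * f y $ j)"
      if "\<And>y. \<bar>f y $ j\<bar> \<le> B" "\<And>y. norm y > \<rho> \<Longrightarrow> f y $ j = 0" "(\<lambda>y. f y $ j) \<in> borel_measurable borel" for f :: "real^3 \<Rightarrow> real^3"
    proof (rule integrable_dominated_by_compact[OF _ compact_cball[of 0 \<rho>] AE_I2[OF hb[OF that(1,2)]]])
      show "(\<lambda>y. H y * f y $ j) \<in> borel_measurable borel"
        by (rule borel_measurable_times[OF _ that(3)]) simp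
    qed
    show "integrable lborel (\<lambda>y. H y * p y $ j)" by (rule hi[OF pb _ pjm]) (simp add: supp)
    show "integrable lborel (\<lambda>y. H y * r y $ j)" by (rule hi[OF rb _ rjm]) (simp add: supp)
  qed
  define F where "F x = (LINT y|lborel. G x y * p y $ 1)" for x
  define g where "g x = (LINT y|lborel. (?b 2 x y * ?b 3 x y) * p y $ 1)" for x
  define Z where "Z x = (vector [\<tau>' (x $ 1) * g x, (LINT y|lborel. G x y * r y $ 3), - (LINT y|lborel. G x y * r y $ 2)] :: real^3)" for x
  have Fd: "(F has_derivative (\<lambda>v. LINT y|lborel. G' x y v * p y $ 1)) (at x)" for x
    unfolding F_def[abs_def]
    by (rule has_derivative_integral_kernel[OF Gd G'c Gy pi compact_cball[of 0 \<rho>] p0]) simp_all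
  \<comment> \<open>for fixed \<open>x\<close> the kernel is an admissible test function of \<open>y\<close>\<close>
  define D where "D x y v = - (?b 1 x y * v $ 1 * ?b 2 x y * ?b 3 x y
      + A x y * (?b' 2 x y * v $ 2) * ?b 3 x y + A x y * ?b 2 x y * (?b' 3 x y * v $ 3))" for x y and v :: "real^3"
  have Gdy: "(G x has_derivative D x y) (at y)" for x y
  proof -
    have "((\<lambda>y. A x y) has_derivative (\<lambda>v. - (?b 1 x y * v $ 1))) (at y)"
      using has_derivative_diff[OF has_derivative_coord_diff(2)[OF kd, of "x $ 1" 1 y] has_derivative_const[of "\<tau> (x $ 1)"]]
      by (simp add: A_def[abs_def])
    note d = has_derivative_mult[OF has_derivative_mult[OF this has_derivative_coord_diff(2)[OF bump_derivative, of \<epsilon> "x $ 2" 2 y]]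
        has_derivative_coord_diff(2)[OF bump_derivative, of \<epsilon> "x $ 3" 3 y]]
    show ?thesis
      unfolding G_def[abs_def]
      by (rule has_derivative_eq_rhs[OF d]) (auto simp: D_def fun_eq_iff algebra_simps)
  qed
  have CG: "Ck_on 1 UNIV (G x)" for x
    unfolding Ck1_iff[OF open_UNIV]
    by (intro exI[of _ "D x"] conjI ballI Gdy) (auto simp: D_def[abs_def] intro!: continuous_intros)
  have pdG: "pd j (G x) y = D x y (axis j 1)" for x y j by (rule pd_eq[OF Gdy])
  have ax: "axis (i::3) (1::real) $ j = (if i = j then 1 else 0)" for i j by (simp add: axis_def)
  have d1: "(LINT y|lborel. G' x y (axis 1 1) * p y $ 1) = mollify \<epsilon> (\<lambda>y. p y $ 1) x - \<tau>' (x $ 1) * g x" for x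
  proof -
    have "G' x y (axis 1 1) * p y $ 1 = moll_kernel \<epsilon> x y * p y $ 1 - \<tau>' (x $ 1) * ((?b 2 x y * ?b 3 x y) * p y $ 1)" for y
      by (simp add: G'_def ax moll_kernel_def algebra_simps)
    then have "(LINT y|lborel. G' x y (axis 1 1) * p y $ 1) =
        (LINT y|lborel. moll_kernel \<epsilon> x y * p y $ 1 - \<tau>' (x $ 1) * ((?b 2 x y * ?b 3 x y) * p y $ 1))" by simp
    also have "\<dots> = mollify \<epsilon> (\<lambda>y. p y $ 1) x - \<tau>' (x $ 1) * g x"
      unfolding mollify_def g_def
      by (subst Bochner_Integration.integral_diff) (auto intro!: moll_kernel_times_integrable[OF \<epsilon>(1) pjm pb] integrable_mult_right ci continuous_intros)
    finally show ?thesis .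
  qed
  have d2: "(LINT y|lborel. G' x y (axis 2 1) * p y $ 1) = mollify \<epsilon> (\<lambda>y. p y $ 2) x - (LINT y|lborel. G x y * r y $ 3)" for x
  proof -
    have e: "p y $ 1 * pd 2 (G x) y - p y $ 2 * pd 1 (G x) y = moll_kernel \<epsilon> x y * p y $ 2 - G' x y (axis 2 1) * p y $ 1" for y
      by (simp add: pdG G'_def D_def ax moll_kernel_def algebra_simps)
    have "(LINT y|lborel. G x y * r y $ 3) = (LINT y|lborel. moll_kernel \<epsilon> x y * p y $ 2 - G' x y (axis 2 1) * p y $ 1)"
      using weak3[OF CG[of x]] unfolding e by (simp add: mult.commute)
    also have "\<dots> = mollify \<epsilon> (\<lambda>y. p y $ 2) x - (LINT y|lborel. G' x y (axis 2 1) * p y $ 1)"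
      unfolding mollify_def by (rule Bochner_Integration.integral_diff[OF moll_kernel_times_integrable[OF \<epsilon>(1) pjm pb] ci(1)[OF G'y]])
    finally show ?thesis by simp
  qed
  have d3: "(LINT y|lborel. G' x y (axis 3 1) * p y $ 1) = mollify \<epsilon> (\<lambda>y. p y $ 3) x + (LINT y|lborel. G x y * r y $ 2)" for x
  proof -
    have e: "p y $ 3 * pd 1 (G x) y - p y $ 1 * pd 3 (G x) y = G' x y (axis 3 1) * p y $ 1 - moll_kernel \<epsilon> x y * p y $ 3" for y
      by (simp add: pdG G'_def D_def ax moll_kernel_def algebra_simps)
    have "(LINT y|lborel. G x y * r y $ 2) = (LINT y|lborel. G' x y (axis 3 1) * p y $ 1 - moll_kernel \<epsilon> x y * p y $ 3)"
      using weak2[OF CG[of x]] unfolding e by (simp add: mult.commute)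
    also have "\<dots> = (LINT y|lborel. G' x y (axis 3 1) * p y $ 1) - mollify \<epsilon> (\<lambda>y. p y $ 3) x"
      unfolding mollify_def by (rule Bochner_Integration.integral_diff[OF ci(1)[OF G'y] moll_kernel_times_integrable[OF \<epsilon>(1) pjm pb]])
    finally show ?thesis by simp
  qed
  have Fd': "(F has_derivative (\<lambda>v. ((\<chi> j. mollify \<epsilon> (\<lambda>y. p y $ j) x) - Z x) \<bullet> v)) (at x)" for x
  proof -
    have lin: "linear (\<lambda>v. LINT y|lborel. G' x y v * p y $ 1)" using Fd has_derivative_linear by blast
    have "(LINT y|lborel. G' x y v * p y $ 1) = ((\<chi> j. mollify \<epsilon> (\<lambda>y. p y $ j) x) - Z x) \<bullet> v" for v
    proof -
      have v: "v = v $ 1 *\<^sub>R axis 1 1 + v $ 2 *\<^sub>R axis 2 1 + v $ 3 *\<^sub>R axis 3 1"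
        by (simp add: vec_eq_iff forall_3 ax)
      have "(LINT y|lborel. G' x y v * p y $ 1) = v $ 1 * (LINT y|lborel. G' x y (axis 1 1) * p y $ 1)
        + v $ 2 * (LINT y|lborel. G' x y (axis 2 1) * p y $ 1) + v $ 3 * (LINT y|lborel. G' x y (axis 3 1) * p y $ 1)"
        by (subst v) (simp only: linear_add[OF lin] linear_cmul[OF lin] real_scaleR_def)
      also have "\<dots> = ((\<chi> j. mollify \<epsilon> (\<lambda>y. p y $ j) x) - Z x) \<bullet> v"
        unfolding d1 d2 d3 by (simp add: inner_vec_def sum_3 Z_def vector_3 algebra_simps)
      finally show ?thesis .
    qed
    then show ?thesis using Fd[of x] by simp
  qed
  have gw: "g x = - (LINT y|lborel. (k (x $ 2 - y $ 2) * ?b 3 x y) * r y $ 3)" for x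
  proof -
    let ?\<phi> = "\<lambda>y. k (x $ 2 - y $ 2) * ?b 3 x y"
    define E where "E y v = - (?b 2 x y * v $ 2 * ?b 3 x y + k (x $ 2 - y $ 2) * (?b' 3 x y * v $ 3))" for y and v :: "real^3"
    have Ed: "(?\<phi> has_derivative E y) (at y)" for y
      using has_derivative_mult[OF has_derivative_coord_diff(2)[OF kd, of "x $ 2" 2 y] has_derivative_coord_diff(2)[OF bump_derivative, of \<epsilon> "x $ 3" 3 y]]
      by (rule has_derivative_eq_rhs) (auto simp: E_def fun_eq_iff algebra_simps)
    have C: "Ck_on 1 UNIV ?\<phi>"
      unfolding Ck1_iff[OF open_UNIV]
      by (intro exI[of _ E] conjI ballI Ed) (auto simp: E_def[abs_def] intro!: continuous_intros)
    have e: "p y $ 1 * pd 2 ?\<phi> y - p y $ 2 * pd 1 ?\<phi> y = - ((?b 2 x y * ?b 3 x y) * p y $ 1)" for y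
      by (simp add: pd_eq[OF Ed] E_def ax algebra_simps)
    show ?thesis using weak3[OF C] unfolding e g_def by (simp add: mult.commute)
  qed
  have cg: "continuous_on UNIV g"
    unfolding g_def[abs_def]
    by (rule continuous_integral_kernel[OF _ pi compact_cball[of 0 \<rho>] p0]) (auto simp: case_prod_unfold intro!: continuous_intros)
  have cZ: "continuous_on UNIV Z"
  proof -
    have r: "continuous_on UNIV (\<lambda>x. LINT y|lborel. G x y * r y $ j)" for j
      by (rule continuous_integral_kernel[OF Gc ri compact_cball[of 0 \<rho>] r0]) simp_all
    have "continuous_on UNIV (\<lambda>x. Z x $ 1)" "continuous_on UNIV (\<lambda>x. Z x $ 2)" "continuous_on UNIV (\<lambda>x. Z x $ 3)"
      unfolding Z_def vector_3 by (intro continuous_on_mult continuous_on_minus cg r \<tau>c continuous_on_component continuous_on_id)+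
    then have "continuous_on UNIV (\<lambda>x. Z x $ j)" for j using exhaust_3[of j] by auto
    then show ?thesis using continuous_on_vec_lambda[of UNIV "\<lambda>j x. Z x $ j"] by simp
  qed
  have cM: "continuous_on UNIV (\<lambda>x. \<chi> j. mollify \<epsilon> (\<lambda>y. p y $ j) x)"
    unfolding mollify_def moll_kernel_def
    by (intro continuous_on_vec_lambda continuous_integral_kernel[OF _ pi compact_cball[of 0 \<rho>] p0]) (auto simp: case_prod_unfold intro!: continuous_intros)
  have bz: "?b j x y = 0" if "\<bar>x $ j\<bar> > 2 * \<rho>" "y \<in> cball 0 \<rho>" for x y j
  proof -
    have "\<bar>y $ j\<bar> \<le> \<rho>" using that(2) component_le_norm_cart[of y j] by simp
    then show ?thesis using that(1) \<epsilon> \<rho> by (intro bump_eq_0) auto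
  qed
  have out: "F x = 0 \<and> (\<forall>j. mollify \<epsilon> (\<lambda>y. p y $ j) x = 0)" if ob: "\<bar>x $ i\<bar> > 2 * \<rho>" for x i
  proof -
    have G0: "G x y = 0" if y: "y \<in> cball 0 \<rho>" for y
    proof -
      have "i = 1 \<or> i = 2 \<or> i = 3" using exhaust_3[of i] .
      moreover have "A x y = 0" if "i = 1"
      proof -
        have y1: "\<bar>y $ 1\<bar> \<le> \<rho>" using y component_le_norm_cart[of y 1] by simp
        show ?thesis
        proof (cases "x $ 1 > 0")
          case True
          then have "x $ 1 > 2 * \<rho>" using ob \<open>i = 1\<close> by simp
          then have "(x $ 1 - y $ 1) / \<epsilon> \<ge> 1" "(x $ 1 + 2 * \<rho>) / (4 * \<rho>) \<ge> 1"
            using y1 \<rho> \<epsilon> by (auto simp: le_divide_eq)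
          then show ?thesis by (simp add: A_def k_def \<tau>_def smoothstep_eq_1)
        next
          case False
          then have "x $ 1 < - 2 * \<rho>" using ob \<open>i = 1\<close> by simp
          then have "(x $ 1 - y $ 1) / \<epsilon> \<le> 0" "(x $ 1 + 2 * \<rho>) / (4 * \<rho>) \<le> 0"
            using y1 \<rho> \<epsilon> by (auto simp: divide_le_0_iff)
          then show ?thesis by (simp add: A_def k_def \<tau>_def smoothstep_eq_0)
        qed
      qed
      ultimately show ?thesis using bz[OF ob y] by (auto simp: G_def)
    qed
    have "moll_kernel \<epsilon> x y = 0" if y: "y \<in> cball 0 \<rho>" for y
      using bz[OF ob y] exhaust_3[of i] by (auto simp: moll_kernel_def)
    then have e: "moll_kernel \<epsilon> x y * p y $ j = 0" "G x y * p y $ 1 = 0" for y j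
      using G0[of y] p0[of y] by (cases "y \<in> cball 0 \<rho>"; simp)+
    show ?thesis unfolding F_def mollify_def e by simp
  qed
  \<comment> \<open>\<open>w2\<close> dominates the kernel \<open>G\<close> of the last two components of \<open>Z\<close>, and \<open>w1\<close> that of \<open>g\<close>, for \<open>x\<close> in the box and \<open>y\<close> in the support\<close>
  define I where "I c t = (indicator {- c..c} t :: real)" for c t :: real
  define w2 where "w2 x y = I (2 * \<rho>) (x $ 1) * I \<rho> (y $ 1) * ?b 2 x y * ?b 3 x y" for x y
  define w1 where "w1 x y = I (2 * \<rho>) (x $ 1) * I (2 * \<rho>) (x $ 2) * I \<rho> (y $ 1) * I \<rho> (y $ 2) * ?b 3 x y" for x y
  define \<sigma> where "\<sigma> y = norm (r y)" for y
  have \<sigma>m[measurable]: "\<sigma> \<in> borel_measurable borel" unfolding \<sigma>_def using rm by measurable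
  have I0: "I c t \<ge> 0" "I c t \<le> 1" for c t by (auto simp: I_def indicator_def)
  have Im[measurable]: "I c \<in> borel_measurable borel" for c unfolding I_def[abs_def] by measurable
  have In: "(\<integral>\<^sup>+t. ennreal (I c t) \<partial>lborel) = ennreal (2 * c)" if "c \<ge> 0" for c
    using that by (simp add: I_def ennreal_indicator)
  have b0: "bump \<epsilon> s \<ge> 0" for s by (rule bump_nonneg[OF \<epsilon>(1)])
  have w0: "w2 x y \<ge> 0" "w1 x y \<ge> 0" for x y using I0 b0 by (auto simp: w1_def w2_def)
  have wm: "case_prod w2 \<in> borel_measurable (borel \<Otimes>\<^sub>M borel)" "case_prod w1 \<in> borel_measurable (borel \<Otimes>\<^sub>M borel)"
    unfolding w1_def w2_def case_prod_unfold by measurable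
  have N: "(\<integral>\<^sup>+y. ennreal (f1 ((y::real^3) $ 1) * f2 (y $ 2) * f3 (y $ 3)) \<partial>lborel) \<le> ennreal (a1 * a2 * a3)"
    if f: "\<And>t. f1 t \<ge> 0" "\<And>t. f2 t \<ge> 0" "\<And>t. f3 t \<ge> 0" "a1 \<ge> 0" "a2 \<ge> 0" "a3 \<ge> 0"
      and [measurable]: "f1 \<in> borel_measurable borel" "f2 \<in> borel_measurable borel" "f3 \<in> borel_measurable borel"
      and le: "(\<integral>\<^sup>+t. ennreal (f1 t) \<partial>lborel) \<le> ennreal a1" "(\<integral>\<^sup>+t. ennreal (f2 t) \<partial>lborel) \<le> ennreal a2" "(\<integral>\<^sup>+t. ennreal (f3 t) \<partial>lborel) \<le> ennreal a3"
    for f1 f2 f3 :: "real \<Rightarrow> real" and a1 a2 a3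
  proof -
    have "(\<integral>\<^sup>+y. ennreal (f1 ((y::real^3) $ 1) * f2 (y $ 2) * f3 (y $ 3)) \<partial>lborel) =
        (\<integral>\<^sup>+y. ennreal (f1 ((y::real^3) $ 1)) * ennreal (f2 (y $ 2)) * ennreal (f3 (y $ 3)) \<partial>lborel)"
      using f by (simp add: ennreal_mult)
    also have "\<dots> = (\<integral>\<^sup>+t. ennreal (f1 t) \<partial>lborel) * (\<integral>\<^sup>+t. ennreal (f2 t) \<partial>lborel) * (\<integral>\<^sup>+t. ennreal (f3 t) \<partial>lborel)"
      by (rule nn_integral_vec3) measurable
    also have "\<dots> \<le> ennreal a1 * ennreal a2 * ennreal a3" by (intro mult_mono le) auto
    finally show ?thesis using f by (simp add: ennreal_mult)
  qed
  have nb: "(\<integral>\<^sup>+t. ennreal (bump \<epsilon> (t - c)) \<partial>lborel) \<le> ennreal 1" "(\<integral>\<^sup>+t. ennreal (bump \<epsilon> (c - t)) \<partial>lborel) \<le> ennreal 1" for c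
    by (simp_all add: nn_integral_bump[OF \<epsilon>(1)])
  have cI: "(\<integral>\<^sup>+t. ennreal (a * I c t) \<partial>lborel) \<le> ennreal (2 * c)" if "0 \<le> a" "a \<le> 1" "c \<ge> 0" for a c
  proof -
    have "(\<integral>\<^sup>+t. ennreal (a * I c t) \<partial>lborel) \<le> (\<integral>\<^sup>+t. ennreal (I c t) \<partial>lborel)"
      using that I0 by (intro nn_integral_mono ennreal_leI) (auto simp: mult_left_le_one_le)
    then show ?thesis using In[OF that(3)] by simp
  qed
  have w2y: "(\<integral>\<^sup>+y. ennreal (w2 x y) \<partial>lborel) \<le> ennreal (2 * \<rho>)" for x
  proof -
    have "(\<integral>\<^sup>+y. ennreal (w2 x y) \<partial>lborel) \<le> ennreal (2 * \<rho> * 1 * 1)"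
      unfolding w2_def by (rule N[of "\<lambda>t. I (2 * \<rho>) (x $ 1) * I \<rho> t"]) (use I0 b0 \<rho> nb cI in auto)
    then show ?thesis by simp
  qed
  have w2x: "(\<integral>\<^sup>+x. ennreal (w2 x y) \<partial>lborel) \<le> ennreal (4 * \<rho>)" for y
  proof -
    have "(\<integral>\<^sup>+x. ennreal ((I \<rho> (y $ 1) * I (2 * \<rho>) (x $ 1)) * ?b 2 x y * ?b 3 x y) \<partial>lborel) \<le> ennreal (2 * (2 * \<rho>) * 1 * 1)"
      by (rule N[of "\<lambda>t. I \<rho> (y $ 1) * I (2 * \<rho>) t"]) (use I0 b0 \<rho> nb cI[of "I \<rho> (y $ 1)" "2 * \<rho>"] in auto)
    then show ?thesis by (simp add: w2_def mult_ac)
  qed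
  have w1y: "(\<integral>\<^sup>+y. ennreal (w1 x y) \<partial>lborel) \<le> ennreal ((2 * \<rho>) * (2 * \<rho>))" for x
  proof -
    have "(\<integral>\<^sup>+y. ennreal ((I (2 * \<rho>) (x $ 1) * I \<rho> (y $ 1)) * (I (2 * \<rho>) (x $ 2) * I \<rho> (y $ 2)) * ?b 3 x y) \<partial>lborel) \<le> ennreal ((2 * \<rho>) * (2 * \<rho>) * 1)"
      by (rule N[of "\<lambda>t. I (2 * \<rho>) (x $ 1) * I \<rho> t" "\<lambda>t. I (2 * \<rho>) (x $ 2) * I \<rho> t"]) (use I0 b0 \<rho> nb cI in auto)
    then show ?thesis by (simp add: w1_def mult_ac)
  qed
  have w1x: "(\<integral>\<^sup>+x. ennreal (w1 x y) \<partial>lborel) \<le> ennreal ((4 * \<rho>) * (4 * \<rho>))" for y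
  proof -
    have "(\<integral>\<^sup>+x. ennreal ((I \<rho> (y $ 1) * I (2 * \<rho>) (x $ 1)) * (I \<rho> (y $ 2) * I (2 * \<rho>) (x $ 2)) * ?b 3 x y) \<partial>lborel) \<le> ennreal ((2 * (2 * \<rho>)) * (2 * (2 * \<rho>)) * 1)"
      by (rule N[of "\<lambda>t. I \<rho> (y $ 1) * I (2 * \<rho>) t" "\<lambda>t. I \<rho> (y $ 2) * I (2 * \<rho>) t"])
        (use I0 b0 \<rho> nb cI[of _ "2 * \<rho>"] in auto)
    then show ?thesis by (simp add: w1_def mult_ac)
  qed
  let ?X = "{x::real^3. \<forall>i. \<bar>x $ i\<bar> \<le> 2 * \<rho>}"
  have IX: "I (2 * \<rho>) (x $ i) = 1" if "x \<in> ?X" for x i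
  proof -
    have "\<bar>x $ i\<bar> \<le> 2 * \<rho>" using that by blast
    then have "- (2 * \<rho>) \<le> x $ i" "x $ i \<le> 2 * \<rho>" by linarith+
    then show ?thesis by (simp add: I_def)
  qed
  have IY: "I \<rho> (y $ i) = 1" if "y \<in> cball 0 \<rho>" for y i
    using that component_le_norm_cart[of y i] by (auto simp: I_def indicator_def abs_le_iff)
  have wb: "ennreal \<bar>LINT y|lborel. H y * r y $ j\<bar> \<le> (\<integral>\<^sup>+y. ennreal (w y * \<sigma> y) \<partial>lborel)"
    if H: "continuous_on UNIV H" and w: "\<And>y. y \<in> cball 0 \<rho> \<Longrightarrow> \<bar>H y\<bar> \<le> w y" and w0: "\<And>y. w y \<ge> 0" for H w j
  proof -
    have "ennreal (norm (LINT y|lborel. H y * r y $ j)) \<le> (\<integral>\<^sup>+y. ennreal (norm (H y * r y $ j)) \<partial>lborel)"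
      by (rule integral_norm_bound_ennreal[OF ci(2)[OF H]])
    also have "\<dots> \<le> (\<integral>\<^sup>+y. ennreal (w y * \<sigma> y) \<partial>lborel)"
    proof (intro nn_integral_mono ennreal_leI)
      fix y
      show "norm (H y * r y $ j) \<le> w y * \<sigma> y"
      proof (cases "y \<in> cball 0 \<rho>")
        case True
        then show ?thesis unfolding norm_mult \<sigma>_def using w[OF True] w0[of y] Finite_Cartesian_Product.norm_nth_le[of "r y" j]
          by (intro mult_mono) auto
      next
        case False
        then show ?thesis using r0 w0 by (simp add: \<sigma>_def)
      qed
    qed
    finally show ?thesis by simp
  qed
  define S where "S = (\<integral>\<^sup>+y. ennreal ((\<sigma> y)\<^sup>2) \<partial>lborel)"
  define V2 where "V2 x = (\<integral>\<^sup>+y. ennreal (w2 x y * \<sigma> y) \<partial>lborel)" for x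
  define V1 where "V1 x = (\<integral>\<^sup>+y. ennreal (w1 x y * \<sigma> y) \<partial>lborel)" for x
  have \<sigma>0: "\<sigma> y \<ge> 0" for y by (simp add: \<sigma>_def)
  have SV2: "(\<integral>\<^sup>+x. (V2 x)\<^sup>2 \<partial>lborel) \<le> ennreal ((2 * \<rho>) * (4 * \<rho>)) * S"
    unfolding V2_def S_def by (rule schur_test[OF wm(1) w0(1) \<sigma>m \<sigma>0 _ _ w2y w2x]) (use \<rho> in auto)
  have SV1: "(\<integral>\<^sup>+x. (V1 x)\<^sup>2 \<partial>lborel) \<le> ennreal (((2 * \<rho>) * (2 * \<rho>)) * ((4 * \<rho>) * (4 * \<rho>))) * S"
    unfolding V1_def S_def by (rule schur_test[OF wm(2) w0(2) \<sigma>m \<sigma>0 _ _ w1y w1x]) (use \<rho> in auto)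
  have V2m[measurable]: "V2 \<in> borel_measurable lborel" and V1m[measurable]: "V1 \<in> borel_measurable lborel"
  proof -
    have "(\<lambda>(x, y). ennreal (w2 x y * \<sigma> y)) \<in> borel_measurable (lborel \<Otimes>\<^sub>M lborel)"
      "(\<lambda>(x, y). ennreal (w1 x y * \<sigma> y)) \<in> borel_measurable (lborel \<Otimes>\<^sub>M lborel)"
      unfolding w1_def w2_def case_prod_unfold by measurable
    then show "V2 \<in> borel_measurable lborel" "V1 \<in> borel_measurable lborel"
      unfolding V2_def[abs_def] V1_def[abs_def] by (auto dest: lborel.borel_measurable_nn_integral)
  qed
  define c where "c = 9 / (4 * \<rho>)"
  have c0: "c \<ge> 0" using \<rho> by (simp add: c_def)
  have Zb: "ennreal ((norm (Z x))\<^sup>2) * indicator ?X x \<le> ennreal (c\<^sup>2) * (V1 x)\<^sup>2 + 2 * (V2 x)\<^sup>2" for x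
  proof (cases "x \<in> ?X")
    case True
    have z2: "ennreal \<bar>LINT y|lborel. G x y * r y $ j\<bar> \<le> V2 x" for j
      unfolding V2_def
    proof (rule wb[OF Gy])
      fix y :: "real^3" assume y: "y \<in> cball 0 \<rho>"
      have "\<bar>G x y\<bar> = \<bar>A x y\<bar> * (?b 2 x y * ?b 3 x y)" using b0 by (simp add: G_def abs_mult mult.assoc)
      also have "\<dots> \<le> 1 * (?b 2 x y * ?b 3 x y)" using A1 b0 by (intro mult_right_mono) auto
      also have "\<dots> = w2 x y" using IX[OF True] IY[OF y] by (simp add: w2_def)
      finally show "\<bar>G x y\<bar> \<le> w2 x y" .
    qed (rule w0)
    have z1: "ennreal \<bar>g x\<bar> \<le> V1 x"
    proof -
      have "ennreal \<bar>LINT y|lborel. (k (x $ 2 - y $ 2) * ?b 3 x y) * r y $ 3\<bar> \<le> V1 x"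
        unfolding V1_def
      proof (rule wb)
        show "continuous_on UNIV (\<lambda>y. k (x $ 2 - y $ 2) * ?b 3 x y)" by (intro continuous_intros)
        fix y :: "real^3" assume y: "y \<in> cball 0 \<rho>"
        have "\<bar>k (x $ 2 - y $ 2) * ?b 3 x y\<bar> = k (x $ 2 - y $ 2) * ?b 3 x y" using b0 k01 by (simp add: abs_mult)
        also have "\<dots> \<le> 1 * ?b 3 x y" using k01 b0 by (intro mult_right_mono) auto
        also have "\<dots> = w1 x y" using IX[OF True] IY[OF y] by (simp add: w1_def)
        finally show "\<bar>k (x $ 2 - y $ 2) * ?b 3 x y\<bar> \<le> w1 x y" .
      qed (rule w0)
      then show ?thesis by (simp add: gw)
    qed
    have sq: "ennreal (s\<^sup>2) \<le> V\<^sup>2" if "ennreal \<bar>s\<bar> \<le> V" for s V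
    proof -
      have "ennreal (s\<^sup>2) = (ennreal \<bar>s\<bar>)\<^sup>2" by (simp add: ennreal_power)
      then show ?thesis using that by (simp add: power_mono)
    qed
    have "(norm (Z x))\<^sup>2 = (\<tau>' (x $ 1))\<^sup>2 * (g x)\<^sup>2 + (LINT y|lborel. G x y * r y $ 3)\<^sup>2 + (LINT y|lborel. G x y * r y $ 2)\<^sup>2"
      unfolding power2_norm_eq_inner inner_vec_def sum_3 Z_def vector_3 by (simp add: power2_eq_square)
    also have "\<dots> \<le> c\<^sup>2 * (g x)\<^sup>2 + (LINT y|lborel. G x y * r y $ 3)\<^sup>2 + (LINT y|lborel. G x y * r y $ 2)\<^sup>2"
      using \<tau>'b[of "x $ 1"] by (intro add_right_mono mult_right_mono power_mono) (auto simp: c_def)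
    finally have "ennreal ((norm (Z x))\<^sup>2) \<le> ennreal (c\<^sup>2) * ennreal ((g x)\<^sup>2) + ennreal ((LINT y|lborel. G x y * r y $ 3)\<^sup>2) + ennreal ((LINT y|lborel. G x y * r y $ 2)\<^sup>2)"
      by (simp add: ennreal_mult[symmetric] ennreal_plus[symmetric] ennreal_leI del: ennreal_plus)
    also have "\<dots> \<le> ennreal (c\<^sup>2) * (V1 x)\<^sup>2 + (V2 x)\<^sup>2 + (V2 x)\<^sup>2"
      by (intro add_mono mult_left_mono sq z1 z2) auto
    also have "\<dots> = ennreal (c\<^sup>2) * (V1 x)\<^sup>2 + 2 * (V2 x)\<^sup>2" by (simp only: mult_2 add.assoc)
    finally have le: "ennreal ((norm (Z x))\<^sup>2) \<le> ennreal (c\<^sup>2) * (V1 x)\<^sup>2 + 2 * (V2 x)\<^sup>2" .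
    have "indicator ?X x = (1 :: ennreal)" using True by (rule indicator_simps(1))
    then show ?thesis using le by (simp only: mult_1_right)
  qed simp
  have "(\<integral>\<^sup>+x. ennreal ((norm (Z x))\<^sup>2) * indicator ?X x \<partial>lborel) \<le> (\<integral>\<^sup>+x. ennreal (c\<^sup>2) * (V1 x)\<^sup>2 + 2 * (V2 x)\<^sup>2 \<partial>lborel)"
    by (rule nn_integral_mono) (rule Zb)
  also have "\<dots> = ennreal (c\<^sup>2) * (\<integral>\<^sup>+x. (V1 x)\<^sup>2 \<partial>lborel) + 2 * (\<integral>\<^sup>+x. (V2 x)\<^sup>2 \<partial>lborel)"
    by (simp add: nn_integral_add nn_integral_cmult)
  also have "\<dots> \<le> ennreal (c\<^sup>2) * (ennreal (((2 * \<rho>) * (2 * \<rho>)) * ((4 * \<rho>) * (4 * \<rho>))) * S) + 2 * (ennreal ((2 * \<rho>) * (4 * \<rho>)) * S)"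
    by (intro add_mono mult_left_mono SV1 SV2) auto
  \<comment> \<open>\<open>c\<^sup>2 * 64 \<rho>\<^sup>4 = 324 \<rho>\<^sup>2\<close> and \<open>2 * 8 \<rho>\<^sup>2 = 16 \<rho>\<^sup>2\<close>\<close>
  also have "\<dots> = ennreal (340 * \<rho>\<^sup>2) * S"
  proof -
    have "ennreal (c\<^sup>2) * (ennreal (((2 * \<rho>) * (2 * \<rho>)) * ((4 * \<rho>) * (4 * \<rho>))) * S) = ennreal (324 * \<rho>\<^sup>2) * S"
      using \<rho> by (simp add: mult.assoc[symmetric] ennreal_mult[symmetric] c_def power2_eq_square)
    moreover have "2 * (ennreal ((2 * \<rho>) * (4 * \<rho>)) * S) = ennreal (16 * \<rho>\<^sup>2) * S"
    proof -
      have "2 * (ennreal ((2 * \<rho>) * (4 * \<rho>)) * S) = (ennreal 2 * ennreal ((2 * \<rho>) * (4 * \<rho>))) * S" by (simp add: mult.assoc)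
      also have "ennreal 2 * ennreal ((2 * \<rho>) * (4 * \<rho>)) = ennreal (16 * \<rho>\<^sup>2)"
        using \<rho> by (subst ennreal_mult[symmetric]) (auto simp: power2_eq_square)
      finally show ?thesis .
    qed
    moreover have "ennreal (324 * \<rho>\<^sup>2) * S + ennreal (16 * \<rho>\<^sup>2) * S = ennreal (340 * \<rho>\<^sup>2) * S"
      by (simp add: distrib_right[symmetric] ennreal_plus[symmetric] del: ennreal_plus)
    ultimately show ?thesis by simp
  qed
  finally have bound: "(\<integral>\<^sup>+x. ennreal ((norm (Z x))\<^sup>2) * indicator ?X x \<partial>lborel) \<le> ennreal (340 * \<rho>\<^sup>2) * (\<integral>\<^sup>+x. ennreal ((norm (r x))\<^sup>2) \<partial>lborel)"
    by (simp add: S_def \<sigma>_def)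
  show ?thesis
    by (intro exI[of _ F] exI[of _ Z] conjI allI Fd' cZ cM bound) (use out in blast)+
qed

section \<open>Korn inequality for incompatible fields in space\<close>

lemma linear_sym_part: "linear sym_part"
  by (rule linearI) (simp_all add: sym_part_def transpose_def vec_eq_iff algebra_simps)

lemma norm_transpose: "norm (transpose X) = norm X" for X :: "real^3^3"
proof -
  have "(norm (transpose X))\<^sup>2 = (norm X)\<^sup>2"
    unfolding norm_matrix_sq by (simp add: transpose_def) (rule sum.swap)
  then show ?thesis by (simp add: power2_eq_iff_nonneg)
qed

lemma norm_sym_part_le: "norm (sym_part X) \<le> norm X"
  using norm_triangle_ineq[of X "transpose X"] by (simp add: sym_part_def norm_transpose)

lemma norm_diff_sq_le: "(norm (a - b))\<^sup>2 \<le> 2 * (norm a)\<^sup>2 + 2 * (norm b)\<^sup>2" for a b :: "'a::real_inner"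
proof -
  have "0 \<le> (norm (a + b))\<^sup>2" by simp
  then show ?thesis by (simp add: power2_norm_eq_inner inner_simps inner_commute)
qed

lemma has_derivative_vecI:
  fixes u :: "real^3 \<Rightarrow> real^3" and W :: "real^3^3"
  assumes "\<And>i. ((\<lambda>x. u x $ i) has_derivative (\<lambda>v. W $ i \<bullet> v)) (at x)"
  shows "(u has_derivative (\<lambda>v. W *v v)) (at x)"
  unfolding has_derivative_componentwise_within[of u]
proof
  fix b :: "real^3" assume "b \<in> Basis"
  then obtain i where b: "b = axis i 1" by (auto simp: Basis_vec_def)
  have "(W *v v) $ i = W $ i \<bullet> v" for v by (simp add: matrix_vector_mult_def inner_vec_def)
  then show "((\<lambda>x. u x \<bullet> b) has_derivative (\<lambda>v. (W *v v) \<bullet> b)) (at x)"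
    using assms[of i] by (simp add: b cart_eq_inner_axis[symmetric])
qed

text \<open>Row by row, the mollified field is \<open>P\<^sub>\<epsilon> = W + Z\<close> with \<open>W\<close> the gradient of a compactly supported field and \<open>\<parallel>Z\<parallel>\<^sup>2 \<le> 340 \<rho>\<^sup>2 \<parallel>R\<parallel>\<^sup>2\<close>. Korn's first inequality for \<open>W\<close>
  gives \<open>\<parallel>P\<^sub>\<epsilon>\<parallel>\<^sup>2 \<le> 2 \<parallel>W\<parallel>\<^sup>2 + 2 \<parallel>Z\<parallel>\<^sup>2 \<le> 4 \<parallel>sym W\<parallel>\<^sup>2 + 2 \<parallel>Z\<parallel>\<^sup>2 \<le> 8 \<parallel>sym P\<^sub>\<epsilon>\<parallel>\<^sup>2 + 10 \<parallel>Z\<parallel>\<^sup>2\<close>. The continuity of \<open>P\<close> almost everywhere is used to let \<open>\<epsilon>\<close> tend to zero.\<close>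

theorem incompatible_korn_weak:
  fixes P R :: "real^3 \<Rightarrow> real^3^3"
  assumes Pm: "P \<in> borel_measurable borel" and Rm: "R \<in> borel_measurable borel"
    and bd: "\<And>x. norm (P x) \<le> B" "\<And>x. norm (R x) \<le> B"
    and supp: "\<And>x. norm x > \<rho> \<Longrightarrow> P x = 0" "\<And>x. norm x > \<rho> \<Longrightarrow> R x = 0" and \<rho>: "\<rho> \<ge> 1"
    and weak3: "\<And>i \<phi>. Ck_on 1 UNIV \<phi> \<Longrightarrow>
      (LINT y|lborel. R y $ i $ 3 * \<phi> y) = (LINT y|lborel. P y $ i $ 1 * pd 2 \<phi> y - P y $ i $ 2 * pd 1 \<phi> y)"
    and weak2: "\<And>i \<phi>. Ck_on 1 UNIV \<phi> \<Longrightarrow>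
      (LINT y|lborel. R y $ i $ 2 * \<phi> y) = (LINT y|lborel. P y $ i $ 3 * pd 1 \<phi> y - P y $ i $ 1 * pd 3 \<phi> y)"
    and cont: "AE x in lborel. isCont P x"
  shows "(LINT x|lborel. (norm (P x))\<^sup>2) \<le>
    8 * (LINT x|lborel. (norm (sym_part (P x)))\<^sup>2) + 3400 * \<rho>\<^sup>2 * (LINT x|lborel. (norm (R x))\<^sup>2)"
proof -
  define Pm' where "Pm' n x = (\<chi> i j. mollify (1 / real (Suc n)) (\<lambda>y. P y $ i $ j) x)" for n x
  let ?X = "{x::real^3. \<forall>i. \<bar>x $ i\<bar> \<le> 2 * \<rho>}"
  have Pij[measurable]: "(\<lambda>y. P y $ i $ j) \<in> borel_measurable borel" for i j
    by (rule borel_measurable_continuous_on[OF _ Pm]) (intro continuous_intros)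
  have Pi[measurable]: "(\<lambda>y. P y $ i) \<in> borel_measurable borel" and Ri[measurable]: "(\<lambda>y. R y $ i) \<in> borel_measurable borel" for i
    by (rule borel_measurable_continuous_on[OF _ Pm], intro continuous_intros)
       (rule borel_measurable_continuous_on[OF _ Rm], intro continuous_intros)
  have bdi: "norm (P x $ i) \<le> B" "norm (R x $ i) \<le> B" for x i
    using order_trans[OF Finite_Cartesian_Product.norm_nth_le bd(1)[of x]] order_trans[OF Finite_Cartesian_Product.norm_nth_le bd(2)[of x]] by simp_all
  have bdij: "\<bar>P x $ i $ j\<bar> \<le> B" for x i j
    using order_trans[OF Finite_Cartesian_Product.norm_nth_le bdi(1)[of x i]] by simp
  have XC: "?X \<subseteq> cball 0 (6 * \<rho>)"
  proof
    fix x assume "x \<in> ?X"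
    then have "(\<Sum>i\<in>UNIV. \<bar>x $ i\<bar>) \<le> (\<Sum>i\<in>(UNIV::3 set). 2 * \<rho>)" by (intro sum_mono) auto
    then show "x \<in> cball 0 (6 * \<rho>)" using norm_le_l1_cart[of x] by simp
  qed
  have Ropen: "open (- ?X)"
  proof -
    have "- ?X = (\<Union>i. {x. 2 * \<rho> < \<bar>x $ i\<bar>})" by (auto simp: not_le[symmetric])
    moreover have "open {x::real^3. 2 * \<rho> < \<bar>x $ i\<bar>}" for i by (intro open_Collect_less continuous_intros)
    ultimately show ?thesis by auto
  qed
  have cint: "integrable lborel (\<lambda>x. (norm (f x))\<^sup>2)" if f: "continuous_on UNIV f" "\<And>x. x \<notin> ?X \<Longrightarrow> f x = 0"
    for f :: "real^3 \<Rightarrow> 'z::real_normed_vector"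
  proof -
    have c: "continuous_on UNIV (\<lambda>x. (norm (f x))\<^sup>2)" by (intro continuous_intros f)
    obtain M where M: "\<And>x. x \<in> cball 0 (6 * \<rho>) \<Longrightarrow> norm ((norm (f x))\<^sup>2) \<le> M"
      using continuous_on_bounded_above[OF c compact_cball[of 0 "6 * \<rho>"]] by auto
    show ?thesis
    proof (rule integrable_dominated_by_compact[OF borel_measurable_continuous_onI[OF c] compact_cball[of 0 "6 * \<rho>"] AE_I2])
      fix x show "\<bar>(norm (f x))\<^sup>2\<bar> \<le> M * indicator (cball 0 (6 * \<rho>)) x"
      proof (cases "x \<in> cball 0 (6 * \<rho>)")
        case False
        then have "f x = 0" using f(2) XC by blast
        then show ?thesis using False by simp
      qed (use M in auto)
    qed
  qed
  have iR: "integrable lborel (\<lambda>x. (norm (R x $ i))\<^sup>2)" for i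
  proof (rule integrable_bounded_support[where B = "B\<^sup>2" and R = \<rho>])
    show "\<bar>(norm (R x $ i))\<^sup>2\<bar> \<le> B\<^sup>2" for x using power_mono[OF bdi(2)[of x i], of 2] by simp
  qed (use supp in \<open>auto\<close>)
  have symc: "continuous_on UNIV sym_part" using linear_sym_part by (simp add: linear_continuous_on linear_conv_bounded_linear)
  have rows: "(norm (M::real^3^3))\<^sup>2 = (\<Sum>i\<in>UNIV. (norm (M $ i))\<^sup>2)" for M
    by (simp add: power2_norm_eq_inner inner_vec_def[of M])
  have Pmc: "continuous_on UNIV (Pm' n)" and Pm0: "\<And>x. x \<notin> ?X \<Longrightarrow> Pm' n x = 0"
    and step: "(LINT x|lborel. (norm (Pm' n x))\<^sup>2) \<le>
      8 * (LINT x|lborel. (norm (sym_part (Pm' n x)))\<^sup>2) + 3400 * \<rho>\<^sup>2 * (LINT x|lborel. (norm (R x))\<^sup>2)" for n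
  proof -
    define \<epsilon> where "\<epsilon> = 1 / real (Suc n)"
    have e: "0 < \<epsilon>" "\<epsilon> \<le> 1" by (auto simp: \<epsilon>_def)
    \<comment> \<open>the conclusion of \<open>gradient_part_of_row\<close> as a predicate, so that \<open>F\<close> and \<open>Z\<close> can be chosen for all rows at once\<close>
    define \<Phi> where "\<Phi> i F Z \<longleftrightarrow> (\<forall>x. (F has_derivative (\<lambda>v. ((\<chi> j. mollify \<epsilon> (\<lambda>y. P y $ i $ j) x) - Z x) \<bullet> v)) (at x)) \<and>
      continuous_on UNIV Z \<and> continuous_on UNIV (\<lambda>x. \<chi> j. mollify \<epsilon> (\<lambda>y. P y $ i $ j) x) \<and>
      (\<forall>x. (\<exists>i. \<bar>x $ i\<bar> > 2 * \<rho>) \<longrightarrow> F x = 0 \<and> (\<forall>j. mollify \<epsilon> (\<lambda>y. P y $ i $ j) x = 0)) \<and>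
      (\<integral>\<^sup>+x. ennreal ((norm (Z x))\<^sup>2) * indicator ?X x \<partial>lborel) \<le>
        ennreal (340 * \<rho>\<^sup>2) * (\<integral>\<^sup>+x. ennreal ((norm (R x $ i))\<^sup>2) \<partial>lborel)" for i F Z
    have "\<exists>F Z. \<Phi> i F Z" for i
      unfolding \<Phi>_def by (rule gradient_part_of_row[OF Pi Ri bdi(1) bdi(2) _ _ \<rho> weak3 weak2 e]) (simp_all add: supp)
    then obtain F Z where FZ: "\<And>i. \<Phi> i (F i) (Z i)" by metis
    have Fd: "(F i has_derivative (\<lambda>v. ((\<chi> j. mollify \<epsilon> (\<lambda>y. P y $ i $ j) x) - Z i x) \<bullet> v)) (at x)" for i x
      using FZ[of i] unfolding \<Phi>_def by blast
    have Zc: "continuous_on UNIV (Z i)" and Mc: "continuous_on UNIV (\<lambda>x. \<chi> j. mollify \<epsilon> (\<lambda>y. P y $ i $ j) x)" for i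
      using FZ[of i] unfolding \<Phi>_def by blast+
    have out: "F i x = 0 \<and> (\<forall>j. mollify \<epsilon> (\<lambda>y. P y $ i $ j) x = 0)" if "\<exists>k. \<bar>x $ k\<bar> > 2 * \<rho>" for i x
      using FZ[of i] that unfolding \<Phi>_def by blast
    have Zb: "(\<integral>\<^sup>+x. ennreal ((norm (Z i x))\<^sup>2) * indicator ?X x \<partial>lborel) \<le>
        ennreal (340 * \<rho>\<^sup>2) * (\<integral>\<^sup>+x. ennreal ((norm (R x $ i))\<^sup>2) \<partial>lborel)" for i
      using FZ[of i] unfolding \<Phi>_def by blast
    have PmE: "Pm' n x = (\<chi> i. \<chi> j. mollify \<epsilon> (\<lambda>y. P y $ i $ j) x)" for x by (simp add: Pm'_def \<epsilon>_def)
    show Pc: "continuous_on UNIV (Pm' n)" unfolding PmE[abs_def] by (intro continuous_on_vec_lambda Mc)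
    have nX: "\<exists>k. \<bar>x $ k\<bar> > 2 * \<rho>" if "x \<notin> ?X" for x using that by (auto simp: not_le)
    show P0: "Pm' n x = 0" if "x \<notin> ?X" for x
      using out[OF nX[OF that]] by (simp add: PmE vec_eq_iff)
    define u where "u x = (\<chi> i. F i x)" for x
    define Zm where "Zm x = (\<chi> i. Z i x)" for x
    define W where "W x = Pm' n x - Zm x" for x
    have Wi: "W x $ i = (\<chi> j. mollify \<epsilon> (\<lambda>y. P y $ i $ j) x) - Z i x" for x i
      by (simp add: W_def PmE Zm_def)
    have Zmc: "continuous_on UNIV Zm" unfolding Zm_def[abs_def] by (intro continuous_on_vec_lambda Zc)
    have Wc: "continuous_on UNIV W" unfolding W_def[abs_def] by (intro continuous_intros Pc Zmc)
    have Fd': "(F i has_derivative (\<lambda>v. W x $ i \<bullet> v)) (at x)" for i x using Fd[of i x] by (simp add: Wi)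
    have W0: "W x = 0" if "x \<notin> ?X" for x
    proof -
      have "W x $ i = 0" for i
      proof -
        have "(F i has_derivative (\<lambda>v. 0)) (at x)"
        proof (rule has_derivative_transform_within_open[OF has_derivative_const[of 0] Ropen])
          show "x \<in> - ?X" using that by simp
          show "0 = F i y" if "y \<in> - ?X" for y using out[OF nX[of y], of i] that by simp
        qed
        from has_derivative_unique[OF Fd'[of i x] this] have "W x $ i \<bullet> W x $ i = 0" by metis
        then show ?thesis by simp
      qed
      then show ?thesis by (simp add: vec_eq_iff)
    qed
    have Z0: "Zm x = 0" if "x \<notin> ?X" for x using W0[OF that] P0[OF that] by (simp add: W_def)
    obtain BW where BW: "\<And>x. x \<in> cball 0 (6 * \<rho>) \<Longrightarrow> norm (W x) \<le> BW" "BW \<ge> 0"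
      using continuous_on_bounded_above[OF Wc compact_cball[of 0 "6 * \<rho>"]] by auto
    have BW': "norm (W x) \<le> BW" for x
    proof (cases "x \<in> cball 0 (6 * \<rho>)")
      case False
      then have "W x = 0" using W0 XC by blast
      then show ?thesis using BW(2) by simp
    qed (use BW in auto)
    have Fl: "\<bar>F i x - F i y\<bar> \<le> BW * dist x y" for i x y
    proof -
      have "norm (F i x - F i y) \<le> BW * norm (x - y)"
      proof (rule differentiable_bound[of UNIV "F i" "\<lambda>z v. W z $ i \<bullet> v"])
        show "onorm (\<lambda>v. W z $ i \<bullet> v) \<le> BW" for z
        proof (rule onorm_le)
          fix v
          have "norm (W z $ i \<bullet> v) \<le> norm (W z $ i) * norm v" by (simp add: Cauchy_Schwarz_ineq2)
          also have "\<dots> \<le> BW * norm v"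
            using order_trans[OF Finite_Cartesian_Product.norm_nth_le BW'[of z]] by (intro mult_right_mono) auto
          finally show "norm (W z $ i \<bullet> v) \<le> BW * norm v" .
        qed
      qed (use Fd' in auto)
      then show ?thesis by (simp add: dist_norm)
    qed
    have ul: "dist (u x) (u y) \<le> (3 * BW) * dist x y" for x y
    proof -
      have "dist (u x) (u y) \<le> (\<Sum>i\<in>UNIV. \<bar>(u x - u y) $ i\<bar>)" unfolding dist_norm by (rule norm_le_l1_cart)
      also have "\<dots> \<le> (\<Sum>i\<in>(UNIV::3 set). BW * dist x y)" using Fl by (intro sum_mono) (simp add: u_def)
      finally show ?thesis by simp
    qed
    have K: "(LINT x|lborel. (norm (W x))\<^sup>2) \<le> 2 * (LINT x|lborel. (norm (sym_part (W x)))\<^sup>2)"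
    proof (rule korn_first[OF ul])
      show "u x = 0" if "norm x > 6 * \<rho>" for x
      proof -
        have "x \<notin> ?X" using that XC by auto
        then show ?thesis using out[OF nX] by (simp add: u_def vec_eq_iff)
      qed
      show "AE x in lborel. (u has_derivative (*v) (W x)) (at x)"
        by (intro AE_I2 has_derivative_vecI) (simp add: u_def Fd')
      show "W \<in> borel_measurable borel" by (rule borel_measurable_continuous_onI[OF Wc])
    qed
    have Zint: "(LINT x|lborel. (norm (Zm x))\<^sup>2) \<le> 340 * \<rho>\<^sup>2 * (LINT x|lborel. (norm (R x))\<^sup>2)"
    proof -
      have Zi0: "Z i x = 0" if "x \<notin> ?X" for i x using Z0[OF that] by (simp add: Zm_def vec_eq_iff)
      have iZ: "integrable lborel (\<lambda>x. (norm (Z i x))\<^sup>2)" for i by (rule cint[OF Zc Zi0]) simp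
      have le: "(LINT x|lborel. (norm (Z i x))\<^sup>2) \<le> 340 * \<rho>\<^sup>2 * (LINT x|lborel. (norm (R x $ i))\<^sup>2)" for i
      proof -
        have "ennreal ((norm (Z i x))\<^sup>2) * indicator ?X x = ennreal ((norm (Z i x))\<^sup>2)" for x
          using Zi0[of x i] by (cases "x \<in> ?X") auto
        then have "ennreal (LINT x|lborel. (norm (Z i x))\<^sup>2) \<le> ennreal (340 * \<rho>\<^sup>2) * ennreal (LINT x|lborel. (norm (R x $ i))\<^sup>2)"
          using Zb[of i] by (simp add: nn_integral_eq_integral iZ iR)
        also have "\<dots> = ennreal (340 * \<rho>\<^sup>2 * (LINT x|lborel. (norm (R x $ i))\<^sup>2))"
          by (rule ennreal_mult[symmetric]) auto
        finally show ?thesis by (subst (asm) ennreal_le_iff) (auto intro!: mult_nonneg_nonneg integral_nonneg_AE)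
      qed
      have "(LINT x|lborel. (norm (Zm x))\<^sup>2) = (\<Sum>i\<in>UNIV. (LINT x|lborel. (norm (Z i x))\<^sup>2))"
        unfolding rows by (simp add: Zm_def iZ)
      also have "\<dots> \<le> (\<Sum>i\<in>UNIV. 340 * \<rho>\<^sup>2 * (LINT x|lborel. (norm (R x $ i))\<^sup>2))" by (rule sum_mono) (rule le)
      also have "\<dots> = 340 * \<rho>\<^sup>2 * (LINT x|lborel. (norm (R x))\<^sup>2)"
        unfolding rows by (simp add: iR sum_distrib_left)
      finally show ?thesis .
    qed
    have sW: "sym_part (W x) = sym_part (Pm' n x) - sym_part (Zm x)" for x
      unfolding W_def by (rule linear_diff[OF linear_sym_part])
    have sc: "continuous_on UNIV (\<lambda>x. sym_part (f x))" if "continuous_on UNIV f" for f :: "real^3 \<Rightarrow> real^3^3"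
      using continuous_on_compose2[OF symc that] by simp
    have s0: "sym_part 0 = 0" by (rule linear_0[OF linear_sym_part])
    have iP: "integrable lborel (\<lambda>x. (norm (Pm' n x))\<^sup>2)" by (rule cint[OF Pc P0]) simp
    have iW: "integrable lborel (\<lambda>x. (norm (W x))\<^sup>2)" by (rule cint[OF Wc W0]) simp
    have iZm: "integrable lborel (\<lambda>x. (norm (Zm x))\<^sup>2)" by (rule cint[OF Zmc Z0]) simp
    have isP: "integrable lborel (\<lambda>x. (norm (sym_part (Pm' n x)))\<^sup>2)" by (rule cint[OF sc[OF Pc]]) (simp add: P0 s0)
    have isW: "integrable lborel (\<lambda>x. (norm (sym_part (W x)))\<^sup>2)" by (rule cint[OF sc[OF Wc]]) (simp add: W0 s0)
    have "(LINT x|lborel. (norm (Pm' n x))\<^sup>2) \<le> (LINT x|lborel. 2 * (norm (W x))\<^sup>2 + 2 * (norm (Zm x))\<^sup>2)"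
    proof (rule Bochner_Integration.integral_mono)
      show "integrable lborel (\<lambda>x. 2 * (norm (W x))\<^sup>2 + 2 * (norm (Zm x))\<^sup>2)"
        by (intro Bochner_Integration.integrable_add integrable_mult_right iW iZm)
      fix x
      have "Pm' n x = W x - (- Zm x)" by (simp add: W_def)
      then show "(norm (Pm' n x))\<^sup>2 \<le> 2 * (norm (W x))\<^sup>2 + 2 * (norm (Zm x))\<^sup>2"
        using norm_diff_sq_le[of "W x" "- Zm x"] by simp
    qed (rule iP)
    also have "\<dots> = 2 * (LINT x|lborel. (norm (W x))\<^sup>2) + 2 * (LINT x|lborel. (norm (Zm x))\<^sup>2)"
      by (simp add: iW iZm)
    finally have 1: "(LINT x|lborel. (norm (Pm' n x))\<^sup>2) \<le> 2 * (LINT x|lborel. (norm (W x))\<^sup>2) + 2 * (LINT x|lborel. (norm (Zm x))\<^sup>2)" .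
    have "(LINT x|lborel. (norm (sym_part (W x)))\<^sup>2) \<le> (LINT x|lborel. 2 * (norm (sym_part (Pm' n x)))\<^sup>2 + 2 * (norm (Zm x))\<^sup>2)"
    proof (rule Bochner_Integration.integral_mono)
      show "integrable lborel (\<lambda>x. 2 * (norm (sym_part (Pm' n x)))\<^sup>2 + 2 * (norm (Zm x))\<^sup>2)"
        by (intro Bochner_Integration.integrable_add integrable_mult_right isP iZm)
      fix x
      have "(norm (sym_part (Zm x)))\<^sup>2 \<le> (norm (Zm x))\<^sup>2" by (rule power_mono[OF norm_sym_part_le]) simp
      then show "(norm (sym_part (W x)))\<^sup>2 \<le> 2 * (norm (sym_part (Pm' n x)))\<^sup>2 + 2 * (norm (Zm x))\<^sup>2"
        using norm_diff_sq_le[of "sym_part (Pm' n x)" "sym_part (Zm x)"] unfolding sW by linarith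
    qed (rule isW)
    also have "\<dots> = 2 * (LINT x|lborel. (norm (sym_part (Pm' n x)))\<^sup>2) + 2 * (LINT x|lborel. (norm (Zm x))\<^sup>2)"
      by (simp add: isP iZm)
    finally have 2: "(LINT x|lborel. (norm (sym_part (W x)))\<^sup>2) \<le> 2 * (LINT x|lborel. (norm (sym_part (Pm' n x)))\<^sup>2) + 2 * (LINT x|lborel. (norm (Zm x))\<^sup>2)" .
    show "(LINT x|lborel. (norm (Pm' n x))\<^sup>2) \<le>
      8 * (LINT x|lborel. (norm (sym_part (Pm' n x)))\<^sup>2) + 3400 * \<rho>\<^sup>2 * (LINT x|lborel. (norm (R x))\<^sup>2)"
      using 1 2 K Zint by linarith
  qed
  have bP: "(norm (Pm' n x))\<^sup>2 \<le> 9 * B\<^sup>2 * indicator (cball 0 (6 * \<rho>)) x" for n x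
  proof (cases "x \<in> cball 0 (6 * \<rho>)")
    case True
    have "\<bar>Pm' n x $ i $ j\<bar> \<le> B" for i j
      unfolding Pm'_def using mollify_bound[OF _ Pij bdij] by simp
    then have "Pm' n x $ i $ j * Pm' n x $ i $ j \<le> B\<^sup>2" for i j
      using power_mono[of "\<bar>Pm' n x $ i $ j\<bar>" B 2] by (simp add: power2_eq_square)
    then have "(norm (Pm' n x))\<^sup>2 \<le> (\<Sum>i\<in>(UNIV::3 set). \<Sum>j\<in>(UNIV::3 set). B\<^sup>2)"
      unfolding norm_matrix_sq by (intro sum_mono) assumption
    then show ?thesis using True by simp
  next
    case False
    then have "x \<notin> ?X" using XC by blast
    then show ?thesis using Pm0[of x n] by simp
  qed
  have lim: "AE x in lborel. (\<lambda>n. Pm' n x) \<longlonglongrightarrow> P x"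
    using cont
  proof eventually_elim
    case (elim x)
    have "(\<lambda>n. Pm' n x $ i $ j) \<longlonglongrightarrow> P x $ i $ j" for i j
      unfolding Pm'_def vec_lambda_beta
      by (rule mollify_tendsto[OF Pij bdij]) (use elim in \<open>auto intro!: continuous_intros\<close>)
    then show ?case by (intro vec_tendstoI) assumption
  qed
  have iI: "integrable lborel (\<lambda>x::real^3. 9 * B\<^sup>2 * indicator (cball 0 (6 * \<rho>)) x :: real)"
    by (intro integrable_mult_right integrable_real_indicator) (use emeasure_bounded_finite[OF bounded_cball] in auto)
  have mPm[measurable]: "Pm' n \<in> borel_measurable borel" for n by (rule borel_measurable_continuous_onI[OF Pmc])
  have msym[measurable]: "sym_part \<in> borel_measurable borel" by (rule borel_measurable_continuous_onI[OF symc])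
  note Pm[measurable]
  have L1: "(\<lambda>n. LINT x|lborel. (norm (Pm' n x))\<^sup>2) \<longlonglongrightarrow> (LINT x|lborel. (norm (P x))\<^sup>2)"
  proof (rule integral_dominated_convergence[OF _ _ iI])
    show "AE x in lborel. (\<lambda>n. (norm (Pm' n x))\<^sup>2) \<longlonglongrightarrow> (norm (P x))\<^sup>2"
      using lim by eventually_elim (intro tendsto_intros)
    show "AE x in lborel. norm ((norm (Pm' n x))\<^sup>2) \<le> 9 * B\<^sup>2 * indicator (cball 0 (6 * \<rho>)) x" for n
      using bP by simp
  qed measurable
  have L2: "(\<lambda>n. LINT x|lborel. (norm (sym_part (Pm' n x)))\<^sup>2) \<longlonglongrightarrow> (LINT x|lborel. (norm (sym_part (P x)))\<^sup>2)"
  proof (rule integral_dominated_convergence[OF _ _ iI])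
    show "AE x in lborel. (\<lambda>n. (norm (sym_part (Pm' n x)))\<^sup>2) \<longlonglongrightarrow> (norm (sym_part (P x)))\<^sup>2"
      using lim
    proof eventually_elim
      case (elim x)
      have "(\<lambda>n. sym_part (Pm' n x)) \<longlonglongrightarrow> sym_part (P x)"
        using continuous_on_tendsto_compose[OF symc elim] by simp
      then show ?case by (rule tendsto_power[OF tendsto_norm])
    qed
    show "AE x in lborel. norm ((norm (sym_part (Pm' n x)))\<^sup>2) \<le> 9 * B\<^sup>2 * indicator (cball 0 (6 * \<rho>)) x" for n
    proof (rule AE_I2)
      fix x
      have "(norm (sym_part (Pm' n x)))\<^sup>2 \<le> (norm (Pm' n x))\<^sup>2" by (rule power_mono[OF norm_sym_part_le]) simp
      then show "norm ((norm (sym_part (Pm' n x)))\<^sup>2) \<le> 9 * B\<^sup>2 * indicator (cball 0 (6 * \<rho>)) x"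
        using bP[of n x] unfolding real_norm_def abs_power2 by linarith
    qed
  qed measurable
  show ?thesis
    by (rule LIMSEQ_le[OF L1 tendsto_add[OF tendsto_mult[OF tendsto_const L2] tendsto_const]]) (use step in auto)
qed

section \<open>Korn inequalities on the domain\<close>

lemma Curl_continuous:
  assumes "open S" "Ck_on 1 S X" shows "continuous_on S (Curl X)"
proof -
  have c: "continuous_on S (pd k (\<lambda>y. X y $ i $ j))" for i j k
    by (intro pd_continuous assms Ck1_nth)
  have e: "Curl X x $ i $ j = (vector [pd 2 (\<lambda>y. X y $ i $ 3) x - pd 3 (\<lambda>y. X y $ i $ 2) x,
      pd 3 (\<lambda>y. X y $ i $ 1) x - pd 1 (\<lambda>y. X y $ i $ 3) x,
      pd 1 (\<lambda>y. X y $ i $ 2) x - pd 2 (\<lambda>y. X y $ i $ 1) x] :: real^3) $ j" if "x \<in> S" for x i j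
    using Curl_nth[OF Ck1_differentiable[OF assms that], of i] exhaust_3[of j] by (auto simp: vector_3)
  have "continuous_on S (\<lambda>x. (vector [pd 2 (\<lambda>y. X y $ i $ 3) x - pd 3 (\<lambda>y. X y $ i $ 2) x,
      pd 3 (\<lambda>y. X y $ i $ 1) x - pd 1 (\<lambda>y. X y $ i $ 3) x,
      pd 1 (\<lambda>y. X y $ i $ 2) x - pd 2 (\<lambda>y. X y $ i $ 1) x] :: real^3) $ j)" for i j
  proof -
    consider "j = 1" | "j = 2" | "j = 3" using exhaust_3[of j] by blast
    then show ?thesis by cases (simp_all only: vector_3, (intro continuous_on_diff c)+)
  qed
  then have "continuous_on S (\<lambda>x. Curl X x $ i $ j)" for i j
    using e by (simp cong: continuous_on_cong)
  then have "continuous_on S (\<lambda>x. \<chi> i j. Curl X x $ i $ j)" by (intro continuous_on_vec_lambda) assumption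
  then show ?thesis by simp
qed

lemma grad_continuous:
  assumes "open S" "Ck_on 1 S u" shows "continuous_on S (grad u)"
proof -
  have "continuous_on S (pd j (\<lambda>y. u y $ i))" for i j by (intro pd_continuous assms Ck1_nth)
  then have "continuous_on S (\<lambda>x. grad u x $ i $ j)" for i j
    using grad_nth[OF Ck1_differentiable[OF assms]] by (simp cong: continuous_on_cong)
  then have "continuous_on S (\<lambda>x. \<chi> i j. grad u x $ i $ j)" by (intro continuous_on_vec_lambda) assumption
  then show ?thesis by simp
qed

lemma pd_const: "pd j (\<lambda>y. c) x = 0"
  by (rule pd_eq[of _ "\<lambda>v. 0"]) (rule has_derivative_const)

lemma cutoff_error:
  fixes f \<theta> :: "'a::euclidean_space \<Rightarrow> real"
  assumes \<Omega>: "open \<Omega>" "bounded \<Omega>" and f: "continuous_on \<Omega> f" "\<And>x. x \<in> \<Omega> \<Longrightarrow> \<bar>f x\<bar> \<le> B"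
    and \<theta>: "continuous_on UNIV \<theta>" "\<And>x. 0 \<le> \<theta> x \<and> \<theta> x \<le> 1"
  shows "integrable lborel (\<lambda>x. indicator \<Omega> x * (\<theta> x * f x))"
    and "\<bar>(LINT x|lborel. indicator \<Omega> x * (\<theta> x * f x)) - (LINT x|lborel. indicator \<Omega> x * f x)\<bar> \<le>
      B * (LINT x|lborel. indicator \<Omega> x * (1 - \<theta> x))"
proof -
  have c\<theta>: "continuous_on \<Omega> \<theta>" by (rule continuous_on_subset[OF \<theta>(1)]) simp
  show i: "integrable lborel (\<lambda>x. indicator \<Omega> x * (\<theta> x * f x))"
  proof (rule indicator_times_integrable[OF \<Omega>])
    show "continuous_on \<Omega> (\<lambda>x. \<theta> x * f x)" by (intro continuous_intros c\<theta> f)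
    fix x assume "x \<in> \<Omega>"
    then show "\<bar>\<theta> x * f x\<bar> \<le> B" using f(2)[of x] \<theta>(2)[of x] mult_mono[of "\<bar>\<theta> x\<bar>" 1 "\<bar>f x\<bar>" B] by (simp add: abs_mult)
  qed
  have i1: "integrable lborel (\<lambda>x. indicator \<Omega> x * f x)" by (rule indicator_times_integrable[OF \<Omega> f])
  have i2: "integrable lborel (\<lambda>x. indicator \<Omega> x * (1 - \<theta> x))"
  proof (rule indicator_times_integrable[OF \<Omega>])
    show "continuous_on \<Omega> (\<lambda>x. 1 - \<theta> x)" by (intro continuous_intros c\<theta>)
    show "\<bar>1 - \<theta> x\<bar> \<le> 1" for x using \<theta>(2)[of x] by auto
  qed
  have "\<bar>(LINT x|lborel. indicator \<Omega> x * (\<theta> x * f x)) - (LINT x|lborel. indicator \<Omega> x * f x)\<bar>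
      = \<bar>(LINT x|lborel. indicator \<Omega> x * (\<theta> x * f x) - indicator \<Omega> x * f x)\<bar>"
    by (simp add: Bochner_Integration.integral_diff[OF i i1])
  also have "\<dots> \<le> (LINT x|lborel. \<bar>indicator \<Omega> x * (\<theta> x * f x) - indicator \<Omega> x * f x\<bar>)" by (rule integral_abs_bound)
  also have "\<dots> \<le> (LINT x|lborel. B * (indicator \<Omega> x * (1 - \<theta> x)))"
  proof (rule Bochner_Integration.integral_mono)
    fix x
    show "\<bar>indicator \<Omega> x * (\<theta> x * f x) - indicator \<Omega> x * f x\<bar> \<le> B * (indicator \<Omega> x * (1 - \<theta> x))"
    proof (cases "x \<in> \<Omega>")
      case True
      have "\<theta> x * f x - f x = - ((1 - \<theta> x) * f x)" by (simp add: algebra_simps)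
      then have "\<bar>\<theta> x * f x - f x\<bar> = (1 - \<theta> x) * \<bar>f x\<bar>" using \<theta>(2)[of x] by (simp add: abs_mult)
      also have "\<dots> \<le> (1 - \<theta> x) * B" using f(2)[OF True] \<theta>(2)[of x] by (intro mult_left_mono) auto
      finally show ?thesis using True by (simp add: mult.commute)
    qed simp
  qed (intro integrable_abs Bochner_Integration.integrable_diff i i1 integrable_mult_right i2)+
  also have "\<dots> = B * (LINT x|lborel. indicator \<Omega> x * (1 - \<theta> x))" by simp
  finally show "\<bar>(LINT x|lborel. indicator \<Omega> x * (\<theta> x * f x)) - (LINT x|lborel. indicator \<Omega> x * f x)\<bar> \<le>
      B * (LINT x|lborel. indicator \<Omega> x * (1 - \<theta> x))" .
qed

text \<open>The extension of \<open>Q\<close> by zero has no curl concentrated on the boundary, because the tangential part of \<open>Q\<close> vanishes there.\<close>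

lemma curl_integration_by_parts:
  assumes dom: "bounded_domain \<Omega>" and pw: "piecewise_smooth_boundary \<Omega>"
    and Q: "continuous_on (closure \<Omega>) Q" "Ck_on 1 \<Omega> Q" "tangentially_zero \<Omega> Q" "\<And>x. x \<in> \<Omega> \<Longrightarrow> norm (Curl Q x) \<le> B"
    and m: "Ck_on 1 UNIV m"
  shows "(LINT x|lborel. indicator \<Omega> x * (Curl m x \<bullet> Q x)) = (LINT x|lborel. indicator \<Omega> x * (m x \<bullet> Curl Q x))"
proof -
  have \<Omega>: "open \<Omega>" "bounded \<Omega>" "\<Omega> \<noteq> {}" using dom by (auto simp: bounded_domain_def)
  obtain \<theta> where \<theta>: "exhausting_cutoffs \<Omega> \<theta>" using boundary_cutoffs(2)[OF dom pw] by blast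
  have \<theta>c: "continuous_on UNIV (\<theta> n)" and \<theta>01: "0 \<le> \<theta> n x \<and> \<theta> n x \<le> 1" for n x
    using \<theta> unfolding exhausting_cutoffs_def by blast+
  have \<theta>0: "(\<lambda>n. LINT x|lborel. indicator \<Omega> x * (1 - \<theta> n x)) \<longlonglongrightarrow> 0"
    using \<theta> unfolding exhausting_cutoffs_def by blast
  obtain e where e: "e \<longlonglongrightarrow> 0" "\<And>n m M. Ck_on 1 \<Omega> m \<Longrightarrow> (\<forall>x\<in>\<Omega>. norm (m x) \<le> M) \<Longrightarrow>
        \<bar>(LINT x|lborel. indicator \<Omega> x * (\<theta> n x * (Curl m x \<bullet> Q x - m x \<bullet> Curl Q x)))\<bar> \<le> M * e n"
    using exhausting_cutoffs_Curl[OF \<theta> Q(1-3)] by blast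
  have cl: "compact (closure \<Omega>)" using \<Omega>(2) by simp
  have mO: "Ck_on 1 \<Omega> m"
  proof -
    obtain m' where "\<forall>x\<in>UNIV. (m has_derivative m' x) (at x)" "\<forall>b\<in>Basis. continuous_on UNIV (\<lambda>x. m' x b)"
      using m unfolding Ck1_iff[OF open_UNIV] by blast
    then show ?thesis unfolding Ck1_iff[OF \<Omega>(1)] by (auto intro: continuous_on_subset)
  qed
  obtain M where M: "\<And>x. x \<in> closure \<Omega> \<Longrightarrow> norm (m x) \<le> M" "M \<ge> 0"
    using continuous_on_bounded_above[OF Ck1_continuous[OF open_UNIV m] cl] by auto
  obtain M' where M': "\<And>x. x \<in> closure \<Omega> \<Longrightarrow> norm (Curl m x) \<le> M'" "M' \<ge> 0"
    using continuous_on_bounded_above[OF Curl_continuous[OF open_UNIV m] cl] by auto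
  obtain BQ where BQ: "\<And>x. x \<in> closure \<Omega> \<Longrightarrow> norm (Q x) \<le> BQ" "BQ \<ge> 0"
    using continuous_on_bounded_above[OF Q(1) cl] by auto
  have B0: "B \<ge> 0" using Q(4) \<Omega>(3) norm_ge_zero order_trans by blast
  have sub: "x \<in> closure \<Omega>" if "x \<in> \<Omega>" for x using that closure_subset by auto
  let ?f = "\<lambda>x. Curl m x \<bullet> Q x - m x \<bullet> Curl Q x"
  have b1: "\<bar>Curl m x \<bullet> Q x\<bar> \<le> M' * BQ" if "x \<in> \<Omega>" for x
    by (rule order_trans[OF Cauchy_Schwarz_ineq2]) (use M' BQ sub[OF that] in \<open>auto intro!: mult_mono\<close>)
  have b2: "\<bar>m x \<bullet> Curl Q x\<bar> \<le> M * B" if "x \<in> \<Omega>" for x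
    by (rule order_trans[OF Cauchy_Schwarz_ineq2]) (use M Q(4)[OF that] sub[OF that] in \<open>auto intro!: mult_mono\<close>)
  have c1: "continuous_on \<Omega> (\<lambda>x. Curl m x \<bullet> Q x)" and c2: "continuous_on \<Omega> (\<lambda>x. m x \<bullet> Curl Q x)"
    by (intro continuous_on_inner Curl_continuous[OF \<Omega>(1)] mO Q(2) Ck1_continuous[OF \<Omega>(1)])+
  have fb: "\<bar>?f x\<bar> \<le> M' * BQ + M * B" if "x \<in> \<Omega>" for x using b1[OF that] b2[OF that] by linarith
  have cf: "continuous_on \<Omega> ?f" by (intro continuous_on_diff c1 c2)
  have "(LINT x|lborel. indicator \<Omega> x * ?f x) = 0"
  proof -
    have "\<bar>(LINT x|lborel. indicator \<Omega> x * ?f x)\<bar> \<le> M * e n + (M' * BQ + M * B) * (LINT x|lborel. indicator \<Omega> x * (1 - \<theta> n x))" for n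
    proof -
      have "\<bar>(LINT x|lborel. indicator \<Omega> x * (\<theta> n x * ?f x))\<bar> \<le> M * e n"
        by (rule e(2)[OF mO]) (use M(1) sub in auto)
      then show ?thesis using cutoff_error(2)[OF \<Omega>(1,2) cf fb \<theta>c \<theta>01, of n] by linarith
    qed
    moreover have "(\<lambda>n. M * e n + (M' * BQ + M * B) * (LINT x|lborel. indicator \<Omega> x * (1 - \<theta> n x))) \<longlonglongrightarrow> M * 0 + (M' * BQ + M * B) * 0"
      by (intro tendsto_add tendsto_mult tendsto_const e(1) \<theta>0)
    ultimately have "\<bar>(LINT x|lborel. indicator \<Omega> x * ?f x)\<bar> \<le> M * 0 + (M' * BQ + M * B) * 0"
      by (intro LIMSEQ_le_const) auto
    then show ?thesis by simp
  qed
  moreover have "(LINT x|lborel. indicator \<Omega> x * ?f x) =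
      (LINT x|lborel. indicator \<Omega> x * (Curl m x \<bullet> Q x)) - (LINT x|lborel. indicator \<Omega> x * (m x \<bullet> Curl Q x))"
    unfolding right_diff_distrib
    by (rule Bochner_Integration.integral_diff)
      (intro indicator_times_integrable[OF \<Omega>(1,2) c1 b1] indicator_times_integrable[OF \<Omega>(1,2) c2 b2]; assumption)+
  ultimately show ?thesis by simp
qed

text \<open>The extension of \<open>P\<close> by zero satisfies the weak curl identities in the whole space, by \<open>curl_integration_by_parts\<close> for matrix fields with a single
  nonzero entry.\<close>

theorem incompatible_korn_on_domain:
  assumes dom: "bounded_domain \<Omega>" and pw: "piecewise_smooth_boundary \<Omega>"
  shows "\<exists>C>0. \<forall>P B. continuous_on (closure \<Omega>) P \<and> Ck_on 1 \<Omega> P \<and> tangentially_zero \<Omega> P \<and> (\<forall>x\<in>\<Omega>. norm (Curl P x) \<le> B) \<longrightarrow>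
    (LINT x|lborel. indicator \<Omega> x * (norm (P x))\<^sup>2) \<le>
      C * ((LINT x|lborel. indicator \<Omega> x * (norm (sym_part (P x)))\<^sup>2) + (LINT x|lborel. indicator \<Omega> x * (norm (Curl P x))\<^sup>2))"
proof -
  have \<Omega>: "open \<Omega>" "bounded \<Omega>" "\<Omega> \<noteq> {}" using dom by (auto simp: bounded_domain_def)
  have null: "frontier \<Omega> \<in> null_sets lborel" by (rule boundary_cutoffs(1)[OF dom pw])
  obtain r where r: "\<And>x. x \<in> \<Omega> \<Longrightarrow> norm x \<le> r" using \<Omega>(2) by (auto simp: bounded_iff)
  define \<rho> where "\<rho> = max 1 r"
  have \<rho>: "\<rho> \<ge> 1" "\<And>x. x \<in> \<Omega> \<Longrightarrow> norm x \<le> \<rho>" using r by (auto simp: \<rho>_def le_max_iff_disj)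
  show ?thesis
  proof (intro exI[of _ "8 + 3400 * \<rho>\<^sup>2"] conjI allI impI)
    show "0 < 8 + 3400 * \<rho>\<^sup>2" by (simp add: add_pos_nonneg)
    fix P B assume "continuous_on (closure \<Omega>) P \<and> Ck_on 1 \<Omega> P \<and> tangentially_zero \<Omega> P \<and> (\<forall>x\<in>\<Omega>. norm (Curl P x) \<le> B)"
    then have P: "continuous_on (closure \<Omega>) P" "Ck_on 1 \<Omega> P" "tangentially_zero \<Omega> P" "\<And>x. x \<in> \<Omega> \<Longrightarrow> norm (Curl P x) \<le> B" by auto
    define Pz where "Pz x = indicator \<Omega> x *\<^sub>R P x" for x
    define Rz where "Rz x = indicator \<Omega> x *\<^sub>R Curl P x" for x
    obtain BP where BP: "\<And>x. x \<in> closure \<Omega> \<Longrightarrow> norm (P x) \<le> BP" "BP \<ge> 0"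
      using continuous_on_bounded_above[OF P(1)] \<Omega>(2) by (metis compact_closure order_refl)
    have B0: "B \<ge> 0" using P(4) \<Omega>(3) norm_ge_zero order_trans by blast
    have sub: "x \<in> closure \<Omega>" if "x \<in> \<Omega>" for x using that closure_subset by auto
    have weak: "(LINT y|lborel. Rz y \<bullet> m y) = (LINT y|lborel. Pz y \<bullet> Curl m y)" if "Ck_on 1 UNIV m" for m
      using curl_integration_by_parts[OF dom pw P that] by (simp add: Rz_def Pz_def inner_commute mult.commute)
    have pz: "pd j (\<lambda>y. if b then \<phi> y else 0) x = (if b then pd j \<phi> x else 0)" for j b \<phi> x
      by (simp add: pd_const)
    have K: "(LINT x|lborel. (norm (Pz x))\<^sup>2) \<le>
      8 * (LINT x|lborel. (norm (sym_part (Pz x)))\<^sup>2) + 3400 * \<rho>\<^sup>2 * (LINT x|lborel. (norm (Rz x))\<^sup>2)"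
    proof (rule incompatible_korn_weak[where B = "max BP B"])
      show "Pz \<in> borel_measurable borel" unfolding Pz_def[abs_def]
        by (rule borel_measurable_continuous_on_indicator[OF _ Ck1_continuous[OF \<Omega>(1) P(2)]]) (simp add: borel_open \<Omega>)
      show "Rz \<in> borel_measurable borel" unfolding Rz_def[abs_def]
        by (rule borel_measurable_continuous_on_indicator[OF _ Curl_continuous[OF \<Omega>(1) P(2)]]) (simp add: borel_open \<Omega>)
      show "norm (Pz x) \<le> max BP B" for x using BP(1)[OF sub] BP(2) by (cases "x \<in> \<Omega>") (auto simp: Pz_def le_max_iff_disj)
      show "norm (Rz x) \<le> max BP B" for x using P(4) B0 by (cases "x \<in> \<Omega>") (auto simp: Rz_def le_max_iff_disj)
      show "Pz x = 0" "Rz x = 0" if "norm x > \<rho>" for x using \<rho>(2)[of x] that by (auto simp: Pz_def Rz_def indicator_def)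
      show "\<rho> \<ge> 1" by (rule \<rho>)
      show "AE x in lborel. isCont Pz x"
        using AE_not_in[OF null]
      proof eventually_elim
        case (elim x)
        show ?case
        proof (cases "x \<in> \<Omega>")
          case True
          have "isCont P x" using Ck1_continuous[OF \<Omega>(1) P(2)] continuous_on_eq_continuous_at[OF \<Omega>(1)] True by blast
          moreover have "\<forall>\<^sub>F y in nhds x. Pz y = P y"
            using eventually_nhds_in_open[OF \<Omega>(1) True] by eventually_elim (simp add: Pz_def)
          ultimately show ?thesis using isCont_cong[of Pz P x] by simp
        next
          case False
          then have "x \<in> - closure \<Omega>" using elim by (auto simp: frontier_def interior_open[OF \<Omega>(1)])
          then have "\<forall>\<^sub>F y in nhds x. y \<in> - closure \<Omega>" by (intro eventually_nhds_in_open) auto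
          then have "\<forall>\<^sub>F y in nhds x. Pz y = 0"
            by eventually_elim (use closure_subset[of \<Omega>] in \<open>auto simp: Pz_def indicator_def\<close>)
          then show ?thesis using isCont_cong[of Pz "\<lambda>_. 0" x] by simp
        qed
      qed
      fix i :: 3 and \<phi> :: "real^3 \<Rightarrow> real" assume \<phi>: "Ck_on 1 UNIV \<phi>"
      have C0: "Ck_on 1 UNIV (\<lambda>y::real^3. 0::real)" unfolding Ck1_iff[OF open_UNIV] by (auto intro!: exI[of _ "\<lambda>x v. 0"])
      define m where "m k y = (\<chi> a b. if a = i \<and> b = k then \<phi> y else 0)" for k :: 3 and y
      have mC: "Ck_on 1 UNIV (m k)" for k
        unfolding m_def[abs_def]
      proof (intro Ck1_vec[OF open_UNIV])
        fix a b
        have "(\<lambda>y. if a = i \<and> b = k then \<phi> y else 0) = (if a = i \<and> b = k then \<phi> else (\<lambda>y. 0))" by auto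
        then show "Ck_on 1 UNIV (\<lambda>y. (\<chi> a b. if a = i \<and> b = k then \<phi> y else 0) $ a $ b)"
          using \<phi> C0 by (simp only: vec_lambda_beta split: if_split) blast
      qed
      have md: "m k differentiable (at y)" for k y by (rule Ck1_differentiable[OF open_UNIV mC]) simp
      have mn: "(\<lambda>y. m k y $ a $ b) = (\<lambda>y. if a = i \<and> b = k then \<phi> y else 0)" for k a b by (simp add: m_def)
      have Rm: "Rz y \<bullet> m k y = Rz y $ i $ k * \<phi> y" for y k
      proof -
        have "Rz y \<bullet> m k y = (\<Sum>a\<in>UNIV. \<Sum>b\<in>UNIV. if a = i then (if b = k then Rz y $ a $ b * \<phi> y else 0) else 0)"
          unfolding inner_vec_def by (intro sum.cong refl) (auto simp: m_def)
        also have "\<dots> = (\<Sum>a\<in>UNIV. if a = i then Rz y $ a $ k * \<phi> y else 0)"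
          by (intro sum.cong refl) (simp add: sum.delta)
        finally show ?thesis by (simp add: sum.delta)
      qed
      have Cm: "Pz y \<bullet> Curl (m k) y = Pz y $ i $ 1 * Curl (m k) y $ i $ 1 + Pz y $ i $ 2 * Curl (m k) y $ i $ 2 + Pz y $ i $ 3 * Curl (m k) y $ i $ 3" for y k
      proof -
        have "Curl (m k) y $ a $ b = 0" if "a \<noteq> i" for a b
          using Curl_nth[OF md[of k y], of a] exhaust_3[of b] that by (auto simp: mn pz pd_const)
        then have h: "Pz y $ a \<bullet> Curl (m k) y $ a = (if a = i then Pz y $ i \<bullet> Curl (m k) y $ i else 0)" for a
          by (auto simp: inner_vec_def)
        have "(\<Sum>a\<in>UNIV. Pz y $ a \<bullet> Curl (m k) y $ a) = (\<Sum>a\<in>UNIV. if a = i then Pz y $ i \<bullet> Curl (m k) y $ i else 0)"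
          by (rule sum.cong[OF refl h])
        then have "Pz y \<bullet> Curl (m k) y = Pz y $ i \<bullet> Curl (m k) y $ i"
          unfolding inner_vec_def[of "Pz y" "Curl (m k) y"] by (simp add: sum.delta)
        then show ?thesis by (simp add: inner_vec_def sum_3)
      qed
      show "(LINT y|lborel. Rz y $ i $ 3 * \<phi> y) = (LINT y|lborel. Pz y $ i $ 1 * pd 2 \<phi> y - Pz y $ i $ 2 * pd 1 \<phi> y)"
        using weak[OF mC[of 3]] unfolding Rm Cm Curl_nth[OF md] mn pz by simp
      show "(LINT y|lborel. Rz y $ i $ 2 * \<phi> y) = (LINT y|lborel. Pz y $ i $ 3 * pd 1 \<phi> y - Pz y $ i $ 1 * pd 3 \<phi> y)"
        using weak[OF mC[of 2]] unfolding Rm Cm Curl_nth[OF md] mn pz by (simp add: algebra_simps)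
    qed
    have sp: "sym_part (c *\<^sub>R X) = c *\<^sub>R sym_part X" for c X by (rule linear_cmul[OF linear_sym_part])
    have ind: "(norm (indicator \<Omega> x *\<^sub>R X))\<^sup>2 = indicator \<Omega> x * (norm X)\<^sup>2" for x and X :: "real^3^3" by (cases "x \<in> \<Omega>") auto
    define a b where "a = (LINT x|lborel. indicator \<Omega> x * (norm (sym_part (P x)))\<^sup>2)"
      and "b = (LINT x|lborel. indicator \<Omega> x * (norm (Curl P x))\<^sup>2)"
    have ab: "a \<ge> 0" "b \<ge> 0" unfolding a_def b_def by (intro integral_nonneg_AE; simp)+
    have "(LINT x|lborel. indicator \<Omega> x * (norm (P x))\<^sup>2) \<le> 8 * a + 3400 * \<rho>\<^sup>2 * b"
      using K unfolding Pz_def Rz_def sp ind a_def b_def .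
    also have "\<dots> \<le> (8 + 3400 * \<rho>\<^sup>2) * a + (8 + 3400 * \<rho>\<^sup>2) * b" using ab by (intro add_mono mult_right_mono) auto
    finally show "(LINT x|lborel. indicator \<Omega> x * (norm (P x))\<^sup>2) \<le> (8 + 3400 * \<rho>\<^sup>2) * (a + b)" by (simp add: distrib_left)
  qed
qed

text \<open>The extension of \<open>u\<close> by zero is Lipschitz in the whole space although \<open>\<Omega>\<close> is not convex: a segment that leaves \<open>\<Omega>\<close> meets the boundary, and at its end
  points \<open>u\<close> is bounded by \<open>B\<close> times the distance to the boundary, which the straight way to the nearest boundary point shows.\<close>

theorem korn_on_domain:
  fixes u :: "real^3 \<Rightarrow> real^3"
  assumes \<Omega>: "open \<Omega>" "bounded \<Omega>" "\<Omega> \<noteq> {}" and null: "frontier \<Omega> \<in> null_sets lborel"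
    and u: "continuous_on (closure \<Omega>) u" "Ck_on 1 \<Omega> u" "\<And>x. x \<in> frontier \<Omega> \<Longrightarrow> u x = 0"
    and B: "\<And>x. x \<in> \<Omega> \<Longrightarrow> onorm ((*v) (grad u x)) \<le> B"
  shows "(LINT x|lborel. indicator \<Omega> x * (norm (grad u x))\<^sup>2) \<le> 2 * (LINT x|lborel. indicator \<Omega> x * (norm (sym_part (grad u x)))\<^sup>2)"
proof -
  note F = bounded_open_frontier[OF \<Omega>]
  define uz where "uz x = (if x \<in> \<Omega> then u x else 0)" for x
  define W where "W x = indicator \<Omega> x *\<^sub>R grad u x" for x
  have der: "(u has_derivative ((*v) (grad u x))) (at x)" if "x \<in> \<Omega>" for x
    using Ck1_differentiable[OF \<Omega>(1) u(2) that] unfolding grad_def jacobian_works .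
  have B0: "B \<ge> 0"
  proof -
    obtain x where "x \<in> \<Omega>" using \<Omega>(3) by auto
    then show ?thesis using order_trans[OF onorm_pos_le[OF matrix_vector_mul_bounded_linear] B] by blast
  qed
  have seg: "norm (u x - u y) \<le> B * norm (x - y)" if "closed_segment x y \<subseteq> \<Omega>" for x y
    by (rule differentiable_bound[of "closed_segment x y" u "\<lambda>x. (*v) (grad u x)"])
      (use that B in \<open>auto intro: has_derivative_at_withinI der\<close>)
  have bdry: "norm (u x) \<le> B * infdist x (frontier \<Omega>)" if x: "x \<in> \<Omega>" for x
  proof -
    obtain p where p: "p \<in> frontier \<Omega>" "dist x p = infdist x (frontier \<Omega>)" using exists_nearest[OF F] by blast
    define q where "q n = x + (1 - 1 / real (Suc n)) *\<^sub>R (p - x)" for n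
    have xp: "dist x p > 0" using x p(1) \<Omega>(1) by (auto simp: frontier_def interior_open)
    have inb: "x + t *\<^sub>R (p - x) \<in> \<Omega>" if "0 \<le> t" "t < 1" for t
    proof -
      have "dist x (x + t *\<^sub>R (p - x)) = t * dist x p" using that by (simp add: dist_norm norm_minus_commute)
      also have "\<dots> < dist x p" using that xp by simp
      finally show ?thesis using ball_in_domain[OF x] p(2) by auto
    qed
    have "norm (u x - u (q n)) \<le> B * dist x p" for n
    proof -
      have "closed_segment x (q n) \<subseteq> \<Omega>"
      proof
        fix z assume "z \<in> closed_segment x (q n)"
        then obtain s where s: "0 \<le> s" "s \<le> 1" "z = (1 - s) *\<^sub>R x + s *\<^sub>R q n" by (auto simp: in_segment)
        then have "z = x + (s * (1 - 1 / real (Suc n))) *\<^sub>R (p - x)" by (simp add: q_def algebra_simps)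
        moreover have "s * (1 - 1 / real (Suc n)) \<le> 1 * (1 - 1 / real (Suc n))" using s by (intro mult_right_mono) auto
        moreover have "1 - 1 / real (Suc n) < 1" by simp
        moreover have "0 \<le> s * (1 - 1 / real (Suc n))" using s by (intro mult_nonneg_nonneg) auto
        ultimately show "z \<in> \<Omega>" using inb[of "s * (1 - 1 / real (Suc n))"] by (metis mult_1 order_le_less_trans)
      qed
      then have "norm (u x - u (q n)) \<le> B * norm (x - q n)" by (rule seg)
      also have "norm (x - q n) = (1 - 1 / real (Suc n)) * dist x p" by (simp add: q_def dist_norm norm_minus_commute)
      also have "B * ((1 - 1 / real (Suc n)) * dist x p) \<le> B * (1 * dist x p)" using B0 by (intro mult_left_mono mult_right_mono) auto
      finally show ?thesis by simp
    qed
    moreover have "(\<lambda>n. norm (u x - u (q n))) \<longlonglongrightarrow> norm (u x - u p)"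
    proof -
      have "(\<lambda>n. x + (1 - 1 / real (Suc n)) *\<^sub>R (p - x)) \<longlonglongrightarrow> x + (1 - 0) *\<^sub>R (p - x)"
        using LIMSEQ_inverse_real_of_nat by (intro tendsto_intros) (simp add: inverse_eq_divide)
      then have "q \<longlonglongrightarrow> p" by (simp add: q_def[abs_def])
      moreover have "q n \<in> closure \<Omega>" for n using inb[of "1 - 1 / real (Suc n)"] closure_subset by (auto simp: q_def)
      moreover have "p \<in> closure \<Omega>" using p(1) by (simp add: frontier_def)
      ultimately have "(\<lambda>n. u (q n)) \<longlonglongrightarrow> u p" 
        by (intro continuous_on_tendsto_compose[OF u(1)]) auto
      then show ?thesis by (rule tendsto_norm[OF tendsto_diff[OF tendsto_const]])
    qed
    ultimately have "norm (u x - u p) \<le> B * dist x p" by (intro LIMSEQ_le_const2) auto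
    then show ?thesis using u(3)[OF p(1)] p(2) by simp
  qed
  have lip: "dist (uz x) (uz y) \<le> (2 * B) * dist x y" for x y
  proof (cases "closed_segment x y \<inter> frontier \<Omega> = {}")
    case True
    have sz: "z \<in> \<Omega> \<longleftrightarrow> x \<in> \<Omega>" if "z \<in> closed_segment x y" for z
    proof -
      have "closed_segment x z \<subseteq> closed_segment x y" using that by (simp add: closed_segment_subset)
      then show ?thesis using same_side_of_frontier[of x z \<Omega>] True by blast
    qed
    show ?thesis
    proof (cases "x \<in> \<Omega>")
      case T: True
      then have s: "closed_segment x y \<subseteq> \<Omega>" using sz by blast
      then have "dist (uz x) (uz y) \<le> B * dist x y" using seg[OF s] T sz[of y] by (auto simp: uz_def dist_norm)
      also have "\<dots> \<le> (2 * B) * dist x y" using B0 by (intro mult_right_mono) auto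
      finally show ?thesis .
    next
      case False
      then show ?thesis using sz[of y] B0 by (auto simp: uz_def)
    qed
  next
    case False
    then obtain z where z: "z \<in> closed_segment x y" "z \<in> frontier \<Omega>" by blast
    have b: "norm (uz w) \<le> B * dist x y" if w: "w \<in> {x, y}" for w
    proof (cases "w \<in> \<Omega>")
      case True
      have "infdist w (frontier \<Omega>) \<le> dist w z" using infdist_le[OF z(2)] .
      also have "\<dots> \<le> dist x y" using dist_in_closed_segment[OF z(1)] w by (auto simp: dist_commute)
      finally have "B * infdist w (frontier \<Omega>) \<le> B * dist x y" using B0 by (rule mult_left_mono)
      then show ?thesis using bdry[OF True] True by (simp add: uz_def)
    qed (use B0 in \<open>simp add: uz_def\<close>)
    have "dist (uz x) (uz y) \<le> norm (uz x) + norm (uz y)" by (simp add: dist_norm norm_triangle_ineq4)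
    then show ?thesis using b[of x] b[of y] by simp
  qed
  obtain R where R: "\<And>x. x \<in> \<Omega> \<Longrightarrow> norm x \<le> R" using \<Omega>(2) by (auto simp: bounded_iff)
  have "(LINT x|lborel. (norm (W x))\<^sup>2) \<le> 2 * (LINT x|lborel. (norm (sym_part (W x)))\<^sup>2)"
  proof (rule korn_first[OF lip])
    show "uz x = 0" if "norm x > R" for x using R[of x] that by (auto simp: uz_def)
    show "W \<in> borel_measurable borel" unfolding W_def[abs_def]
      by (rule borel_measurable_continuous_on_indicator[OF _ grad_continuous[OF \<Omega>(1) u(2)]]) (simp add: borel_open \<Omega>)
    show "AE x in lborel. (uz has_derivative (*v) (W x)) (at x)"
      using AE_not_in[OF null]
    proof eventually_elim
      case (elim x)
      show ?case
      proof (cases "x \<in> \<Omega>")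
        case True
        have "(uz has_derivative (*v) (grad u x)) (at x)"
          by (rule has_derivative_transform_within_open[OF der[OF True] \<Omega>(1) True]) (simp add: uz_def)
        then show ?thesis using True by (simp add: W_def)
      next
        case False
        then have x: "x \<in> - closure \<Omega>" using elim by (auto simp: frontier_def interior_open[OF \<Omega>(1)])
        have "(uz has_derivative (\<lambda>v. 0)) (at x)"
        proof (rule has_derivative_transform_within_open[OF has_derivative_const[of 0] _ x])
          show "0 = uz y" if "y \<in> - closure \<Omega>" for y using that closure_subset[of \<Omega>] by (auto simp: uz_def)
        qed auto
        moreover have "(*v) (W x) = (\<lambda>v. 0)" using False by (simp add: W_def fun_eq_iff)
        ultimately show ?thesis by simp
      qed
    qed
  qed
  moreover have "sym_part (W x) = indicator \<Omega> x *\<^sub>R sym_part (grad u x)" for x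
    unfolding W_def by (rule linear_cmul[OF linear_sym_part])
  moreover have "(norm (indicator \<Omega> x *\<^sub>R X))\<^sup>2 = indicator \<Omega> x * (norm X)\<^sup>2" for x and X :: "real^3^3" by (cases "x \<in> \<Omega>") auto
  ultimately show ?thesis by (simp add: W_def)
qed

section \<open>Energy identity from a symmetric pairing\<close>

text \<open>Put \<open>D s t = N s t - N t s\<close>. By symmetry of \<open>b\<close> and \<open>k\<close>, \<open>\<partial>\<^sub>s D + \<partial>\<^sub>t D = 0\<close>, so \<open>D\<close> depends on \<open>s - t\<close> only. Its derivative in \<open>s\<close> on the diagonal, which
  is \<open>- (b t t + k t t)\<close>, is therefore independent of \<open>t\<close>. No derivative of \<open>b\<close> or \<open>k\<close> enters.\<close>

lemma energy_identity_from_symmetric_pairing: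
  fixes N b k :: "real \<Rightarrow> real \<Rightarrow> real"
  assumes T: "0 < T"
    and Ns: "\<And>s t. s \<in> {0..T} \<Longrightarrow> t \<in> {0..T} \<Longrightarrow>
        ((\<lambda>r. N r t) has_real_derivative - b s t) (at s within {0..T})"
    and Nt: "\<And>s t. s \<in> {0..T} \<Longrightarrow> t \<in> {0..T} \<Longrightarrow>
        (N s has_real_derivative k s t) (at t within {0..T})"
    and kc: "continuous_on ({0..T} \<times> {0..T}) (\<lambda>(s, t). k s t)"
    and bsym: "\<And>s t. b s t = b t s" and ksym: "\<And>s t. k s t = k t s"
    and t: "t \<in> {0..T}"
  shows "b t t + k t t = b 0 0 + k 0 0"
proof -
  have N2: "((\<lambda>(x, y). N x y) has_derivative (\<lambda>(dx, dy). - b s t * dx + dy * k s t))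
      (at (s, t) within {0..T} \<times> {0..T})" if st: "s \<in> {0..T}" "t \<in> {0..T}" for s t
  proof -
    have "((\<lambda>(x, y). N x y) has_derivative
        (\<lambda>(dx, dy). - b s t * dx + blinfun_apply (blinfun_scaleR_left (k s t)) dy))
        (at (s, t) within {0..T} \<times> {0..T})"
    proof (rule has_derivative_partialsI)
      show "((\<lambda>x. N x t) has_derivative (*) (- b s t)) (at s within {0..T})"
        using Ns[OF st] by (simp add: has_field_derivative_def)
      show "(N x has_derivative blinfun_apply (blinfun_scaleR_left (k x y))) (at y within {0..T})"
        if "x \<in> {0..T}" "y \<in> {0..T}" for x y
        using Nt[OF that] by (simp add: has_field_derivative_def mult_commute_abs)
      have "continuous (at (s, t) within {0..T} \<times> {0..T}) (\<lambda>(s, t). k s t)"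
        using kc st by (auto simp: continuous_on_eq_continuous_within)
      then have "continuous (at (s, t) within {0..T} \<times> {0..T})
          (\<lambda>z. blinfun_scaleR_left ((\<lambda>(s, t). k s t) z))"
        by (rule bounded_linear.continuous[OF bounded_linear_blinfun_scaleR_left])
      then show "continuous (at (s, t) within {0..T} \<times> {0..T})
          (\<lambda>(x, y). blinfun_scaleR_left (k x y))"
        by (simp add: case_prod_unfold)
    qed (use st in auto)
    then show ?thesis by simp
  qed
  define D where "D s t = N s t - N t s" for s t
  have Dconst: "D (t + e) t = D e 0" if e: "e \<ge> 0" "t \<ge> 0" "t + e \<le> T" for t e
  proof -
    have c1: "((\<lambda>r. (r + e, r)) has_derivative (\<lambda>h. (h, h))) (at r within {0..T - e})" for r
      by (auto intro!: derivative_eq_intros)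
    have c2: "((\<lambda>r. (r, r + e)) has_derivative (\<lambda>h. (h, h))) (at r within {0..T - e})" for r
      by (auto intro!: derivative_eq_intros)
    have "((\<lambda>r. D (r + e) r) has_derivative (\<lambda>h. 0)) (at r within {0..T - e})"
      if r: "r \<in> {0..T - e}" for r
    proof -
      have N1: "((\<lambda>r. N (r + e) r) has_derivative (\<lambda>h. - b (r + e) r * h + h * k (r + e) r))
          (at r within {0..T - e})"
        using has_derivative_in_compose[OF c1 has_derivative_subset[OF N2[of "r + e" r]]] r e
        by (auto simp: image_subset_iff)
      have N1': "((\<lambda>r. N r (r + e)) has_derivative (\<lambda>h. - b r (r + e) * h + h * k r (r + e)))
          (at r within {0..T - e})"
        using has_derivative_in_compose[OF c2 has_derivative_subset[OF N2[of r "r + e"]]] r e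
        by (auto simp: image_subset_iff)
      show ?thesis
        using has_derivative_diff[OF N1 N1'] unfolding D_def
        by (simp add: bsym[of r] ksym[of r])
    qed
    then obtain c where "\<And>r. r \<in> {0..T - e} \<Longrightarrow> D (r + e) r = c"
      using has_derivative_zero_constant[of "{0..T - e}" "\<lambda>r. D (r + e) r"] by (meson convex_real_interval(5))
    from this[of t] this[of 0] e show ?thesis by simp
  qed
  have D': "((\<lambda>r. D r t) has_real_derivative - (b t t + k t t)) (at t within {0..T})"
    if "t \<in> {0..T}" for t
    unfolding D_def using DERIV_diff[OF Ns Nt, OF that that that that] by simp
  have lim: "((\<lambda>r. D r t / (r - t)) \<longlongrightarrow> - (b t t + k t t)) (at t within {0..T})"
    if "t \<in> {0..T}" for t
    using D'[OF that] unfolding has_field_derivative_iff by (simp add: D_def)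
  have at0: "((\<lambda>e. D e 0 / e) \<longlongrightarrow> - (b 0 0 + k 0 0)) (at_right 0)"
    using lim[of 0] T by (simp add: at_within_Icc_at_right)
  show ?thesis
  proof (cases "t = T")
    case False
    then have tT: "t < T" "0 \<le> t" using t by auto
    have "((\<lambda>r. D r t / (r - t)) \<longlongrightarrow> - (b t t + k t t)) (at_right t)"
    proof -
      have "at_right t = at t within {t<..<T}"
        by (rule at_within_nhd[of t "{..<T}"]) (use tT in auto)
      moreover have "{t<..<T} \<subseteq> {0..T}" using tT by auto
      ultimately show ?thesis using tendsto_within_subset[OF lim[OF t]] by metis
    qed
    then have "((\<lambda>e. D (e + t) t / e) \<longlongrightarrow> - (b t t + k t t)) (at_right 0)"
      by (subst (asm) filterlim_at_right_to_0) simp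
    moreover have "\<forall>\<^sub>F e in at_right 0. D (e + t) t / e = D e 0 / e"
    proof -
      have "D (e + t) t / e = D e 0 / e" if "e \<in> {0<..<T - t}" for e
        using Dconst[of e t] that tT by (simp add: add.commute)
      then show ?thesis using eventually_at_right_real[of 0 "T - t"] tT by (auto elim!: eventually_mono)
    qed
    ultimately have "((\<lambda>e. D e 0 / e) \<longlongrightarrow> - (b t t + k t t)) (at_right 0)"
      by (simp cong: tendsto_cong)
    from tendsto_unique[OF _ this at0] show ?thesis by simp
  next
    case True
    have "((\<lambda>r. D r T / (r - T)) \<longlongrightarrow> - (b T T + k T T)) (at_left T)"
      using lim[of T] T by (simp add: at_within_Icc_at_left)
    then have "((\<lambda>e. D (T - e) T / - e) \<longlongrightarrow> - (b T T + k T T)) (at_right 0)"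
      by (simp add: filterlim_at_left_to_right filterlim_at_right_to_0[of _ _ "-T"])
    moreover have "\<forall>\<^sub>F e in at_right 0. D (T - e) T / - e = D e 0 / e"
    proof -
      have "D (T - e) T / - e = D e 0 / e" if "e \<in> {0<..<T}" for e
      proof -
        have "D T (T - e) = D e 0" using Dconst[of e "T - e"] that by simp
        then have "D (T - e) T = - D e 0" by (simp add: D_def)
        then show ?thesis by simp
      qed
      then show ?thesis using eventually_at_right_real[of 0 T] T by (auto elim!: eventually_mono)
    qed
    ultimately have "((\<lambda>e. D e 0 / e) \<longlongrightarrow> - (b T T + k T T)) (at_right 0)"
      by (simp cong: tendsto_cong)
    from tendsto_unique[OF _ this at0] show ?thesis by (simp add: True)
  qed
qed

section \<open>Parameter integrals\<close>

lemma Ck_on_cong: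
  assumes "\<And>x. x \<in> S \<Longrightarrow> f x = g x" "Ck_on k S f" shows "Ck_on k S g"
  using assms
proof (induction k arbitrary: f g)
  case 0
  then show ?case by (simp cong: continuous_on_cong)
next
  case (Suc k)
  have h: "(f has_derivative f') (at x within S) \<longleftrightarrow> (g has_derivative f') (at x within S)" if "x \<in> S" for x f'
    using has_derivative_transform[OF that, of g f f'] has_derivative_transform[OF that, of f g f'] Suc.prems(1) by auto
  then have fr: "frechet_derivative f (at x within S) = frechet_derivative g (at x within S)" if "x \<in> S" for x
    using that by (simp add: frechet_derivative_def)
  have "g differentiable (at x within S)" if "x \<in> S" for x
    using Suc.prems(2) h[OF that] that unfolding Ck_on.simps differentiable_def by blast
  moreover have "Ck_on k S (\<lambda>x. frechet_derivative g (at x within S) b)" if "b \<in> Basis" for b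
    by (rule Suc.IH[of "\<lambda>x. frechet_derivative f (at x within S) b"]) (use Suc.prems(2) fr that in auto)
  ultimately show ?case by simp
qed

lemma continuous_on_parameter_integral:
  fixes f :: "'p::metric_space \<Rightarrow> 'a::euclidean_space \<Rightarrow> real"
  assumes \<Omega>: "open \<Omega>" "bounded \<Omega>"
    and f: "\<And>p. p \<in> S \<Longrightarrow> continuous_on \<Omega> (f p)" "\<And>x p. x \<in> \<Omega> \<Longrightarrow> p \<in> S \<Longrightarrow> \<bar>f p x\<bar> \<le> B"
    and c: "\<And>x. x \<in> \<Omega> \<Longrightarrow> continuous_on S (\<lambda>p. f p x)"
  shows "continuous_on S (\<lambda>p. LINT x|lborel. indicator \<Omega> x * f p x)"
  unfolding continuous_on_sequentially comp_def
proof (intro allI ballI impI)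
  fix q p assume p: "p \<in> S" and q: "(\<forall>n. q n \<in> S) \<and> q \<longlonglongrightarrow> p"
  have m: "(\<lambda>x. indicator \<Omega> x * f r x) \<in> borel_measurable borel" if "r \<in> S" for r
    using borel_measurable_continuous_on_indicator[OF _ f(1)[OF that]] \<Omega>(1) by (simp add: borel_open)
  show "(\<lambda>n. LINT x|lborel. indicator \<Omega> x * f (q n) x) \<longlonglongrightarrow> (LINT x|lborel. indicator \<Omega> x * f p x)"
  proof (rule integral_dominated_convergence[where w = "\<lambda>x. indicator \<Omega> x * \<bar>B\<bar>"])
    show "integrable lborel (\<lambda>x. indicator \<Omega> x * \<bar>B\<bar>)"
      by (rule indicator_times_integrable[OF \<Omega>]) auto
    show "AE x in lborel. (\<lambda>n. indicator \<Omega> x * f (q n) x) \<longlonglongrightarrow> indicator \<Omega> x * f p x"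
    proof (rule AE_I2)
      fix x
      show "(\<lambda>n. indicator \<Omega> x * f (q n) x) \<longlonglongrightarrow> indicator \<Omega> x * f p x"
      proof (cases "x \<in> \<Omega>")
        case True
        then have "(\<lambda>n. f (q n) x) \<longlonglongrightarrow> f p x"
          using c[OF True] p q unfolding continuous_on_sequentially comp_def by blast
        then show ?thesis by (rule tendsto_mult[OF tendsto_const])
      qed simp
    qed
    show "AE x in lborel. norm (indicator \<Omega> x * f (q n) x) \<le> indicator \<Omega> x * \<bar>B\<bar>" for n
    proof (rule AE_I2)
      fix x
      show "norm (indicator \<Omega> x * f (q n) x) \<le> indicator \<Omega> x * \<bar>B\<bar>"
        using f(2)[of x "q n"] q by (cases "x \<in> \<Omega>") auto
    qed
  qed (use m p q in auto)
qed

lemma leibniz_rule_bounded: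
  fixes f f' :: "real \<Rightarrow> 'a::euclidean_space \<Rightarrow> real"
  assumes \<Omega>: "open \<Omega>" "bounded \<Omega>" 
    and c: "\<And>t. t \<in> {0..T} \<Longrightarrow> continuous_on \<Omega> (f t)" "\<And>t. t \<in> {0..T} \<Longrightarrow> continuous_on \<Omega> (f' t)"
    and d: "\<And>x t. x \<in> \<Omega> \<Longrightarrow> t \<in> {0..T} \<Longrightarrow> ((\<lambda>s. f s x) has_real_derivative f' t x) (at t within {0..T})"
    and B: "\<And>x t. x \<in> \<Omega> \<Longrightarrow> t \<in> {0..T} \<Longrightarrow> \<bar>f t x\<bar> \<le> A" "\<And>x t. x \<in> \<Omega> \<Longrightarrow> t \<in> {0..T} \<Longrightarrow> \<bar>f' t x\<bar> \<le> B"
    and t: "t \<in> {0..T}"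
  shows "((\<lambda>s. LINT x|lborel. indicator \<Omega> x * f s x) has_real_derivative (LINT x|lborel. indicator \<Omega> x * f' t x)) (at t within {0..T})"
  unfolding has_field_derivative_iff tendsto_at_iff_sequentially comp_def
proof (intro allI impI)
  fix q :: "nat \<Rightarrow> real" assume q: "\<forall>i. q i \<in> {0..T} - {t}" "q \<longlonglongrightarrow> t"
  then have qI: "q n \<in> {0..T}" "q n \<noteq> t" for n by auto
  have m: "(\<lambda>x. indicator \<Omega> x * g x) \<in> borel_measurable borel" if "continuous_on \<Omega> g" for g :: "'a \<Rightarrow> real"
    using borel_measurable_continuous_on_indicator[OF _ that] \<Omega>(1) by (simp add: borel_open)
  have lip: "\<bar>f s x - f t x\<bar> \<le> B * \<bar>s - t\<bar>" if "x \<in> \<Omega>" "s \<in> {0..T}" for x s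
    using field_differentiable_bound[of "{0..T}" "\<lambda>s. f s x" "\<lambda>s. f' s x" B s t] d[OF that(1)] B(2)[OF that(1)] t that(2)
    by auto
  have cq: "continuous_on \<Omega> (\<lambda>x. (f (q n) x - f t x) / (q n - t))" for n
    using qI by (intro continuous_intros c t) auto
  have "(\<lambda>n. LINT x|lborel. indicator \<Omega> x * ((f (q n) x - f t x) / (q n - t))) \<longlonglongrightarrow> (LINT x|lborel. indicator \<Omega> x * f' t x)"
  proof (rule integral_dominated_convergence[where w = "\<lambda>x. indicator \<Omega> x * \<bar>B\<bar>"])
    show "integrable lborel (\<lambda>x. indicator \<Omega> x * \<bar>B\<bar>)"
      by (rule indicator_times_integrable[OF \<Omega>]) auto
    show "AE x in lborel. (\<lambda>n. indicator \<Omega> x * ((f (q n) x - f t x) / (q n - t))) \<longlonglongrightarrow> indicator \<Omega> x * f' t x"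
    proof (rule AE_I2)
      fix x
      show "(\<lambda>n. indicator \<Omega> x * ((f (q n) x - f t x) / (q n - t))) \<longlonglongrightarrow> indicator \<Omega> x * f' t x"
      proof (cases "x \<in> \<Omega>")
        case True
        then have "(\<lambda>n. (f (q n) x - f t x) / (q n - t)) \<longlonglongrightarrow> f' t x"
          using d[OF True t] q unfolding has_field_derivative_iff tendsto_at_iff_sequentially comp_def by blast
        then show ?thesis by (rule tendsto_mult[OF tendsto_const])
      qed simp
    qed
    show "AE x in lborel. norm (indicator \<Omega> x * ((f (q n) x - f t x) / (q n - t))) \<le> indicator \<Omega> x * \<bar>B\<bar>" for n
    proof (rule AE_I2)
      fix x
      show "norm (indicator \<Omega> x * ((f (q n) x - f t x) / (q n - t))) \<le> indicator \<Omega> x * \<bar>B\<bar>"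
      proof (cases "x \<in> \<Omega>")
        case True
        have "\<bar>(f (q n) x - f t x) / (q n - t)\<bar> \<le> B"
          using lip[OF True qI(1)[of n]] qI(2)[of n] by (simp add: pos_divide_le_eq)
        then show ?thesis using True by simp
      qed simp
    qed
    show "(\<lambda>x. indicator \<Omega> x * ((f (q n) x - f t x) / (q n - t))) \<in> borel_measurable lborel" for n
      using m[OF cq] by simp
    show "(\<lambda>x. indicator \<Omega> x * f' t x) \<in> borel_measurable lborel"
      using m[OF c(2)[OF t]] by simp
  qed
  moreover have e: "(LINT x|lborel. indicator \<Omega> x * ((f (q n) x - f t x) / (q n - t))) =
      ((LINT x|lborel. indicator \<Omega> x * f (q n) x) - (LINT x|lborel. indicator \<Omega> x * f t x)) / (q n - t)" for n
  proof -
    have i: "integrable lborel (\<lambda>x. indicator \<Omega> x * f s x)" if "s \<in> {0..T}" for s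
      by (rule indicator_times_integrable[OF \<Omega> c(1)[OF that] B(1)]) (use that in auto)
    have "(LINT x|lborel. indicator \<Omega> x * ((f (q n) x - f t x) / (q n - t))) =
       (LINT x|lborel. (indicator \<Omega> x * f (q n) x - indicator \<Omega> x * f t x) / (q n - t))"
      by (simp add: right_diff_distrib)
    also have "\<dots> = (LINT x|lborel. indicator \<Omega> x * f (q n) x - indicator \<Omega> x * f t x) / (q n - t)"
      by (rule integral_divide_zero)
    finally show ?thesis by (simp add: Bochner_Integration.integral_diff[OF i[OF qI(1)] i[OF t]])
  qed
  ultimately show "(\<lambda>n. ((LINT x|lborel. indicator \<Omega> x * f (q n) x) - (LINT x|lborel. indicator \<Omega> x * f t x)) / (q n - t))
      \<longlonglongrightarrow> (LINT x|lborel. indicator \<Omega> x * f' t x)" by (simp only: e)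
qed

section \<open>Regularity of the slices of a space-time field\<close>

text \<open>The time derivative is the derivative in the direction \<open>(0, 1)\<close>, one-sided at the ends of the time interval.\<close>

lemma space_time_slices:
  fixes w :: "real^3 \<Rightarrow> real \<Rightarrow> 'b::real_normed_vector"
  assumes \<Omega>: "open \<Omega>" and T: "0 < T" and U: "Ck_on 1 (\<Omega> \<times> {0..T}) (\<lambda>(x, t). w x t)"
    and x: "x \<in> \<Omega>" and t: "t \<in> {0..T}"
  defines "D \<equiv> frechet_derivative (\<lambda>(x, t). w x t) (at (x, t) within \<Omega> \<times> {0..T})"
  shows "((\<lambda>y. w y t) has_derivative (\<lambda>v. D (v, 0))) (at x)"
    and "((\<lambda>s. w x s) has_vector_derivative dt T w x t) (at t within {0..T})"
    and "dt T w x t = D (0, 1)"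
proof -
  let ?S = "\<Omega> \<times> {0..T}"
  have "(\<lambda>(x, t). w x t) differentiable (at (x, t) within ?S)" using U x t by auto
  then have d: "((\<lambda>(x, t). w x t) has_derivative D) (at (x, t) within ?S)"
    unfolding D_def by (simp add: frechet_derivative_works)
  have "((\<lambda>y. (y, t)) has_derivative (\<lambda>v. (v, 0))) (at x within \<Omega>)" by (auto intro!: derivative_eq_intros)
  moreover have "((\<lambda>(x, t). w x t) has_derivative D) (at (x, t) within (\<lambda>y. (y, t)) ` \<Omega>)"
    by (rule has_derivative_subset[OF d]) (use t in auto)
  ultimately have "((\<lambda>y. w y t) has_derivative (\<lambda>v. D (v, 0))) (at x within \<Omega>)"
    using has_derivative_in_compose[of "\<lambda>y. (y, t)" _ x \<Omega> "\<lambda>(x, t). w x t" D] by simp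
  then show "((\<lambda>y. w y t) has_derivative (\<lambda>v. D (v, 0))) (at x)" using at_within_open[OF x \<Omega>] by simp
  have "((\<lambda>s. (x, s)) has_derivative (\<lambda>h. (0, h))) (at t within {0..T})" by (auto intro!: derivative_eq_intros)
  moreover have "((\<lambda>(x, t). w x t) has_derivative D) (at (x, t) within (\<lambda>s. (x, s)) ` {0..T})"
    by (rule has_derivative_subset[OF d]) (use x in auto)
  ultimately have h: "((\<lambda>s. w x s) has_derivative (\<lambda>h. D (0, h))) (at t within {0..T})"
    using has_derivative_in_compose[of "\<lambda>s. (x, s)" _ t "{0..T}" "\<lambda>(x, t). w x t" D] by simp
  have sc: "D (0, h) = h *\<^sub>R D (0, 1)" for h
    using linear_cmul[OF has_derivative_linear[OF d], of h "(0, 1)"] by simp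
  have v: "((\<lambda>s. w x s) has_vector_derivative D (0, 1)) (at t within {0..T})"
    using h unfolding has_vector_derivative_def sc[symmetric] .
  show e: "dt T w x t = D (0, 1)"
    unfolding dt_def using vector_derivative_within_cbox[OF T, of t "w x" "D (0, 1)"] t v by (simp add: cbox_interval)
  show "((\<lambda>s. w x s) has_vector_derivative dt T w x t) (at t within {0..T})" using v e by simp
qed

lemma Ck1_slices:
  fixes w :: "real^3 \<Rightarrow> real \<Rightarrow> 'b::real_normed_vector"
  assumes \<Omega>: "open \<Omega>" and T: "0 < T" and U: "Ck_on 1 (\<Omega> \<times> {0..T}) (\<lambda>(x, t). w x t)"
  shows "t \<in> {0..T} \<Longrightarrow> Ck_on 1 \<Omega> (\<lambda>x. w x t)"
    and "continuous_on (\<Omega> \<times> {0..T}) (\<lambda>(x, t). w x t)"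
    and "continuous_on (\<Omega> \<times> {0..T}) (\<lambda>(x, t). dt T w x t)"
    and "b \<in> Basis \<Longrightarrow> continuous_on (\<Omega> \<times> {0..T}) (\<lambda>(x, t). frechet_derivative (\<lambda>y. w y t) (at x) b)"
proof -
  let ?S = "\<Omega> \<times> {0..T}" and ?U = "\<lambda>(x, t). w x t"
  let ?D = "\<lambda>z. frechet_derivative ?U (at z within ?S)"
  have c: "continuous_on ?S (\<lambda>z. ?D z v)" if "v \<in> Basis" for v using U that by simp
  have c0: "continuous_on ?S (\<lambda>z. ?D z (b, 0))" if "b \<in> Basis" for b
    by (rule c) (use that in \<open>simp add: Basis_prod_def\<close>)
  have c1: "continuous_on ?S (\<lambda>z. ?D z (0, 1))" by (rule c) (simp add: Basis_prod_def)
  show "continuous_on ?S ?U"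
    using U by (auto simp: continuous_on_eq_continuous_within intro: differentiable_imp_continuous_within)
  show "continuous_on ?S (\<lambda>(x, t). dt T w x t)"
    by (rule continuous_on_eq[OF c1]) (auto simp: space_time_slices(3)[OF \<Omega> T U])
  show "continuous_on ?S (\<lambda>(x, t). frechet_derivative (\<lambda>y. w y t) (at x) b)" if "b \<in> Basis" for b
    by (rule continuous_on_eq[OF c0[OF that]])
      (auto simp: frechet_derivative_at[OF space_time_slices(1)[OF \<Omega> T U], symmetric])
  show "Ck_on 1 \<Omega> (\<lambda>x. w x t)" if t: "t \<in> {0..T}" for t
    unfolding Ck1_iff[OF \<Omega>]
  proof (intro exI conjI ballI)
    show "((\<lambda>y. w y t) has_derivative (\<lambda>v. ?D (x, t) (v, 0))) (at x)" if "x \<in> \<Omega>" for x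
      by (rule space_time_slices(1)[OF \<Omega> T U that t])
    show "continuous_on \<Omega> (\<lambda>x. ?D (x, t) (b, 0))" if "b \<in> Basis" for b
      by (rule continuous_on_compose2[OF c0[OF that], of _ "\<lambda>x. (x, t)"]) (use t in \<open>auto intro!: continuous_intros\<close>)
  qed
qed

text \<open>Second derivatives exist and are continuous inside, without any bound near the boundary; first derivatives are bounded up to the boundary, because they
  extend continuously to a compact set.\<close>

lemma field_regularity:
  fixes w :: "real^3 \<Rightarrow> real \<Rightarrow> 'b::euclidean_space"
  assumes \<Omega>: "open \<Omega>" "bounded \<Omega>" and T: "0 < T" and U: "Ck_on 2 (\<Omega> \<times> {0..T}) (\<lambda>(x, t). w x t)"
    and cl: "C1_on_closure (\<Omega> \<times> {0..T}) (\<lambda>(x, t). w x t)"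
  shows "Ck_on 1 (\<Omega> \<times> {0..T}) (\<lambda>(x, t). w x t)"
    and "Ck_on 1 (\<Omega> \<times> {0..T}) (\<lambda>(x, t). dt T w x t)"
    and "b \<in> Basis \<Longrightarrow> Ck_on 1 (\<Omega> \<times> {0..T}) (\<lambda>(x, t). frechet_derivative (\<lambda>y. w y t) (at x) b)"
    and "t \<in> {0..T} \<Longrightarrow> continuous_on (closure \<Omega>) (\<lambda>x. w x t)"
    and "\<exists>B\<ge>0. \<forall>x\<in>\<Omega>. \<forall>t\<in>{0..T}. norm (w x t) \<le> B \<and> norm (dt T w x t) \<le> B \<and>
          (\<forall>b\<in>Basis. norm (frechet_derivative (\<lambda>y. w y t) (at x) b) \<le> B)"
proof -
  let ?S = "\<Omega> \<times> {0..T}" and ?U = "\<lambda>(x, t). w x t"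
  let ?D = "\<lambda>z. frechet_derivative ?U (at z within ?S)"
  have closS: "closure ?S = closure \<Omega> \<times> {0..T}" by (simp add: closure_Times)
  have cS: "compact (closure ?S)" unfolding closS using \<Omega>(2) by (intro compact_Times) auto
  show U1: "Ck_on 1 ?S ?U" using cl by (simp add: C1_on_closure_def)
  have "Ck_on (Suc (Suc 0)) ?S ?U" using U by (simp only: numeral_2_eq_2)
  then have U2: "Ck_on 1 ?S (\<lambda>z. ?D z v)" if "v \<in> Basis" for v
    unfolding Ck_on.simps(2)[of "Suc 0"] One_nat_def using that by blast
  have b0: "(b, 0) \<in> (Basis :: ((real^3) \<times> real) set)" if "b \<in> Basis" for b :: "real^3" using that by (simp add: Basis_prod_def)
  have b1: "(0, 1) \<in> (Basis :: ((real^3) \<times> real) set)" by (simp add: Basis_prod_def)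
  have D1: "?D (x, t) (0, 1) = dt T w x t" if "x \<in> \<Omega>" "t \<in> {0..T}" for x t
    by (rule space_time_slices(3)[OF \<Omega>(1) T U1 that, symmetric])
  have D0: "?D (x, t) (v, 0) = frechet_derivative (\<lambda>y. w y t) (at x) v" if "x \<in> \<Omega>" "t \<in> {0..T}" for x t v
    using fun_cong[OF frechet_derivative_at[OF space_time_slices(1)[OF \<Omega>(1) T U1 that]], of v] .
  show "Ck_on 1 ?S (\<lambda>(x, t). dt T w x t)" by (rule Ck_on_cong[OF _ U2[OF b1]]) (auto simp: D1)
  show "Ck_on 1 ?S (\<lambda>(x, t). frechet_derivative (\<lambda>y. w y t) (at x) b)" if "b \<in> Basis" for b
    by (rule Ck_on_cong[OF _ U2[OF b0[OF that]]]) (auto simp: D0)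
  have cU: "continuous_on (closure ?S) ?U" using cl by (simp add: C1_on_closure_def)
  show "continuous_on (closure \<Omega>) (\<lambda>x. w x t)" if "t \<in> {0..T}" for t
  proof -
    have "continuous_on (closure \<Omega>) (\<lambda>x. (x, t))" by (intro continuous_intros)
    moreover have "(\<lambda>x. (x, t)) ` closure \<Omega> \<subseteq> closure ?S" using that unfolding closS by auto
    ultimately show ?thesis using continuous_on_compose2[OF cU] by force
  qed
  have "\<exists>B\<ge>0. \<forall>z\<in>?S. norm (?D z v) \<le> B" if v: "v \<in> Basis" for v
  proof -
    obtain g where g: "continuous_on (closure ?S) g" "\<forall>z\<in>?S. g z = ?D z v"
      using cl v unfolding C1_on_closure_def by blast
    obtain B where "\<And>z. z \<in> closure ?S \<Longrightarrow> norm (g z) \<le> B" "B \<ge> 0"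
      using continuous_on_bounded_above[OF g(1) cS order_refl] by blast
    then show ?thesis using g(2) closure_subset[of ?S] by (intro exI[of _ B]) fastforce
  qed
  then obtain Bv where Bv: "\<And>v z. v \<in> Basis \<Longrightarrow> z \<in> ?S \<Longrightarrow> norm (?D z v) \<le> Bv v" "\<And>v. v \<in> Basis \<Longrightarrow> Bv v \<ge> 0" by metis
  define BD where "BD = (\<Sum>v\<in>Basis. Bv v)"
  have BD: "norm (?D z v) \<le> BD" if "v \<in> Basis" "z \<in> ?S" for v z
    using Bv(1)[OF that] member_le_sum[of v Basis Bv] Bv(2) that(1) unfolding BD_def by fastforce
  obtain BU where BU: "\<And>z. z \<in> closure ?S \<Longrightarrow> norm (?U z) \<le> BU" "BU \<ge> 0"
    using continuous_on_bounded_above[OF cU cS order_refl] by blast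
  show "\<exists>B\<ge>0. \<forall>x\<in>\<Omega>. \<forall>t\<in>{0..T}. norm (w x t) \<le> B \<and> norm (dt T w x t) \<le> B \<and>
          (\<forall>b\<in>Basis. norm (frechet_derivative (\<lambda>y. w y t) (at x) b) \<le> B)"
  proof (intro exI[of _ "max BU BD"] conjI ballI)
    show "0 \<le> max BU BD" using BU(2) by simp
    fix x t assume xt: "x \<in> \<Omega>" "t \<in> {0..T}"
    then have z: "(x, t) \<in> ?S" by simp
    show "norm (w x t) \<le> max BU BD" using BU(1)[of "(x, t)"] closure_subset[of ?S] z by fastforce
    show "norm (dt T w x t) \<le> max BU BD" using BD[OF b1 z] D1[OF xt] by simp
    show "norm (frechet_derivative (\<lambda>y. w y t) (at x) b) \<le> max BU BD" if "b \<in> Basis" for b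
      using BD[OF b0[OF that] z] D0[OF xt] by simp
  qed
qed

lemma grad_eq_frechet: "u differentiable (at x) \<Longrightarrow> grad u x $ i $ j = frechet_derivative u (at x) (axis j 1) $ i"
  by (simp add: grad_def jacobian_def matrix_def)

lemma Curl_eq_frechet:
  assumes "X differentiable (at x)"
  defines "D \<equiv> frechet_derivative X (at x)"
  shows "Curl X x = (\<chi> i. vector [D (axis 2 1) $ i $ 3 - D (axis 3 1) $ i $ 2,
    D (axis 3 1) $ i $ 1 - D (axis 1 1) $ i $ 3, D (axis 1 1) $ i $ 2 - D (axis 2 1) $ i $ 1])"
proof -
  have d: "(X has_derivative D) (at x)" using assms(1) unfolding D_def frechet_derivative_works .
  have "pd j (\<lambda>y. X y $ i $ k) x = D (axis j 1) $ i $ k" for i j k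
    by (rule pd_eq) (intro bounded_linear.has_derivative[OF bounded_linear_vec_nth] d)
  then have "Curl X x $ i $ k = (\<chi> i. vector [D (axis 2 1) $ i $ 3 - D (axis 3 1) $ i $ 2,
    D (axis 3 1) $ i $ 1 - D (axis 1 1) $ i $ 3, D (axis 1 1) $ i $ 2 - D (axis 2 1) $ i $ 1]) $ i $ k" for i k
    using Curl_nth[OF assms(1), of i] exhaust_3[of k] by (auto simp: vector_3)
  then show ?thesis by (simp add: vec_eq_iff)
qed

lemma axis_Basis: "axis j 1 \<in> (Basis :: (real^3) set)"
  by (simp add: axis_in_Basis_iff)

lemma norm_matrix_le_entries:
  fixes X :: "real^3^3"
  assumes "\<And>i j. \<bar>X $ i $ j\<bar> \<le> B" shows "norm X \<le> 9 * B"
proof -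
  have r: "norm (X $ i) \<le> 3 * B" for i
    using norm_le_l1_cart[of "X $ i"] assms[of i 1] assms[of i 2] assms[of i 3] unfolding sum_3 by linarith
  have "norm X \<le> (\<Sum>i\<in>UNIV. norm (X $ i))" unfolding norm_vec_def[of X] by (rule L2_set_le_sum) (rule norm_ge_zero)
  then show ?thesis using r[of 1] r[of 2] r[of 3] unfolding sum_3 by linarith
qed

lemma grad_regularity:
  fixes w :: "real^3 \<Rightarrow> real \<Rightarrow> real^3"
  assumes \<Omega>: "open \<Omega>" "bounded \<Omega>" and T: "0 < T" and U: "Ck_on 2 (\<Omega> \<times> {0..T}) (\<lambda>(x, t). w x t)"
    and cl: "C1_on_closure (\<Omega> \<times> {0..T}) (\<lambda>(x, t). w x t)"
  shows "t \<in> {0..T} \<Longrightarrow> Ck_on 1 \<Omega> (grad (\<lambda>x. w x t))"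
    and "\<exists>B\<ge>0. \<forall>x\<in>\<Omega>. \<forall>t\<in>{0..T}. norm (grad (\<lambda>x. w x t) x) \<le> B"
proof -
  note R = field_regularity[OF \<Omega> T U cl]
  have df: "(\<lambda>y. w y t) differentiable (at x)" if "x \<in> \<Omega>" "t \<in> {0..T}" for x t
    using Ck1_differentiable[OF \<Omega>(1) Ck1_slices(1)[OF \<Omega>(1) T R(1) that(2)] that(1)] .
  have g: "grad (\<lambda>x. w x t) x $ i $ j = frechet_derivative (\<lambda>y. w y t) (at x) (axis j 1) $ i" if "x \<in> \<Omega>" "t \<in> {0..T}" for x t i j
    by (rule grad_eq_frechet[OF df[OF that]])
  show "Ck_on 1 \<Omega> (grad (\<lambda>x. w x t))" if t: "t \<in> {0..T}" for t
  proof (intro Ck1_vec[OF \<Omega>(1)])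
    fix i j
    have "Ck_on 1 \<Omega> (\<lambda>x. frechet_derivative (\<lambda>y. w y t) (at x) (axis j 1) $ i)"
      by (intro Ck1_nth[OF \<Omega>(1)] Ck1_slices(1)[OF \<Omega>(1) T R(3) t] axis_Basis)
    then show "Ck_on 1 \<Omega> (\<lambda>x. grad (\<lambda>x. w x t) x $ i $ j)"
      by (rule Ck_on_cong[rotated]) (simp add: g[OF _ t])
  qed
  obtain B where B: "B \<ge> 0" "\<And>x t b. x \<in> \<Omega> \<Longrightarrow> t \<in> {0..T} \<Longrightarrow> b \<in> Basis \<Longrightarrow> norm (frechet_derivative (\<lambda>y. w y t) (at x) b) \<le> B"
    using R(5) by blast
  show "\<exists>B\<ge>0. \<forall>x\<in>\<Omega>. \<forall>t\<in>{0..T}. norm (grad (\<lambda>x. w x t) x) \<le> B"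
  proof (intro exI[of _ "9 * B"] conjI ballI)
    show "0 \<le> 9 * B" using B(1) by simp
    fix x t assume xt: "x \<in> \<Omega>" "t \<in> {0..T}"
    have "\<bar>grad (\<lambda>x. w x t) x $ i $ j\<bar> \<le> B" for i j
      unfolding g[OF xt] using component_le_norm_cart B(2)[OF xt axis_Basis, of j] order_trans by blast
    then show "norm (grad (\<lambda>x. w x t) x) \<le> 9 * B" by (rule norm_matrix_le_entries)
  qed
qed

lemma Curl_regularity:
  fixes w :: "real^3 \<Rightarrow> real \<Rightarrow> real^3^3"
  assumes \<Omega>: "open \<Omega>" "bounded \<Omega>" and T: "0 < T" and U: "Ck_on 2 (\<Omega> \<times> {0..T}) (\<lambda>(x, t). w x t)"
    and cl: "C1_on_closure (\<Omega> \<times> {0..T}) (\<lambda>(x, t). w x t)"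
  shows "t \<in> {0..T} \<Longrightarrow> Ck_on 1 \<Omega> (Curl (\<lambda>x. w x t))"
    and "\<exists>B\<ge>0. \<forall>x\<in>\<Omega>. \<forall>t\<in>{0..T}. norm (Curl (\<lambda>x. w x t) x) \<le> B"
proof -
  note R = field_regularity[OF \<Omega> T U cl]
  have df: "(\<lambda>y. w y t) differentiable (at x)" if "x \<in> \<Omega>" "t \<in> {0..T}" for x t
    using Ck1_differentiable[OF \<Omega>(1) Ck1_slices(1)[OF \<Omega>(1) T R(1) that(2)] that(1)] .
  \<comment> \<open>the two derivatives whose difference is a given component of the curl\<close>
  define p q :: "3 \<Rightarrow> 3" where "p k = (if k = 1 then 2 else if k = 2 then 3 else 1)"
    and "q k = (if k = 1 then 3 else if k = 2 then 1 else 2)" for k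
  have g: "Curl (\<lambda>x. w x t) x $ i $ k = frechet_derivative (\<lambda>y. w y t) (at x) (axis (p k) 1) $ i $ q k -
      frechet_derivative (\<lambda>y. w y t) (at x) (axis (q k) 1) $ i $ p k" if "x \<in> \<Omega>" "t \<in> {0..T}" for x t i k
    using exhaust_3[of k] unfolding Curl_eq_frechet[OF df[OF that]] p_def q_def by auto
  show "Ck_on 1 \<Omega> (Curl (\<lambda>x. w x t))" if t: "t \<in> {0..T}" for t
  proof (intro Ck1_vec[OF \<Omega>(1)])
    fix i k
    have c: "Ck_on 1 \<Omega> (\<lambda>x. frechet_derivative (\<lambda>y. w y t) (at x) (axis j 1) $ i $ l)" for j l
      by (intro Ck1_nth[OF \<Omega>(1)] Ck1_slices(1)[OF \<Omega>(1) T R(3) t] axis_Basis)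
    have "Ck_on 1 \<Omega> (\<lambda>x. frechet_derivative (\<lambda>y. w y t) (at x) (axis (p k) 1) $ i $ q k +
      - (frechet_derivative (\<lambda>y. w y t) (at x) (axis (q k) 1) $ i $ p k))"
      by (intro Ck1_add[OF \<Omega>(1)] Ck1_linear[OF \<Omega>(1) _ bounded_linear_minus[OF bounded_linear_ident]] c)
    then show "Ck_on 1 \<Omega> (\<lambda>x. Curl (\<lambda>x. w x t) x $ i $ k)"
      by (rule Ck_on_cong[rotated]) (simp add: g[OF _ t])
  qed
  obtain B where B: "B \<ge> 0" "\<And>x t b. x \<in> \<Omega> \<Longrightarrow> t \<in> {0..T} \<Longrightarrow> b \<in> Basis \<Longrightarrow> norm (frechet_derivative (\<lambda>y. w y t) (at x) b) \<le> B"
    using R(5) by blast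
  show "\<exists>B\<ge>0. \<forall>x\<in>\<Omega>. \<forall>t\<in>{0..T}. norm (Curl (\<lambda>x. w x t) x) \<le> B"
  proof (intro exI[of _ "18 * B"] conjI ballI)
    show "0 \<le> 18 * B" using B(1) by simp
    fix x t assume xt: "x \<in> \<Omega>" "t \<in> {0..T}"
    have c: "\<bar>frechet_derivative (\<lambda>y. w y t) (at x) (axis j 1) $ i $ l\<bar> \<le> B" for i j l
      using component_le_norm_cart[of "frechet_derivative (\<lambda>y. w y t) (at x) (axis j 1) $ i" l]
        Finite_Cartesian_Product.norm_nth_le[of "frechet_derivative (\<lambda>y. w y t) (at x) (axis j 1)" i] B(2)[OF xt axis_Basis, of j] by linarith
    have "\<bar>Curl (\<lambda>x. w x t) x $ i $ k\<bar> \<le> 2 * B" for i k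
      unfolding g[OF xt] using c[of "p k" i "q k"] c[of "q k" i "p k"] by linarith
    then have "norm (Curl (\<lambda>x. w x t) x) \<le> 9 * (2 * B)" by (rule norm_matrix_le_entries)
    then show "norm (Curl (\<lambda>x. w x t) x) \<le> 18 * B" by simp
  qed
qed

section \<open>Fourth order tensors\<close>

lemma tensor_app_symmetric:
  assumes "major_symmetric A" shows "(A \<odot> X) \<bullet> Y = (A \<odot> Y) \<bullet> X"
proof -
  have "(A \<odot> X) \<bullet> Y = (\<Sum>i\<in>UNIV. \<Sum>j\<in>UNIV. \<Sum>k\<in>UNIV. \<Sum>l\<in>UNIV. A $ i $ j $ k $ l * X $ k $ l * Y $ i $ j)" for X Y
    by (simp add: inner_vec_def tensor_app_def sum_distrib_right)
  note e = this
  have "(A \<odot> X) \<bullet> Y = (\<Sum>i\<in>UNIV. \<Sum>k\<in>UNIV. \<Sum>j\<in>UNIV. \<Sum>l\<in>UNIV. A $ i $ j $ k $ l * X $ k $ l * Y $ i $ j)"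
    unfolding e by (intro sum.cong refl sum.swap)
  also have "\<dots> = (\<Sum>k\<in>UNIV. \<Sum>i\<in>UNIV. \<Sum>l\<in>UNIV. \<Sum>j\<in>UNIV. A $ i $ j $ k $ l * X $ k $ l * Y $ i $ j)"
    by (rule trans[OF sum.swap]) (intro sum.cong refl sum.swap)
  also have "\<dots> = (\<Sum>k\<in>UNIV. \<Sum>l\<in>UNIV. \<Sum>i\<in>UNIV. \<Sum>j\<in>UNIV. A $ i $ j $ k $ l * X $ k $ l * Y $ i $ j)"
    by (intro sum.cong refl sum.swap)
  also have "\<dots> = (\<Sum>k\<in>UNIV. \<Sum>l\<in>UNIV. \<Sum>i\<in>UNIV. \<Sum>j\<in>UNIV. A $ k $ l $ i $ j * Y $ i $ j * X $ k $ l)"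
  proof (intro sum.cong refl)
    fix k l i j :: 3
    have "A $ i $ j $ k $ l = A $ k $ l $ i $ j" using assms by (simp add: major_symmetric_def)
    then show "A $ i $ j $ k $ l * X $ k $ l * Y $ i $ j = A $ k $ l $ i $ j * Y $ i $ j * X $ k $ l" by simp
  qed
  finally show ?thesis unfolding e .
qed

lemma tensor_app_linear: "linear ((\<odot>) A)"
  by (rule linearI) (simp_all add: tensor_app_def vec_eq_iff algebra_simps sum.distrib sum_distrib_left)

lemma inner_sym_part: "\<sigma> \<in> Sym3 \<Longrightarrow> \<sigma> \<bullet> sym_part X = \<sigma> \<bullet> X"
proof -
  assume "\<sigma> \<in> Sym3"
  then have s: "\<sigma> $ j $ i = \<sigma> $ i $ j" for i j by (auto simp: Sym3_def transpose_def vec_eq_iff)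
  have "\<sigma> \<bullet> transpose X = (\<Sum>i\<in>UNIV. \<Sum>j\<in>UNIV. \<sigma> $ i $ j * X $ j $ i)" by (simp add: inner_vec_def transpose_def)
  also have "\<dots> = (\<Sum>j\<in>UNIV. \<Sum>i\<in>UNIV. \<sigma> $ i $ j * X $ j $ i)" by (rule sum.swap)
  also have "\<dots> = \<sigma> \<bullet> X" by (simp add: inner_vec_def s)
  finally show ?thesis by (simp add: sym_part_def inner_add_right)
qed

lemma sym_part_Sym3: "sym_part X \<in> Sym3"
  by (simp add: Sym3_def sym_part_def transpose_def vec_eq_iff)

text \<open>A nonnegative symmetric form is bounded by its diagonal: expanding \<open>\<langle>A (X - Y / M), X - Y / M\<rangle> \<ge> 0\<close> with \<open>Y = A X\<close>
  bounds \<open>\<parallel>A X\<parallel>\<^sup>2\<close> by values of the form on the diagonal.\<close>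

lemma norm_tensor_app_le:
  assumes A: "major_symmetric A" and V: "subspace V" "X \<in> V" "A \<odot> X \<in> V" and M: "M > 0"
    and pos: "\<And>Z. Z \<in> V \<Longrightarrow> 0 \<le> (A \<odot> Z) \<bullet> Z" and le: "\<And>Z. Z \<in> V \<Longrightarrow> (A \<odot> Z) \<bullet> Z \<le> M * (norm Z)\<^sup>2"
  shows "norm (A \<odot> X) \<le> M * norm X"
proof -
  define Y where "Y = A \<odot> X"
  have diff: "A \<odot> (X - (1/M) *\<^sub>R Y) = Y - (1/M) *\<^sub>R (A \<odot> Y)"
    using linear_diff[OF tensor_app_linear] linear_cmul[OF tensor_app_linear] by (simp add: Y_def)
  have Yv: "Y \<in> V" using V by (simp add: Y_def)
  have s: "(A \<odot> Y) \<bullet> X = Y \<bullet> Y" using tensor_app_symmetric[OF A, of Y X] by (simp add: Y_def)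
  have "0 \<le> (A \<odot> (X - (1/M) *\<^sub>R Y)) \<bullet> (X - (1/M) *\<^sub>R Y)" by (intro pos subspace_diff subspace_scale V Yv)
  also have "\<dots> = Y \<bullet> X - (2/M) * (Y \<bullet> Y) + (1/M)\<^sup>2 * ((A \<odot> Y) \<bullet> Y)"
    unfolding diff by (simp add: inner_diff_left inner_diff_right s power2_eq_square algebra_simps)
  also have "\<dots> \<le> M * (norm X)\<^sup>2 - (2/M) * (norm Y)\<^sup>2 + (1/M)\<^sup>2 * (M * (norm Y)\<^sup>2)"
  proof (intro add_mono diff_mono mult_left_mono)
    show "Y \<bullet> X \<le> M * (norm X)\<^sup>2" using le[OF V(2)] by (simp only: Y_def)
    show "(A \<odot> Y) \<bullet> Y \<le> M * (norm Y)\<^sup>2" by (rule le[OF Yv])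
  qed (use M in \<open>simp_all add: power2_norm_eq_inner\<close>)
  also have "\<dots> = M * (norm X)\<^sup>2 - (1/M) * (norm Y)\<^sup>2" using M by (simp add: power2_eq_square field_simps)
  finally have "(norm Y)\<^sup>2 \<le> M * (M * (norm X)\<^sup>2)" using M by (simp add: field_simps)
  then have "(norm Y)\<^sup>2 \<le> (M * norm X)\<^sup>2" by (simp add: power_mult_distrib power2_eq_square mult_ac)
  then show ?thesis unfolding Y_def by (rule power2_le_imp_le) (use M in auto)
qed

lemma Ck1_tensor_app:
  assumes S: "open S" "Ck_on 1 S A" "Ck_on 1 S X"
  shows "Ck_on 1 S (\<lambda>x. A x \<odot> X x)"
proof (intro Ck1_vec[OF S(1)])
  fix i j
  have "Ck_on 1 S (\<lambda>x. \<Sum>k\<in>UNIV. \<Sum>l\<in>UNIV. A x $ i $ j $ k $ l * X x $ k $ l)"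
    by (intro Ck1_sum Ck1_mult Ck1_nth S finite)
  then show "Ck_on 1 S (\<lambda>x. (A x \<odot> X x) $ i $ j)" by (simp add: tensor_app_def)
qed

lemma subspace_Sym3: "subspace Sym3"
  by (auto simp: subspace_def Sym3_def transpose_def vec_eq_iff)

lemma onorm_matrix_le: "onorm ((*v) A) \<le> norm A" for A :: "real^'n^'m"
proof (rule onorm_le)
  fix v
  have "norm (A *v v) \<le> L2_set (\<lambda>i. norm (A $ i) * norm v) UNIV"
    unfolding norm_vec_def[of "A *v v"]
    by (rule L2_set_mono) (auto simp: matrix_vector_mul_component intro: Cauchy_Schwarz_ineq2)
  also have "\<dots> = norm A * norm v" by (simp add: L2_set_left_distrib norm_vec_def[of A])
  finally show "norm (A *v v) \<le> norm A * norm v" .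
qed

section \<open>Conservation of energy\<close>

text \<open>A solution for vanishing body force and body moment. The densities \<open>elastic\<close>, \<open>kinetic\<close> and \<open>pairing\<close> below take their two factors at two different
  times; on the diagonal \<open>elastic\<close> and \<open>kinetic\<close> add up to twice the energy density.\<close>

locale homogeneous_solution =
  fixes \<Omega> :: "(real^3) set" and T :: real and \<C> \<H> \<L> :: "real^3 \<Rightarrow> tensor4"
    and u :: "real^3 \<Rightarrow> real \<Rightarrow> real^3" and P :: "real^3 \<Rightarrow> real \<Rightarrow> real^3^3"
    and u0 du0 P0 dP0
  assumes dom: "bounded_domain \<Omega>" and pw: "piecewise_smooth_boundary \<Omega>" and T: "0 < T"
    and coeff: "admissible_coefficients \<Omega> \<C> \<H> \<L>"
    and sol: "solution_of_P \<Omega> T \<C> \<H> \<L> (\<lambda>_ _. 0) (\<lambda>_ _. 0) u0 du0 P0 dP0 u P"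
begin

definition "strain t x = sym_part (grad (\<lambda>z. u z t) x - P x t)"
definition "stress t x = \<C> x \<odot> strain t x"
definition "micro_stress t x = \<H> x \<odot> sym_part (P x t)"
definition "curl_stress t x = \<L> x \<odot> Curl (\<lambda>z. P z t) x"
definition "elastic s t x = stress s x \<bullet> strain t x + micro_stress s x \<bullet> sym_part (P x t) + curl_stress s x \<bullet> Curl (\<lambda>z. P z t) x"
definition "kinetic s t x = dt T u x s \<bullet> dt T u x t + dt T P x s \<bullet> dt T P x t"
definition "pairing s t x = dt T u x s \<bullet> u x t + dt T P x s \<bullet> P x t"

lemma \<Omega>: "open \<Omega>" "bounded \<Omega>" "\<Omega> \<noteq> {}"
  using dom by (auto simp: bounded_domain_def)

lemma u_reg: "Ck_on 2 (\<Omega> \<times> {0..T}) (\<lambda>(x, t). u x t)" "C1_on_closure (\<Omega> \<times> {0..T}) (\<lambda>(x, t). u x t)"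
  and P_reg: "Ck_on 2 (\<Omega> \<times> {0..T}) (\<lambda>(x, t). P x t)" "C1_on_closure (\<Omega> \<times> {0..T}) (\<lambda>(x, t). P x t)"
  and momentum: "\<And>x t. x \<in> \<Omega> \<Longrightarrow> t \<in> {0..T} \<Longrightarrow> dt T (dt T u) x t = Div (stress t) x"
  and micro_momentum: "\<And>x t. x \<in> \<Omega> \<Longrightarrow> t \<in> {0..T} \<Longrightarrow> dt T (dt T P) x t = - Curl (curl_stress t) x + stress t x - micro_stress t x"
  and u_boundary: "\<And>x t. x \<in> frontier \<Omega> \<Longrightarrow> t \<in> {0..T} \<Longrightarrow> u x t = 0"
  and P_boundary: "\<And>t. t \<in> {0..T} \<Longrightarrow> tangentially_zero \<Omega> (\<lambda>x. P x t)"
  using sol unfolding solution_of_P_def tangentially_zero_def stress_def[abs_def] micro_stress_def[abs_def] curl_stress_def[abs_def] strain_def[abs_def]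
  by simp_all

lemmas ur = field_regularity[OF \<Omega>(1,2) T u_reg]
lemmas Pr = field_regularity[OF \<Omega>(1,2) T P_reg]
lemmas us = Ck1_slices[OF \<Omega>(1) T ur(1)]
lemmas Ps = Ck1_slices[OF \<Omega>(1) T Pr(1)]
lemmas dus = Ck1_slices[OF \<Omega>(1) T ur(2)]
lemmas dPs = Ck1_slices[OF \<Omega>(1) T Pr(2)]

lemma uniform_bounds:
  "\<exists>B>0. \<forall>x\<in>\<Omega>. \<forall>t\<in>{0..T}. norm (u x t) \<le> B \<and> norm (P x t) \<le> B \<and> norm (dt T u x t) \<le> B \<and> norm (dt T P x t) \<le> B \<and>
    norm (grad (\<lambda>z. u z t) x) \<le> B \<and> norm (Curl (\<lambda>z. P z t) x) \<le> B"
proof -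
  obtain B1 where B1: "\<And>x t. x \<in> \<Omega> \<Longrightarrow> t \<in> {0..T} \<Longrightarrow> norm (u x t) \<le> B1 \<and> norm (dt T u x t) \<le> B1" using ur(5) by blast
  obtain B2 where B2: "\<And>x t. x \<in> \<Omega> \<Longrightarrow> t \<in> {0..T} \<Longrightarrow> norm (P x t) \<le> B2 \<and> norm (dt T P x t) \<le> B2" using Pr(5) by blast
  obtain B3 where B3: "\<And>x t. x \<in> \<Omega> \<Longrightarrow> t \<in> {0..T} \<Longrightarrow> norm (grad (\<lambda>z. u z t) x) \<le> B3" using grad_regularity(2)[OF \<Omega>(1,2) T u_reg] by blast
  obtain B4 where B4: "\<And>x t. x \<in> \<Omega> \<Longrightarrow> t \<in> {0..T} \<Longrightarrow> norm (Curl (\<lambda>z. P z t) x) \<le> B4" using Curl_regularity(2)[OF \<Omega>(1,2) T P_reg] by blast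
  show ?thesis
    by (rule exI[of _ "max 1 (max (max B1 B2) (max B3 B4))"]) (use B1 B2 B3 B4 in \<open>auto simp: le_max_iff_disj\<close>)
qed

lemma coefficient_facts:
  "Ck_on 1 \<Omega> \<C>" "Ck_on 1 \<Omega> \<H>" "Ck_on 1 \<Omega> \<L>"
  "\<And>x. x \<in> \<Omega> \<Longrightarrow> major_symmetric (\<C> x)" "\<And>x. x \<in> \<Omega> \<Longrightarrow> minor_symmetric (\<C> x)"
  "\<And>x. x \<in> \<Omega> \<Longrightarrow> major_symmetric (\<H> x)" "\<And>x. x \<in> \<Omega> \<Longrightarrow> minor_symmetric (\<H> x)"
  "\<And>x. x \<in> \<Omega> \<Longrightarrow> major_symmetric (\<L> x)"
  "positive_definite_on Sym3 \<Omega> \<C>" "positive_definite_on Sym3 \<Omega> \<H>" "positive_definite_on UNIV \<Omega> \<L>"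
  using coeff unfolding admissible_coefficients_def by auto

lemma C1_fields:
  assumes t: "t \<in> {0..T}"
  shows "Ck_on 1 \<Omega> (strain t)" "Ck_on 1 \<Omega> (\<lambda>x. sym_part (P x t))" "Ck_on 1 \<Omega> (Curl (\<lambda>z. P z t))" "Ck_on 1 \<Omega> (grad (\<lambda>z. u z t))"
    "Ck_on 1 \<Omega> (stress t)" "Ck_on 1 \<Omega> (micro_stress t)" "Ck_on 1 \<Omega> (curl_stress t)"
proof -
  have bl: "bounded_linear sym_part" using linear_sym_part by (simp add: linear_conv_bounded_linear)
  show g: "Ck_on 1 \<Omega> (grad (\<lambda>z. u z t))" by (rule grad_regularity(1)[OF \<Omega>(1,2) T u_reg t])
  have "Ck_on 1 \<Omega> (\<lambda>x. grad (\<lambda>z. u z t) x + - P x t)"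
    by (intro Ck1_add[OF \<Omega>(1)] g Ck1_linear[OF \<Omega>(1) _ bounded_linear_minus[OF bounded_linear_ident]] Ps(1) t)
  then have "Ck_on 1 \<Omega> (\<lambda>x. sym_part (grad (\<lambda>z. u z t) x + - P x t))" by (rule Ck1_linear[OF \<Omega>(1) _ bl])
  then show e: "Ck_on 1 \<Omega> (strain t)" by (simp add: strain_def[abs_def])
  show s: "Ck_on 1 \<Omega> (\<lambda>x. sym_part (P x t))" by (rule Ck1_linear[OF \<Omega>(1) Ps(1)[OF t] bl])
  show c: "Ck_on 1 \<Omega> (Curl (\<lambda>z. P z t))" by (rule Curl_regularity(1)[OF \<Omega>(1,2) T P_reg t])
  show "Ck_on 1 \<Omega> (stress t)" unfolding stress_def[abs_def] by (rule Ck1_tensor_app[OF \<Omega>(1) coefficient_facts(1) e])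
  show "Ck_on 1 \<Omega> (micro_stress t)" unfolding micro_stress_def[abs_def] by (rule Ck1_tensor_app[OF \<Omega>(1) coefficient_facts(2) s])
  show "Ck_on 1 \<Omega> (curl_stress t)" unfolding curl_stress_def[abs_def] by (rule Ck1_tensor_app[OF \<Omega>(1) coefficient_facts(3) c])
qed

lemmas C1_continuous = C1_fields[THEN Ck1_continuous[OF \<Omega>(1)]]

lemma stress_Sym3: "x \<in> \<Omega> \<Longrightarrow> stress t x \<in> Sym3" "x \<in> \<Omega> \<Longrightarrow> micro_stress t x \<in> Sym3"
  by (simp_all add: stress_def micro_stress_def minor_symmetric_app coefficient_facts)

lemma bounded_tensor_app:
  assumes "positive_definite_on V \<Omega> A" "subspace V" "\<And>x. x \<in> \<Omega> \<Longrightarrow> major_symmetric (A x)"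
    "\<And>x X. x \<in> \<Omega> \<Longrightarrow> X \<in> V \<Longrightarrow> A x \<odot> X \<in> V"
  obtains M where "M > 0" "\<And>x X. x \<in> \<Omega> \<Longrightarrow> X \<in> V \<Longrightarrow> norm (A x \<odot> X) \<le> M * norm X"
proof -
  obtain m M where m: "0 < m" "0 < M" "\<And>x X. x \<in> \<Omega> \<Longrightarrow> X \<in> V \<Longrightarrow> m * (norm X)\<^sup>2 \<le> (A x \<odot> X) \<bullet> X \<and> (A x \<odot> X) \<bullet> X \<le> M * (norm X)\<^sup>2"
    using assms(1) unfolding positive_definite_on_def by blast
  have "norm (A x \<odot> X) \<le> M * norm X" if xX: "x \<in> \<Omega>" "X \<in> V" for x X
  proof (rule norm_tensor_app_le[OF assms(3)[OF xX(1)] assms(2) xX(2) assms(4)[OF xX] m(2)])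
    fix Z assume Z: "Z \<in> V"
    have "0 \<le> m * (norm Z)\<^sup>2" using m(1) by simp
    then show "0 \<le> (A x \<odot> Z) \<bullet> Z" using m(3)[OF xX(1) Z] by linarith
    show "(A x \<odot> Z) \<bullet> Z \<le> M * (norm Z)\<^sup>2" using m(3)[OF xX(1) Z] by blast
  qed
  then show thesis using that m(2) by blast
qed

lemma stress_bounds:
  "\<exists>B>0. \<forall>x\<in>\<Omega>. \<forall>t\<in>{0..T}. norm (stress t x) \<le> B \<and> norm (micro_stress t x) \<le> B \<and>
    norm (curl_stress t x) \<le> B \<and> norm (strain t x) \<le> B"
proof -
  obtain B where B: "B > 0" 
    "\<And>x t. x \<in> \<Omega> \<Longrightarrow> t \<in> {0..T} \<Longrightarrow> norm (P x t) \<le> B"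
    "\<And>x t. x \<in> \<Omega> \<Longrightarrow> t \<in> {0..T} \<Longrightarrow> norm (grad (\<lambda>z. u z t) x) \<le> B"
    "\<And>x t. x \<in> \<Omega> \<Longrightarrow> t \<in> {0..T} \<Longrightarrow> norm (Curl (\<lambda>z. P z t) x) \<le> B"
    using uniform_bounds by blast
  obtain c where c: "c > 0" "\<And>x X. x \<in> \<Omega> \<Longrightarrow> X \<in> Sym3 \<Longrightarrow> norm (\<C> x \<odot> X) \<le> c * norm X"
    by (rule bounded_tensor_app[OF coefficient_facts(9) subspace_Sym3])
      (use coefficient_facts minor_symmetric_app in auto)
  obtain h where h: "h > 0" "\<And>x X. x \<in> \<Omega> \<Longrightarrow> X \<in> Sym3 \<Longrightarrow> norm (\<H> x \<odot> X) \<le> h * norm X"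
    by (rule bounded_tensor_app[OF coefficient_facts(10) subspace_Sym3])
      (use coefficient_facts minor_symmetric_app in auto)
  obtain l where l: "l > 0" "\<And>x X. x \<in> \<Omega> \<Longrightarrow> norm (\<L> x \<odot> X) \<le> l * norm X"
    by (rule bounded_tensor_app[OF coefficient_facts(11) subspace_UNIV])
      (use coefficient_facts in auto)
  have e: "norm (strain t x) \<le> 2 * B" if "x \<in> \<Omega>" "t \<in> {0..T}" for x t
    using norm_sym_part_le[of "grad (\<lambda>z. u z t) x - P x t"] norm_triangle_ineq4[of "grad (\<lambda>z. u z t) x" "P x t"] B(2,3)[OF that]
    unfolding strain_def by linarith
  define b where "b = max (max (c * (2 * B)) (2 * B)) (max (h * B) (l * B))"
  show ?thesis
  proof (intro exI[of _ b] conjI ballI)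
    show "b > 0" using B(1) by (simp add: b_def less_max_iff_disj)
    fix x t assume xt: "x \<in> \<Omega>" "t \<in> {0..T}"
    show "norm (strain t x) \<le> b" using e[OF xt] by (simp add: b_def le_max_iff_disj)
    have "norm (stress t x) \<le> c * norm (strain t x)" unfolding stress_def by (rule c(2)[OF xt(1)]) (simp add: strain_def sym_part_Sym3)
    also have "\<dots> \<le> c * (2 * B)" using e[OF xt] c(1) by simp
    finally show "norm (stress t x) \<le> b" by (simp add: b_def)
    have "norm (micro_stress t x) \<le> h * norm (sym_part (P x t))" unfolding micro_stress_def by (rule h(2)[OF xt(1) sym_part_Sym3])
    also have "\<dots> \<le> h * B" using order_trans[OF norm_sym_part_le B(2)[OF xt]] h(1) by simp
    finally show "norm (micro_stress t x) \<le> b" by (simp add: b_def)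
    have "norm (curl_stress t x) \<le> l * norm (Curl (\<lambda>z. P z t) x)" unfolding curl_stress_def by (rule l(2)[OF xt(1)])
    also have "\<dots> \<le> l * B" using B(4)[OF xt] l(1) by simp
    finally show "norm (curl_stress t x) \<le> b" by (simp add: b_def)
  qed
qed

lemma inner_bound: "norm a \<le> A \<Longrightarrow> norm b \<le> B \<Longrightarrow> \<bar>a \<bullet> b\<bar> \<le> A * B" for a b :: "'z::real_inner"
  by (rule order_trans[OF Cauchy_Schwarz_ineq2 mult_mono]) (auto intro: order_trans[OF norm_ge_zero])

lemma elastic_bound: "\<exists>B. \<forall>x\<in>\<Omega>. \<forall>s\<in>{0..T}. \<forall>t\<in>{0..T}. \<bar>elastic s t x\<bar> \<le> B"
proof -
  obtain b where b: 
    "\<And>x t. x \<in> \<Omega> \<Longrightarrow> t \<in> {0..T} \<Longrightarrow> norm (stress t x) \<le> b"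
    "\<And>x t. x \<in> \<Omega> \<Longrightarrow> t \<in> {0..T} \<Longrightarrow> norm (micro_stress t x) \<le> b"
    "\<And>x t. x \<in> \<Omega> \<Longrightarrow> t \<in> {0..T} \<Longrightarrow> norm (curl_stress t x) \<le> b"
    "\<And>x t. x \<in> \<Omega> \<Longrightarrow> t \<in> {0..T} \<Longrightarrow> norm (strain t x) \<le> b"
    using stress_bounds by blast
  obtain B where B: 
    "\<And>x t. x \<in> \<Omega> \<Longrightarrow> t \<in> {0..T} \<Longrightarrow> norm (P x t) \<le> B"
    "\<And>x t. x \<in> \<Omega> \<Longrightarrow> t \<in> {0..T} \<Longrightarrow> norm (Curl (\<lambda>z. P z t) x) \<le> B"
    using uniform_bounds by blast
  have "\<bar>elastic s t x\<bar> \<le> b * b + b * B + b * B" if x: "x \<in> \<Omega>" and s: "s \<in> {0..T}" and t: "t \<in> {0..T}" for x s t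
    using inner_bound[OF b(1)[OF x s] b(4)[OF x t]] inner_bound[OF b(2)[OF x s] order_trans[OF norm_sym_part_le B(1)[OF x t]]]
      inner_bound[OF b(3)[OF x s] B(2)[OF x t]] unfolding elastic_def by linarith
  then show ?thesis by blast
qed

lemma elastic_continuous: "s \<in> {0..T} \<Longrightarrow> t \<in> {0..T} \<Longrightarrow> continuous_on \<Omega> (elastic s t)"
  unfolding elastic_def[abs_def] by (intro continuous_on_add continuous_on_inner C1_continuous) assumption+

lemma elastic_symmetric: "x \<in> \<Omega> \<Longrightarrow> elastic s t x = elastic t s x"
  unfolding elastic_def stress_def micro_stress_def curl_stress_def
  using tensor_app_symmetric[OF coefficient_facts(4)] tensor_app_symmetric[OF coefficient_facts(6)] tensor_app_symmetric[OF coefficient_facts(8)]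
  by metis

lemma time_derivatives:
  assumes "x \<in> \<Omega>" "t \<in> {0..T}"
  shows "((\<lambda>s. u x s) has_vector_derivative dt T u x t) (at t within {0..T})"
    "((\<lambda>s. P x s) has_vector_derivative dt T P x t) (at t within {0..T})"
    "((\<lambda>s. dt T u x s) has_vector_derivative dt T (dt T u) x t) (at t within {0..T})"
    "((\<lambda>s. dt T P x s) has_vector_derivative dt T (dt T P) x t) (at t within {0..T})"
  using space_time_slices(2)[OF \<Omega>(1) T ur(1) assms] space_time_slices(2)[OF \<Omega>(1) T Pr(1) assms]
    space_time_slices(2)[OF \<Omega>(1) T ur(2) assms] space_time_slices(2)[OF \<Omega>(1) T Pr(2) assms] .

lemma inner_has_real_derivative:
  fixes f :: "real \<Rightarrow> 'z::real_inner"
  assumes "(f has_vector_derivative f') F"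
  shows "((\<lambda>s. f s \<bullet> c) has_real_derivative f' \<bullet> c) F" and "((\<lambda>s. c \<bullet> f s) has_real_derivative c \<bullet> f') F"
  using bounded_linear.has_vector_derivative[OF bounded_linear_inner_left assms, of c]
    bounded_linear.has_vector_derivative[OF bounded_linear_inner_right assms, of c]
  by (simp_all add: has_real_derivative_iff_has_vector_derivative)

lemma slice_continuous:
  assumes "continuous_on (\<Omega> \<times> {0..T}) (\<lambda>(x, t). w x t)"
  shows "t \<in> {0..T} \<Longrightarrow> continuous_on \<Omega> (\<lambda>x. w x t)" "x \<in> \<Omega> \<Longrightarrow> continuous_on {0..T} (w x)"
proof -
  show "continuous_on \<Omega> (\<lambda>x. w x t)" if "t \<in> {0..T}"
    by (rule continuous_on_compose2[OF assms, of \<Omega> "\<lambda>x. (x, t)", simplified]) (use that in \<open>auto intro!: continuous_intros\<close>)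
  show "continuous_on {0..T} (w x)" if "x \<in> \<Omega>"
    by (rule continuous_on_compose2[OF assms, of "{0..T}" "\<lambda>t. (x, t)", simplified]) (use that in \<open>auto intro!: continuous_intros\<close>)
qed

text \<open>Only first time derivatives occur here, and they are bounded up to the boundary.\<close>

lemma pairing_derivative_second:
  assumes s: "s \<in> {0..T}" and t: "t \<in> {0..T}"
  shows "((\<lambda>r. LINT x|lborel. indicator \<Omega> x * pairing s r x) has_real_derivative
      (LINT x|lborel. indicator \<Omega> x * kinetic s t x)) (at t within {0..T})"
proof -
  obtain B where B: "B > 0" 
    "\<And>x t. x \<in> \<Omega> \<Longrightarrow> t \<in> {0..T} \<Longrightarrow> norm (u x t) \<le> B"
    "\<And>x t. x \<in> \<Omega> \<Longrightarrow> t \<in> {0..T} \<Longrightarrow> norm (P x t) \<le> B"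
    "\<And>x t. x \<in> \<Omega> \<Longrightarrow> t \<in> {0..T} \<Longrightarrow> norm (dt T u x t) \<le> B"
    "\<And>x t. x \<in> \<Omega> \<Longrightarrow> t \<in> {0..T} \<Longrightarrow> norm (dt T P x t) \<le> B"
    using uniform_bounds by blast
  show ?thesis
  proof (rule leibniz_rule_bounded[OF \<Omega>(1,2) _ _ _ _ _ t, where A = "B * B + B * B" and B = "B * B + B * B"])
    fix r assume r: "r \<in> {0..T}"
    show "continuous_on \<Omega> (pairing s r)" unfolding pairing_def[abs_def]
      by (intro continuous_on_add continuous_on_inner slice_continuous(1) us Ps r s)
    show "continuous_on \<Omega> (kinetic s r)" unfolding kinetic_def[abs_def]
      by (intro continuous_on_add continuous_on_inner slice_continuous(1) us Ps r s)
    fix x assume x: "x \<in> \<Omega>"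
    show "((\<lambda>r. pairing s r x) has_real_derivative kinetic s r x) (at r within {0..T})"
      unfolding pairing_def kinetic_def
      by (intro DERIV_add inner_has_real_derivative(2) time_derivatives x r)
    show "\<bar>pairing s r x\<bar> \<le> B * B + B * B"
      using inner_bound[OF B(4)[OF x s] B(2)[OF x r]] inner_bound[OF B(5)[OF x s] B(3)[OF x r]] unfolding pairing_def by linarith
    show "\<bar>kinetic s r x\<bar> \<le> B * B + B * B"
      using inner_bound[OF B(4)[OF x s] B(4)[OF x r]] inner_bound[OF B(5)[OF x s] B(5)[OF x r]] unfolding kinetic_def by linarith
  qed
qed

lemma kinetic_integral_continuous:
  "continuous_on ({0..T} \<times> {0..T}) (\<lambda>(s, t). LINT x|lborel. indicator \<Omega> x * kinetic s t x)"
proof -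
  obtain B where B: "B > 0" 
    "\<And>x t. x \<in> \<Omega> \<Longrightarrow> t \<in> {0..T} \<Longrightarrow> norm (dt T u x t) \<le> B"
    "\<And>x t. x \<in> \<Omega> \<Longrightarrow> t \<in> {0..T} \<Longrightarrow> norm (dt T P x t) \<le> B"
    using uniform_bounds by blast
  have "continuous_on ({0..T} \<times> {0..T}) (\<lambda>p. LINT x|lborel. indicator \<Omega> x * kinetic (fst p) (snd p) x)"
  proof (rule continuous_on_parameter_integral[OF \<Omega>(1,2)])
    fix p assume "p \<in> {0..T} \<times> {0..T}"
    then have p: "fst p \<in> {0..T}" "snd p \<in> {0..T}" by auto
    show "continuous_on \<Omega> (kinetic (fst p) (snd p))" unfolding kinetic_def[abs_def]
      by (intro continuous_on_add continuous_on_inner slice_continuous(1) us Ps p)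
    fix x assume x: "x \<in> \<Omega>"
    show "\<bar>kinetic (fst p) (snd p) x\<bar> \<le> B * B + B * B"
      using inner_bound[OF B(2)[OF x p(1)] B(2)[OF x p(2)]] inner_bound[OF B(3)[OF x p(1)] B(3)[OF x p(2)]] unfolding kinetic_def by linarith
  next
    fix x assume x: "x \<in> \<Omega>"
    have c: "continuous_on ({0..T} \<times> {0..T}) (\<lambda>p. w x (fst p))" "continuous_on ({0..T} \<times> {0..T}) (\<lambda>p. w x (snd p))"
      if "continuous_on {0..T} (w x)" for w :: "real^3 \<Rightarrow> real \<Rightarrow> 'z::real_normed_vector"
      by (rule continuous_on_compose2[OF that]; auto intro!: continuous_intros)+
    show "continuous_on ({0..T} \<times> {0..T}) (\<lambda>p. kinetic (fst p) (snd p) x)" unfolding kinetic_def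
      by (intro continuous_on_add continuous_on_inner c slice_continuous(2)[OF us(3)] slice_continuous(2)[OF Ps(3)] x)
  qed
  then show ?thesis by (simp add: case_prod_unfold)
qed

lemma elastic_expand:
  assumes "x \<in> \<Omega>"
  shows "elastic s t x = stress s x \<bullet> grad (\<lambda>z. u z t) x - stress s x \<bullet> P x t + micro_stress s x \<bullet> P x t
    + curl_stress s x \<bullet> Curl (\<lambda>z. P z t) x"
  unfolding elastic_def strain_def by (simp add: inner_sym_part stress_Sym3 assms inner_diff_right)

text \<open>This is the weak form of the field equations. Second time derivatives may be unbounded near the boundary, so the differentiation under the integral is done
  with cutoffs. There the equations can be inserted, and the Green formulas bound the difference from the claimed derivative by a null sequence that is
  uniform in time, so the derivatives pass to the limit.\<close>

lemma pairing_derivative_first: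
  assumes s: "s \<in> {0..T}" and t: "t \<in> {0..T}"
  shows "((\<lambda>r. LINT x|lborel. indicator \<Omega> x * pairing r t x) has_real_derivative
      - (LINT x|lborel. indicator \<Omega> x * elastic s t x)) (at s within {0..T})"
proof -
  obtain \<theta> where \<theta>: "exhausting_cutoffs \<Omega> \<theta>" using boundary_cutoffs(2)[OF dom pw] by blast
  have \<theta>c: "continuous_on UNIV (\<theta> n)" and \<theta>01: "0 \<le> \<theta> n x \<and> \<theta> n x \<le> 1" for n x
    using \<theta> unfolding exhausting_cutoffs_def by blast+
  have "\<exists>K. compact K \<and> K \<subseteq> \<Omega> \<and> (\<forall>x\<in>\<Omega> - K. \<theta> n x = 0)" for n
    using \<theta> unfolding exhausting_cutoffs_def by blast
  then obtain K where K: "compact (K n)" "K n \<subseteq> \<Omega>" "\<And>x. x \<in> \<Omega> - K n \<Longrightarrow> \<theta> n x = 0" for n by metis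
  define \<epsilon> where "\<epsilon> n = (LINT x|lborel. indicator \<Omega> x * (1 - \<theta> n x))" for n
  have \<epsilon>0: "\<epsilon> \<longlonglongrightarrow> 0" using \<theta> unfolding exhausting_cutoffs_def \<epsilon>_def by blast
  obtain d where d: "d \<longlonglongrightarrow> 0" "\<And>n \<sigma> M. Ck_on 1 \<Omega> \<sigma> \<Longrightarrow> (\<forall>x\<in>\<Omega>. norm (\<sigma> x) \<le> M) \<Longrightarrow>
      \<bar>(LINT x|lborel. indicator \<Omega> x * (\<theta> n x * (Div \<sigma> x \<bullet> u x t + \<sigma> x \<bullet> grad (\<lambda>z. u z t) x)))\<bar> \<le> M * d n"
    using exhausting_cutoffs_Div[OF \<theta> ur(4)[OF t] us(1)[OF t] u_boundary[OF _ t]] by blast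
  obtain e where e: "e \<longlonglongrightarrow> 0" "\<And>n m M. Ck_on 1 \<Omega> m \<Longrightarrow> (\<forall>x\<in>\<Omega>. norm (m x) \<le> M) \<Longrightarrow>
      \<bar>(LINT x|lborel. indicator \<Omega> x * (\<theta> n x * (Curl m x \<bullet> P x t - m x \<bullet> Curl (\<lambda>z. P z t) x)))\<bar> \<le> M * e n"
    using exhausting_cutoffs_Curl[OF \<theta> Pr(4)[OF t] Ps(1)[OF t] P_boundary[OF t]] by blast
  obtain b where b: "b > 0"
    "\<And>x t. x \<in> \<Omega> \<Longrightarrow> t \<in> {0..T} \<Longrightarrow> norm (stress t x) \<le> b"
    "\<And>x t. x \<in> \<Omega> \<Longrightarrow> t \<in> {0..T} \<Longrightarrow> norm (curl_stress t x) \<le> b"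
    using stress_bounds by blast
  obtain B\<^sub>e where Be: "\<And>x s t. x \<in> \<Omega> \<Longrightarrow> s \<in> {0..T} \<Longrightarrow> t \<in> {0..T} \<Longrightarrow> \<bar>elastic s t x\<bar> \<le> B\<^sub>e" using elastic_bound by blast
  obtain B where B: "B > 0" 
    "\<And>x t. x \<in> \<Omega> \<Longrightarrow> t \<in> {0..T} \<Longrightarrow> norm (u x t) \<le> B"
    "\<And>x t. x \<in> \<Omega> \<Longrightarrow> t \<in> {0..T} \<Longrightarrow> norm (P x t) \<le> B"
    "\<And>x t. x \<in> \<Omega> \<Longrightarrow> t \<in> {0..T} \<Longrightarrow> norm (dt T u x t) \<le> B"
    "\<And>x t. x \<in> \<Omega> \<Longrightarrow> t \<in> {0..T} \<Longrightarrow> norm (dt T P x t) \<le> B"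
    using uniform_bounds by blast
  define a where "a r x = dt T (dt T u) x r \<bullet> u x t + dt T (dt T P) x r \<bullet> P x t" for r x
  have pc: "continuous_on \<Omega> (pairing r t)" if r: "r \<in> {0..T}" for r
    unfolding pairing_def[abs_def] by (intro continuous_on_add continuous_on_inner slice_continuous(1) us Ps r t)
  have pb: "\<bar>pairing r t x\<bar> \<le> B * B + B * B" if x: "x \<in> \<Omega>" and r: "r \<in> {0..T}" for x r
    using inner_bound[OF B(4)[OF x r] B(2)[OF x t]] inner_bound[OF B(5)[OF x r] B(3)[OF x t]] unfolding pairing_def by linarith
  have ac: "continuous_on \<Omega> (a r)" if r: "r \<in> {0..T}" for r
    unfolding a_def[abs_def]
    by (intro continuous_on_add continuous_on_inner slice_continuous(1)[OF dus(3) r] slice_continuous(1)[OF dPs(3) r] slice_continuous(1)[OF us(2) t] slice_continuous(1)[OF Ps(2) t])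
  have tc: "continuous_on \<Omega> (\<theta> n)" for n by (rule continuous_on_subset[OF \<theta>c]) simp
  have K2: "compact (K n \<times> {0..T})" "K n \<times> {0..T} \<subseteq> \<Omega> \<times> {0..T}" for n using K(1,2)[of n] by (auto intro: compact_Times)
  have deriv: "((\<lambda>r. LINT x|lborel. indicator \<Omega> x * (\<theta> n x * pairing r t x)) has_real_derivative
      (LINT x|lborel. indicator \<Omega> x * (\<theta> n x * a r x))) (at r within {0..T})" if r: "r \<in> {0..T}" for n r
  proof -
    obtain B1 where B1: "\<And>z. z \<in> K n \<times> {0..T} \<Longrightarrow> norm ((\<lambda>(x, t). dt T (dt T u) x t) z) \<le> B1"
      using continuous_on_bounded_above[OF dus(3) K2[of n]] by blast
    obtain B2 where B2: "\<And>z. z \<in> K n \<times> {0..T} \<Longrightarrow> norm ((\<lambda>(x, t). dt T (dt T P) x t) z) \<le> B2"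
      using continuous_on_bounded_above[OF dPs(3) K2[of n]] by blast
    show ?thesis
    proof (rule leibniz_rule_bounded[OF \<Omega>(1,2) _ _ _ _ _ r, where A = "B * B + B * B" and B = "\<bar>B1 * B + B2 * B\<bar>"])
      fix r assume r: "r \<in> {0..T}"
      show "continuous_on \<Omega> (\<lambda>x. \<theta> n x * pairing r t x)" by (intro continuous_on_mult tc pc r)
      show "continuous_on \<Omega> (\<lambda>x. \<theta> n x * a r x)" by (intro continuous_on_mult tc ac r)
      fix x assume x: "x \<in> \<Omega>"
      show "((\<lambda>r. \<theta> n x * pairing r t x) has_real_derivative \<theta> n x * a r x) (at r within {0..T})"
        unfolding pairing_def a_def by (intro DERIV_cmult DERIV_add inner_has_real_derivative(1) time_derivatives x r)
      show "\<bar>\<theta> n x * pairing r t x\<bar> \<le> B * B + B * B"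
        using pb[OF x r] \<theta>01[of n x] mult_mono[of "\<bar>\<theta> n x\<bar>" 1 "\<bar>pairing r t x\<bar>" "B * B + B * B"] by (simp add: abs_mult)
      show "\<bar>\<theta> n x * a r x\<bar> \<le> \<bar>B1 * B + B2 * B\<bar>"
      proof (cases "x \<in> K n")
        case True
        have "norm (dt T (dt T u) x r) \<le> B1" "norm (dt T (dt T P) x r) \<le> B2" using B1[of "(x, r)"] B2[of "(x, r)"] True r by auto
        then have "\<bar>a r x\<bar> \<le> \<bar>B1 * B + B2 * B\<bar>"
          using inner_bound[OF _ B(2)[OF x t], of "dt T (dt T u) x r" B1] inner_bound[OF _ B(3)[OF x t], of "dt T (dt T P) x r" B2] unfolding a_def by linarith
        then show ?thesis using \<theta>01[of n x] mult_mono[of "\<bar>\<theta> n x\<bar>" 1 "\<bar>a r x\<bar>" "\<bar>B1 * B + B2 * B\<bar>"] by (simp add: abs_mult)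
      next
        case False
        then show ?thesis using K(3)[of x n] x by simp
      qed
    qed
  qed
  have int: "integrable lborel (\<lambda>x. indicator \<Omega> x * (\<theta> n x * f x))" if "continuous_on \<Omega> f" for n f
    by (rule cutoff_integrable_continuous[OF \<Omega>(1,2) that \<theta>c \<theta>01 K]) auto
  have weak: "\<bar>(LINT x|lborel. indicator \<Omega> x * (\<theta> n x * a r x)) + (LINT x|lborel. indicator \<Omega> x * elastic r t x)\<bar>
      \<le> b * d n + b * e n + B\<^sub>e * \<epsilon> n" if r: "r \<in> {0..T}" for n r
  proof -
    let ?f = "\<lambda>x. Div (stress r) x \<bullet> u x t + stress r x \<bullet> grad (\<lambda>z. u z t) x"
    let ?g = "\<lambda>x. Curl (curl_stress r) x \<bullet> P x t - curl_stress r x \<bullet> Curl (\<lambda>z. P z t) x"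
    have "a r x + elastic r t x = ?f x - ?g x" if "x \<in> \<Omega>" for x
      unfolding a_def elastic_expand[OF that] momentum[OF that r] micro_momentum[OF that r]
      by (simp add: inner_add_left inner_diff_left)
    then have eq: "indicator \<Omega> x * (\<theta> n x * a r x) + indicator \<Omega> x * (\<theta> n x * elastic r t x)
        = indicator \<Omega> x * (\<theta> n x * ?f x) - indicator \<Omega> x * (\<theta> n x * ?g x)" for x
      by (cases "x \<in> \<Omega>") (simp_all add: distrib_left[symmetric] right_diff_distrib[symmetric])
    have cD: "continuous_on \<Omega> (Div (stress r))"
      using slice_continuous(1)[OF dus(3) r] momentum[OF _ r] by (simp cong: continuous_on_cong)
    have cf: "continuous_on \<Omega> ?f"
      by (intro continuous_on_add continuous_on_inner cD C1_continuous slice_continuous(1)[OF us(2)] r t)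
    have cg: "continuous_on \<Omega> ?g"
      by (intro continuous_on_diff continuous_on_inner Curl_continuous[OF \<Omega>(1)] C1_fields C1_continuous slice_continuous(1)[OF Ps(2)] r t)
    have "(LINT x|lborel. indicator \<Omega> x * (\<theta> n x * a r x)) + (LINT x|lborel. indicator \<Omega> x * (\<theta> n x * elastic r t x)) =
        (LINT x|lborel. indicator \<Omega> x * (\<theta> n x * ?f x)) - (LINT x|lborel. indicator \<Omega> x * (\<theta> n x * ?g x))"
      unfolding Bochner_Integration.integral_add[OF int[OF ac[OF r]] int[OF elastic_continuous[OF r t]], symmetric]
        Bochner_Integration.integral_diff[OF int[OF cf] int[OF cg], symmetric] eq ..
    moreover have "\<bar>(LINT x|lborel. indicator \<Omega> x * (\<theta> n x * ?f x))\<bar> \<le> b * d n"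
      by (rule d(2)[OF C1_fields(5)[OF r]]) (use b(2) r in auto)
    moreover have "\<bar>(LINT x|lborel. indicator \<Omega> x * (\<theta> n x * ?g x))\<bar> \<le> b * e n"
      by (rule e(2)[OF C1_fields(7)[OF r]]) (use b(3) r in auto)
    moreover have "\<bar>(LINT x|lborel. indicator \<Omega> x * (\<theta> n x * elastic r t x)) - (LINT x|lborel. indicator \<Omega> x * elastic r t x)\<bar> \<le> B\<^sub>e * \<epsilon> n"
      unfolding \<epsilon>_def by (rule cutoff_error(2)[OF \<Omega>(1,2) elastic_continuous[OF r t] Be[OF _ r t] \<theta>c \<theta>01])
    ultimately show ?thesis by linarith
  qed
  have lim: "(\<lambda>n. LINT x|lborel. indicator \<Omega> x * (\<theta> n x * pairing r t x)) \<longlonglongrightarrow> (LINT x|lborel. indicator \<Omega> x * pairing r t x)"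
    if r: "r \<in> {0..T}" for r
  proof (rule LIM_zero_cancel, rule Lim_null_comparison)
    show "(\<lambda>n. (B * B + B * B) * \<epsilon> n) \<longlonglongrightarrow> 0" using tendsto_mult_left[OF \<epsilon>0, of "B * B + B * B"] by simp
    show "\<forall>\<^sub>F n in sequentially. norm ((LINT x|lborel. indicator \<Omega> x * (\<theta> n x * pairing r t x)) - (LINT x|lborel. indicator \<Omega> x * pairing r t x)) \<le> (B * B + B * B) * \<epsilon> n"
      unfolding \<epsilon>_def real_norm_def by (intro always_eventually allI cutoff_error(2)[OF \<Omega>(1,2) pc[OF r] pb[OF _ r] \<theta>c \<theta>01])
  qed
  have err0: "(\<lambda>n. b * d n + b * e n + B\<^sub>e * \<epsilon> n) \<longlonglongrightarrow> 0"
    using tendsto_add[OF tendsto_add[OF tendsto_mult_left[OF d(1), of b] tendsto_mult_left[OF e(1), of b]] tendsto_mult_left[OF \<epsilon>0, of B\<^sub>e]] by simp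
  have "\<exists>g. \<forall>r\<in>{0..T}. (\<lambda>n. LINT x|lborel. indicator \<Omega> x * (\<theta> n x * pairing r t x)) \<longlonglongrightarrow> g r \<and>
      (g has_derivative (*) (- (LINT x|lborel. indicator \<Omega> x * elastic r t x))) (at r within {0..T})"
  proof (rule has_derivative_sequence[where f = "\<lambda>n r. LINT x|lborel. indicator \<Omega> x * (\<theta> n x * pairing r t x)"
        and f' = "\<lambda>n r. (*) (LINT x|lborel. indicator \<Omega> x * (\<theta> n x * a r x))"
        and g' = "\<lambda>r. (*) (- (LINT x|lborel. indicator \<Omega> x * elastic r t x))", OF convex_real_interval(5) _ _ s lim[OF s]])
    show "((\<lambda>r. LINT x|lborel. indicator \<Omega> x * (\<theta> n x * pairing r t x)) has_derivative
        (*) (LINT x|lborel. indicator \<Omega> x * (\<theta> n x * a r x))) (at r within {0..T})" if "r \<in> {0..T}" for n r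
      using deriv[OF that] by (simp add: has_field_derivative_def)
    fix \<eta> :: real assume \<eta>: "\<eta> > 0"
    have "\<forall>\<^sub>F n in sequentially. b * d n + b * e n + B\<^sub>e * \<epsilon> n < \<eta>" by (rule order_tendstoD(2)[OF err0 \<eta>])
    then show "\<forall>\<^sub>F n in sequentially. \<forall>r\<in>{0..T}. \<forall>h. norm ((LINT x|lborel. indicator \<Omega> x * (\<theta> n x * a r x)) * h -
        - (LINT x|lborel. indicator \<Omega> x * elastic r t x) * h) \<le> \<eta> * norm h"
    proof eventually_elim
      case (elim n)
      show ?case
      proof (intro ballI allI)
        fix r h assume r: "r \<in> {0..T}"
        have "\<bar>(LINT x|lborel. indicator \<Omega> x * (\<theta> n x * a r x)) + (LINT x|lborel. indicator \<Omega> x * elastic r t x)\<bar> * \<bar>h\<bar> \<le> \<eta> * \<bar>h\<bar>"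
          using weak[OF r, of n] elim by (intro mult_right_mono) auto
        then show "norm ((LINT x|lborel. indicator \<Omega> x * (\<theta> n x * a r x)) * h -
            - (LINT x|lborel. indicator \<Omega> x * elastic r t x) * h) \<le> \<eta> * norm h"
          by (simp add: abs_mult[symmetric] distrib_right)
      qed
    qed
  qed
  then obtain g where g: "\<And>r. r \<in> {0..T} \<Longrightarrow> (\<lambda>n. LINT x|lborel. indicator \<Omega> x * (\<theta> n x * pairing r t x)) \<longlonglongrightarrow> g r"
      "\<And>r. r \<in> {0..T} \<Longrightarrow> (g has_derivative (*) (- (LINT x|lborel. indicator \<Omega> x * elastic r t x))) (at r within {0..T})" by blast
  have "g r = (LINT x|lborel. indicator \<Omega> x * pairing r t x)" if "r \<in> {0..T}" for r
    using LIMSEQ_unique[OF g(1)[OF that] lim[OF that]] .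
  then show ?thesis
    unfolding has_field_derivative_def by (intro has_derivative_transform[OF s _ g(2)[OF s]]) simp
qed

lemma energy_eq:
  assumes t: "t \<in> {0..T}"
  shows "energy \<Omega> T \<C> \<H> \<L> u P t = (1/2) * ((LINT x|lborel. indicator \<Omega> x * elastic t t x) + (LINT x|lborel. indicator \<Omega> x * kinetic t t x))"
proof -
  obtain B where B: "B > 0" 
    "\<And>x t. x \<in> \<Omega> \<Longrightarrow> t \<in> {0..T} \<Longrightarrow> norm (dt T u x t) \<le> B"
    "\<And>x t. x \<in> \<Omega> \<Longrightarrow> t \<in> {0..T} \<Longrightarrow> norm (dt T P x t) \<le> B"
    using uniform_bounds by blast
  obtain B\<^sub>e where Be: "\<And>x s t. x \<in> \<Omega> \<Longrightarrow> s \<in> {0..T} \<Longrightarrow> t \<in> {0..T} \<Longrightarrow> \<bar>elastic s t x\<bar> \<le> B\<^sub>e" using elastic_bound by blast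
  have i1: "integrable lborel (\<lambda>x. indicator \<Omega> x * elastic t t x)"
    by (rule indicator_times_integrable[OF \<Omega>(1,2) elastic_continuous[OF t t] Be[OF _ t t]])
  have kc: "continuous_on \<Omega> (kinetic t t)" unfolding kinetic_def[abs_def]
    by (intro continuous_on_add continuous_on_inner slice_continuous(1) us Ps t)
  have kb: "\<bar>kinetic t t x\<bar> \<le> B * B + B * B" if x: "x \<in> \<Omega>" for x
    using inner_bound[OF B(2)[OF x t] B(2)[OF x t]] inner_bound[OF B(3)[OF x t] B(3)[OF x t]] unfolding kinetic_def by linarith
  have i2: "integrable lborel (\<lambda>x. indicator \<Omega> x * kinetic t t x)"
    by (rule indicator_times_integrable[OF \<Omega>(1,2) kc kb])
  have "energy \<Omega> T \<C> \<H> \<L> u P t = (1/2) * (LINT x|lborel. indicator \<Omega> x * elastic t t x + indicator \<Omega> x * kinetic t t x)"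
    unfolding energy_def set_lebesgue_integral_def
    by (simp add: elastic_def kinetic_def stress_def strain_def micro_stress_def curl_stress_def dot_square_norm algebra_simps)
  then show ?thesis unfolding Bochner_Integration.integral_add[OF i1 i2] .
qed

theorem energy_conserved:
  assumes "t \<in> {0..T}"
  shows "energy \<Omega> T \<C> \<H> \<L> u P t = energy \<Omega> T \<C> \<H> \<L> u P 0"
proof -
  have es: "(LINT x|lborel. indicator \<Omega> x * elastic s t x) = (LINT x|lborel. indicator \<Omega> x * elastic t s x)" for s t
    by (intro Bochner_Integration.integral_cong refl) (auto simp: indicator_def elastic_symmetric)
  have ks: "(LINT x|lborel. indicator \<Omega> x * kinetic s t x) = (LINT x|lborel. indicator \<Omega> x * kinetic t s x)" for s t
    by (simp add: kinetic_def inner_commute)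
  have "(LINT x|lborel. indicator \<Omega> x * elastic t t x) + (LINT x|lborel. indicator \<Omega> x * kinetic t t x) =
      (LINT x|lborel. indicator \<Omega> x * elastic 0 0 x) + (LINT x|lborel. indicator \<Omega> x * kinetic 0 0 x)"
    by (rule energy_identity_from_symmetric_pairing[OF T pairing_derivative_first pairing_derivative_second kinetic_integral_continuous es ks assms])
  moreover have "0 \<in> {0..T}" using T by simp
  ultimately show ?thesis by (simp only: energy_eq[OF assms] energy_eq)
qed

end

section \<open>Coercivity of the energy and continuous dependence\<close>

lemma L2_norm_sq: "(L2_norm \<Omega> f)\<^sup>2 = (LINT x|lborel. indicator \<Omega> x * (norm (f x))\<^sup>2)"
proof -
  have "0 \<le> (LINT x|lborel. indicator \<Omega> x * (norm (f x))\<^sup>2)" by (intro integral_nonneg_AE) simp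
  then show ?thesis by (simp add: L2_norm_def set_lebesgue_integral_def)
qed

lemma square_integrable:
  fixes f :: "real^3 \<Rightarrow> 'b::real_normed_vector"
  assumes "open \<Omega>" "bounded \<Omega>" "continuous_on \<Omega> f" "\<And>x. x \<in> \<Omega> \<Longrightarrow> norm (f x) \<le> B"
  shows "integrable lborel (\<lambda>x. indicator \<Omega> x * (norm (f x))\<^sup>2)"
proof (rule indicator_times_integrable[OF assms(1,2)])
  show "continuous_on \<Omega> (\<lambda>x. (norm (f x))\<^sup>2)" by (intro continuous_intros assms(3))
  show "\<bar>(norm (f x))\<^sup>2\<bar> \<le> B\<^sup>2" if "x \<in> \<Omega>" for x using assms(4)[OF that] by (simp add: power_mono)
qed

context homogeneous_solution
begin

text \<open>The symmetric part of \<open>\<nabla>u\<close> is the sum of the strain \<open>sym (\<nabla>u - P)\<close> and \<open>sym P\<close>.\<close>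

lemma displacement_korn:
  assumes t: "t \<in> {0..T}"
  shows "(L2_norm \<Omega> (grad (\<lambda>x. u x t)))\<^sup>2 \<le> 4 * (L2_norm \<Omega> (strain t))\<^sup>2 + 4 * (L2_norm \<Omega> (\<lambda>x. sym_part (P x t)))\<^sup>2"
proof -
  obtain B where B: "B > 0" 
    "\<And>x t. x \<in> \<Omega> \<Longrightarrow> t \<in> {0..T} \<Longrightarrow> norm (P x t) \<le> B"
    "\<And>x t. x \<in> \<Omega> \<Longrightarrow> t \<in> {0..T} \<Longrightarrow> norm (grad (\<lambda>z. u z t) x) \<le> B"
    using uniform_bounds by blast
  obtain b where b: "\<And>x t. x \<in> \<Omega> \<Longrightarrow> t \<in> {0..T} \<Longrightarrow> norm (strain t x) \<le> b" using stress_bounds by blast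
  let ?S = "\<lambda>x. sym_part (grad (\<lambda>z. u z t) x)"
  have "continuous_on UNIV sym_part"
    using linear_sym_part by (simp add: linear_continuous_on linear_conv_bounded_linear)
  then have cS: "continuous_on \<Omega> ?S" by (rule continuous_on_compose2[OF _ C1_continuous(4)[OF t]]) simp
  have i0: "integrable lborel (\<lambda>x. indicator \<Omega> x * (norm (?S x))\<^sup>2)"
    by (rule square_integrable[OF \<Omega>(1,2) cS order_trans[OF norm_sym_part_le B(3)[OF _ t]]])
  have i1: "integrable lborel (\<lambda>x. indicator \<Omega> x * (norm (strain t x))\<^sup>2)"
    by (rule square_integrable[OF \<Omega>(1,2) C1_continuous(1)[OF t] b[OF _ t]])
  have i2: "integrable lborel (\<lambda>x. indicator \<Omega> x * (norm (sym_part (P x t)))\<^sup>2)"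
    by (rule square_integrable[OF \<Omega>(1,2) C1_continuous(2)[OF t] order_trans[OF norm_sym_part_le B(2)[OF _ t]]])
  have "(LINT x|lborel. indicator \<Omega> x * (norm (grad (\<lambda>x. u x t) x))\<^sup>2) \<le> 2 * (LINT x|lborel. indicator \<Omega> x * (norm (?S x))\<^sup>2)"
    by (rule korn_on_domain[OF \<Omega> boundary_cutoffs(1)[OF dom pw] ur(4)[OF t] us(1)[OF t] u_boundary[OF _ t] order_trans[OF onorm_matrix_le B(3)[OF _ t]]])
  also have "(LINT x|lborel. indicator \<Omega> x * (norm (?S x))\<^sup>2) \<le>
      (LINT x|lborel. 2 * (indicator \<Omega> x * (norm (strain t x))\<^sup>2) + 2 * (indicator \<Omega> x * (norm (sym_part (P x t)))\<^sup>2))"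
  proof (rule Bochner_Integration.integral_mono[OF i0])
    show "integrable lborel (\<lambda>x. 2 * (indicator \<Omega> x * (norm (strain t x))\<^sup>2) + 2 * (indicator \<Omega> x * (norm (sym_part (P x t)))\<^sup>2))"
      by (intro Bochner_Integration.integrable_add integrable_mult_right i1 i2)
    fix x
    have "?S x = strain t x - - sym_part (P x t)"
      unfolding strain_def linear_diff[OF linear_sym_part] by simp
    then have "(norm (?S x))\<^sup>2 \<le> 2 * (norm (strain t x))\<^sup>2 + 2 * (norm (sym_part (P x t)))\<^sup>2"
      using norm_diff_sq_le[of "strain t x" "- sym_part (P x t)"] by simp
    then show "indicator \<Omega> x * (norm (?S x))\<^sup>2 \<le>
        2 * (indicator \<Omega> x * (norm (strain t x))\<^sup>2) + 2 * (indicator \<Omega> x * (norm (sym_part (P x t)))\<^sup>2)"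
      by (cases "x \<in> \<Omega>") auto
  qed
  also have "\<dots> = 2 * (LINT x|lborel. indicator \<Omega> x * (norm (strain t x))\<^sup>2) + 2 * (LINT x|lborel. indicator \<Omega> x * (norm (sym_part (P x t)))\<^sup>2)"
    using i1 i2 by simp
  finally show ?thesis unfolding L2_norm_sq by simp
qed

lemma energy_lower_bound:
  assumes t: "t \<in> {0..T}" and \<mu>: "\<mu> \<le> 1"
    and c: "\<And>x X. x \<in> \<Omega> \<Longrightarrow> X \<in> Sym3 \<Longrightarrow> \<mu> * (norm X)\<^sup>2 \<le> (\<C> x \<odot> X) \<bullet> X"
    and h: "\<And>x X. x \<in> \<Omega> \<Longrightarrow> X \<in> Sym3 \<Longrightarrow> \<mu> * (norm X)\<^sup>2 \<le> (\<H> x \<odot> X) \<bullet> X"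
    and l: "\<And>x X. x \<in> \<Omega> \<Longrightarrow> \<mu> * (norm X)\<^sup>2 \<le> (\<L> x \<odot> X) \<bullet> X"
  shows "\<mu> * ((L2_norm \<Omega> (\<lambda>x. dt T u x t))\<^sup>2 + (L2_norm \<Omega> (\<lambda>x. dt T P x t))\<^sup>2
      + (L2_norm \<Omega> (strain t))\<^sup>2 + (L2_norm \<Omega> (\<lambda>x. sym_part (P x t)))\<^sup>2
      + (L2_norm \<Omega> (Curl (\<lambda>x. P x t)))\<^sup>2) \<le> 2 * energy \<Omega> T \<C> \<H> \<L> u P t"
proof -
  obtain B where B: "B > 0" 
    "\<And>x t. x \<in> \<Omega> \<Longrightarrow> t \<in> {0..T} \<Longrightarrow> norm (P x t) \<le> B"
    "\<And>x t. x \<in> \<Omega> \<Longrightarrow> t \<in> {0..T} \<Longrightarrow> norm (dt T u x t) \<le> B"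
    "\<And>x t. x \<in> \<Omega> \<Longrightarrow> t \<in> {0..T} \<Longrightarrow> norm (dt T P x t) \<le> B"
    "\<And>x t. x \<in> \<Omega> \<Longrightarrow> t \<in> {0..T} \<Longrightarrow> norm (Curl (\<lambda>z. P z t) x) \<le> B"
    using uniform_bounds by blast
  obtain b where b: "\<And>x t. x \<in> \<Omega> \<Longrightarrow> t \<in> {0..T} \<Longrightarrow> norm (strain t x) \<le> b" using stress_bounds by blast
  obtain B\<^sub>e where Be: "\<And>x s t. x \<in> \<Omega> \<Longrightarrow> s \<in> {0..T} \<Longrightarrow> t \<in> {0..T} \<Longrightarrow> \<bar>elastic s t x\<bar> \<le> B\<^sub>e" using elastic_bound by blast
  have ie: "integrable lborel (\<lambda>x. indicator \<Omega> x * elastic t t x)"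
    by (rule indicator_times_integrable[OF \<Omega>(1,2) elastic_continuous[OF t t] Be[OF _ t t]])
  have i1: "integrable lborel (\<lambda>x. indicator \<Omega> x * (norm (strain t x))\<^sup>2)"
    by (rule square_integrable[OF \<Omega>(1,2) C1_continuous(1)[OF t] b[OF _ t]])
  have i2: "integrable lborel (\<lambda>x. indicator \<Omega> x * (norm (sym_part (P x t)))\<^sup>2)"
    by (rule square_integrable[OF \<Omega>(1,2) C1_continuous(2)[OF t] order_trans[OF norm_sym_part_le B(2)[OF _ t]]])
  have i3: "integrable lborel (\<lambda>x. indicator \<Omega> x * (norm (Curl (\<lambda>z. P z t) x))\<^sup>2)"
    by (rule square_integrable[OF \<Omega>(1,2) C1_continuous(3)[OF t] B(5)[OF _ t]])
  have i4: "integrable lborel (\<lambda>x. indicator \<Omega> x * (norm (dt T u x t))\<^sup>2)"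
    by (rule square_integrable[OF \<Omega>(1,2) slice_continuous(1)[OF us(3) t] B(3)[OF _ t]])
  have i5: "integrable lborel (\<lambda>x. indicator \<Omega> x * (norm (dt T P x t))\<^sup>2)"
    by (rule square_integrable[OF \<Omega>(1,2) slice_continuous(1)[OF Ps(3) t] B(4)[OF _ t]])
  define n1 n2 n3 n4 n5 where
    n: "n1 = (LINT x|lborel. indicator \<Omega> x * (norm (strain t x))\<^sup>2)"
      "n2 = (LINT x|lborel. indicator \<Omega> x * (norm (sym_part (P x t)))\<^sup>2)"
      "n3 = (LINT x|lborel. indicator \<Omega> x * (norm (Curl (\<lambda>z. P z t) x))\<^sup>2)"
      "n4 = (LINT x|lborel. indicator \<Omega> x * (norm (dt T u x t))\<^sup>2)"
      "n5 = (LINT x|lborel. indicator \<Omega> x * (norm (dt T P x t))\<^sup>2)"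
  have "(LINT x|lborel. indicator \<Omega> x * kinetic t t x) =
      (LINT x|lborel. indicator \<Omega> x * (norm (dt T u x t))\<^sup>2 + indicator \<Omega> x * (norm (dt T P x t))\<^sup>2)"
    by (simp add: kinetic_def dot_square_norm distrib_left)
  then have k: "(LINT x|lborel. indicator \<Omega> x * kinetic t t x) = n4 + n5"
    unfolding Bochner_Integration.integral_add[OF i4 i5] n .
  have "\<mu> * (n1 + n2 + n3) = (LINT x|lborel. \<mu> * (indicator \<Omega> x * (norm (strain t x))\<^sup>2 + indicator \<Omega> x * (norm (sym_part (P x t)))\<^sup>2
      + indicator \<Omega> x * (norm (Curl (\<lambda>z. P z t) x))\<^sup>2))"
    unfolding n using i1 i2 i3 by simp
  also have "\<dots> \<le> (LINT x|lborel. indicator \<Omega> x * elastic t t x)"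
  proof (rule Bochner_Integration.integral_mono[OF _ ie])
    fix x
    show "\<mu> * (indicator \<Omega> x * (norm (strain t x))\<^sup>2 + indicator \<Omega> x * (norm (sym_part (P x t)))\<^sup>2
      + indicator \<Omega> x * (norm (Curl (\<lambda>z. P z t) x))\<^sup>2) \<le> indicator \<Omega> x * elastic t t x"
    proof (cases "x \<in> \<Omega>")
      case True
      have "strain t x \<in> Sym3" by (simp add: strain_def sym_part_Sym3)
      from c[OF True this] h[OF True sym_part_Sym3, of "P x t"] l[OF True, of "Curl (\<lambda>z. P z t) x"]
      show ?thesis using True by (simp add: elastic_def stress_def micro_stress_def curl_stress_def distrib_left)
    qed simp
  qed (intro integrable_mult_right Bochner_Integration.integrable_add i1 i2 i3)
  finally have e: "\<mu> * (n1 + n2 + n3) \<le> (LINT x|lborel. indicator \<Omega> x * elastic t t x)" .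
  have "0 \<le> n4 + n5" unfolding n by (intro add_nonneg_nonneg integral_nonneg_AE) simp_all
  then have p: "\<mu> * (n4 + n5) \<le> 1 * (n4 + n5)" using \<mu> by (rule mult_right_mono[rotated])
  have "\<mu> * (n4 + n5 + n1 + n2 + n3) = \<mu> * (n1 + n2 + n3) + \<mu> * (n4 + n5)" by (simp add: algebra_simps)
  also have "\<dots> \<le> (LINT x|lborel. indicator \<Omega> x * elastic t t x) + 1 * (n4 + n5)" by (rule add_mono[OF e p])
  also have "\<dots> = 2 * energy \<Omega> T \<C> \<H> \<L> u P t" by (simp add: energy_eq[OF t] k)
  finally have "\<mu> * (n4 + n5 + n1 + n2 + n3) \<le> 2 * energy \<Omega> T \<C> \<H> \<L> u P t" .
  then show ?thesis unfolding L2_norm_sq n .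
qed

end

theorem theorem5p3:
  fixes \<Omega> :: "(real^3) set" and T :: real
    and \<C> \<H> \<L> :: "real^3 \<Rightarrow> tensor4"
  assumes "bounded_domain \<Omega>" and "piecewise_smooth_boundary \<Omega>"
    and "0 < T"
    and "admissible_coefficients \<Omega> \<C> \<H> \<L>"
  shows "\<exists>a>0. \<forall>u0 du0 P0 dP0 u P.
    solution_of_P \<Omega> T \<C> \<H> \<L> (\<lambda>_ _. 0) (\<lambda>_ _. 0) u0 du0 P0 dP0 u P \<longrightarrow>
    (\<forall>t\<in>{0..T}.
      a * ((L2_norm \<Omega> (\<lambda>x. dt T u x t))\<^sup>2 + (L2_norm \<Omega> (\<lambda>x. dt T P x t))\<^sup>2
           + (L2_norm \<Omega> (grad (\<lambda>x. u x t)))\<^sup>2 + (L2_norm \<Omega> (\<lambda>x. P x t))\<^sup>2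
           + (L2_norm \<Omega> (Curl (\<lambda>x. P x t)))\<^sup>2)
      \<le> energy \<Omega> T \<C> \<H> \<L> u P 0)"
proof -
  obtain C where C: "C > 0" "\<And>P B. continuous_on (closure \<Omega>) P \<Longrightarrow> Ck_on 1 \<Omega> P \<Longrightarrow> tangentially_zero \<Omega> P \<Longrightarrow>
      (\<And>x. x \<in> \<Omega> \<Longrightarrow> norm (Curl P x) \<le> B) \<Longrightarrow>
      (L2_norm \<Omega> P)\<^sup>2 \<le> C * ((L2_norm \<Omega> (\<lambda>x. sym_part (P x)))\<^sup>2 + (L2_norm \<Omega> (Curl P))\<^sup>2)"
    using incompatible_korn_on_domain[OF assms(1,2)] unfolding L2_norm_sq by blast
  have "\<exists>m>0. \<forall>x\<in>\<Omega>. \<forall>X\<in>V. m * (norm X)\<^sup>2 \<le> (A x \<odot> X) \<bullet> X" if "positive_definite_on V \<Omega> A" for V A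
    using that unfolding positive_definite_on_def by blast
  then obtain c h l where m: "c > 0" "h > 0" "l > 0" "\<And>x X. x \<in> \<Omega> \<Longrightarrow> X \<in> Sym3 \<Longrightarrow> c * (norm X)\<^sup>2 \<le> (\<C> x \<odot> X) \<bullet> X"
      "\<And>x X. x \<in> \<Omega> \<Longrightarrow> X \<in> Sym3 \<Longrightarrow> h * (norm X)\<^sup>2 \<le> (\<H> x \<odot> X) \<bullet> X"
      "\<And>x X. x \<in> \<Omega> \<Longrightarrow> l * (norm X)\<^sup>2 \<le> (\<L> x \<odot> X) \<bullet> X"
    using assms(4) unfolding admissible_coefficients_def by (metis UNIV_I)
  define \<mu> where "\<mu> = min (min 1 c) (min h l)"
  have \<mu>: "0 < \<mu>" "\<mu> \<le> 1" using m(1-3) by (simp_all add: \<mu>_def)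
  have weaken: "\<mu> * (norm X)\<^sup>2 \<le> r" if "p * (norm X)\<^sup>2 \<le> r" "\<mu> \<le> p" for p r and X :: "real^3^3"
    using order_trans[OF mult_right_mono[OF that(2), of "(norm X)\<^sup>2"] that(1)] by simp
  \<comment> \<open>\<open>5 + C\<close> bounds the sum of the five norms by the norms that the energy controls: \<open>\<nabla>u\<close> contributes \<open>4\<close> and \<open>P\<close> contributes \<open>C\<close>\<close>
  define a where "a = \<mu> / (2 * (5 + C))"
  have a: "a > 0" using \<mu>(1) C(1) by (simp add: a_def)
  show ?thesis
  proof (intro exI[of _ a] conjI a allI impI ballI)
    fix u0 du0 P0 dP0 u P t
    assume sol: "solution_of_P \<Omega> T \<C> \<H> \<L> (\<lambda>_ _. 0) (\<lambda>_ _. 0) u0 du0 P0 dP0 u P" and t: "t \<in> {0..T}"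
    interpret homogeneous_solution \<Omega> T \<C> \<H> \<L> u P u0 du0 P0 dP0
      using assms sol by unfold_locales
    let ?n = "\<lambda>f :: real^3 \<Rightarrow> real^3^3. (L2_norm \<Omega> f)\<^sup>2"
    let ?k = "(L2_norm \<Omega> (\<lambda>x. dt T u x t))\<^sup>2 + ?n (\<lambda>x. dt T P x t)"
    let ?e = "?n (strain t)" and ?s = "?n (\<lambda>x. sym_part (P x t))" and ?c = "?n (Curl (\<lambda>x. P x t))"
    have "\<mu> * (?k + ?e + ?s + ?c) \<le> 2 * energy \<Omega> T \<C> \<H> \<L> u P t"
    proof (rule energy_lower_bound[OF t \<mu>(2)])
      fix x and X :: "real^3^3" assume x: "x \<in> \<Omega>"
      show "\<mu> * (norm X)\<^sup>2 \<le> (\<L> x \<odot> X) \<bullet> X" by (rule weaken[OF m(6)[OF x]]) (simp add: \<mu>_def)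
      assume X: "X \<in> Sym3"
      show "\<mu> * (norm X)\<^sup>2 \<le> (\<C> x \<odot> X) \<bullet> X" by (rule weaken[OF m(4)[OF x X]]) (simp add: \<mu>_def)
      show "\<mu> * (norm X)\<^sup>2 \<le> (\<H> x \<odot> X) \<bullet> X" by (rule weaken[OF m(5)[OF x X]]) (simp add: \<mu>_def)
    qed
    then have E: "\<mu> * (?k + ?e + ?s + ?c) \<le> 2 * energy \<Omega> T \<C> \<H> \<L> u P 0" unfolding energy_conserved[OF t] .
    obtain B where B: "\<And>x. x \<in> \<Omega> \<Longrightarrow> norm (Curl (\<lambda>z. P z t) x) \<le> B" using uniform_bounds t by blast
    have KP: "?n (\<lambda>x. P x t) \<le> C * (?s + ?c)"
      by (rule C(2)[OF Pr(4)[OF t] Ps(1)[OF t] P_boundary[OF t] B])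
    have KU: "?n (grad (\<lambda>x. u x t)) \<le> 4 * ?e + 4 * ?s" by (rule displacement_korn[OF t])
    have "?k + ?n (grad (\<lambda>x. u x t)) + ?n (\<lambda>x. P x t) + ?c \<le> ?k + (4 * ?e + 4 * ?s) + C * (?s + ?c) + ?c"
      using KP KU by linarith
    also have "\<dots> \<le> (5 + C) * (?k + ?e + ?s + ?c)"
    proof -
      have nn: "0 \<le> ?k" "0 \<le> ?e" "0 \<le> ?s" "0 \<le> ?c" by simp_all
      have "0 \<le> 4 * ?k + C * ?k + ?e + C * ?e + ?s + 4 * ?c" using nn C(1) by (intro add_nonneg_nonneg mult_nonneg_nonneg) auto
      then show ?thesis unfolding distrib_left distrib_right by linarith
    qed
    finally have "a * (?k + ?n (grad (\<lambda>x. u x t)) + ?n (\<lambda>x. P x t) + ?c) \<le> a * ((5 + C) * (?k + ?e + ?s + ?c))"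
      using a by (intro mult_left_mono) auto
    also have "\<dots> = \<mu> * (?k + ?e + ?s + ?c) / 2" using C(1) by (simp add: a_def field_simps)
    also have "\<dots> \<le> energy \<Omega> T \<C> \<H> \<L> u P 0" using E by simp
    finally show "a * ((L2_norm \<Omega> (\<lambda>x. dt T u x t))\<^sup>2 + (L2_norm \<Omega> (\<lambda>x. dt T P x t))\<^sup>2
           + (L2_norm \<Omega> (grad (\<lambda>x. u x t)))\<^sup>2 + (L2_norm \<Omega> (\<lambda>x. P x t))\<^sup>2
           + (L2_norm \<Omega> (Curl (\<lambda>x. P x t)))\<^sup>2) \<le> energy \<Omega> T \<C> \<H> \<L> u P 0" .
  qed
qed

end
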